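(* Let $m,n$ be non-negative integers, $N$ a positive integer and $q\in\mathbb C^*$ arbitrary (possibly a root of unity). Let $\mathbb C_\omega[\mathbf x]$ be the associative algebra generated by $x_i^r$, $1\le i\le m+n$, $1\le r\le N$, with relations $$x_i^rx_i^s=(-1)^{[i]}x_i^sx_i^r,\qquad x_i^rx_j^s=(-1)^{[i][j]}\,q\,x_j^sx_i^r\quad(i<j),$$ for all $r,s$. Then $\mathbb C_\omega[\mathbf x]$ is a $\mathrm U(\mathfrak{gl}_q(m|n))\otimes\mathrm U(\mathfrak{gl}_N(\mathbb C))$-module algebra, and it has the multiplicity free decomposition $$\mathbb C_\omega[\mathbf x]=\bigoplus_{\lambda\in P_{m|n;N}}L_{\lambda^\sharp}\otimes L_\lambda(\mathfrak{gl}_N).$$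
   Context: Let $\Gamma=\mathbb Z^{m+n}$ with standard basis $\varepsilon_1,\dots,\varepsilon_{m+n}$; $[i]=0$ if $i\le m$ and $[i]=1$ if $i>m$. (Here $r$ in $x_i^r$ is an index, not a power.) Let $(\ ,\ )_0$ be the symmetric $\mathbb Z$-bilinear form with $(\varepsilon_i,\varepsilon_j)_0=[i][j]$ and $(\ ,\ )$ the skew symmetric $\mathbb Z$-bilinear form with $(\varepsilon_i,\varepsilon_j)=1$ for $i<j$. The commutative factor is $\omega(\alpha,\beta)=(-1)^{(\alpha,\beta)_0}q^{(\alpha,\beta)}$. Let $V=\bigoplus_i\mathbb Cb_i$ be the $\Gamma$-graded space with $b_i$ of degree $\varepsilon_i$. $\mathfrak{gl}_q(m|n)$ is $\mathrm{End}_{\mathbb C}(V)$ with basis the matrix units $\mathscr E_{ij}$ ($\mathscr E_{ij}b_k=\delta_{jk}b_i$), $\Gamma$-graded by $d(\mathscr E_{ij})=\varepsilon_i-\varepsilon_j$, with bracket $[X,Y]=XY-\omega(d(X),d(Y))YX$; explicitly $[\mathscr E_{ij},\mathscr E_{kl}]=\delta_{jk}\mathscr E_{il}-(-1)^{([i]+[j])([k]+[l])}q^{(\varepsilon_i-\varepsilon_j,\varepsilon_k-\varepsilon_l)}\delta_{li}\mathscr E_{kj}$. Its universal enveloping algebra is the tensor algebra modulo $XY-\omega(d(X),d(Y))YX=[X,Y]$; modules are $\Gamma$-graded. $\mathbb C_\omega[\mathbf x]$ is $\Gamma$-graded with $d(x_i^r)=\varepsilon_i$. Let $\partial_{i,r}$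 be the operator on $\mathbb C_\omega[\mathbf x]$ of degree $-\varepsilon_i$ with $\partial_{i,r}(1)=0$, $\partial_{i,r}(x_j^s)=\delta_{ij}\delta_{rs}$ and $\partial_{i,r}(fg)=\partial_{i,r}(f)g+\omega(-\varepsilon_i,d(f))f\partial_{i,r}(g)$. $\mathfrak{gl}_q(m|n)$ acts by $\mathscr E_{ij}\mapsto\sum_{r=1}^Nx_i^r\partial_{j,r}$ and $\mathfrak{gl}_N(\mathbb C)$ by sending the $(r,s)$ matrix unit to $\sum_{i=1}^{m+n}x_i^r\partial_{i,s}$; these actions commute. Module algebra means $X(fg)=X(f)g+\omega(d(X),d(f))fX(g)$ for Lie algebra elements. For $\mu=(\mu_1,\dots,\mu_{m+n})$, $L_\mu$ is the simple $\mathfrak{gl}_q(m|n)$-module generated by a nonzero vector $v$ with $\mathscr E_{ij}v=0$ for $i<j$ and $\mathscr E_{ii}v=\mu_iv$. $L_\lambda(\mathfrak{gl}_N)$ is the simple $\mathfrak{gl}_N(\mathbb C)$-module with highest weight $\lambda$. $P_{m|n;N}$ is the set of partitions $\lambda=(\lambda_1\ge\lambda_2\ge\cdots)$ with $\lambda_{m+1}\le n$ and $\lambda_{N+1}=0$; with transpose $\lambda'$ and $\theta(x)=\max(x,0)$, $\lambda^\sharp=(\lambda_1,\dots,\lambda_m,\theta(\lambda_1'-m),\dots,\theta(\lambda_n'-m))$. *)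

theory Defs
  imports
    "HOL-Library.Poly_Mapping"
    "HOL-Algebra.Algebra"
    "HOL-Algebra.Algebraic_Closure_Type"
begin

text \<open>
  All indices start at 0: the index \<open>i\<close> of the mathematical text is \<open>i - 1\<close> here, for the
  basis of \<open>\<Gamma>\<close>, for both indices of \<open>x\<^sub>i\<^sup>r\<close>, for matrix units and for the parts of partitions.
\<close>

section \<open>Graded vector spaces and graded modules\<close>

type_synonym degree = "nat \<Rightarrow>\<^sub>0 int"

abbreviation CC :: "complex ring" where
  "CC \<equiv> ring_of_type_algebra"

text \<open>
  One record serves for graded vector spaces and for graded algebras. For a mere vector space the
  fields \<^const>\<open>monoid.mult\<close> and \<^const>\<open>monoid.one\<close> are irrelevant.
\<close>

record 'w graded = "(complex, 'w) module" +
  hcomp :: "degree \<Rightarrow> 'w set"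

record ('r, 'w) gmodule = "'w graded" +
  act :: "'r \<Rightarrow> 'w \<Rightarrow> 'w"

definition is_grading :: "degree set \<Rightarrow> ('w, 'z) graded_scheme \<Rightarrow> bool" where
  "is_grading \<Gamma> W \<longleftrightarrow>
     (\<forall>\<alpha>. submodule (hcomp W \<alpha>) CC W) \<and>
     (\<forall>\<alpha>. \<alpha> \<notin> \<Gamma> \<longrightarrow> hcomp W \<alpha> = {\<zero>\<^bsub>W\<^esub>}) \<and>
     (\<forall>w\<in>carrier W. \<exists>!f. (\<forall>\<alpha>. f \<alpha> \<in> hcomp W \<alpha>) \<and> finite {\<alpha>. f \<alpha> \<noteq> \<zero>\<^bsub>W\<^esub>} \<and>
        w = finsum W f {\<alpha>. f \<alpha> \<noteq> \<zero>\<^bsub>W\<^esub>})"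

definition is_left_module :: "('r, 'y) graded_scheme \<Rightarrow> ('r, 'w, 'z) gmodule_scheme \<Rightarrow> bool" where
  "is_left_module R W \<longleftrightarrow>
     module CC W \<and>
     (\<forall>a\<in>carrier R. \<forall>w\<in>carrier W. act W a w \<in> carrier W) \<and>
     (\<forall>a\<in>carrier R. \<forall>v\<in>carrier W. \<forall>w\<in>carrier W.
        act W a (v \<oplus>\<^bsub>W\<^esub> w) = act W a v \<oplus>\<^bsub>W\<^esub> act W a w) \<and>
     (\<forall>a\<in>carrier R. \<forall>b\<in>carrier R. \<forall>w\<in>carrier W.
        act W (a \<oplus>\<^bsub>R\<^esub> b) w = act W a w \<oplus>\<^bsub>W\<^esub> act W b w) \<and>
     (\<forall>c. \<forall>a\<in>carrier R. \<forall>w\<in>carrier W.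
        act W (c \<odot>\<^bsub>R\<^esub> a) w = c \<odot>\<^bsub>W\<^esub> act W a w \<and> act W a (c \<odot>\<^bsub>W\<^esub> w) = c \<odot>\<^bsub>W\<^esub> act W a w) \<and>
     (\<forall>a\<in>carrier R. \<forall>b\<in>carrier R. \<forall>w\<in>carrier W.
        act W (a \<otimes>\<^bsub>R\<^esub> b) w = act W a (act W b w)) \<and>
     (\<forall>w\<in>carrier W. act W \<one>\<^bsub>R\<^esub> w = w)"

definition is_graded_module ::
  "degree set \<Rightarrow> ('r, 'y) graded_scheme \<Rightarrow> ('r, 'w, 'z) gmodule_scheme \<Rightarrow> bool" where
  "is_graded_module \<Gamma> R W \<longleftrightarrow>
     is_left_module R W \<and> is_grading \<Gamma> W \<and>
     (\<forall>\<alpha> \<beta>. \<forall>a\<in>hcomp R \<alpha>. \<forall>w\<in>hcomp W \<beta>. act W a w \<in> hcomp W (\<alpha> + \<beta>))"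

definition is_graded_submodule ::
  "degree set \<Rightarrow> ('r, 'y) graded_scheme \<Rightarrow> ('r, 'w, 'z) gmodule_scheme \<Rightarrow> 'w set \<Rightarrow> bool" where
  "is_graded_submodule \<Gamma> R W S \<longleftrightarrow>
     submodule S CC W \<and>
     (\<forall>a\<in>carrier R. \<forall>w\<in>S. act W a w \<in> S) \<and>
     is_grading \<Gamma> (W\<lparr>carrier := S, hcomp := (\<lambda>\<alpha>. S \<inter> hcomp W \<alpha>)\<rparr>)"

definition is_simple ::
  "degree set \<Rightarrow> ('r, 'y) graded_scheme \<Rightarrow> ('r, 'w, 'z) gmodule_scheme \<Rightarrow> bool" where
  "is_simple \<Gamma> R W \<longleftrightarrow>
     is_graded_module \<Gamma> R W \<and> carrier W \<noteq> {\<zero>\<^bsub>W\<^esub>} \<and>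
     (\<forall>S. is_graded_submodule \<Gamma> R W S \<longrightarrow> S = {\<zero>\<^bsub>W\<^esub>} \<or> S = carrier W)"

definition is_module_iso ::
  "('r, 'y) graded_scheme \<Rightarrow> ('r, 'v, 'z) gmodule_scheme \<Rightarrow> ('r, 'w, 'zz) gmodule_scheme \<Rightarrow>
   ('v \<Rightarrow> 'w) \<Rightarrow> bool" where
  "is_module_iso R V W \<phi> \<longleftrightarrow>
     bij_betw \<phi> (carrier V) (carrier W) \<and>
     (\<forall>v\<in>carrier V. \<forall>w\<in>carrier V. \<phi> (v \<oplus>\<^bsub>V\<^esub> w) = \<phi> v \<oplus>\<^bsub>W\<^esub> \<phi> w) \<and>
     (\<forall>c. \<forall>v\<in>carrier V. \<phi> (c \<odot>\<^bsub>V\<^esub> v) = c \<odot>\<^bsub>W\<^esub> \<phi> v) \<and>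
     (\<forall>a\<in>carrier R. \<forall>v\<in>carrier V. \<phi> (act V a v) = act W a (\<phi> v))"

definition is_graded_module_iso ::
  "('r, 'y) graded_scheme \<Rightarrow> ('r, 'v, 'z) gmodule_scheme \<Rightarrow> ('r, 'w, 'zz) gmodule_scheme \<Rightarrow>
   ('v \<Rightarrow> 'w) \<Rightarrow> bool" where
  "is_graded_module_iso R V W \<phi> \<longleftrightarrow>
     is_module_iso R V W \<phi> \<and> (\<forall>\<alpha>. \<phi> ` hcomp V \<alpha> = hcomp W \<alpha>)"

definition with_action :: "'w graded \<Rightarrow> ('r \<Rightarrow> 'w \<Rightarrow> 'w) \<Rightarrow> ('r, 'w) gmodule" where
  "with_action W \<rho> = graded.extend W (gmodule.fields \<rho>)"

definition direct_sum :: "'i set \<Rightarrow> ('i \<Rightarrow> ('r, 'w) gmodule) \<Rightarrow> ('r, 'i \<Rightarrow> 'w) gmodule" where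
  "direct_sum I W =
     (let S = {f \<in> (\<Pi>\<^sub>E i\<in>I. carrier (W i)). finite {i\<in>I. f i \<noteq> \<zero>\<^bsub>W i\<^esub>}} in
      \<lparr>carrier = S,
       monoid.mult = (\<lambda>f g. \<lambda>i\<in>I. f i \<otimes>\<^bsub>W i\<^esub> g i),
       one = (\<lambda>i\<in>I. \<one>\<^bsub>W i\<^esub>),
       ring.zero = (\<lambda>i\<in>I. \<zero>\<^bsub>W i\<^esub>),
       add = (\<lambda>f g. \<lambda>i\<in>I. f i \<oplus>\<^bsub>W i\<^esub> g i),
       module.smult = (\<lambda>c f. \<lambda>i\<in>I. c \<odot>\<^bsub>W i\<^esub> f i),
       hcomp = (\<lambda>\<alpha>. {f \<in> S. \<forall>i\<in>I. f i \<in> hcomp (W i) \<alpha>}),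
       act = (\<lambda>a f. \<lambda>i\<in>I. act (W i) a (f i))\<rparr>)"


section \<open>Tensor products over the complex numbers\<close>

text \<open>
  \<open>V \<otimes> W\<close> is the free vector space on \<open>V \<times> W\<close> modulo the span of the bilinearity relations.
\<close>

definition tensor_relations ::
  "('v, 'y) graded_scheme \<Rightarrow> ('w, 'z) graded_scheme \<Rightarrow> ('v \<times> 'w \<Rightarrow>\<^sub>0 complex) set" where
  "tensor_relations V W =
     {Poly_Mapping.single (v \<oplus>\<^bsub>V\<^esub> v', w) 1 - Poly_Mapping.single (v, w) 1
        - Poly_Mapping.single (v', w) 1 |v v' w.
        v \<in> carrier V \<and> v' \<in> carrier V \<and> w \<in> carrier W} \<union>
     {Poly_Mapping.single (v, w \<oplus>\<^bsub>W\<^esub> w') 1 - Poly_Mapping.single (v, w) 1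
        - Poly_Mapping.single (v, w') 1 |v w w'.
        v \<in> carrier V \<and> w \<in> carrier W \<and> w' \<in> carrier W} \<union>
     {Poly_Mapping.single (c \<odot>\<^bsub>V\<^esub> v, w) 1 - Poly_Mapping.single (v, w) c |c v w.
        v \<in> carrier V \<and> w \<in> carrier W} \<union>
     {Poly_Mapping.single (v, c \<odot>\<^bsub>W\<^esub> w) 1 - Poly_Mapping.single (v, w) c |c v w.
        v \<in> carrier V \<and> w \<in> carrier W}"

definition tensor_class ::
  "('v, 'y) graded_scheme \<Rightarrow> ('w, 'z) graded_scheme \<Rightarrow>
   ('v \<times> 'w \<Rightarrow>\<^sub>0 complex) \<Rightarrow> ('v \<times> 'w \<Rightarrow>\<^sub>0 complex) set" where
  "tensor_class V W t =
     {s. s - t \<in> Modules.module.span (\<lambda>c. Poly_Mapping.map ((*) c)) (tensor_relations V W)}"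

definition pure_tensor ::
  "('v, 'y) graded_scheme \<Rightarrow> ('w, 'z) graded_scheme \<Rightarrow> 'v \<Rightarrow> 'w \<Rightarrow>
   ('v \<times> 'w \<Rightarrow>\<^sub>0 complex) set" where
  "pure_tensor V W v w = tensor_class V W (Poly_Mapping.single (v, w) 1)"

text \<open>Bilinear extension to free vector spaces of a map defined on the bases.\<close>

definition bilinear_extension ::
  "('a \<Rightarrow> 'b \<Rightarrow> 'c) \<Rightarrow> ('a \<Rightarrow>\<^sub>0 complex) \<Rightarrow> ('b \<Rightarrow>\<^sub>0 complex) \<Rightarrow> ('c \<Rightarrow>\<^sub>0 complex)" where
  "bilinear_extension h s t =
     (\<Sum>a\<in>Poly_Mapping.keys s. \<Sum>b\<in>Poly_Mapping.keys t.
        Poly_Mapping.single (h a b) (Poly_Mapping.lookup s a * Poly_Mapping.lookup t b))"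

text \<open>
  The product is \<open>(a \<otimes> b) (a' \<otimes> b') = a a' \<otimes> b b'\<close>, without a commutative factor: below it is only
  used when the second algebra is homogeneous of degree 0.
\<close>

definition tensor_product ::
  "('v, 'y) graded_scheme \<Rightarrow> ('w, 'z) graded_scheme \<Rightarrow> ('v \<times> 'w \<Rightarrow>\<^sub>0 complex) set graded" where
  "tensor_product V W =
     \<lparr>carrier = {tensor_class V W t |t. Poly_Mapping.keys t \<subseteq> carrier V \<times> carrier W},
      monoid.mult = (\<lambda>S T. \<Union>s\<in>S. \<Union>t\<in>T. tensor_class V W
        (bilinear_extension (\<lambda>(a, b) (a', b'). (a \<otimes>\<^bsub>V\<^esub> a', b \<otimes>\<^bsub>W\<^esub> b')) s t)),
      one = pure_tensor V W \<one>\<^bsub>V\<^esub> \<one>\<^bsub>W\<^esub>,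
      ring.zero = tensor_class V W 0,
      add = (\<lambda>S T. \<Union>s\<in>S. \<Union>t\<in>T. tensor_class V W (s + t)),
      module.smult = (\<lambda>c S. \<Union>t\<in>S. tensor_class V W (Poly_Mapping.map ((*) c) t)),
      hcomp = (\<lambda>\<gamma>. {tensor_class V W t |t. Poly_Mapping.keys t \<subseteq>
        {(v, w). v \<in> carrier V \<and> w \<in> carrier W \<and>
           (\<exists>\<alpha> \<beta>. v \<in> hcomp V \<alpha> \<and> w \<in> hcomp W \<beta> \<and> \<alpha> + \<beta> = \<gamma>)}})\<rparr>"

definition tensor_module ::
  "('r, 'v) gmodule \<Rightarrow> ('s, 'w) gmodule \<Rightarrow>
   (('r \<times> 's \<Rightarrow>\<^sub>0 complex) set, ('v \<times> 'w \<Rightarrow>\<^sub>0 complex) set) gmodule" where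
  "tensor_module V W = with_action (tensor_product V W)
     (\<lambda>A S. \<Union>s\<in>A. \<Union>t\<in>S. tensor_class V W
        (bilinear_extension (\<lambda>(a, b) (v, w). (act V a v, act W b w)) s t))"


section \<open>Algebras given by generators and relations\<close>

text \<open>Words form the free monoid; the free algebra is its monoid algebra.\<close>

instantiation list :: (type) monoid_add
begin

definition zero_list :: "'a list" where "zero_list = []"

definition plus_list :: "'a list \<Rightarrow> 'a list \<Rightarrow> 'a list" where "plus_list = append"

instance by standard (simp_all add: zero_list_def plus_list_def)

end

type_synonym 'g free = "'g list \<Rightarrow>\<^sub>0 complex"

definition gen :: "'g \<Rightarrow> 'g free" where
  "gen g = Poly_Mapping.single [g] 1"

definition scal :: "complex \<Rightarrow> 'g free" where
  "scal c = Poly_Mapping.single [] c"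

definition free_algebra :: "'g set \<Rightarrow> (complex, 'g free) module" where
  "free_algebra G =
     \<lparr>carrier = {f. Poly_Mapping.keys f \<subseteq> lists G}, monoid.mult = (*), one = 1, ring.zero = 0,
      add = (+), module.smult = (\<lambda>c f. scal c * f)\<rparr>"

definition presented_class :: "'g set \<Rightarrow> 'g free set \<Rightarrow> 'g free \<Rightarrow> 'g free set" where
  "presented_class G R f = (Idl\<^bsub>free_algebra G\<^esub> R) +>\<^bsub>free_algebra G\<^esub> f"

text \<open>
  The quotient of the free algebra on \<open>G\<close> by the two-sided ideal generated by \<open>R\<close>, where \<open>d\<close> gives
  the degrees of the generators.
\<close>

definition presented_algebra ::
  "'g set \<Rightarrow> ('g \<Rightarrow> degree) \<Rightarrow> 'g free set \<Rightarrow> 'g free set graded" where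
  "presented_algebra G d R =
     (let Q = free_algebra G Quot (Idl\<^bsub>free_algebra G\<^esub> R) in
      \<lparr>carrier = carrier Q, monoid.mult = monoid.mult Q, one = one Q, ring.zero = ring.zero Q,
       add = add Q,
       module.smult = (\<lambda>c S. \<Union>f\<in>S. presented_class G R (scal c * f)),
       hcomp = (\<lambda>\<alpha>. {presented_class G R f |f.
         Poly_Mapping.keys f \<subseteq> {w \<in> lists G. (\<Sum>g\<leftarrow>w. d g) = \<alpha>}})\<rparr>)"


section \<open>The commutative factor\<close>

definition \<Gamma>grp :: "nat \<Rightarrow> nat \<Rightarrow> degree set" where
  "\<Gamma>grp m n = {\<alpha>. Poly_Mapping.keys \<alpha> \<subseteq> {..<m + n}}"

definition eps :: "nat \<Rightarrow> degree" where
  "eps i = Poly_Mapping.single i 1"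

definition par :: "nat \<Rightarrow> nat \<Rightarrow> nat" where
  "par m i = (if i < m then 0 else 1)"

definition sym_form :: "nat \<Rightarrow> nat \<Rightarrow> degree \<Rightarrow> degree \<Rightarrow> int" where
  "sym_form m n \<alpha> \<beta> = (\<Sum>i<m + n. \<Sum>j<m + n.
     Poly_Mapping.lookup \<alpha> i * Poly_Mapping.lookup \<beta> j * int (par m i * par m j))"

definition skew_form :: "nat \<Rightarrow> nat \<Rightarrow> degree \<Rightarrow> degree \<Rightarrow> int" where
  "skew_form m n \<alpha> \<beta> = (\<Sum>j<m + n. \<Sum>i<j.
     Poly_Mapping.lookup \<alpha> i * Poly_Mapping.lookup \<beta> j
     - Poly_Mapping.lookup \<alpha> j * Poly_Mapping.lookup \<beta> i)"

definition omega :: "nat \<Rightarrow> nat \<Rightarrow> complex \<Rightarrow> degree \<Rightarrow> degree \<Rightarrow> complex" where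
  "omega m n q \<alpha> \<beta> = (-1) powi sym_form m n \<alpha> \<beta> * q powi skew_form m n \<alpha> \<beta>"


section \<open>Enveloping algebras of general linear Lie (colour) algebras\<close>

text \<open>
  The tensor algebra of the span of the matrix units \<open>E\<^sub>i\<^sub>j\<close> is the free algebra on the pairs
  \<open>(i, j)\<close>. The bracket of two matrix units is
  \<open>[X, Y] = X Y - \<omega>(d(X), d(Y)) Y X\<close>, computed with the matrix product; in the relations of
  the enveloping algebra the products are those of the tensor algebra.
\<close>

definition gl_bracket ::
  "(nat \<times> nat \<Rightarrow> degree) \<Rightarrow> (degree \<Rightarrow> degree \<Rightarrow> complex) \<Rightarrow> nat \<times> nat \<Rightarrow> nat \<times> nat \<Rightarrow>
   (nat \<times> nat) free" where
  "gl_bracket d \<omega> = (\<lambda>(i, j) (k, l).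
     (if j = k then gen (i, l) else 0)
     - scal (\<omega> (d (i, j)) (d (k, l))) * (if l = i then gen (k, j) else 0))"

definition gl_relations ::
  "nat \<Rightarrow> (nat \<times> nat \<Rightarrow> degree) \<Rightarrow> (degree \<Rightarrow> degree \<Rightarrow> complex) \<Rightarrow> (nat \<times> nat) free set" where
  "gl_relations r d \<omega> =
     {gen x * gen y - scal (\<omega> (d x) (d y)) * gen y * gen x - gl_bracket d \<omega> x y |x y.
        x \<in> {..<r} \<times> {..<r} \<and> y \<in> {..<r} \<times> {..<r}}"

definition glq_degree :: "nat \<times> nat \<Rightarrow> degree" where
  "glq_degree = (\<lambda>(i, j). eps i - eps j)"

definition U_glq :: "nat \<Rightarrow> nat \<Rightarrow> complex \<Rightarrow> (nat \<times> nat) free set graded" where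
  "U_glq m n q = presented_algebra ({..<m + n} \<times> {..<m + n}) glq_degree
     (gl_relations (m + n) glq_degree (omega m n q))"

definition E_glq :: "nat \<Rightarrow> nat \<Rightarrow> complex \<Rightarrow> nat \<Rightarrow> nat \<Rightarrow> (nat \<times> nat) free set" where
  "E_glq m n q i j = presented_class ({..<m + n} \<times> {..<m + n})
     (gl_relations (m + n) glq_degree (omega m n q)) (gen (i, j))"

text \<open>The ordinary Lie algebra, homogeneous of degree 0 and with trivial commutative factor.\<close>

definition U_glN :: "nat \<Rightarrow> (nat \<times> nat) free set graded" where
  "U_glN N = presented_algebra ({..<N} \<times> {..<N}) (\<lambda>_. 0) (gl_relations N (\<lambda>_. 0) (\<lambda>_ _. 1))"

definition E_glN :: "nat \<Rightarrow> nat \<Rightarrow> nat \<Rightarrow> (nat \<times> nat) free set" where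
  "E_glN N r s = presented_class ({..<N} \<times> {..<N}) (gl_relations N (\<lambda>_. 0) (\<lambda>_ _. 1)) (gen (r, s))"

text \<open>
  \<open>M\<close> is the simple module of highest weight \<open>\<mu>\<close>; \<open>E i j\<close> for \<open>i, j < r\<close> are the matrix units in
  \<open>U\<close>. If \<open>U\<close> is homogeneous of degree 0, every homogeneous component is a submodule, so that a
  simple graded module is just a simple module placed in a single degree.
\<close>

definition is_simple_highest_weight ::
  "degree set \<Rightarrow> 'u graded \<Rightarrow> (nat \<Rightarrow> nat \<Rightarrow> 'u) \<Rightarrow> nat \<Rightarrow> (nat \<Rightarrow> complex) \<Rightarrow>
   ('u, 'w) gmodule \<Rightarrow> bool" where
  "is_simple_highest_weight \<Gamma> U E r \<mu> M \<longleftrightarrow>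
     is_simple \<Gamma> U M \<and>
     (\<exists>\<gamma>. \<exists>v\<in>hcomp M \<gamma>. v \<noteq> \<zero>\<^bsub>M\<^esub> \<and>
        (\<forall>i j. i < j \<and> j < r \<longrightarrow> act M (E i j) v = \<zero>\<^bsub>M\<^esub>) \<and>
        (\<forall>i<r. act M (E i i) v = \<mu> i \<odot>\<^bsub>M\<^esub> v) \<and>
        (\<forall>S. is_graded_submodule \<Gamma> U M S \<and> v \<in> S \<longrightarrow> S = carrier M))"


section \<open>The algebra \<open>\<complex>\<^sub>\<omega>[x]\<close>\<close>

definition x_relations :: "nat \<Rightarrow> nat \<Rightarrow> nat \<Rightarrow> complex \<Rightarrow> (nat \<times> nat) free set" where
  "x_relations m n N q =
     {gen (i, r) * gen (i, s) - scal ((-1) ^ par m i) * gen (i, s) * gen (i, r) |i r s.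
        i < m + n \<and> r < N \<and> s < N} \<union>
     {gen (i, r) * gen (j, s) - scal ((-1) ^ (par m i * par m j) * q) * gen (j, s) * gen (i, r)
        |i j r s. i < j \<and> j < m + n \<and> r < N \<and> s < N}"

definition C_omega :: "nat \<Rightarrow> nat \<Rightarrow> nat \<Rightarrow> complex \<Rightarrow> (nat \<times> nat) free set graded" where
  "C_omega m n N q =
     presented_algebra ({..<m + n} \<times> {..<N}) (\<lambda>(i, r). eps i) (x_relations m n N q)"

definition x_gen :: "nat \<Rightarrow> nat \<Rightarrow> nat \<Rightarrow> complex \<Rightarrow> nat \<Rightarrow> nat \<Rightarrow> (nat \<times> nat) free set" where
  "x_gen m n N q i r = presented_class ({..<m + n} \<times> {..<N}) (x_relations m n N q) (gen (i, r))"

definition is_partial ::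
  "nat \<Rightarrow> nat \<Rightarrow> nat \<Rightarrow> complex \<Rightarrow> nat \<Rightarrow> nat \<Rightarrow>
   ((nat \<times> nat) free set \<Rightarrow> (nat \<times> nat) free set) \<Rightarrow> bool" where
  "is_partial m n N q i r D \<longleftrightarrow>
     (let A = C_omega m n N q in
      (\<forall>f\<in>carrier A. \<forall>g\<in>carrier A. D (f \<oplus>\<^bsub>A\<^esub> g) = D f \<oplus>\<^bsub>A\<^esub> D g) \<and>
      (\<forall>c. \<forall>f\<in>carrier A. D (c \<odot>\<^bsub>A\<^esub> f) = c \<odot>\<^bsub>A\<^esub> D f) \<and>
      (\<forall>\<alpha>\<in>\<Gamma>grp m n. \<forall>f\<in>hcomp A \<alpha>. D f \<in> hcomp A (\<alpha> - eps i)) \<and>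
      D \<one>\<^bsub>A\<^esub> = \<zero>\<^bsub>A\<^esub> \<and>
      (\<forall>j<m + n. \<forall>s<N.
         D (x_gen m n N q j s) = (if i = j \<and> r = s then \<one>\<^bsub>A\<^esub> else \<zero>\<^bsub>A\<^esub>)) \<and>
      (\<forall>\<alpha>\<in>\<Gamma>grp m n. \<forall>f\<in>hcomp A \<alpha>. \<forall>g\<in>carrier A.
         D (f \<otimes>\<^bsub>A\<^esub> g) = (D f \<otimes>\<^bsub>A\<^esub> g) \<oplus>\<^bsub>A\<^esub> (omega m n q (- eps i) \<alpha> \<odot>\<^bsub>A\<^esub> (f \<otimes>\<^bsub>A\<^esub> D g))))"

text \<open>
  \<open>L\<close> consists of pairs \<open>(x, d(x))\<close> with \<open>x\<close> running through a homogeneous basis of the Lie algebra.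
\<close>

definition is_module_algebra ::
  "degree set \<Rightarrow> (degree \<Rightarrow> degree \<Rightarrow> complex) \<Rightarrow> 'r graded \<Rightarrow> ('r \<times> degree) set \<Rightarrow>
   ('r, 'w) gmodule \<Rightarrow> bool" where
  "is_module_algebra \<Gamma> \<omega> R L A \<longleftrightarrow>
     is_graded_module \<Gamma> R A \<and>
     (\<forall>(x, \<delta>)\<in>L. \<forall>\<alpha>\<in>\<Gamma>. \<forall>f\<in>hcomp A \<alpha>. \<forall>g\<in>carrier A.
        act A x (f \<otimes>\<^bsub>A\<^esub> g) =
          (act A x f \<otimes>\<^bsub>A\<^esub> g) \<oplus>\<^bsub>A\<^esub> (\<omega> \<delta> \<alpha> \<odot>\<^bsub>A\<^esub> (f \<otimes>\<^bsub>A\<^esub> act A x g)))"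

definition UU ::
  "nat \<Rightarrow> nat \<Rightarrow> nat \<Rightarrow> complex \<Rightarrow> ((nat \<times> nat) free set \<times> (nat \<times> nat) free set \<Rightarrow>\<^sub>0 complex) set graded"
  where "UU m n N q = tensor_product (U_glq m n q) (U_glN N)"

definition glq_elem ::
  "nat \<Rightarrow> nat \<Rightarrow> nat \<Rightarrow> complex \<Rightarrow> nat \<Rightarrow> nat \<Rightarrow>
   ((nat \<times> nat) free set \<times> (nat \<times> nat) free set \<Rightarrow>\<^sub>0 complex) set" where
  "glq_elem m n N q i j = pure_tensor (U_glq m n q) (U_glN N) (E_glq m n q i j) \<one>\<^bsub>U_glN N\<^esub>"

definition glN_elem ::
  "nat \<Rightarrow> nat \<Rightarrow> nat \<Rightarrow> complex \<Rightarrow> nat \<Rightarrow> nat \<Rightarrow>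
   ((nat \<times> nat) free set \<times> (nat \<times> nat) free set \<Rightarrow>\<^sub>0 complex) set" where
  "glN_elem m n N q r s = pure_tensor (U_glq m n q) (U_glN N) \<one>\<^bsub>U_glq m n q\<^esub> (E_glN N r s)"

definition lie_elems ::
  "nat \<Rightarrow> nat \<Rightarrow> nat \<Rightarrow> complex \<Rightarrow>
   (((nat \<times> nat) free set \<times> (nat \<times> nat) free set \<Rightarrow>\<^sub>0 complex) set \<times> degree) set" where
  "lie_elems m n N q =
     {(glq_elem m n N q i j, eps i - eps j) |i j. i < m + n \<and> j < m + n} \<union>
     {(glN_elem m n N q r s, 0) |r s. r < N \<and> s < N}"


section \<open>Partitions in the hook\<close>

definition hook_partitions :: "nat \<Rightarrow> nat \<Rightarrow> nat \<Rightarrow> (nat \<Rightarrow> nat) set" where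
  "hook_partitions m n N = {\<nu>. antimono \<nu> \<and> \<nu> m \<le> n \<and> \<nu> N = 0}"

definition transpose_part :: "(nat \<Rightarrow> nat) \<Rightarrow> nat \<Rightarrow> nat" where
  "transpose_part \<nu> j = card {i. j < \<nu> i}"

text \<open>The truncated subtraction of natural numbers is \<open>\<theta>\<close> of the difference.\<close>

definition sharp :: "nat \<Rightarrow> (nat \<Rightarrow> nat) \<Rightarrow> nat \<Rightarrow> nat" where
  "sharp m \<nu> i = (if i < m then \<nu> i else transpose_part \<nu> (i - m) - m)"

end

theory Submission
 imports Defs "HOL-Library.Function_Algebras"
begin

text \<open>
 The algebra is realised on finitely supported functions on exponent vectors, where the generators
 and the derivatives become twisted creation and annihilation operators. For the form that makes
 the monomials orthogonal with factorials as squared lengths, \<open>F\<^sub>r\<^sub>s\<close> is adjoint to \<open>F\<^sub>s\<^sub>r\<close>, and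
 \<open>E\<^sub>i\<^sub>j\<close> to \<open>E\<^sub>j\<^sub>i\<close> up to a nonzero factor on each homogeneous component, whatever the order of \<open>q\<close>.
 Hence complements of submodules are submodules. A joint highest weight vector of column weight
 \<open>\<nu>\<close> is determined by its coefficient at one monomial; this forces \<open>\<nu>\<close> into the hook and the row
 weight to be that of \<open>\<nu>\<^sup>\<sharp>\<close>, and every \<open>\<nu>\<close> in the hook occurs. So the submodules generated by these vectors
 are simple, pairwise orthogonal, and exhaust the algebra. The submodule generated by \<open>f\<close> is a tensor
 product because the map \<open>\<Phi>(a f, b f) = a b f\<close> for \<open>a\<close>, \<open>b\<close> in the two enveloping algebras satisfies
 \<open>\<langle>\<Phi>(v, w), \<Phi>(v', w')\<rangle> \<langle>f, f\<rangle> = \<langle>v, v'\<rangle> \<langle>w, w'\<rangle>\<close>.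
\<close>

section \<open>Creation and annihilation operators\<close>

text \<open>No quantum integers occur: q enters only through invertible commutation factors, and the
  eigenvalues of the diagonal operators are ordinary integers. Since |q| may differ from 1, row
  operators have adjoints only on row-homogeneous vectors; hence every submodule in the argument is
  graded by rows, and projections are taken inside single finite-dimensional components. The
  rigidity of a joint highest weight vector has two sources. In the first min m N rows and columns
  an extremal monomial must be diagonal. On the remaining odd block the row and column Casimir sums
  have equal quartic parts with opposite signs; adding them gives a numerical identity for a 0-1
  matrix. As k distinct naturals sum to at least 0 + ... + (k - 1), it holds only when the columns
  are initial segments. The abstract modules of the statement are replaced by coordinates: a
  bijection to a subspace of functions on which the action is explicit.\<close>

type_synonym mon = "nat \<times> nat => nat"
type_synonym 'a fn = "'a => complex"
type_synonym vec = "mon fn"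

abbreviation "single \<equiv> Poly_Mapping.single"

abbreviation "keys \<equiv> Poly_Mapping.keys"

abbreviation "lookup \<equiv> Poly_Mapping.lookup"

lemma sum_fun_apply [simp]: "(\<Sum>i\<in>A. f i) x = (\<Sum>i\<in>A. f i x)"
 for f :: "'i => 'a => 'b::comm_monoid_add"
 by (induction A rule: infinite_finite_induct) auto

lemma minus_fun_apply [simp]: "(f - g) x = f x - g x"
 for f :: "'a => 'b::ab_group_add"
 by (simp add: fun_diff_def)

lemma uminus_fun_apply [simp]: "(- f) x = - f x"
 for f :: "'a => 'b::ab_group_add"
 by (simp add: fun_Compl_def)

section \<open>Linear operators and subspaces of spaces of functions\<close>

definition sc :: "complex => 'a fn => 'a => complex" where
 "sc c f = (\<lambda>x. c * f x)"

lemma sc_apply [simp]: "sc c f x = c * f x"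
 by (simp add: sc_def)

lemma sc_simps [simp]: "sc 0 f = 0" "sc 1 f = f" "sc c 0 = 0" "sc c (sc d f) = sc (c * d) f"
 by (auto simp: fun_eq_iff)

lemma sc_add: "sc c (f + g) = sc c f + sc c g" "sc (c + d) f = sc c f + sc d f"
 by (auto simp: fun_eq_iff algebra_simps)

lemma sc_diff: "sc c (f - g) = sc c f - sc c g" "sc (c - d) f = sc c f - sc d f"
 by (auto simp: fun_eq_iff algebra_simps)

lemma sc_sum: "sc c (\<Sum>i\<in>A. f i) = (\<Sum>i\<in>A. sc c (f i))"
 by (auto simp: fun_eq_iff sum_distrib_left)

lemma minus_eq_sc: "- f = sc (- 1) f" "f - g = f + sc (- 1) g"
 by (auto simp: fun_eq_iff)

text \<open>Linearity is demanded on all functions, not only on those of finite support, so that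
  operators compose and add up without side conditions.\<close>

definition linop :: "('a fn => 'b => complex) => bool" where
 "linop T \<longleftrightarrow> (\<forall>f g. T (f + g) = T f + T g) \<and> (\<forall>c f. T (sc c f) = sc c (T f))"

lemma linop_add: "linop T ==> T (f + g) = T f + T g"
 and linop_sc: "linop T ==> T (sc c f) = sc c (T f)"
 by (auto simp: linop_def)

lemma linop_0: "linop T ==> T 0 = 0"
 using linop_sc[of T 0 0] by simp

lemma linop_diff: "linop T ==> T (f - g) = T f - T g"
 by (simp only: minus_eq_sc(2) linop_add linop_sc)

lemma linop_sum: "linop T ==> T (\<Sum>i\<in>A. f i) = (\<Sum>i\<in>A. T (f i))"
 by (induction A rule: infinite_finite_induct) (auto simp: linop_0 linop_add)

lemma linop_comp: "linop S ==> linop T ==> linop (\<lambda>f. S (T f))"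
 by (simp add: linop_def)

lemma linop_sumI: "(\<And>i. i \<in> A ==> linop (T i)) ==> linop (\<lambda>f. \<Sum>i\<in>A. T i f)"
 by (simp add: linop_def sum.distrib sc_sum)

definition subsp :: "'a fn set => bool" where
 "subsp S \<longleftrightarrow> 0 \<in> S \<and> (\<forall>f\<in>S. \<forall>g\<in>S. f + g \<in> S) \<and> (\<forall>c. \<forall>f\<in>S. sc c f \<in> S)"

lemma subsp_0: "subsp S ==> 0 \<in> S"
 and subsp_add: "subsp S ==> f \<in> S ==> g \<in> S ==> f + g \<in> S"
 and subsp_sc: "subsp S ==> f \<in> S ==> sc c f \<in> S"
 by (auto simp: subsp_def)

lemma subsp_diff: "subsp S ==> f \<in> S ==> g \<in> S ==> f - g \<in> S"
 by (simp only: minus_eq_sc(2) subsp_add subsp_sc)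

lemma subsp_sum: "subsp S ==> (\<And>i. i \<in> A ==> f i \<in> S) ==> (\<Sum>i\<in>A. f i) \<in> S"
 by (induction A rule: infinite_finite_induct) (auto simp: subsp_0 subsp_add)

lemma subsp_Int: "subsp S ==> subsp T ==> subsp (S \<inter> T)"
 by (auto simp: subsp_def)


section \<open>Twisted operators on exponent vectors and their commutation relations\<close>

locale oscillator =
 fixes m N :: nat and q :: complex
 assumes q0: "q \<noteq> 0"
begin

text \<open>The commutative factor \<omega> at two basis vectors of the grading group, see
  \<open>omega_eps\<close>; it is the constant by which generators of rows i and j commute.\<close>

definition om :: "nat => nat => complex" where
 "om i j = (-1) ^ (par m i * par m j) * (if i < j then q else if j < i then inverse q else 1)"

lemma om_nz [simp]: "om i j \<noteq> 0"
 using q0 by (auto simp: om_def)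

lemma om_inverse: "om i j * om j i = 1"
 using q0 by (auto simp: om_def mult.commute[of "par m j"] power_mult_distrib[symmetric] mult_ac)

lemma om_inverse': "om i j = inverse (om j i)"
 using om_inverse by (metis inverse_unique)

lemma om_same: "om i i = (if i < m then 1 else -1)"
 by (auto simp: om_def par_def)

text \<open>Positions \<open>(i, r)\<close> are ordered lexicographically; monomials are written in increasing order.\<close>

definition below :: "nat \<times> nat => (nat \<times> nat) set" where
 "below p = {..<fst p} \<times> {..<N} \<union> {fst p} \<times> {..<snd p}"

lemma finite_below [simp]: "finite (below p)"
 by (simp add: below_def)

lemma below_irrefl [simp]: "p \<notin> below p"
 by (auto simp: below_def)

lemma below_total: "snd p < N ==> snd p' < N ==> p \<noteq> p' ==> p \<in> below p' \<or> p' \<in> below p"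
 by (cases p; cases p') (auto simp: below_def)

lemma below_asym: "p \<in> below p' ==> p' \<notin> below p"
 by (cases p; cases p') (auto simp: below_def)

text \<open>The scalar that arises when a generator at p, multiplied from the left, is moved past
  all smaller generators to its place in the ordered monomial. It does not depend on the exponent at
  p itself.\<close>

definition sg :: "nat \<times> nat => mon => complex" where
 "sg p a = (\<Prod>p'\<in>below p. om (fst p) (fst p') ^ a p')"

lemma sg_nz [simp]: "sg p a \<noteq> 0"
 by (simp add: sg_def)

lemma sg_upd_not: "p' \<notin> below p ==> sg p (a(p' := k)) = sg p a"
 unfolding sg_def by (intro prod.cong) auto

lemma sg_upd_Suc:
 assumes "p' \<in> below p"
 shows "sg p (a(p' := Suc k)) = om (fst p) (fst p') * sg p (a(p' := k))"
 using assms unfolding sg_def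
 by (subst (1 2) prod.remove[of _ p']) (auto intro!: prod.cong)

lemma sg_Suc: "p' \<in> below p ==> sg p (a(p' := Suc (a p'))) = om (fst p) (fst p') * sg p a"
 by (simp add: sg_upd_Suc)

lemma sg_pred: "p' \<in> below p ==> a p' \<noteq> 0 ==> sg p (a(p' := a p' - Suc 0)) = om (fst p') (fst p) * sg p a"
 using sg_upd_Suc[of p' p a "a p' - 1"] om_inverse[of "fst p'" "fst p"]
 by (simp add: mult.assoc[symmetric])

text \<open>Left multiplication by the generator at p in the basis of ordered monomials. In an odd
  row the generator squares to zero, so a product can only carry the exponent 1 there.\<close>

definition xx :: "nat \<times> nat => vec => vec" where
 "xx p f = (\<lambda>a. if a p = 0 \<or> (m \<le> fst p \<and> a p \<noteq> 1) then 0 else sg p a * f (a(p := a p - 1)))"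

text \<open>The twisted partial derivative. The division by \<open>sg\<close> undoes the sorting:
  before differentiating, the generator at p is brought back to the front.\<close>

definition dd :: "nat \<times> nat => vec => vec" where
 "dd p f = (\<lambda>a. if m \<le> fst p \<and> a p \<noteq> 0 then 0
   else of_nat (Suc (a p)) / sg p a * f (a(p := Suc (a p))))"

lemma linop_xx [simp]: "linop (xx p)" and linop_dd [simp]: "linop (dd p)"
 by (auto simp: linop_def xx_def dd_def fun_eq_iff algebra_simps)

lemmas X_lin = linop_add[OF linop_xx] linop_sc[OF linop_xx] linop_0[OF linop_xx] linop_diff[OF linop_xx]
 and dd_lin = linop_add[OF linop_dd] linop_sc[OF linop_dd] linop_0[OF linop_dd] linop_diff[OF linop_dd]

lemmas xx_sum = linop_sum[OF linop_xx] and dd_sum = linop_sum[OF linop_dd]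

text \<open>As p' precedes p, changing the exponent at p leaves \<open>sg p'\<close> alone, whereas
  a change at p' multiplies \<open>sg p\<close> by one factor \<open>om\<close>. That single factor
  is the commutation constant, here and in the next three lemmas.\<close>

lemma X_X_below:
 assumes "p' \<in> below p"
 shows "xx p (xx p' f) = sc (om (fst p) (fst p')) (xx p' (xx p f))"
proof
 fix a :: mon
 have ne: "p \<noteq> p'" "p' \<noteq> p" using assms below_irrefl by blast+
 have na: "p \<notin> below p'" "p' \<notin> below p'" using assms below_asym by auto
 have tw: "a(p' := x, p := y) = a(p := y, p' := x)" for x y using ne by (simp add: fun_upd_twist)
 have om: "om (fst p) (fst p') * om (fst p') (fst p) = 1" "om (fst p') (fst p) * om (fst p) (fst p') = 1"
  by (rule om_inverse)+
 have om': "om (fst p) (fst p') = inverse (om (fst p') (fst p))"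
  by (rule om_inverse')
 show "xx p (xx p' f) a = (sc (om (fst p) (fst p')) (xx p' (xx p f))) a"
  using assms ne
  by (simp add: xx_def dd_def na tw sg_upd_not sg_pred sg_Suc om' field_simps)
qed

lemma dd_dd_below:
 assumes "p' \<in> below p"
 shows "dd p (dd p' f) = sc (om (fst p) (fst p')) (dd p' (dd p f))"
proof
 fix a :: mon
 have ne: "p \<noteq> p'" "p' \<noteq> p" using assms below_irrefl by blast+
 have na: "p \<notin> below p'" "p' \<notin> below p'" using assms below_asym by auto
 have tw: "a(p' := x, p := y) = a(p := y, p' := x)" for x y using ne by (simp add: fun_upd_twist)
 have om: "om (fst p) (fst p') * om (fst p') (fst p) = 1" "om (fst p') (fst p) * om (fst p) (fst p') = 1"
  by (rule om_inverse)+
 have om': "om (fst p) (fst p') = inverse (om (fst p') (fst p))"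
  by (rule om_inverse')
 show "dd p (dd p' f) a = (sc (om (fst p) (fst p')) (dd p' (dd p f))) a"
  using assms ne
  by (simp add: xx_def dd_def na tw sg_upd_not sg_pred sg_Suc om' field_simps)
qed

lemma dd_X_below:
 assumes "p' \<in> below p"
 shows "dd p (xx p' f) = sc (om (fst p') (fst p)) (xx p' (dd p f))"
proof
 fix a :: mon
 have ne: "p \<noteq> p'" "p' \<noteq> p" using assms below_irrefl by blast+
 have na: "p \<notin> below p'" "p' \<notin> below p'" using assms below_asym by auto
 have tw: "a(p' := x, p := y) = a(p := y, p' := x)" for x y using ne by (simp add: fun_upd_twist)
 have om: "om (fst p) (fst p') * om (fst p') (fst p) = 1" "om (fst p') (fst p) * om (fst p) (fst p') = 1"
  by (rule om_inverse)+
 have om': "om (fst p) (fst p') = inverse (om (fst p') (fst p))"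
  by (rule om_inverse')
 show "dd p (xx p' f) a = (sc (om (fst p') (fst p)) (xx p' (dd p f))) a"
  using assms ne
  by (simp add: xx_def dd_def na tw sg_upd_not sg_pred sg_Suc om' field_simps)
qed

lemma dd_X_above:
 assumes "p' \<in> below p"
 shows "dd p' (xx p f) = sc (om (fst p) (fst p')) (xx p (dd p' f))"
proof
 fix a :: mon
 have ne: "p \<noteq> p'" "p' \<noteq> p" using assms below_irrefl by blast+
 have na: "p \<notin> below p'" "p' \<notin> below p'" using assms below_asym by auto
 have tw: "a(p' := x, p := y) = a(p := y, p' := x)" for x y using ne by (simp add: fun_upd_twist)
 have om: "om (fst p) (fst p') * om (fst p') (fst p) = 1" "om (fst p') (fst p) * om (fst p) (fst p') = 1"
  by (rule om_inverse)+
 have om': "om (fst p) (fst p') = inverse (om (fst p') (fst p))"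
  by (rule om_inverse')
 show "dd p' (xx p f) a = (sc (om (fst p) (fst p')) (xx p (dd p' f))) a"
  using assms ne
  by (simp add: xx_def dd_def na tw sg_upd_not sg_pred sg_Suc om' field_simps)
qed

lemma X_X:
 assumes "snd p < N" "snd p' < N"
 shows "xx p (xx p' f) = sc (om (fst p) (fst p')) (xx p' (xx p f))"
proof (cases "p = p'")
 case True
 thus ?thesis by (auto simp: xx_def om_same fun_eq_iff)
next
 case False
 then consider "p' \<in> below p" | "p \<in> below p'" using below_total assms by blast
 thus ?thesis
  by cases (auto simp: X_X_below om_inverse)
qed

lemma dd_dd:
 assumes "snd p < N" "snd p' < N"
 shows "dd p (dd p' f) = sc (om (fst p) (fst p')) (dd p' (dd p f))"
proof (cases "p = p'")
 case True
 thus ?thesis by (auto simp: dd_def om_same fun_eq_iff)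
next
 case False
 then consider "p' \<in> below p" | "p \<in> below p'" using below_total assms by blast
 thus ?thesis
  by cases (auto simp: dd_dd_below om_inverse)
qed

text \<open>\<open>M\<close> stands for \<open>m + n\<close>; it is kept variable in order to compare different \<open>n\<close>.\<close>

definition valid :: "nat => mon => bool" where
 "valid M a \<longleftrightarrow> (\<forall>p. a p \<noteq> 0 \<longrightarrow> fst p < M \<and> snd p < N) \<and> (\<forall>p. m \<le> fst p \<longrightarrow> a p \<le> 1)"

lemma valid_box: "valid M a ==> a p \<noteq> 0 ==> fst p < M \<and> snd p < N"
 and valid_odd: "valid M a ==> m \<le> fst p ==> a p \<le> 1"
 unfolding valid_def by blast+

lemma validI: "(\<And>p. a p \<noteq> 0 ==> fst p < M \<and> snd p < N) ==> (\<And>p. m \<le> fst p ==> a p \<le> 1) ==> valid M a"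
 unfolding valid_def by blast

text \<open>The space of coordinates of the algebra, see \<open>psi_lin_model\<close>.\<close>

definition B :: "nat => vec set" where
 "B M = {f. finite {a. f a \<noteq> 0} \<and> (\<forall>a. f a \<noteq> 0 \<longrightarrow> valid M a)}"

lemma B_finite: "f \<in> B M ==> finite {a. f a \<noteq> 0}"
 and B_valid: "f \<in> B M ==> f a \<noteq> 0 ==> valid M a"
 by (auto simp: B_def)

lemma subsp_B [simp]: "subsp (B M)"
proof -
 have "finite {a. f a + g a \<noteq> 0}" if "finite {a. f a \<noteq> 0}" "finite {a. g a \<noteq> 0}" for f g :: vec
  by (rule finite_subset[OF _ finite_UnI[OF that]]) auto
 moreover have "finite {a. c * f a \<noteq> 0}" if "finite {a. f a \<noteq> 0}" for f :: vec and c
  by (rule finite_subset[OF _ that]) auto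
 ultimately show ?thesis
  by (auto simp: subsp_def B_def) (metis add_0)
qed

text \<open>Membership in \<open>B M\<close> is essential in odd rows: at an exponent larger than 1
  both operator products vanish, so the identity forces f to vanish there as well.\<close>

lemma dd_X_same:
 assumes "f \<in> B M"
 shows "dd p (xx p f) = f + sc (om (fst p) (fst p)) (xx p (dd p f))"
proof
 fix a :: mon
 show "dd p (xx p f) a = (f + sc (om (fst p) (fst p)) (xx p (dd p f))) a"
 proof (cases "fst p < m")
  case True
  thus ?thesis
   by (auto simp: dd_def xx_def om_same sg_upd_not field_simps)
 next
  case False
  have "f a = 0" if "a p > 1"
  proof (rule ccontr)
   assume "f a \<noteq> 0"
   hence "valid M a" using assms B_valid by blast
   thus False using that False valid_odd[of M a p] by simp
  qed
  thus ?thesis using False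
   by (cases "a p = 0"; cases "a p = 1")
     (auto simp: dd_def xx_def om_same sg_upd_not fun_upd_idem)
 qed
qed

lemma dd_X:
 assumes "f \<in> B M" "snd p < N" "snd p' < N"
 shows "dd p (xx p' f) = (if p = p' then f else 0) + sc (om (fst p') (fst p)) (xx p' (dd p f))"
proof (cases "p = p'")
 case True
 thus ?thesis using dd_X_same[OF assms(1), of p] by simp
next
 case False
 thus ?thesis using dd_X_below[of p' p] dd_X_above[of p p'] below_total[OF assms(2,3)] by auto
qed

lemma valid_mono:
 assumes "valid M a" "\<And>p. b p \<le> a p"
 shows "valid M b"
proof (rule validI)
 show "fst p < M \<and> snd p < N" if "b p \<noteq> 0" for p
  using valid_box[OF assms(1), of p] assms(2)[of p] that by simp
 show "b p \<le> 1" if "m \<le> fst p" for p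
  using valid_odd[OF assms(1) that] assms(2)[of p] by simp
qed

lemma valid_pred: "valid M a ==> valid M (a(p := a p - 1))"
 by (rule valid_mono) auto

lemma X_B:
 assumes "f \<in> B M" "fst p < M" "snd p < N"
 shows "xx p f \<in> B M"
proof -
 have "{a. xx p f a \<noteq> 0} \<subseteq> (\<lambda>b. b(p := Suc (b p))) ` {a. f a \<noteq> 0}"
 proof
  fix a assume "a \<in> {a. xx p f a \<noteq> 0}"
  hence "a p \<noteq> 0" "f (a(p := a p - 1)) \<noteq> 0" by (auto simp: xx_def split: if_splits)
  thus "a \<in> (\<lambda>b. b(p := Suc (b p))) ` {a. f a \<noteq> 0}"
   by (intro image_eqI[of _ _ "a(p := a p - 1)"]) auto
 qed
 hence "finite {a. xx p f a \<noteq> 0}" using assms(1) B_finite finite_surj by blast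
 moreover have "valid M a" if "xx p f a \<noteq> 0" for a
 proof -
  have *: "a p \<noteq> 0" "m \<le> fst p \<longrightarrow> a p = 1" "f (a(p := a p - 1)) \<noteq> 0"
   using that by (auto simp: xx_def split: if_splits)
  hence "valid M (a(p := a p - 1))" using assms B_valid by blast
  from valid_box[OF this] valid_odd[OF this] show ?thesis
   using * assms(2,3) by (intro validI) (metis fun_upd_other le_refl)+
 qed
 ultimately show ?thesis by (auto simp: B_def)
qed

lemma dd_B:
 assumes "f \<in> B M"
 shows "dd p f \<in> B M"
proof -
 have "{a. dd p f a \<noteq> 0} \<subseteq> (\<lambda>b. b(p := b p - 1)) ` {a. f a \<noteq> 0}"
 proof
  fix a assume "a \<in> {a. dd p f a \<noteq> 0}"
  hence "f (a(p := Suc (a p))) \<noteq> 0" by (auto simp: dd_def split: if_splits)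
  thus "a \<in> (\<lambda>b. b(p := b p - 1)) ` {a. f a \<noteq> 0}"
   by (intro image_eqI[of _ _ "a(p := Suc (a p))"]) auto
 qed
 hence "finite {a. dd p f a \<noteq> 0}" using assms(1) B_finite finite_surj by blast
 moreover have "valid M a" if "dd p f a \<noteq> 0" for a
 proof -
  have "f (a(p := Suc (a p))) \<noteq> 0"
   using that by (auto simp: dd_def split: if_splits)
  hence "valid M (a(p := Suc (a p)))" using assms B_valid by blast
  from valid_pred[OF this, of p] show ?thesis by simp
 qed
 ultimately show ?thesis by (auto simp: B_def)
qed

text \<open>The common source of the commutation relations of row and column operators. Both sides
  are brought to the order creation, creation, annihilation, annihilation; the quartic terms match
  for this c, which is \<omega> at the degrees of the two quadratic operators, compare
  \<open>omega_glq_degree\<close>.\<close>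

lemma quadratic_commutation:
 assumes "f \<in> B M" "snd p1 < N" "snd p2 < N" "snd p3 < N" "snd p4 < N" "fst p1 < M" "fst p3 < M"
  and c: "c = om (fst p1) (fst p3) * om (fst p4) (fst p1) * om (fst p3) (fst p2) * om (fst p2) (fst p4)"
 shows "xx p1 (dd p2 (xx p3 (dd p4 f))) =
  sc c (xx p3 (dd p4 (xx p1 (dd p2 f))))
   + (if p2 = p3 then xx p1 (dd p4 f) else 0) - sc c (if p4 = p1 then xx p3 (dd p2 f) else 0)"
proof -
 have 1: "xx p1 (dd p2 (xx p3 (dd p4 f))) = (if p2 = p3 then xx p1 (dd p4 f) else 0)
  + sc (om (fst p3) (fst p2)) (xx p1 (xx p3 (dd p2 (dd p4 f))))"
  using assms by (auto simp: dd_X[OF dd_B] X_lin)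
 have 2: "xx p3 (dd p4 (xx p1 (dd p2 f))) = (if p4 = p1 then xx p3 (dd p2 f) else 0)
  + sc (om (fst p1) (fst p4)) (xx p3 (xx p1 (dd p4 (dd p2 f))))"
  using assms by (auto simp: dd_X[OF dd_B] X_lin)
 have 3: "xx p1 (xx p3 (dd p2 (dd p4 f)))
   = sc (om (fst p1) (fst p3) * om (fst p2) (fst p4)) (xx p3 (xx p1 (dd p4 (dd p2 f))))"
  using assms by (simp add: X_X[of p1 p3] dd_dd[of p2 p4] X_lin mult_ac)
 have "c * om (fst p1) (fst p4) = om (fst p3) (fst p2) * (om (fst p1) (fst p3) * om (fst p2) (fst p4))"
  using om_inverse[of "fst p1" "fst p4"] unfolding c by (simp add: mult_ac)
 thus ?thesis unfolding 1 2 3 by (simp add: sc_add X_lin)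
qed

definition E :: "nat => nat => vec => vec" where
 "E i j f = (\<Sum>r<N. xx (i, r) (dd (j, r) f))"

definition F :: "nat => nat => nat => vec => vec" where
 "F M r s f = (\<Sum>i<M. xx (i, r) (dd (i, s) f))"

lemma linop_E [simp]: "linop (E i j)" and linop_F [simp]: "linop (F M r s)"
 unfolding E_def[abs_def] F_def[abs_def] by (rule linop_sumI, rule linop_comp[OF linop_xx linop_dd])+

lemmas E_lin = linop_add[OF linop_E] linop_sc[OF linop_E] linop_0[OF linop_E] linop_diff[OF linop_E]
 and F_lin = linop_add[OF linop_F] linop_sc[OF linop_F] linop_0[OF linop_F] linop_diff[OF linop_F]

lemma E_B: "f \<in> B M ==> i < M ==> E i j f \<in> B M"
 unfolding E_def by (intro subsp_sum X_B dd_B) auto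

lemma F_B: "f \<in> B M ==> r < N ==> F M r s f \<in> B M"
 unfolding F_def by (intro subsp_sum X_B dd_B) auto

lemma E_E:
 assumes "f \<in> B M" "i < M" "k < M" and c: "c = om i k * om l i * om k j * om j l"
 shows "E i j (E k l f) = sc c (E k l (E i j f)) + (if j = k then E i l f else 0)
  - sc c (if l = i then E k j f else 0)"
proof -
 have "E i j (E k l f) = (\<Sum>r<N. \<Sum>s<N. xx (i, r) (dd (j, r) (xx (k, s) (dd (l, s) f))))"
  unfolding E_def xx_sum dd_sum ..
 also have "\<dots> = (\<Sum>r<N. \<Sum>s<N. sc c (xx (k, s) (dd (l, s) (xx (i, r) (dd (j, r) f))))
   + (if j = k \<and> r = s then xx (i, r) (dd (l, s) f) else 0)
   - sc c (if l = i \<and> s = r then xx (k, s) (dd (j, r) f) else 0))"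
  by (intro sum.cong refl, subst quadratic_commutation[OF assms(1), where c = c]) (use assms in auto)
 also have "\<dots> = sc c (\<Sum>r<N. \<Sum>s<N. (xx (k, s) (dd (l, s) (xx (i, r) (dd (j, r) f)))))
   + (\<Sum>r<N. \<Sum>s<N. if j = k \<and> r = s then xx (i, r) (dd (l, s) f) else 0)
   - sc c (\<Sum>r<N. \<Sum>s<N. if l = i \<and> s = r then xx (k, s) (dd (j, r) f) else 0)"
  by (simp add: sum.distrib sum_subtractf sc_sum)
 also have "(\<Sum>r<N. \<Sum>s<N. (xx (k, s) (dd (l, s) (xx (i, r) (dd (j, r) f))))) = E k l (E i j f)"
  unfolding E_def xx_sum dd_sum by (rule sum.swap)
 also have "(\<Sum>r<N. \<Sum>s<N. if j = k \<and> r = s then xx (i, r) (dd (l, s) f) else 0)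
   = (if j = k then E i l f else 0)"
  unfolding E_def by simp
 also have "(\<Sum>r<N. \<Sum>s<N. if l = i \<and> s = r then xx (k, s) (dd (j, r) f) else 0)
   = (if l = i then E k j f else 0)"
  unfolding E_def by simp
 finally show ?thesis .
qed

text \<open>Every summand of a column operator creates and annihilates in one row, hence has degree
  zero, and the constant of \<open>quadratic_commutation\<close> is 1.\<close>

lemma F_F:
 assumes "f \<in> B M" "r < N" "s < N" "t < N" "u < N"
 shows "F M r s (F M t u f) = F M t u (F M r s f) + (if s = t then F M r u f else 0)
  - (if u = r then F M t s f else 0)"
proof -
 have "F M r s (F M t u f) = (\<Sum>i<M. \<Sum>j<M. xx (i, r) (dd (i, s) (xx (j, t) (dd (j, u) f))))"
  unfolding F_def xx_sum dd_sum ..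
 also have "\<dots> = (\<Sum>i<M. \<Sum>j<M. (xx (j, t) (dd (j, u) (xx (i, r) (dd (i, s) f))))
   + (if i = j \<and> s = t then xx (i, r) (dd (j, u) f) else 0)
   - (if j = i \<and> u = r then xx (j, t) (dd (i, s) f) else 0))"
 proof (intro sum.cong refl, goal_cases)
  case (1 i j)
  thus ?case
   by (subst quadratic_commutation[OF assms(1), where c = 1]) (use assms om_inverse[of i j] in \<open>auto simp: mult_ac\<close>)
 qed
 also have "\<dots> = (\<Sum>i<M. \<Sum>j<M. (xx (j, t) (dd (j, u) (xx (i, r) (dd (i, s) f)))))
   + (\<Sum>i<M. \<Sum>j<M. if i = j \<and> s = t then xx (i, r) (dd (j, u) f) else 0)
   - (\<Sum>i<M. \<Sum>j<M. if j = i \<and> u = r then xx (j, t) (dd (i, s) f) else 0)"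
  by (simp add: sum.distrib sum_subtractf)
 also have "(\<Sum>i<M. \<Sum>j<M. (xx (j, t) (dd (j, u) (xx (i, r) (dd (i, s) f))))) = F M t u (F M r s f)"
  unfolding F_def xx_sum dd_sum by (rule sum.swap)
 also have "(\<Sum>i<M. \<Sum>j<M. if i = j \<and> s = t then xx (i, r) (dd (j, u) f) else 0)
   = (if s = t then F M r u f else 0)"
  unfolding F_def by (cases "s = t") auto
 also have "(\<Sum>i<M. \<Sum>j<M. if j = i \<and> u = r then xx (j, t) (dd (i, s) f) else 0)
   = (if u = r then F M t s f else 0)"
  unfolding F_def by (cases "u = r") auto
 finally show ?thesis .
qed

text \<open>The summands of the column operator have degree zero, so no twist arises, and the two
  contraction sums are both \<open>xx (i, r) (dd (j, s) f)\<close> and cancel.\<close>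

lemma E_F_commute:
 assumes "f \<in> B M" "i < M" "j < M" "r < N" "s < N"
 shows "E i j (F M r s f) = F M r s (E i j f)"
proof -
 have "E i j (F M r s f) = (\<Sum>t<N. \<Sum>k<M. xx (i, t) (dd (j, t) (xx (k, r) (dd (k, s) f))))"
  unfolding E_def F_def xx_sum dd_sum ..
 also have "\<dots> = (\<Sum>t<N. \<Sum>k<M. (xx (k, r) (dd (k, s) (xx (i, t) (dd (j, t) f))))
   + (if k = j \<and> t = r then xx (i, t) (dd (k, s) f) else 0)
   - (if k = i \<and> s = t then xx (k, r) (dd (j, t) f) else 0))"
 proof (intro sum.cong refl, goal_cases)
  case (1 t k)
  have "om k i * (om i k * om k j * om j k) = 1"
   using om_inverse[of k i] om_inverse[of k j] by (simp add: mult.assoc[symmetric])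
  with 1 show ?case
   by (subst quadratic_commutation[OF assms(1), where c = 1])
     (use assms om_inverse[of i k] om_inverse[of j k] in \<open>auto simp: mult_ac\<close>)
 qed
 also have "\<dots> = (\<Sum>t<N. \<Sum>k<M. (xx (k, r) (dd (k, s) (xx (i, t) (dd (j, t) f)))))
   + (\<Sum>t<N. \<Sum>k<M. if k = j \<and> t = r then xx (i, t) (dd (k, s) f) else 0)
   - (\<Sum>t<N. \<Sum>k<M. if k = i \<and> s = t then xx (k, r) (dd (j, t) f) else 0)"
  by (simp add: sum.distrib sum_subtractf)
 also have "(\<Sum>t<N. \<Sum>k<M. (xx (k, r) (dd (k, s) (xx (i, t) (dd (j, t) f))))) = F M r s (E i j f)"
  unfolding F_def E_def xx_sum dd_sum by (rule sum.swap)
 also have "(\<Sum>t<N. \<Sum>k<M. if k = j \<and> t = r then xx (i, t) (dd (k, s) f) else 0)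
   = xx (i, r) (dd (j, s) f)"
 proof -
  have "(\<Sum>k<M. if k = j \<and> t = r then xx (i, t) (dd (k, s) f) else 0)
    = (if t = r then xx (i, r) (dd (j, s) f) else 0)" for t
   using assms by (cases "t = r") auto
  thus ?thesis using assms by simp
 qed
 also have "(\<Sum>t<N. \<Sum>k<M. if k = i \<and> s = t then xx (k, r) (dd (j, t) f) else 0)
   = xx (i, r) (dd (j, s) f)"
 proof -
  have "(\<Sum>k<M. if k = i \<and> s = t then xx (k, r) (dd (j, t) f) else 0)
    = (if s = t then xx (i, r) (dd (j, s) f) else 0)" for t
   using assms by (cases "s = t") auto
  thus ?thesis using assms by simp
 qed
 finally show ?thesis by simp
qed

end

section \<open>The contravariant form\<close>

definition FS :: "'a fn set" where
 "FS = {f. finite {a. f a \<noteq> 0}}"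

lemma subsp_FS [simp]: "subsp FS"
proof -
 have "finite {a. f a + g a \<noteq> 0}" if "finite {a. f a \<noteq> 0}" "finite {a. g a \<noteq> 0}"
  for f g :: "'a => complex"
  by (rule finite_subset[OF _ finite_UnI[OF that]]) auto
 moreover have "finite {a. c * f a \<noteq> 0}" if "finite {a. f a \<noteq> 0}" for f :: "'a => complex" and c
  by (rule finite_subset[OF _ that]) auto
 ultimately show ?thesis
  by (auto simp: subsp_def FS_def)
qed

definition prj :: "('a => 'd) => 'd => 'a fn => 'a => complex" where
 "prj \<delta> d f = (\<lambda>a. if \<delta> a = d then f a else 0)"

definition supported :: "'a set => 'a fn => bool" where
 "supported K f \<longleftrightarrow> (\<forall>a. f a \<noteq> 0 \<longrightarrow> a \<in> K)"

abbreviation homog :: "('a => 'd) => 'd => 'a fn => bool" where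
 "homog \<delta> d \<equiv> supported {a. \<delta> a = d}"

lemma linop_prj [simp]: "linop (prj \<delta> d)"
 by (auto simp: linop_def prj_def fun_eq_iff)

lemma homog_prj [simp]: "homog \<delta> d (prj \<delta> d f)"
 by (simp add: supported_def prj_def)

lemma prj_homog: "homog \<delta> d f ==> prj \<delta> e f = (if d = e then f else 0)"
 by (auto simp: supported_def prj_def fun_eq_iff)

lemma subsp_supported [simp]: "subsp {f. supported K f}"
 by (auto simp: subsp_def supported_def) (metis add_0)

lemma supported_0 [simp]: "supported K 0"
 by (simp add: supported_def)

lemma supported_FS: "finite K ==> supported K f ==> f \<in> FS"
 by (auto simp: supported_def FS_def intro: finite_subset)

lemma sum_prj:
 assumes "finite D" "\<And>a. f a \<noteq> 0 ==> \<delta> a \<in> D"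
 shows "(\<Sum>d\<in>D. prj \<delta> d f) = f"
 using assms by (auto simp: fun_eq_iff prj_def)

lemma sum_prj_FS: "f \<in> FS ==> (\<Sum>d\<in>\<delta> ` {a. f a \<noteq> 0}. prj \<delta> d f) = f"
 by (intro sum_prj) (auto simp: FS_def)

lemma prj_FS: "f \<in> FS ==> prj \<delta> d f \<in> FS"
 unfolding FS_def by (auto simp: prj_def intro: finite_subset[of _ "{a. f a \<noteq> 0}"])

definition graded_by :: "('a => 'd) => 'a fn set => bool" where
 "graded_by \<delta> S \<longleftrightarrow> (\<forall>f\<in>S. \<forall>d. prj \<delta> d f \<in> S)"

text \<open>The new degree is only asserted to exist: for vectors of naturals it is given by the
  truncated \<open>move\<close> and not by a translation.\<close>

definition hop :: "('a => 'd) => ('a fn => 'a => complex) => bool" where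
 "hop \<delta> T \<longleftrightarrow> (\<forall>d. \<exists>d'. \<forall>f. homog \<delta> d f \<longrightarrow> homog \<delta> d' (T f))"

definition orb :: "('a fn => 'a => complex) set => 'a fn => 'a fn set" where
 "orb O' f = \<Inter>{S. subsp S \<and> f \<in> S \<and> (\<forall>T\<in>O'. \<forall>x\<in>S. T x \<in> S)}"

lemma orb_least:
 assumes "f \<in> S" "subsp S" "\<And>x T. x \<in> S ==> T \<in> O' ==> T x \<in> S"
 shows "orb O' f \<subseteq> S"
 unfolding orb_def by (rule Inter_lower) (use assms in blast)

lemma subsp_orb [simp]: "subsp (orb O' f)"
 unfolding orb_def subsp_def by blast

lemma orb_base: "f \<in> orb O' f"
 unfolding orb_def by blast

lemma orb_step: "x \<in> orb O' f ==> T \<in> O' ==> T x \<in> orb O' f"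
 unfolding orb_def by blast

text \<open>Induction over a generated submodule in which the step may also use that x belongs to
  that submodule.\<close>

lemma orb_subset:
 assumes "f \<in> S" "subsp S" "\<And>x T. x \<in> S ==> x \<in> orb O' f ==> T \<in> O' ==> T x \<in> S"
 shows "orb O' f \<subseteq> S"
proof -
 have "orb O' f \<subseteq> orb O' f \<inter> S"
  by (rule orb_least) (use assms in \<open>auto simp: orb_base orb_step subsp_Int\<close>)
 thus ?thesis by blast
qed

lemma orb_mono: "O' \<subseteq> P ==> orb O' f \<subseteq> orb P f"
 by (rule orb_least) (auto simp: orb_base orb_step)

text \<open>The induction proves that all components of x lie in the orbit. A component of
  \<open>T x\<close> is a sum of images \<open>T (prj \<delta> d x)\<close>, because each of these
  images is homogeneous and so is either kept or killed by a projection.\<close>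

lemma orb_graded:
 assumes "homog \<delta> d f" "f \<in> FS" "\<And>T. T \<in> O' ==> linop T" "\<And>T. T \<in> O' ==> hop \<delta> T"
  and FS: "\<And>T x. T \<in> O' ==> x \<in> FS ==> T x \<in> FS"
 shows "graded_by \<delta> (orb O' f)"
proof -
 let ?S = "{x \<in> FS. \<forall>e. prj \<delta> e x \<in> orb O' f}"
 have "orb O' f \<subseteq> ?S"
 proof (rule orb_subset)
  show "f \<in> ?S" using assms(1,2) orb_base[of f O'] subsp_0[OF subsp_orb[of O' f]] by (simp add: prj_homog)
  show "subsp ?S"
   unfolding subsp_def
   by (auto simp: linop_0[OF linop_prj] linop_add[OF linop_prj] linop_sc[OF linop_prj]
     subsp_0 subsp_add subsp_sc)
  fix x T assume x: "x \<in> ?S" "x \<in> orb O' f" and T: "T \<in> O'"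
  have "prj \<delta> e (T x) \<in> orb O' f" for e
  proof -
   let ?D = "\<delta> ` {a. x a \<noteq> 0}"
   have "T x = (\<Sum>d\<in>?D. T (prj \<delta> d x))"
    using linop_sum[OF assms(3)[OF T], of "\<lambda>d. prj \<delta> d x" ?D] sum_prj_FS[of x \<delta>] x by simp
   from arg_cong[OF this, of "prj \<delta> e"]
   have "prj \<delta> e (T x) = (\<Sum>d\<in>?D. prj \<delta> e (T (prj \<delta> d x)))"
    by (rule trans) (rule linop_sum[OF linop_prj])
   moreover have "prj \<delta> e (T (prj \<delta> d x)) \<in> orb O' f" for d
   proof -
    have "\<exists>d'. \<forall>f. homog \<delta> d f \<longrightarrow> homog \<delta> d' (T f)"
     using assms(4)[OF T] unfolding hop_def by (rule spec)
    then obtain d' where d': "\<forall>f. homog \<delta> d f \<longrightarrow> homog \<delta> d' (T f)" ..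
    have "homog \<delta> d' (T (prj \<delta> d x))" by (rule d'[rule_format, OF homog_prj])
    moreover have "T (prj \<delta> d x) \<in> orb O' f" using x(1) by (intro orb_step[OF _ T]) simp
    ultimately show ?thesis using subsp_0[OF subsp_orb[of O' f]] by (simp add: prj_homog)
   qed
   ultimately show ?thesis by (simp only:) (rule subsp_sum[OF subsp_orb])
  qed
  thus "T x \<in> ?S" using x FS[OF T] by blast
 qed
 thus ?thesis by (auto simp: graded_by_def)
qed


section \<open>Factorial weights and the Hermitian form\<close>

definition wt :: "mon => complex" where
 "wt a = (\<Prod>p | a p \<noteq> 0. of_nat (fact (a p)))"

lemma wt_nz [simp]: "wt a \<noteq> 0"
 by (cases "finite {p. a p \<noteq> 0}") (auto simp: wt_def)

lemma wt_Real [simp]: "cnj (wt a) = wt a"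
 by (simp add: wt_def)

lemma wt_pos: "\<exists>c>0. wt a = of_real c"
proof -
 have "wt a = of_real (\<Prod>p | a p \<noteq> 0. real (fact (a p)))" by (simp add: wt_def)
 moreover have "(\<Prod>p | a p \<noteq> 0. real (fact (a p))) > 0" by (intro prod_pos) auto
 ultimately show ?thesis by blast
qed

text \<open>The recursion for which the factorials are chosen: it absorbs the factor
  \<open>Suc (a p)\<close> of the derivative and makes \<open>dd p\<close> adjoint to
  \<open>xx p\<close> up to a positive factor.\<close>

lemma wt_Suc:
 assumes "finite {p. a p \<noteq> 0}"
 shows "wt (a(p := Suc (a p))) = of_nat (Suc (a p)) * wt a"
proof -
 have eq: "wt b = (\<Prod>p'\<in>insert p {p. a p \<noteq> 0}. of_nat (fact (b p')))"
  if "{p. b p \<noteq> 0} \<subseteq> insert p {p. a p \<noteq> 0}" for b :: mon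
  unfolding wt_def by (rule prod.mono_neutral_left) (use assms that in auto)
 have "wt (a(p := Suc (a p))) = of_nat (fact (Suc (a p))) * (\<Prod>p'\<in>{p. a p \<noteq> 0} - {p}. of_nat (fact ((a(p := Suc (a p))) p')))"
  by (subst eq, force split: if_splits, subst prod.insert_remove[OF assms], simp del: fact_Suc)
 also have "(\<Prod>p'\<in>{p. a p \<noteq> 0} - {p}. of_nat (fact ((a(p := Suc (a p))) p')))
   = (\<Prod>p'\<in>{p. a p \<noteq> 0} - {p}. of_nat (fact (a p')) :: complex)"
  by (rule prod.cong) auto
 also have "of_nat (fact (Suc (a p))) * \<dots> = of_nat (Suc (a p)) * wt a"
  by (subst eq, force, subst prod.insert_remove[OF assms], simp add: algebra_simps)
 finally show ?thesis .
qed

text \<open>Linear in the first argument, conjugate linear in the second. The sum runs over the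
  common support, so finite support of one argument is enough for it to be finite.\<close>

definition ip :: "vec => vec => complex" where
 "ip f g = (\<Sum>a | f a \<noteq> 0 \<and> g a \<noteq> 0. wt a * f a * cnj (g a))"

lemma ip_eq:
 assumes "finite K" "\<And>a. f a \<noteq> 0 ==> g a \<noteq> 0 ==> a \<in> K"
 shows "ip f g = (\<Sum>a\<in>K. wt a * f a * cnj (g a))"
 unfolding ip_def by (rule sum.mono_neutral_left) (use assms in auto)

lemma ip_left: "g \<in> FS ==> ip f g = (\<Sum>a | g a \<noteq> 0. wt a * f a * cnj (g a))"
 by (rule ip_eq) (auto simp: FS_def)

lemma ip_cnj: "ip g f = cnj (ip f g)"
 by (auto simp: ip_def intro!: sum.cong)

lemma ip_add_left: "g \<in> FS ==> ip (f + f') g = ip f g + ip f' g"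
 by (simp add: ip_left ring_distribs sum.distrib)

lemma ip_sc_left: "g \<in> FS ==> ip (sc c f) g = c * ip f g"
 by (simp add: ip_left sum_distrib_left mult_ac)

lemma ip_add_right: "f \<in> FS ==> ip f (g + g') = ip f g + ip f g'"
 by (metis ip_cnj ip_add_left complex_cnj_add)

lemma ip_sc_right: "f \<in> FS ==> ip f (sc c g) = cnj c * ip f g"
 by (metis ip_cnj ip_sc_left complex_cnj_mult)

lemma ip_0 [simp]: "ip 0 f = 0" "ip f 0 = 0"
 by (simp_all add: ip_def)

lemma ip_diff_right: "f \<in> FS ==> ip f (g - g') = ip f g - ip f g'"
 by (simp only: minus_eq_sc(2) ip_add_right ip_sc_right) simp

lemma ip_sum_left: "g \<in> FS ==> ip (\<Sum>i\<in>A. f i) g = (\<Sum>i\<in>A. ip (f i) g)"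
 by (induction A rule: infinite_finite_induct) (auto simp: ip_add_left)

lemma ip_prj: "ip (prj \<delta> d f) g = ip f (prj \<delta> d g)"
 unfolding ip_def prj_def by (rule sum.cong) (auto split: if_splits)

lemma ip_self: "f \<in> FS ==> ip f f = 0 \<or> (\<exists>c>0. ip f f = of_real c)"
 and ip_definite: "f \<in> FS ==> ip f f = 0 \<longleftrightarrow> f = 0"
proof -
 assume f: "f \<in> FS"
 define c where "c a = (SOME c. c > 0 \<and> wt a = of_real c)" for a
 have c: "c a > 0" "wt a = of_real (c a)" for a
  using someI_ex[of "\<lambda>c. c > 0 \<and> wt a = of_real c"] wt_pos unfolding c_def by auto
 define s where "s = (\<Sum>a | f a \<noteq> 0. c a * (norm (f a))\<^sup>2)"
 have eq: "ip f f = of_real s"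
  using f by (simp add: s_def ip_left c(2) mult.assoc complex_norm_square[symmetric] del: of_real_power)
 have ge: "s \<ge> 0"
  unfolding s_def using c(1) by (intro sum_nonneg mult_nonneg_nonneg less_imp_le) auto
 thus "ip f f = 0 \<or> (\<exists>c>0. ip f f = of_real c)"
  unfolding eq by (cases "s = 0") auto
 have fin: "finite {a. f a \<noteq> 0}" using f by (simp add: FS_def)
 have "s = 0 \<longleftrightarrow> (\<forall>a\<in>{a. f a \<noteq> 0}. c a * (norm (f a))\<^sup>2 = 0)"
  unfolding s_def by (rule sum_nonneg_eq_0_iff[OF fin]) (simp add: c(1) less_imp_le)
 moreover have "c a \<noteq> 0" for a using c(1)[of a] by simp
 ultimately show "ip f f = 0 \<longleftrightarrow> f = 0"
  unfolding eq by (auto simp: fun_eq_iff)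
qed

text \<open>Gram-Schmidt by induction on the supporting set. The vectors of S that vanish at the new
  point a form a subspace of codimension at most one, and a vector u of S orthogonal to it supplies
  the missing direction.\<close>

lemma orthogonal_projection:
 assumes "finite K" "subsp S" "\<And>x. x \<in> S ==> supported K x" "supported K f"
 shows "\<exists>s\<in>S. \<forall>x\<in>S. ip x (f - s) = 0"
 using assms
proof (induction K arbitrary: S f rule: finite_induct)
 case empty
 hence "S \<subseteq> {0}" "f = 0" by (auto simp: supported_def fun_eq_iff)
 have "ip x (f - 0) = 0" if "x \<in> S" for x
  using that \<open>S \<subseteq> {0}\<close> by auto
 thus ?case using subsp_0[OF empty(1)] by blast
next
 case (insert a K)
 have FS: "supported (insert a K) x ==> x \<in> FS" for x
  using supported_FS[of "insert a K"] insert(1) by simp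
 define S' where "S' = S \<inter> {f. supported K f}"
 have S': "subsp S'" "\<And>x. x \<in> S' ==> supported K x"
  using insert.prems subsp_Int[OF _ subsp_supported] by (auto simp: S'_def)
 have S'I: "x \<in> S'" if "x \<in> S" "x a = 0" for x
 proof -
  have "supported (insert a K) x" using insert.prems that by blast
  with that show ?thesis unfolding S'_def supported_def by auto
 qed
 have proj: "\<exists>s\<in>S'. \<forall>x\<in>S'. ip x (g - s) = 0" if g: "supported (insert a K) g" for g
 proof -
  \<comment> \<open>Vectors of \<open>S'\<close> vanish at a, so erasing this coordinate of g
    changes none of the inner products in question.\<close>
  let ?g = "g(a := 0)"
  have "supported K ?g" using g by (auto simp: supported_def)
  from insert.IH[OF S' this] obtain s where s: "s \<in> S'" "\<forall>x\<in>S'. ip x (?g - s) = 0" by blast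
  have "ip x (g - s) = ip x (?g - s)" if "x \<in> S'" for x
  proof -
   have x: "supported K x" using S' that by blast
   hence "x a = 0" using insert.hyps by (auto simp: supported_def)
   have fin: "finite (insert a K)" using insert.hyps by simp
   have "ip x (g - s) = (\<Sum>b\<in>insert a K. wt b * x b * cnj ((g - s) b))"
    by (rule ip_eq[OF fin]) (use x in \<open>auto simp: supported_def\<close>)
   also have "\<dots> = (\<Sum>b\<in>insert a K. wt b * x b * cnj ((?g - s) b))"
    by (rule sum.cong) (auto simp: \<open>x a = 0\<close>)
   also have "\<dots> = ip x (?g - s)"
    by (rule ip_eq[OF fin, symmetric]) (use x in \<open>auto simp: supported_def\<close>)
   finally show ?thesis .
  qed
  thus ?thesis using s by (intro bexI[of _ s]) auto
 qed
 show ?case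
 proof (cases "\<exists>s0\<in>S. s0 a \<noteq> 0")
  case False
  hence "S' = S" using S'I by (auto simp: S'_def)
  thus ?thesis using proj insert.prems by blast
 next
  case True
  then obtain s0 where s0: "s0 \<in> S" "s0 a \<noteq> 0" by blast
  then obtain t where t: "t \<in> S'" "\<forall>x\<in>S'. ip x (s0 - t) = 0"
   using proj insert.prems by blast
  define u where "u = s0 - t"
  have tS: "t \<in> S" using t by (simp add: S'_def)
  have uS: "u \<in> S" unfolding u_def using s0 tS insert.prems by (simp add: subsp_diff)
  have "t a = 0" using S'(2)[OF t(1)] insert.hyps by (auto simp: supported_def)
  hence ua: "u a \<noteq> 0" using s0 by (simp add: u_def)
  have uFS: "u \<in> FS" using uS insert.prems FS by blast
  have uu: "ip u u \<noteq> 0" using ip_definite[OF uFS] ua by auto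
  obtain s1 where s1: "s1 \<in> S'" "\<forall>x\<in>S'. ip x (f - s1) = 0"
   using proj insert.prems by blast
  \<comment> \<open>The usual projection coefficient, conjugated because u is subtracted in the
    conjugate linear argument.\<close>
  define c where "c = cnj (ip u (f - s1) / ip u u)"
  define s where "s = s1 + sc c u"
  have sS: "s \<in> S" unfolding s_def using s1 uS insert.prems
   by (intro subsp_add subsp_sc) (auto simp: S'_def)
  have fs: "f - s = (f - s1) - sc c u" by (simp add: s_def)
  have "ip x (f - s) = 0" if x: "x \<in> S" for x
  proof -
   define d where "d = x a / u a"
   define x' where "x' = x - sc d u"
   have "x' \<in> S" unfolding x'_def using x uS insert.prems by (intro subsp_diff subsp_sc)
   moreover have "x' a = 0" using ua by (simp add: x'_def d_def)
   ultimately have x': "x' \<in> S'" by (rule S'I)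
   have x'FS: "x' \<in> FS" using FS insert.prems(2) \<open>x' \<in> S\<close> by blast
   have "ip x' (f - s) = ip x' (f - s1) - cnj c * ip x' u"
    unfolding fs using x'FS by (simp only: ip_diff_right ip_sc_right)
   also have "\<dots> = 0" using s1 t x' by (simp add: u_def)
   finally have 1: "ip x' (f - s) = 0" .
   have 2: "ip u (f - s) = 0"
    unfolding fs ip_diff_right[OF uFS, of "f - s1"] ip_sc_right[OF uFS] using uu by (simp add: c_def)
   have xeq: "x = x' + sc d u" by (simp add: x'_def)
   have "f - s \<in> FS" using FS insert.prems sS by (intro subsp_diff) auto
   thus ?thesis using 1 2 by (subst xeq) (simp add: ip_add_left ip_sc_left)
  qed
  thus ?thesis using sS by blast
 qed
qed

section \<open>Row and column degrees, adjoint operators and orthogonal complements\<close>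

context oscillator
begin

lemma B_FS: "f \<in> B M ==> f \<in> FS"
 by (simp add: FS_def B_finite)

lemma valid_finite: "valid M a ==> finite {p. a p \<noteq> 0}"
proof -
 assume a: "valid M a"
 have "{p. a p \<noteq> 0} \<subseteq> {..<M} \<times> {..<N}"
  using valid_box[OF a] by (auto simp: mem_Times_iff)
 thus ?thesis by (rule finite_subset) simp
qed

lemma BI: "f \<in> FS ==> (\<And>a. f a \<noteq> 0 ==> valid M a) ==> f \<in> B M"
 by (simp add: B_def FS_def)

lemma prj_B: "f \<in> B M ==> prj \<delta> d f \<in> B M"
 by (rule BI, rule prj_FS, erule B_FS) (auto simp: prj_def split: if_splits dest: B_valid)

definition rdeg :: "mon => nat => nat" where
 "rdeg a = (\<lambda>i. \<Sum>s<N. a (i, s))"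

definition cdeg :: "nat => mon => nat => nat" where
 "cdeg M a = (\<lambda>r. \<Sum>i<M. a (i, r))"

lemma rdeg_upd:
 assumes "r < N"
 shows "rdeg (a((i, r) := k)) = (rdeg a)(i := rdeg a i - a (i, r) + k)"
proof -
 have "(\<Sum>s<N. (a((i, r) := k)) (i, s)) = (\<Sum>s\<in>{..<N} - {r}. a (i, s)) + k"
  using assms by (subst sum.remove[of _ r]) (auto intro!: sum.cong)
 moreover have "(\<Sum>s<N. a (i, s)) = (\<Sum>s\<in>{..<N} - {r}. a (i, s)) + a (i, r)"
  using assms by (subst sum.remove[of _ r]) auto
 ultimately show ?thesis by (auto simp: rdeg_def fun_eq_iff)
qed

lemma cdeg_upd:
 assumes "i < M"
 shows "cdeg M (a((i, r) := k)) = (cdeg M a)(r := cdeg M a r - a (i, r) + k)"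
proof -
 have "(\<Sum>s<M. (a((i, r) := k)) (s, r)) = (\<Sum>s\<in>{..<M} - {i}. a (s, r)) + k"
  using assms by (subst sum.remove[of _ i]) (auto intro!: sum.cong)
 moreover have "(\<Sum>s<M. a (s, r)) = (\<Sum>s\<in>{..<M} - {i}. a (s, r)) + a (i, r)"
  using assms by (subst sum.remove[of _ i]) auto
 ultimately show ?thesis by (auto simp: cdeg_def fun_eq_iff)
qed

lemma rdeg_ge: "r < N ==> a (i, r) \<le> rdeg a i"
 unfolding rdeg_def by (rule member_le_sum) auto

lemma cdeg_ge: "i < M ==> a (i, r) \<le> cdeg M a r"
 unfolding cdeg_def by (rule member_le_sum[of i "{..<M}" "\<lambda>i. a (i, r)"]) auto

lemma rdeg_Suc: "r < N ==> rdeg (a((i, r) := Suc (a (i, r)))) = (rdeg a)(i := Suc (rdeg a i))"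
 and rdeg_pred: "r < N ==> a (i, r) \<noteq> 0 ==> rdeg (a((i, r) := a (i, r) - 1)) = (rdeg a)(i := rdeg a i - 1)"
 using rdeg_ge[of r a i] by (auto simp: rdeg_upd fun_eq_iff)

lemma cdeg_Suc: "i < M ==> cdeg M (a((i, r) := Suc (a (i, r)))) = (cdeg M a)(r := Suc (cdeg M a r))"
 and cdeg_pred: "i < M ==> a (i, r) \<noteq> 0 ==> cdeg M (a((i, r) := a (i, r) - 1)) = (cdeg M a)(r := cdeg M a r - 1)"
 using cdeg_ge[of i M a r] by (auto simp: cdeg_upd fun_eq_iff)

lemma xx_nz: "xx p f a \<noteq> 0 ==> \<exists>b. f b \<noteq> 0 \<and> a = b(p := Suc (b p))"
 by (rule exI[of _ "a(p := a p - 1)"]) (auto simp: xx_def split: if_splits)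

lemma dd_nz: "dd p f a \<noteq> 0 ==> \<exists>b. f b \<noteq> 0 \<and> b p \<noteq> 0 \<and> a = b(p := b p - 1)"
 by (rule exI[of _ "a(p := Suc (a p))"]) (auto simp: dd_def split: if_splits)

lemma E_nz:
 assumes "E i j f a \<noteq> 0"
 shows "\<exists>r<N. \<exists>b c. f b \<noteq> 0 \<and> b (j, r) \<noteq> 0 \<and> c = b((j, r) := b (j, r) - 1) \<and> a = c((i, r) := Suc (c (i, r)))"
proof -
 obtain r where "r < N" "xx (i, r) (dd (j, r) f) a \<noteq> 0"
  using assms unfolding E_def by (auto elim: sum.not_neutral_contains_not_neutral)
 thus ?thesis using xx_nz dd_nz by blast
qed

lemma F_nz:
 assumes "F M r s f a \<noteq> 0"
 shows "\<exists>i<M. \<exists>b c. f b \<noteq> 0 \<and> b (i, s) \<noteq> 0 \<and> c = b((i, s) := b (i, s) - 1) \<and> a = c((i, r) := Suc (c (i, r)))"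
proof -
 obtain i where "i < M" "xx (i, r) (dd (i, s) f) a \<noteq> 0"
  using assms unfolding F_def by (auto elim: sum.not_neutral_contains_not_neutral)
 thus ?thesis using xx_nz dd_nz by blast
qed

text \<open>One unit of weight passes from j to i; the nested update covers i = j too.\<close>

definition move :: "nat => nat => (nat => nat) => nat => nat" where
 "move i j \<rho> = (\<rho>(j := \<rho> j - 1))(i := Suc ((\<rho>(j := \<rho> j - 1)) i))"

lemma rdeg_E:
 assumes "E i j f a \<noteq> 0"
 shows "\<exists>b. f b \<noteq> 0 \<and> rdeg b j \<noteq> 0 \<and> rdeg a = move i j (rdeg b) \<and> (i < M \<longrightarrow> j < M \<longrightarrow> cdeg M a = cdeg M b)"
proof -
 obtain r b c where b: "r < N" "f b \<noteq> 0" "b (j, r) \<noteq> 0" "c = b((j, r) := b (j, r) - 1)"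
  "a = c((i, r) := Suc (c (i, r)))"
  using E_nz[OF assms] by blast
 have 1: "rdeg c = (rdeg b)(j := rdeg b j - 1)"
  unfolding b(4) by (rule rdeg_pred) (use b in auto)
 have 2: "rdeg a = (rdeg c)(i := Suc (rdeg c i))"
  unfolding b(5) by (rule rdeg_Suc) (use b in auto)
 have "cdeg M c = (cdeg M b)(r := cdeg M b r - 1)" if "j < M"
  unfolding b(4) by (rule cdeg_pred) (use b that in auto)
 moreover have "cdeg M a = (cdeg M c)(r := Suc (cdeg M c r))" if "i < M"
  unfolding b(5) by (rule cdeg_Suc) (use that in auto)
 moreover have "cdeg M b r \<noteq> 0" if "j < M" using cdeg_ge[of j M b r] b that by auto
 ultimately have "i < M \<longrightarrow> j < M \<longrightarrow> cdeg M a = cdeg M b" by (auto simp: fun_eq_iff)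
 moreover have "rdeg b j \<noteq> 0" using rdeg_ge[of r b j] b by auto
 ultimately show ?thesis using b 1 2 unfolding move_def by metis
qed

lemma cdeg_F:
 assumes "F M r s f a \<noteq> 0"
 shows "\<exists>b. f b \<noteq> 0 \<and> cdeg M b s \<noteq> 0 \<and> cdeg M a = move r s (cdeg M b) \<and> (r < N \<longrightarrow> s < N \<longrightarrow> rdeg a = rdeg b)"
proof -
 obtain i b c where b: "i < M" "f b \<noteq> 0" "b (i, s) \<noteq> 0" "c = b((i, s) := b (i, s) - 1)"
  "a = c((i, r) := Suc (c (i, r)))"
  using F_nz[OF assms] by blast
 have 1: "cdeg M c = (cdeg M b)(s := cdeg M b s - 1)"
  unfolding b(4) by (rule cdeg_pred) (use b in auto)
 have 2: "cdeg M a = (cdeg M c)(r := Suc (cdeg M c r))"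
  unfolding b(5) by (rule cdeg_Suc) (use b in auto)
 have "rdeg c = (rdeg b)(i := rdeg b i - 1)" if "s < N"
  unfolding b(4) by (rule rdeg_pred) (use b that in auto)
 moreover have "rdeg a = (rdeg c)(i := Suc (rdeg c i))" if "r < N"
  unfolding b(5) by (rule rdeg_Suc) (use that in auto)
 moreover have "rdeg b i \<noteq> 0" if "s < N" using rdeg_ge[of s b i] b that by auto
 ultimately have "r < N \<longrightarrow> s < N \<longrightarrow> rdeg a = rdeg b" by (auto simp: fun_eq_iff)
 moreover have "cdeg M b s \<noteq> 0" using cdeg_ge[of i M b s] b by auto
 ultimately show ?thesis using b 1 2 unfolding move_def by metis
qed

lemma homog_E: "homog rdeg \<rho> f ==> homog rdeg (move i j \<rho>) (E i j f)"
 and homog_E_cdeg: "i < M ==> j < M ==> homog (cdeg M) \<nu> f ==> homog (cdeg M) \<nu> (E i j f)"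
 and homog_F: "r < N ==> s < N ==> homog rdeg \<rho> f ==> homog rdeg \<rho> (F M r s f)"
 and homog_F_cdeg: "homog (cdeg M) \<nu> f ==> homog (cdeg M) (move r s \<nu>) (F M r s f)"
 unfolding supported_def using rdeg_E cdeg_F by blast+

lemma hopI: "(\<And>d f. homog \<delta> d f ==> homog \<delta> (h d) (T f)) ==> hop \<delta> T"
 unfolding hop_def by (intro allI, rule_tac x = "h d" in exI) simp

lemma hop_E: "hop rdeg (E i j)"
 by (rule hopI) (rule homog_E)

lemma hop_E_cdeg: "i < M ==> j < M ==> hop (cdeg M) (E i j)"
 by (rule hopI) (rule homog_E_cdeg)

lemma hop_F: "r < N ==> s < N ==> hop rdeg (F M r s)"
 by (rule hopI) (rule homog_F)

lemma hop_F_cdeg: "hop (cdeg M) (F M r s)"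
 by (rule hopI) (rule homog_F_cdeg)

lemma homog_dd: "r < N ==> homog rdeg \<rho> f ==> homog rdeg (\<rho>(i := \<rho> i - 1)) (dd (i, r) f)"
proof (unfold supported_def, intro allI impI)
 fix a assume *: "r < N" "\<forall>a. f a \<noteq> 0 \<longrightarrow> a \<in> {a. rdeg a = \<rho>}" "dd (i, r) f a \<noteq> 0"
 then obtain b where "f b \<noteq> 0" "b (i, r) \<noteq> 0" "a = b((i, r) := b (i, r) - 1)" using dd_nz by blast
 thus "a \<in> {a. rdeg a = \<rho>(i := \<rho> i - 1)}"
  using * rdeg_pred[of r b i] by simp
qed

text \<open>A row degree bounds every exponent of the row. This makes the row-homogeneous components
  finite dimensional, as \<open>orthogonal_projection\<close> requires.\<close>

lemma finite_rdeg: "finite {a. valid M a \<and> rdeg a = \<rho>}"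
proof -
 let ?P = "{..<M} \<times> {..<N}"
 have "a \<in> {f. (\<forall>p. (p \<in> ?P \<longrightarrow> f p \<in> {..Max (\<rho> ` {..<M})}) \<and> (p \<notin> ?P \<longrightarrow> f p = 0))}"
  if a: "valid M a" "rdeg a = \<rho>" for a
 proof -
  have "a p \<le> Max (\<rho> ` {..<M})" if "p \<in> ?P" for p
  proof -
   have "a p \<le> \<rho> (fst p)" using rdeg_ge[of "snd p" a "fst p"] a(2) that by auto
   also have "\<dots> \<le> Max (\<rho> ` {..<M})" using that by (intro Max_ge) auto
   finally show ?thesis .
  qed
  moreover have "a p = 0" if "p \<notin> ?P" for p
   using valid_box[OF a(1), of p] that by (auto simp: mem_Times_iff)
  ultimately show ?thesis by auto
 qed
 moreover have "finite {f. (\<forall>p. (p \<in> ?P \<longrightarrow> f p \<in> {..Max (\<rho> ` {..<M})}) \<and> (p \<notin> ?P \<longrightarrow> f p = (0::nat)))}"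
  by (rule finite_set_of_finite_funs) auto
 ultimately show ?thesis by (rule_tac finite_subset[rotated]) auto
qed

lemma xx_dd:
 assumes "f \<in> B M"
 shows "xx p (dd p f) a = of_nat (a p) * f a"
proof (cases "fst p < m")
 case True
 thus ?thesis by (auto simp: xx_def dd_def sg_upd_not)
next
 case False
 have "f a = 0" if "a p > 1"
  using B_valid[OF assms, of a] valid_odd[of M a p] that False by fastforce
 thus ?thesis using False
  by (cases "a p = 0"; cases "a p = 1") (auto simp: dd_def xx_def sg_upd_not fun_upd_idem)
qed

lemma E_diag: "f \<in> B M ==> E i i f a = of_nat (rdeg a i) * f a"
 by (simp add: E_def xx_dd rdeg_def sum_distrib_right)

lemma F_diag: "f \<in> B M ==> F M r r f a = of_nat (cdeg M a r) * f a"
 by (simp add: F_def xx_dd cdeg_def sum_distrib_right)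

definition kap :: "nat => (nat => nat) => complex" where
 "kap i \<rho> = of_real ((\<Prod>j<i. inverse (norm q) ^ \<rho> j)\<^sup>2)"

lemma kap_pos: "\<exists>c>0. kap i \<rho> = of_real c"
proof -
 have "(\<Prod>j<i. inverse (norm q) ^ \<rho> j) > 0" using q0 by (intro prod_pos) auto
 thus ?thesis unfolding kap_def by (metis zero_less_power)
qed

text \<open>Positions of the same row contribute signs and those of earlier rows factors of modulus
  1/|q|, so the squared modulus of \<open>sg\<close> is a function of the row degrees alone. This is
  what saves adjointness when |q| is not 1.\<close>

lemma sg_cnj: "sg p a * cnj (sg p a) = kap (fst p) (rdeg a)"
proof -
 have om: "norm (om i j) = (if i < j then norm q else if j < i then inverse (norm q) else 1)" for i j
  by (auto simp: om_def norm_mult norm_power norm_inverse)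
 have "norm (sg p a) = (\<Prod>p'\<in>below p. norm (om (fst p) (fst p')) ^ a p')"
  by (simp add: sg_def norm_power prod_norm[symmetric])
 also have "\<dots> = (\<Prod>p'\<in>{..<fst p} \<times> {..<N}. norm (om (fst p) (fst p')) ^ a p')"
  by (rule prod.mono_neutral_right) (auto simp: below_def om)
 also have "\<dots> = (\<Prod>p'\<in>{..<fst p} \<times> {..<N}. inverse (norm q) ^ a p')"
  by (rule prod.cong) (auto simp: om)
 also have "\<dots> = (\<Prod>j<fst p. \<Prod>s<N. inverse (norm q) ^ a (j, s))"
  by (simp add: prod.cartesian_product)
 also have "\<dots> = (\<Prod>j<fst p. inverse (norm q) ^ rdeg a j)"
  by (simp add: rdeg_def power_sum)
 finally show ?thesis by (simp add: kap_def complex_norm_square[symmetric])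
qed

definition zz :: "nat => vec => vec" where
 "zz i f = (\<lambda>a. kap i (rdeg a) * f a)"

text \<open>Substitute a = b plus one unit at p. The weight ratio cancels the integer factor of
  \<open>dd\<close>, and \<open>sg\<close> times its conjugate leaves the factor \<open>kap\<close>,
  which \<open>zz\<close> records.\<close>

lemma xx_adjoint:
 assumes "f \<in> B M" "g \<in> FS"
 shows "ip (xx p f) g = ip (zz (fst p) f) (dd p g)"
proof -
 let ?K = "{a. f a \<noteq> 0}" and ?u = "\<lambda>b::mon. b(p := Suc (b p))"
 have fin: "finite ?K" using assms B_finite by blast
 have inj: "inj_on ?u ?K"
 proof (rule inj_onI)
  fix x y :: mon assume *: "x(p := Suc (x p)) = y(p := Suc (y p))"
  have "x p' = y p'" for p' using fun_cong[OF *, of p'] by (cases "p' = p") auto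
  thus "x = y" by blast
 qed
 have "ip (xx p f) g = (\<Sum>a\<in>?u ` ?K. wt a * xx p f a * cnj (g a))"
  by (rule ip_eq) (use fin xx_nz[of p f] in auto)
 also have "\<dots> = (\<Sum>b\<in>?K. wt (?u b) * xx p f (?u b) * cnj (g (?u b)))"
  by (simp add: sum.reindex[OF inj])
 also have "\<dots> = (\<Sum>b\<in>?K. wt b * zz (fst p) f b * cnj (dd p g b))"
 proof (rule sum.cong[OF refl])
  fix b assume b: "b \<in> ?K"
  hence "finite {p. b p \<noteq> 0}" using B_valid[OF assms(1)] valid_finite by blast
  from wt_Suc[OF this] have w: "wt (?u b) = of_nat (Suc (b p)) * wt b" .
  show "wt (?u b) * xx p f (?u b) * cnj (g (?u b)) = wt b * zz (fst p) f b * cnj (dd p g b)"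
   unfolding w using sg_nz[of p b]
   by (auto simp: xx_def dd_def zz_def sg_cnj[symmetric] sg_upd_not field_simps)
 qed
 also have "\<dots> = ip (zz (fst p) f) (dd p g)"
  by (rule ip_eq[symmetric]) (use fin in \<open>auto simp: zz_def\<close>)
 finally show ?thesis .
qed

lemma zz_homog: "homog rdeg \<rho> g ==> g \<in> FS ==> ip (zz i f) g = kap i \<rho> * ip f g"
 unfolding ip_left sum_distrib_left
 by (rule sum.cong) (auto simp: zz_def supported_def)

lemma zz_cnj: "f \<in> FS ==> g \<in> FS ==> ip (zz i f) g = cnj (ip (zz i g) f)"
proof -
 assume *: "f \<in> FS" "g \<in> FS"
 have "ip (zz i f) g = (\<Sum>a\<in>{a. f a \<noteq> 0}. wt a * zz i f a * cnj (g a))"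
  by (rule ip_eq) (use * in \<open>auto simp: FS_def zz_def\<close>)
 moreover have "ip (zz i g) f = (\<Sum>a\<in>{a. f a \<noteq> 0}. wt a * zz i g a * cnj (f a))"
  by (rule ip_eq) (use * in \<open>auto simp: FS_def zz_def\<close>)
 ultimately show ?thesis by (simp add: zz_def kap_def mult_ac)
qed

text \<open>Each summand creates and annihilates in the same row i, so both sides carry the same
  real factor \<open>kap i\<close> and no correction remains.\<close>

lemma F_adjoint:
 assumes "f \<in> B M" "g \<in> B M"
 shows "ip (F M r s f) g = ip f (F M s r g)"
proof -
 have "ip (F M r s f) g = (\<Sum>i<M. ip (zz i (dd (i, s) f)) (dd (i, r) g))"
  unfolding F_def using assms by (simp add: ip_sum_left B_FS xx_adjoint[OF dd_B])
 moreover have "ip (F M s r g) f = (\<Sum>i<M. ip (zz i (dd (i, r) g)) (dd (i, s) f))"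
  unfolding F_def using assms by (simp add: ip_sum_left B_FS xx_adjoint[OF dd_B])
 moreover have "ip (zz i (dd (i, s) f)) (dd (i, r) g) = cnj (ip (zz i (dd (i, r) g)) (dd (i, s) f))" for i
  using assms by (intro zz_cnj B_FS[OF dd_B])
 ultimately show ?thesis by (subst ip_cnj) simp
qed

text \<open>Here one side carries \<open>kap i\<close> and the other \<open>kap j\<close>. Both are
  constants once g is homogeneous, because \<open>dd (i, r) g\<close> then has a single row degree;
  their quotient is c.\<close>

lemma E_adjoint:
 assumes "f \<in> B M" "g \<in> B M" "homog rdeg \<rho> g"
 shows "\<exists>c. c \<noteq> 0 \<and> ip (E i j f) g = c * ip f (E j i g)"
proof -
 let ?\<rho> = "\<rho>(i := \<rho> i - 1)"
 let ?S = "\<Sum>r<N. ip (dd (j, r) f) (dd (i, r) g)"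
 have 1: "ip (E i j f) g = (\<Sum>r<N. ip (zz i (dd (j, r) f)) (dd (i, r) g))"
  unfolding E_def using assms by (simp add: ip_sum_left B_FS xx_adjoint[OF dd_B])
 also have "\<dots> = kap i ?\<rho> * ?S"
  unfolding sum_distrib_left using assms homog_dd
  by (intro sum.cong zz_homog B_FS[OF dd_B]) auto
 finally have 1: "ip (E i j f) g = kap i ?\<rho> * ?S" .
 have "ip (E j i g) f = (\<Sum>r<N. ip (zz j (dd (i, r) g)) (dd (j, r) f))"
  unfolding E_def using assms by (simp add: ip_sum_left B_FS xx_adjoint[OF dd_B])
 also have "\<dots> = (\<Sum>r<N. cnj (ip (zz j (dd (j, r) f)) (dd (i, r) g)))"
  using assms by (intro sum.cong zz_cnj B_FS[OF dd_B] refl)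
 also have "\<dots> = cnj (\<Sum>r<N. ip (zz j (dd (j, r) f)) (dd (i, r) g))" by simp
 also have "(\<Sum>r<N. ip (zz j (dd (j, r) f)) (dd (i, r) g)) = kap j ?\<rho> * ?S"
  unfolding sum_distrib_left using assms homog_dd
  by (intro sum.cong zz_homog B_FS[OF dd_B]) auto
 finally have "ip f (E j i g) = kap j ?\<rho> * ?S" by (subst ip_cnj) simp
 moreover have "kap i ?\<rho> \<noteq> 0" "kap j ?\<rho> \<noteq> 0"
  using kap_pos[of i ?\<rho>] kap_pos[of j ?\<rho>] by auto
 ultimately show ?thesis using 1 by (intro exI[of _ "kap i ?\<rho> / kap j ?\<rho>"]) auto
qed

definition perp :: "nat => vec set => vec set" where
 "perp M S = {y \<in> B M. \<forall>x\<in>S. ip x y = 0}"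

lemma subsp_perp: "S \<subseteq> B M ==> subsp (perp M S)"
 unfolding subsp_def perp_def
 by (auto simp: ip_add_right ip_sc_right B_FS subset_iff subsp_add subsp_sc subsp_0)

lemma perp_graded:
 assumes "graded_by \<delta> S"
 shows "graded_by \<delta> (perp M S)"
 using assms unfolding graded_by_def perp_def by (auto simp: prj_B ip_prj[symmetric])

lemma perp_F:
 assumes "S \<subseteq> B M" "\<And>x. x \<in> S ==> F M s r x \<in> S" "y \<in> perp M S" "r < N"
 shows "F M r s y \<in> perp M S"
proof -
 have "ip x (F M r s y) = 0" if "x \<in> S" for x
  using F_adjoint[of x M y s r] assms that by (auto simp: perp_def)
 thus ?thesis using assms by (auto simp: perp_def F_B)
qed

text \<open>The adjunction for row operators holds only on homogeneous vectors, so x is split into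
  its row components, all of which lie in the graded S.\<close>

lemma perp_E:
 assumes "S \<subseteq> B M" "graded_by rdeg S" "\<And>x. x \<in> S ==> E j i x \<in> S" "y \<in> perp M S" "i < M"
 shows "E i j y \<in> perp M S"
proof -
 have y: "y \<in> B M" using assms by (simp add: perp_def)
 have Ey: "E i j y \<in> FS" using E_B[OF y] assms B_FS by blast
 have *: "ip x (E i j y) = 0" if xS: "x \<in> S" and hx: "homog rdeg \<rho> x" for x \<rho>
 proof -
  have x: "x \<in> B M" using assms xS by blast
  obtain c where "ip (E i j y) x = c * ip y (E j i x)"
   using E_adjoint[OF y x hx] by blast
  moreover have "ip (E j i x) y = 0" using assms xS by (auto simp: perp_def)
  hence "ip y (E j i x) = 0" by (subst ip_cnj) simp
  ultimately show ?thesis by (subst ip_cnj) simp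
 qed
 have "ip x (E i j y) = 0" if x: "x \<in> S" for x
 proof -
  have "x \<in> FS" using x assms B_FS by blast
  from sum_prj_FS[OF this, of rdeg]
  have "ip x (E i j y) = (\<Sum>d\<in>rdeg ` {a. x a \<noteq> 0}. ip (prj rdeg d x) (E i j y))"
   by (metis (no_types) ip_sum_left[OF Ey])
  also have "\<dots> = 0"
   using x assms(2) by (intro sum.neutral ballI *[OF _ homog_prj]) (auto simp: graded_by_def)
  finally show ?thesis .
 qed
 thus ?thesis using y assms by (auto simp: perp_def E_B)
qed

end

section \<open>Joint highest weight vectors\<close>

text \<open>Remove the maximum, which is at least \<open>card S - 1\<close>. This is the comparison
  of k distinct naturals with 0, ..., k - 1, written without subtraction or division to avoid
  truncation.\<close>

lemma twice_sum_ge: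
 fixes S :: "nat set"
 assumes "finite S"
 shows "card S * card S \<le> 2 * \<Sum>S + card S
  \<and> (2 * \<Sum>S + card S = card S * card S \<longrightarrow> S = {..<card S})"
 using assms
proof (induction "card S" arbitrary: S)
 case 0
 thus ?case by auto
next
 case (Suc k)
 define x where "x = Max S"
 have ne: "S \<noteq> {}" using Suc.hyps by auto
 have xS: "x \<in> S" unfolding x_def using ne Suc.prems by simp
 define S' where "S' = S - {x}"
 have S: "S = insert x S'" "x \<notin> S'" "finite S'" using xS Suc.prems by (auto simp: S'_def)
 have card: "k = card S'" using Suc.hyps xS Suc.prems by (simp add: S'_def)
 have "S \<subseteq> {..x}" unfolding x_def using Suc.prems by auto
 hence "card S \<le> card {..x}" by (rule card_mono[rotated]) simp
 hence xk: "k \<le> x" using Suc.hyps by simp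
 have sum: "\<Sum>S = x + \<Sum>S'" using S by simp
 note IH = Suc.hyps(1)[OF card S(3)]
 have cS: "card S = Suc k" using Suc.hyps by simp
 have "k * k \<le> 2 * \<Sum>S' + k" using IH card by simp
 hence 1: "Suc k * Suc k \<le> 2 * \<Sum>S + Suc k" using xk by (simp add: sum)
 moreover have "S = {..<Suc k}" if "2 * \<Sum>S + Suc k = Suc k * Suc k"
 proof -
  have "x = k \<and> 2 * \<Sum>S' + k = k * k"
   using that xk \<open>k * k \<le> 2 * \<Sum>S' + k\<close> by (simp add: sum)
  hence "x = k" "S' = {..<k}" using IH card by auto
  thus ?thesis using S by auto
 qed
 ultimately show ?case unfolding cS by blast
qed

lemma sum_swap3:
 "(\<Sum>s\<in>A. \<Sum>i\<in>I. \<Sum>j\<in>K. h s i j) = (\<Sum>i\<in>I. \<Sum>j\<in>K. \<Sum>s\<in>A. h s i j)"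
proof -
 have "(\<Sum>s\<in>A. \<Sum>i\<in>I. \<Sum>j\<in>K. h s i j) = (\<Sum>i\<in>I. \<Sum>s\<in>A. \<Sum>j\<in>K. h s i j)"
  by (rule sum.swap)
 also have "\<dots> = (\<Sum>i\<in>I. \<Sum>j\<in>K. \<Sum>s\<in>A. h s i j)"
  by (intro sum.cong refl sum.swap)
 finally show ?thesis .
qed

section \<open>Peeling off the even rows and the Casimir identity on the odd block\<close>

context oscillator
begin

text \<open>Joint highest weight vectors of row weight \<mu> and column weight \<nu>. The weights
  are encoded by the support and not by eigenvalue equations for the diagonal operators.\<close>

definition jhw :: "nat => (nat => nat) => (nat => nat) => vec => bool" where
 "jhw M \<mu> \<nu> f \<longleftrightarrow> f \<in> B M \<and> (\<forall>i j. i < j \<longrightarrow> j < M \<longrightarrow> E i j f = 0) \<and>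
   (\<forall>r s. r < s \<longrightarrow> s < N \<longrightarrow> F M r s f = 0) \<and> homog rdeg \<mu> f \<and> homog (cdeg M) \<nu> f"

lemma jhwD:
 assumes "jhw M \<mu> \<nu> f"
 shows "f \<in> B M" "\<And>i j. i < j ==> j < M ==> E i j f = 0" "\<And>r s. r < s ==> s < N ==> F M r s f = 0"
  "homog rdeg \<mu> f" "homog (cdeg M) \<nu> f"
  "\<And>a. f a \<noteq> 0 ==> valid M a" "\<And>a. f a \<noteq> 0 ==> rdeg a = \<mu>" "\<And>a. f a \<noteq> 0 ==> cdeg M a = \<nu>"
 using assms B_valid unfolding jhw_def supported_def by blast+

text \<open>The shape of an exponent matrix after k rows and k columns have been peeled off, see
  \<open>peel\<close>.\<close>

definition blk :: "nat => mon => bool" where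
 "blk k a \<longleftrightarrow> (\<forall>i r. (i < k \<or> r < k) \<and> i \<noteq> r \<longrightarrow> a (i, r) = 0)"

lemma blkD: "blk k a ==> i < k \<or> r < k ==> i \<noteq> r ==> a (i, r) = 0"
 by (simp add: blk_def)

lemma blkI: "(\<And>i r. i < k \<or> r < k ==> i \<noteq> r ==> a (i, r) = 0) ==> blk k a"
 by (simp add: blk_def)

definition res :: "nat => vec => vec" where
 "res k = prj (blk k) True"

lemma res_apply: "res k f a = (if blk k a then f a else 0)"
 by (simp add: res_def prj_def)

lemma res_0 [simp]: "res k 0 = 0"
 by (rule ext) (simp add: res_apply)

text \<open>If both positions are forbidden, neither matrix has block form: the first has a nonzero
  entry at p, the second one at p'. If both are allowed, no forbidden entry changes.\<close>

lemma blk_move: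
 assumes "a p \<noteq> 0" "p = (i, r)" "p' = (i', r')"
  and "(i < k \<or> r < k) \<and> i \<noteq> r \<longleftrightarrow> (i' < k \<or> r' < k) \<and> i' \<noteq> r'"
 shows "blk k ((a(p := a p - 1))(p' := Suc ((a(p := a p - 1)) p'))) \<longleftrightarrow> blk k a"
  (is "blk k ?a' \<longleftrightarrow> _")
proof (cases "(i < k \<or> r < k) \<and> i \<noteq> r")
 case True
 hence True': "(i' < k \<or> r' < k) \<and> i' \<noteq> r'" using assms(4) by simp
 have "a (i, r) \<noteq> 0" using assms(1,2) by simp
 hence "\<not> blk k a" using True blkD[of k a i r] by argo
 moreover have "?a' (i', r') \<noteq> 0" unfolding assms(3) by simp
 hence "\<not> blk k ?a'" using True' blkD[of k ?a' i' r'] by argo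
 ultimately show ?thesis by blast
next
 case False
 hence False': "\<not> ((i' < k \<or> r' < k) \<and> i' \<noteq> r')" using assms(4) by simp
 have "?a' (x, y) = a (x, y)" if "(x < k \<or> y < k) \<and> x \<noteq> y" for x y
  using that False False' assms(2,3) by auto
 thus ?thesis unfolding blk_def by (intro iff_allI) auto
qed

lemma xx_dd_res:
 assumes "(i < k \<or> r < k) \<and> i \<noteq> r \<longleftrightarrow> (i' < k \<or> r' < k) \<and> i' \<noteq> r'"
 shows "xx (i, r) (dd (i', r') (res k f)) a = (if blk k a then xx (i, r) (dd (i', r') f) a else 0)"
proof (cases "a (i, r) = 0")
 case True
 thus ?thesis by (simp add: xx_def)
next
 case False
 from blk_move[of a "(i, r)", OF False refl refl assms]
 show ?thesis using False by (simp add: xx_def dd_def res_apply)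
qed

text \<open>Rows i and j from k on are forbidden in the same columns, those below k. Hence
  truncation to block form preserves annihilation by the raising operators with indices at least
  k.\<close>

lemma E_res:
 assumes "k \<le> i" "k \<le> j"
 shows "E i j (res k f) = res k (E i j f)"
proof
 fix a :: mon
 have "xx (i, r) (dd (j, r) (res k f)) a = (if blk k a then xx (i, r) (dd (j, r) f) a else 0)" for r
  by (rule xx_dd_res) (use assms in auto)
 thus "E i j (res k f) a = res k (E i j f) a"
  by (simp add: E_def res_apply)
qed

lemma F_res:
 assumes "k \<le> r" "k \<le> s"
 shows "F M r s (res k f) = res k (F M r s f)"
proof
 fix a :: mon
 have "xx (i, r) (dd (i, s) (res k f)) a = (if blk k a then xx (i, r) (dd (i, s) f) a else 0)" for i
  by (rule xx_dd_res) (use assms in auto)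
 thus "F M r s (res k f) a = res k (F M r s f) a"
  by (simp add: F_def res_apply)
qed

text \<open>In an even row no exponent is too large, so creation never kills the target
  monomial.\<close>

lemma xx_dd_transfer:
 assumes "f b \<noteq> 0" "valid M b" "b p' \<noteq> 0" "p \<noteq> p'" "fst p < m"
 shows "xx p (dd p' f) ((b(p' := b p' - 1))(p := Suc (b p))) \<noteq> 0"
proof -
 have "m \<le> fst p' \<longrightarrow> b p' - 1 = 0" using valid_odd[OF assms(2), of p'] assms(3) by auto
 thus ?thesis using assms
  by (auto simp: xx_def dd_def fun_upd_twist[of p p'] fun_upd_idem)
qed

text \<open>Among the monomials of the truncated vector g take one, b, with least mass p in row k
  right of the diagonal. If b had an entry below the diagonal in column k, raising it into (k, k)
  would give a monomial of \<open>E k j g\<close> fed by b alone, against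
  \<open>E k j g = 0\<close>. The same argument with columns clears row k.\<close>

lemma peel:
 assumes f: "jhw M \<mu> \<nu> f" and k: "k < m" "k < N" "m \<le> M" and res: "res k f \<noteq> 0"
 shows "res (Suc k) f \<noteq> 0"
proof -
 define g where "g = res k f"
 have gf: "f a \<noteq> 0" "blk k a" if "g a \<noteq> 0" for a using that by (auto simp: g_def res_apply split: if_splits)
 have val: "valid M a" if "g a \<noteq> 0" for a using jhwD(6)[OF f gf(1)[OF that]] .
 have E0: "E k j g = 0" if "k < j" "j < M" for j
  unfolding g_def using that jhwD(2)[OF f that] by (simp add: E_res)
 have F0: "F M k s g = 0" if "k < s" "s < N" for s
  unfolding g_def using that jhwD(3)[OF f that] by (simp add: F_res)
 define p where "p a = (\<Sum>r\<in>{k<..<N}. a (k, r))" for a :: mon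
 define p' where "p' a = (\<Sum>j\<in>{k<..<M}. a (j, k))" for a :: mon
 have pp: "a (k, k) + p a = \<mu> k" "a (k, k) + p' a = \<nu> k" if a: "g a \<noteq> 0" for a
 proof -
  have z: "a (k, r) = 0" "a (r, k) = 0" if "r < k" for r
   using blkD[OF gf(2)[OF a], of k r] blkD[OF gf(2)[OF a], of r k] that by auto
  have "rdeg a k = (\<Sum>r\<in>insert k {k<..<N}. a (k, r))"
   unfolding rdeg_def by (rule sum.mono_neutral_right) (use k z in \<open>auto simp: not_less le_less\<close>)
  thus "a (k, k) + p a = \<mu> k" using jhwD(7)[OF f gf(1)[OF a]] by (simp add: p_def)
  have "cdeg M a k = (\<Sum>r\<in>insert k {k<..<M}. a (r, k))"
   unfolding cdeg_def by (rule sum.mono_neutral_right) (use k z in \<open>auto simp: not_less le_less\<close>)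
  thus "a (k, k) + p' a = \<nu> k" using jhwD(8)[OF f gf(1)[OF a]] by (simp add: p'_def)
 qed
 obtain b0 where "g b0 \<noteq> 0" using res by (auto simp: g_def fun_eq_iff)
 then obtain b where b: "g b \<noteq> 0" and min: "\<And>a. g a \<noteq> 0 ==> p b \<le> p a"
  using arg_min_nat_lemma[of "\<lambda>a. g a \<noteq> 0" b0 p] by blast
 \<comment> \<open>By the weights, the entry at (k, k) plus p, and likewise plus p', is constant on
   the support of g; so b minimises p' as well.\<close>
 have min': "p' b \<le> p' a" if "g a \<noteq> 0" for a
  using min[OF that] pp[OF that] pp[OF b] by linarith
 have zcol: "b (j, k) = 0" if j: "k < j" "j < M" for j
 proof (rule ccontr)
  assume nz: "b (j, k) \<noteq> 0"
  define a where "a = (b((j, k) := b (j, k) - 1))((k, k) := Suc (b (k, k)))"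
  have pa: "p a = p b" unfolding p_def a_def by (rule sum.cong) auto
  \<comment> \<open>A contribution through another column r would come from a monomial of g with
    smaller p, or, for r below k, would contradict the block form of b.\<close>
  have "xx (k, r) (dd (j, r) g) a = 0" if r: "r < N" "r \<noteq> k" for r
  proof (rule ccontr)
   assume nz': "xx (k, r) (dd (j, r) g) a \<noteq> 0"
   then obtain c b' where b': "a = c((k, r) := Suc (c (k, r)))" "g b' \<noteq> 0" "b' (j, r) \<noteq> 0"
     "c = b'((j, r) := b' (j, r) - 1)"
    using xx_nz[OF nz'] dd_nz by metis
   have akr: "a (k, r) = Suc (b' (k, r))" using b' j by auto
   show False
   proof (cases "r < k")
    case True
    hence "b (k, r) \<noteq> 0" using akr r j by (auto simp: a_def)
    thus False using blkD[OF gf(2)[OF b]] True by auto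
   next
    case False
    hence rk: "r \<in> {k<..<N}" using r by auto
    have "p a = a (k, r) + (\<Sum>s\<in>{k<..<N} - {r}. a (k, s))"
     unfolding p_def by (rule sum.remove) (use rk in auto)
    moreover have "p b' = b' (k, r) + (\<Sum>s\<in>{k<..<N} - {r}. b' (k, s))"
     unfolding p_def by (rule sum.remove) (use rk in auto)
    moreover have "(\<Sum>s\<in>{k<..<N} - {r}. a (k, s)) = (\<Sum>s\<in>{k<..<N} - {r}. b' (k, s))"
     by (rule sum.cong) (use b' j in auto)
    ultimately have "p b' < p a" using akr by simp
    thus False using min[OF b'(2)] pa by simp
   qed
  qed
  hence "E k j g a = xx (k, k) (dd (j, k) g) a"
   unfolding E_def using k by (simp add: sum.remove[of "{..<N}" k])
  moreover have "\<dots> \<noteq> 0"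
   unfolding a_def using xx_dd_transfer[of g b M "(j, k)" "(k, k)"] b val[OF b] nz k j by auto
  ultimately show False using E0[OF j] by simp
 qed
 have zrow: "b (k, s) = 0" if s: "k < s" "s < N" for s
 proof (rule ccontr)
  assume nz: "b (k, s) \<noteq> 0"
  define a where "a = (b((k, s) := b (k, s) - 1))((k, k) := Suc (b (k, k)))"
  have pa: "p' a = p' b" unfolding p'_def a_def by (rule sum.cong) auto
  have "xx (i, k) (dd (i, s) g) a = 0" if i: "i < M" "i \<noteq> k" for i
  proof (rule ccontr)
   assume nz': "xx (i, k) (dd (i, s) g) a \<noteq> 0"
   then obtain c b' where b': "a = c((i, k) := Suc (c (i, k)))" "g b' \<noteq> 0" "b' (i, s) \<noteq> 0"
     "c = b'((i, s) := b' (i, s) - 1)"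
    using xx_nz[OF nz'] dd_nz by metis
   have aik: "a (i, k) = Suc (b' (i, k))" using b' s by auto
   show False
   proof (cases "i < k")
    case True
    hence "b (i, k) \<noteq> 0" using aik i s by (auto simp: a_def)
    thus False using blkD[OF gf(2)[OF b]] True by auto
   next
    case False
    hence ik: "i \<in> {k<..<M}" using i by auto
    have "p' a = a (i, k) + (\<Sum>j\<in>{k<..<M} - {i}. a (j, k))"
     unfolding p'_def by (rule sum.remove) (use ik in auto)
    moreover have "p' b' = b' (i, k) + (\<Sum>j\<in>{k<..<M} - {i}. b' (j, k))"
     unfolding p'_def by (rule sum.remove) (use ik in auto)
    moreover have "(\<Sum>j\<in>{k<..<M} - {i}. a (j, k)) = (\<Sum>j\<in>{k<..<M} - {i}. b' (j, k))"
     by (rule sum.cong) (use b' s in auto)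
    ultimately have "p' b' < p' a" using aik by simp
    thus False using min'[OF b'(2)] pa by simp
   qed
  qed
  hence "F M k s g a = xx (k, k) (dd (k, s) g) a"
   unfolding F_def using k by (simp add: sum.remove[of "{..<M}" k])
  moreover have "\<dots> \<noteq> 0"
   unfolding a_def using xx_dd_transfer[of g b M "(k, s)" "(k, k)"] b val[OF b] nz k s by auto
  ultimately show False using F0[OF s] by simp
 qed
 have "blk (Suc k) b"
 proof (rule blkI)
  fix i r assume ir: "i < Suc k \<or> r < Suc k" "i \<noteq> r"
  show "b (i, r) = 0"
  proof (rule ccontr)
   assume nz: "b (i, r) \<noteq> 0"
   hence "i < M" "r < N" using valid_box[OF val[OF b] nz] by auto
   moreover have "\<not> ((i < k \<or> r < k) \<and> i \<noteq> r)" using blkD[OF gf(2)[OF b]] nz by auto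
   ultimately show False using ir zrow[of r] zcol[of i] nz
    by (metis less_Suc_eq linorder_neqE_nat)
  qed
 qed
 hence "res (Suc k) f b \<noteq> 0" using gf(1)[OF b] by (simp add: res_apply)
 thus ?thesis by auto
qed

lemma res_nz:
 assumes "jhw M \<mu> \<nu> f" "f \<noteq> 0" "m \<le> M" "k \<le> m" "k \<le> N"
 shows "\<exists>a. res k f a \<noteq> 0"
 using assms(4,5)
proof (induction k)
 case 0
 have "res 0 f = f" by (rule ext) (simp add: res_apply blk_def)
 thus ?case using assms(2) by (auto simp: fun_eq_iff)
next
 case (Suc k)
 hence "\<exists>a. res k f a \<noteq> 0" by simp
 hence "res k f \<noteq> 0" by auto
 hence "res (Suc k) f \<noteq> 0" using peel[OF assms(1)] assms(3) Suc.prems by simp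
 thus ?case by (auto simp: fun_eq_iff)
qed

text \<open>After normal ordering, the sums of \<open>E i j (E j i g)\<close> and of
  \<open>F M r s (F M s r g)\<close> over the odd block have the same quartic part with opposite
  signs, and both quadratic parts are multiples of the total degree. On the other hand a highest
  weight vector is an eigenvector of each sum; comparing coefficients at b yields the
  identity.\<close>

lemma casimir_odd_block:
 assumes f: "jhw M \<mu> \<nu> f" and mM: "m \<le> M" and mN: "m \<le> N" and b: "f b \<noteq> 0" "blk m b"
 shows "(\<Sum>i\<in>{m..<M}. int (\<mu> i) * int (\<mu> i)) + (\<Sum>i\<in>{m..<M}. \<Sum>j\<in>{i<..<M}. int (\<mu> i) - int (\<mu> j))
  + ((\<Sum>r\<in>{m..<N}. int (\<nu> r) * int (\<nu> r)) + (\<Sum>r\<in>{m..<N}. \<Sum>s\<in>{r<..<N}. int (\<nu> r) - int (\<nu> s)))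
  = int (M - m) * (\<Sum>i\<in>{m..<M}. int (\<mu> i)) + int (N - m) * (\<Sum>i\<in>{m..<M}. int (\<mu> i))"
proof -
 let ?I = "{m..<M}" and ?J = "{m..<N}"
 define g where "g = res m f"
 have gB: "g \<in> B M" unfolding g_def res_def using jhwD(1)[OF f] by (rule prj_B)
 have gf: "f a \<noteq> 0" "blk m a" if "g a \<noteq> 0" for a using that by (auto simp: g_def res_apply split: if_splits)
 have gb: "g b \<noteq> 0" using b by (simp add: g_def res_apply)
 have E0: "E i j g = 0" if "m \<le> i" "i < j" "j < M" for i j
  unfolding g_def using that jhwD(2)[OF f, of i j] by (simp add: E_res)
 have F0: "F M r s g = 0" if "m \<le> r" "r < s" "s < N" for r s
  unfolding g_def using that jhwD(3)[OF f, of r s] by (simp add: F_res)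
 have Ed: "E i i g = sc (of_nat (\<mu> i)) g" for i
  using E_diag[OF gB, of i] jhwD(7)[OF f gf(1)] by (auto simp: fun_eq_iff)
 have Fd: "F M r r g = sc (of_nat (\<nu> r)) g" for r
  using F_diag[OF gB, of r] jhwD(8)[OF f gf(1)] by (auto simp: fun_eq_iff)
 \<comment> \<open>Block form is inherited by derivatives and makes all derivatives at positions off
   the two blocks vanish; this cuts the sums over all rows and columns down to the odd
   block.\<close>
 define bl where "bl h \<longleftrightarrow> (\<forall>a. h a \<noteq> 0 \<longrightarrow> blk m a)" for h :: vec
 have blg: "bl g" using gf by (auto simp: bl_def)
 have bl_dd: "bl (dd p h)" if "bl h" for p h
 proof (unfold bl_def, intro allI impI)
  fix a assume "dd p h a \<noteq> 0"
  then obtain c where c: "h c \<noteq> 0" "a = c(p := c p - 1)" using dd_nz by blast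
  hence "blk m c" using that by (auto simp: bl_def)
  thus "blk m a" unfolding c by (intro blkI) (auto simp: blkD)
 qed
 have dd0: "dd (i, r) h = 0" if "bl h" "m \<le> i" "r < m" for i r h
 proof (rule ccontr)
  assume "dd (i, r) h \<noteq> 0"
  then obtain a where "dd (i, r) h a \<noteq> 0" by (auto simp: fun_eq_iff)
  then obtain c where "h c \<noteq> 0" "c (i, r) \<noteq> 0" using dd_nz by blast
  thus False using that blkD[of m c i r] unfolding bl_def by auto
 qed
 have dd0': "dd (i, r) h = 0" if "bl h" "i < m" "m \<le> r" for i r h
 proof (rule ccontr)
  assume "dd (i, r) h \<noteq> 0"
  then obtain a where "dd (i, r) h a \<noteq> 0" by (auto simp: fun_eq_iff)
  then obtain c where "h c \<noteq> 0" "c (i, r) \<noteq> 0" using dd_nz by blast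
  thus False using that blkD[of m c i r] unfolding bl_def by auto
 qed
 define Q where "Q i j r s = xx (i, r) (xx (j, s) (dd (j, r) (dd (i, s) g)))" for i j r s
 define D where "D i r = xx (i, r) (dd (i, r) g)" for i r
 have EE: "E i j (E j i g) = (\<Sum>r\<in>?J. D i r) - (\<Sum>r\<in>?J. \<Sum>s\<in>?J. Q i j r s)"
  if ij: "i \<in> ?I" "j \<in> ?I" for i j
 proof -
  have "E i j (E j i g) = (\<Sum>r<N. \<Sum>s<N. xx (i, r) (dd (j, r) (xx (j, s) (dd (i, s) g))))"
   unfolding E_def xx_sum dd_sum ..
  also have "\<dots> = (\<Sum>r<N. \<Sum>s<N. (if r = s then D i r else 0) - Q i j r s)"
  proof (intro sum.cong refl, goal_cases)
   case (1 r s)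
   \<comment> \<open>Both inner operators sit in the odd row j, which gives Q its minus
     sign.\<close>
   have "om j j = -1" using ij by (simp add: om_same)
   hence "dd (j, r) (xx (j, s) (dd (i, s) g))
     = (if r = s then dd (i, s) g else 0) - xx (j, s) (dd (j, r) (dd (i, s) g))"
    using 1 by (subst dd_X[OF dd_B[OF gB]]) (auto simp: minus_eq_sc(2))
   thus ?case using 1 by (simp add: Q_def D_def X_lin)
  qed
  also have "\<dots> = (\<Sum>r<N. D i r) - (\<Sum>r<N. \<Sum>s<N. Q i j r s)"
   by (simp add: sum_subtractf)
  also have "(\<Sum>r<N. D i r) = (\<Sum>r\<in>?J. D i r)"
   by (rule sum.mono_neutral_right) (use ij dd0[OF blg] in \<open>auto simp: D_def X_lin\<close>)
  also have "(\<Sum>r<N. \<Sum>s<N. Q i j r s) = (\<Sum>r<N. \<Sum>s\<in>?J. Q i j r s)"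
   by (rule sum.cong[OF refl], rule sum.mono_neutral_right)
     (use ij dd0[OF blg] in \<open>auto simp: Q_def X_lin dd_lin\<close>)
  also have "\<dots> = (\<Sum>r\<in>?J. \<Sum>s\<in>?J. Q i j r s)"
   by (rule sum.mono_neutral_right)
     (use ij dd0[OF bl_dd[OF blg]] in \<open>auto simp: Q_def X_lin intro!: sum.neutral\<close>)
  finally show ?thesis .
 qed
 have FF: "F M r s (F M s r g) = (\<Sum>i\<in>?I. D i r) + (\<Sum>i\<in>?I. \<Sum>j\<in>?I. Q i j r s)"
  if rs: "r \<in> ?J" "s \<in> ?J" for r s
 proof -
  have "F M r s (F M s r g) = (\<Sum>i<M. \<Sum>j<M. xx (i, r) (dd (i, s) (xx (j, s) (dd (j, r) g))))"
   unfolding F_def xx_sum dd_sum ..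
  also have "\<dots> = (\<Sum>i<M. \<Sum>j<M. (if i = j then D i r else 0) + Q i j r s)"
  proof (intro sum.cong refl, goal_cases)
   case (1 i j)
   have e1: "dd (i, s) (xx (j, s) (dd (j, r) g))
     = (if i = j then dd (j, r) g else 0) + sc (om j i) (xx (j, s) (dd (i, s) (dd (j, r) g)))"
    using rs by (subst dd_X[OF dd_B[OF gB]]) auto
   have e2: "dd (i, s) (dd (j, r) g) = sc (om i j) (dd (j, r) (dd (i, s) g))"
    using rs dd_dd[of "(i, s)" "(j, r)"] by simp
   \<comment> \<open>The factor from passing the creation operator and the one from exchanging the
     derivatives are inverse to each other, so Q appears with a plus sign.\<close>
   show ?case using om_inverse[of j i] by (simp add: e1 e2 Q_def D_def X_lin)
  qed
  also have "\<dots> = (\<Sum>i<M. D i r) + (\<Sum>i<M. \<Sum>j<M. Q i j r s)"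
   by (simp add: sum.distrib)
  also have "(\<Sum>i<M. D i r) = (\<Sum>i\<in>?I. D i r)"
   by (rule sum.mono_neutral_right) (use rs dd0'[OF blg] in \<open>auto simp: D_def X_lin\<close>)
  also have "(\<Sum>i<M. \<Sum>j<M. Q i j r s) = (\<Sum>i<M. \<Sum>j\<in>?I. Q i j r s)"
   by (rule sum.cong[OF refl], rule sum.mono_neutral_right)
     (use rs dd0'[OF bl_dd[OF blg]] in \<open>auto simp: Q_def X_lin\<close>)
  also have "\<dots> = (\<Sum>i\<in>?I. \<Sum>j\<in>?I. Q i j r s)"
   by (rule sum.mono_neutral_right)
     (use rs dd0'[OF blg] in \<open>auto simp: Q_def X_lin dd_lin intro!: sum.neutral\<close>)
  finally show ?thesis .
 qed
 \<comment> \<open>The second evaluation: for i < j the commutator turns the product into a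
   difference of weights, since \<open>E i j\<close> kills g; for i > j the inner operator already
   kills g.\<close>
 have EE': "E i j (E j i g) = sc (if i = j then of_nat (\<mu> i) * of_nat (\<mu> i)
   else if i < j then of_nat (\<mu> i) - of_nat (\<mu> j) else 0) g" if ij: "i \<in> ?I" "j \<in> ?I" for i j
 proof -
  consider "i = j" | "i < j" | "j < i" by linarith
  thus ?thesis
  proof cases
   case 1
   thus ?thesis by (simp add: Ed E_lin)
  next
   case 2
   have "E i j (E j i g) = sc 1 (E j i (E i j g)) + E i i g - sc 1 (E j j g)"
    using E_E[OF gB, of i j 1 i j] ij om_inverse[of i j] by (simp add: om_same)
   thus ?thesis using 2 ij E0[of i j] by (simp add: Ed E_lin sc_diff)
  next
   case 3
   thus ?thesis using ij E0[of j i] by (simp add: E_lin)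
  qed
 qed
 have FF': "F M r s (F M s r g) = sc (if r = s then of_nat (\<nu> r) * of_nat (\<nu> r)
   else if r < s then of_nat (\<nu> r) - of_nat (\<nu> s) else 0) g" if rs: "r \<in> ?J" "s \<in> ?J" for r s
 proof -
  consider "r = s" | "r < s" | "s < r" by linarith
  thus ?thesis
  proof cases
   case 1
   thus ?thesis by (simp add: Fd F_lin)
  next
   case 2
   have "F M r s (F M s r g) = F M s r (F M r s g) + F M r r g - F M s s g"
    using F_F[OF gB, of r s s r] rs by simp
   thus ?thesis using 2 rs F0[of r s] by (simp add: Fd F_lin sc_diff)
  next
   case 3
   thus ?thesis using rs F0[of s r] by (simp add: F_lin)
  qed
 qed
 define QQ where "QQ = (\<Sum>i\<in>?I. \<Sum>j\<in>?I. \<Sum>r\<in>?J. \<Sum>s\<in>?J. Q i j r s)"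
 define DD where "DD = (\<Sum>i\<in>?I. \<Sum>r\<in>?J. D i r)"
 \<comment> \<open>An odd row has no entries in the first m columns, so the number operators of its
   block entries add up to \<open>E i i\<close>.\<close>
 have DDb: "DD b = of_int (\<Sum>i\<in>?I. int (\<mu> i)) * g b"
 proof -
  have "(\<Sum>r\<in>?J. D i r) = E i i g" if "i \<in> ?I" for i
   unfolding E_def D_def[symmetric]
   by (rule sum.mono_neutral_left) (use that dd0[OF blg] in \<open>auto simp: D_def X_lin\<close>)
  hence "DD = (\<Sum>i\<in>?I. sc (of_nat (\<mu> i)) g)" unfolding DD_def by (simp add: Ed)
  thus ?thesis by (simp add: sum_distrib_right)
 qed
 have s1: "(\<Sum>i\<in>?I. \<Sum>j\<in>?I. E i j (E j i g)) = sc (of_nat (M - m)) DD - QQ"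
 proof -
  have "(\<Sum>i\<in>?I. \<Sum>j\<in>?I. E i j (E j i g))
    = (\<Sum>i\<in>?I. \<Sum>j\<in>?I. (\<Sum>r\<in>?J. D i r) - (\<Sum>r\<in>?J. \<Sum>s\<in>?J. Q i j r s))"
   by (intro sum.cong refl EE)
  also have "\<dots> = (\<Sum>i\<in>?I. \<Sum>j\<in>?I. (\<Sum>r\<in>?J. D i r)) - QQ"
   by (simp only: sum_subtractf QQ_def)
  also have "(\<Sum>i\<in>?I. \<Sum>j\<in>?I. (\<Sum>r\<in>?J. D i r)) = sc (of_nat (M - m)) DD"
   unfolding DD_def by (rule ext) (simp add: sum_distrib_left)
  finally show ?thesis .
 qed
 have s2: "(\<Sum>r\<in>?J. \<Sum>s\<in>?J. F M r s (F M s r g)) = sc (of_nat (N - m)) DD + QQ"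
 proof -
  have "(\<Sum>r\<in>?J. \<Sum>s\<in>?J. F M r s (F M s r g))
    = (\<Sum>r\<in>?J. \<Sum>s\<in>?J. (\<Sum>i\<in>?I. D i r) + (\<Sum>i\<in>?I. \<Sum>j\<in>?I. Q i j r s))"
   by (intro sum.cong refl FF)
  also have "\<dots> = (\<Sum>r\<in>?J. \<Sum>s\<in>?J. (\<Sum>i\<in>?I. D i r))
    + (\<Sum>r\<in>?J. \<Sum>s\<in>?J. (\<Sum>i\<in>?I. \<Sum>j\<in>?I. Q i j r s))"
   by (simp only: sum.distrib)
  also have "(\<Sum>r\<in>?J. \<Sum>s\<in>?J. (\<Sum>i\<in>?I. D i r)) = sc (of_nat (N - m)) DD"
   unfolding DD_def by (subst (2) sum.swap, rule ext) (simp add: sum_distrib_left)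
  also have "(\<Sum>r\<in>?J. \<Sum>s\<in>?J. (\<Sum>i\<in>?I. \<Sum>j\<in>?I. Q i j r s)) = QQ"
  proof -
   have "(\<Sum>r\<in>?J. \<Sum>s\<in>?J. (\<Sum>i\<in>?I. \<Sum>j\<in>?I. Q i j r s))
     = (\<Sum>r\<in>?J. (\<Sum>i\<in>?I. \<Sum>j\<in>?I. \<Sum>s\<in>?J. Q i j r s))"
    by (intro sum.cong refl sum_swap3)
   also have "\<dots> = QQ" unfolding QQ_def by (rule sum_swap3)
   finally show ?thesis .
  qed
  finally show ?thesis .
 qed
 have tri: "(\<Sum>i\<in>{m..<K}. \<Sum>j\<in>{m..<K}. if i = j then of_nat (\<rho> i) * of_nat (\<rho> i)
   else if i < j then of_nat (\<rho> i) - of_nat (\<rho> j) else 0)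
  = (of_int ((\<Sum>i\<in>{m..<K}. int (\<rho> i) * int (\<rho> i)) + (\<Sum>i\<in>{m..<K}. \<Sum>j\<in>{i<..<K}. int (\<rho> i) - int (\<rho> j))) :: complex)"
  for K and \<rho> :: "nat => nat"
 proof -
  have "(\<Sum>j\<in>{m..<K}. if i = j then of_nat (\<rho> i) * of_nat (\<rho> i)
    else if i < j then of_nat (\<rho> i) - of_nat (\<rho> j) else 0)
   = of_nat (\<rho> i) * of_nat (\<rho> i) + (\<Sum>j\<in>{i<..<K}. of_nat (\<rho> i) - of_nat (\<rho> j) :: complex)"
   if "i \<in> {m..<K}" for i
  proof -
   have "(\<Sum>j\<in>{m..<K}. if i = j then of_nat (\<rho> i) * of_nat (\<rho> i)
    else if i < j then of_nat (\<rho> i) - of_nat (\<rho> j) else (0::complex))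
    = (\<Sum>j\<in>insert i {i<..<K}. if i = j then of_nat (\<rho> i) * of_nat (\<rho> i)
    else if i < j then of_nat (\<rho> i) - of_nat (\<rho> j) else 0)"
    by (rule sum.mono_neutral_right) (use that in auto)
   also have "\<dots> = of_nat (\<rho> i) * of_nat (\<rho> i) + (\<Sum>j\<in>{i<..<K}. of_nat (\<rho> i) - of_nat (\<rho> j))"
    by simp
   finally show ?thesis .
  qed
  thus ?thesis by (simp add: sum.distrib)
 qed
 have "(\<Sum>i\<in>?I. \<Sum>j\<in>?I. E i j (E j i g)) b
   = (\<Sum>i\<in>?I. \<Sum>j\<in>?I. (if i = j then of_nat (\<mu> i) * of_nat (\<mu> i)
   else if i < j then of_nat (\<mu> i) - of_nat (\<mu> j) else 0)) * g b"
  unfolding sum_fun_apply sum_distrib_right by (intro sum.cong refl) (simp only: EE' sc_apply)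
 moreover have "(\<Sum>r\<in>?J. \<Sum>s\<in>?J. F M r s (F M s r g)) b
   = (\<Sum>r\<in>?J. \<Sum>s\<in>?J. (if r = s then of_nat (\<nu> r) * of_nat (\<nu> r)
   else if r < s then of_nat (\<nu> r) - of_nat (\<nu> s) else 0)) * g b"
  unfolding sum_fun_apply sum_distrib_right by (intro sum.cong refl) (simp only: FF' sc_apply)
 moreover have "(\<Sum>i\<in>?I. \<Sum>j\<in>?I. E i j (E j i g)) b + (\<Sum>r\<in>?J. \<Sum>s\<in>?J. F M r s (F M s r g)) b
   = (of_nat (M - m) + of_nat (N - m)) * DD b"
  unfolding s1 s2 by (simp add: algebra_simps)
 ultimately have "of_int ((\<Sum>i\<in>?I. int (\<mu> i) * int (\<mu> i)) + (\<Sum>i\<in>?I. \<Sum>j\<in>{i<..<M}. int (\<mu> i) - int (\<mu> j))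
  + ((\<Sum>r\<in>?J. int (\<nu> r) * int (\<nu> r)) + (\<Sum>r\<in>?J. \<Sum>s\<in>{r<..<N}. int (\<nu> r) - int (\<nu> s)))) * g b
  = of_int ((int (M - m) + int (N - m)) * (\<Sum>i\<in>?I. int (\<mu> i))) * g b"
  unfolding tri DDb by (simp only: of_int_add of_int_mult of_int_of_nat_eq distrib_right mult.assoc)
 hence "(\<Sum>i\<in>?I. int (\<mu> i) * int (\<mu> i)) + (\<Sum>i\<in>?I. \<Sum>j\<in>{i<..<M}. int (\<mu> i) - int (\<mu> j))
  + ((\<Sum>r\<in>?J. int (\<nu> r) * int (\<nu> r)) + (\<Sum>r\<in>?J. \<Sum>s\<in>{r<..<N}. int (\<nu> r) - int (\<nu> s)))
  = (int (M - m) + int (N - m)) * (\<Sum>i\<in>?I. int (\<mu> i))"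
  by (simp only: mult_right_cancel[OF gb] of_int_eq_iff)
 thus ?thesis by (simp only: distrib_right)
qed

end

text \<open>Let R i and C r be the supports of the rows and columns of the 0-1 matrix c. Double
  counting rewrites the hypothesis as the equality case of the sum of all inequalities
  \<open>twice_sum_ge\<close> for the sets R i and C r. So each of them is an equality, and every C
  r is an initial segment.\<close>

lemma staircase:
 fixes c :: "nat => nat => nat"
 assumes c: "\<And>i r. c i r \<le> 1"
  and eq: "(\<Sum>i<n. (\<Sum>r<k. c i r) * (\<Sum>r<k. c i r)) + (\<Sum>r<k. (\<Sum>i<n. c i r) * (\<Sum>i<n. c i r))
   = 2 * (\<Sum>i<n. i * (\<Sum>r<k. c i r)) + 2 * (\<Sum>r<k. r * (\<Sum>i<n. c i r))
    + (\<Sum>i<n. \<Sum>r<k. c i r) + (\<Sum>r<k. \<Sum>i<n. c i r)"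
  and ir: "i < n" "r < k"
 shows "c i r \<noteq> 0 \<longleftrightarrow> i < (\<Sum>i<n. c i r)"
proof -
 define R where "R i = {r. r < k \<and> c i r \<noteq> 0}" for i
 define C where "C r = {i. i < n \<and> c i r \<noteq> 0}" for r
 have c01: "c i r = 0 \<or> c i r = 1" for i r
  using c[of i r] by auto
 have fin: "finite (R i)" "finite (C r)" for i r by (simp_all add: R_def C_def)
 have cardR: "(\<Sum>r<k. c i r) = card (R i)" for i
 proof -
  have "c i r = (if c i r \<noteq> 0 then 1 else 0)" for r using c01[of i r] by auto
  hence "(\<Sum>r<k. c i r) = (\<Sum>r<k. if c i r \<noteq> 0 then 1 else 0)" by (rule sum.cong[OF refl])
  also have "\<dots> = card {r\<in>{..<k}. c i r \<noteq> 0}" by (simp add: sum.inter_filter[symmetric])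
  also have "{r\<in>{..<k}. c i r \<noteq> 0} = R i" by (auto simp: R_def)
  finally show ?thesis .
 qed
 have cardC: "(\<Sum>i<n. c i r) = card (C r)" for r
 proof -
  have "c i r = (if c i r \<noteq> 0 then 1 else 0)" for i using c01[of i r] by auto
  hence "(\<Sum>i<n. c i r) = (\<Sum>i<n. if c i r \<noteq> 0 then 1 else 0)" by (rule sum.cong[OF refl])
  also have "\<dots> = card {i\<in>{..<n}. c i r \<noteq> 0}" by (simp add: sum.inter_filter[symmetric])
  also have "{i\<in>{..<n}. c i r \<noteq> 0} = C r" by (auto simp: C_def)
  finally show ?thesis .
 qed
 have sumR: "(\<Sum>r<k. r * c i r) = \<Sum>(R i)" for i
 proof -
  have "r * c i r = (if c i r \<noteq> 0 then r else 0)" for r using c01[of i r] by auto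
  hence "(\<Sum>r<k. r * c i r) = (\<Sum>r<k. if c i r \<noteq> 0 then r else 0)" by (rule sum.cong[OF refl])
  also have "\<dots> = (\<Sum>r\<in>{r\<in>{..<k}. c i r \<noteq> 0}. r)" by (rule sum.inter_filter[symmetric]) simp
  also have "{r\<in>{..<k}. c i r \<noteq> 0} = R i" by (auto simp: R_def)
  finally show ?thesis .
 qed
 have sumC: "(\<Sum>i<n. i * c i r) = \<Sum>(C r)" for r
 proof -
  have "i * c i r = (if c i r \<noteq> 0 then i else 0)" for i using c01[of i r] by auto
  hence "(\<Sum>i<n. i * c i r) = (\<Sum>i<n. if c i r \<noteq> 0 then i else 0)" by (rule sum.cong[OF refl])
  also have "\<dots> = (\<Sum>i\<in>{i\<in>{..<n}. c i r \<noteq> 0}. i)" by (rule sum.inter_filter[symmetric]) simp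
  also have "{i\<in>{..<n}. c i r \<noteq> 0} = C r" by (auto simp: C_def)
  finally show ?thesis .
 qed
 \<comment> \<open>The row indices of all ones, summed once by rows and once by columns.\<close>
 have t1: "(\<Sum>i<n. i * (\<Sum>r<k. c i r)) = (\<Sum>r<k. \<Sum>(C r))"
  unfolding sumC[symmetric] sum_distrib_left by (rule sum.swap)
 have t2: "(\<Sum>r<k. r * (\<Sum>i<n. c i r)) = (\<Sum>i<n. \<Sum>(R i))"
  unfolding sumR[symmetric] sum_distrib_left by (rule sum.swap)
 have geC: "card (C r) * card (C r) \<le> 2 * \<Sum>(C r) + card (C r)" for r
  using twice_sum_ge[OF fin(2)] by blast
 have geR: "(\<Sum>i<n. card (R i) * card (R i)) \<le> (\<Sum>i<n. 2 * \<Sum>(R i) + card (R i))"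
  by (intro sum_mono) (use twice_sum_ge[OF fin(1)] in blast)
 have tot: "(\<Sum>i<n. card (R i) * card (R i)) + (\<Sum>r<k. card (C r) * card (C r))
   = (\<Sum>i<n. 2 * \<Sum>(R i) + card (R i)) + (\<Sum>r<k. 2 * \<Sum>(C r) + card (C r))"
  using eq unfolding t1 t2 unfolding cardR cardC by (simp add: sum.distrib sum_distrib_left)
 have "2 * \<Sum>(C r) + card (C r) = card (C r) * card (C r)"
 proof (rule ccontr)
  assume "\<not> ?thesis"
  hence "card (C r) * card (C r) < 2 * \<Sum>(C r) + card (C r)" using geC[of r] by simp
  hence "(\<Sum>r<k. card (C r) * card (C r)) < (\<Sum>r<k. 2 * \<Sum>(C r) + card (C r))"
   by (intro sum_strict_mono_ex1) (use geC ir in auto)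
  thus False using tot geR by linarith
 qed
 hence "C r = {..<card (C r)}" using twice_sum_ge[OF fin(2)] by blast
 thus ?thesis unfolding cardC using ir by (auto simp: C_def)
qed

text \<open>The entry \<open>x i\<close> occurs K - 1 - i times with a plus sign and i times with a
  minus sign.\<close>

lemma sum_pairwise_differences:
 fixes x :: "nat => int"
 shows "(\<Sum>i<K. \<Sum>j\<in>{i<..<K}. x i - x j) = (\<Sum>i<K. x i * (int K - 1 - 2 * int i))"
proof (induction K)
 case (Suc K)
 have empty: "{K<..<Suc K} = {}" by auto
 have "(\<Sum>j\<in>{i<..<Suc K}. x i - x j) = (\<Sum>j\<in>{i<..<K}. x i - x j) + (x i - x K)" if "i < K" for i
 proof -
  have "{i<..<Suc K} = insert K {i<..<K}" using that by auto
  thus ?thesis by simp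
 qed
 hence "(\<Sum>i<K. \<Sum>j\<in>{i<..<Suc K}. x i - x j)
   = (\<Sum>i<K. (\<Sum>j\<in>{i<..<K}. x i - x j) + (x i - x K))"
  by (intro sum.cong refl) blast
 also have "\<dots> = (\<Sum>i<K. \<Sum>j\<in>{i<..<K}. x i - x j) + (\<Sum>i<K. x i - x K)"
  by (rule sum.distrib)
 also have "(\<Sum>i<K. x i - x K) = (\<Sum>i<K. x i) - int K * x K"
  by (simp add: sum_subtractf)
 finally have "(\<Sum>i<Suc K. \<Sum>j\<in>{i<..<Suc K}. x i - x j)
   = (\<Sum>i<K. \<Sum>j\<in>{i<..<K}. x i - x j) + ((\<Sum>i<K. x i) - int K * x K)"
  by (simp add: empty)
 thus ?case unfolding Suc by (simp add: algebra_simps sum.distrib sum_subtractf sum_distrib_left)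
qed simp

lemma sum_affine_weight:
 fixes x :: "nat => int"
 shows "(\<Sum>i<K. x i * (L - 1 - 2 * int i)) = (L - 1) * (\<Sum>i<K. x i) - 2 * (\<Sum>i<K. int i * x i)"
 by (simp add: algebra_simps sum.distrib sum_subtractf sum_distrib_left)

lemma sum_shift: "(\<Sum>i\<in>{m..<M}. g i) = (\<Sum>i<M - m. g (m + i))" for m M :: nat
 by (rule sum.reindex_bij_witness[of _ "\<lambda>i. m + i" "\<lambda>i. i - m"]) auto

lemma sum_shift_gt: "(\<Sum>j\<in>{m + i<..<M}. g j) = (\<Sum>j\<in>{i<..<M - m}. g (m + j))" for m M :: nat
 by (rule sum.reindex_bij_witness[of _ "\<lambda>i. m + i" "\<lambda>i. i - m"]) auto

section \<open>The leading monomial of a joint highest weight vector\<close>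

context oscillator
begin

text \<open>The diagram of \<nu> cut after its first m parts: these sit on the diagonal of the even
  rows, the others become columns of ones in the odd rows.\<close>

definition lead :: "(nat => nat) => mon" where
 "lead \<nu> = (\<lambda>(i, r). if i < m then (if i = r then \<nu> r else 0) else if m \<le> r \<and> i - m < \<nu> r then 1 else 0)"

lemma sum_single: "i \<in> A ==> finite A ==> (\<And>j. j \<in> A ==> j \<noteq> i ==> g j = 0) ==> sum g A = (g i :: nat)"
 by (subst sum.remove[of _ i]) (auto intro!: sum.neutral)

text \<open>By \<open>res_nz\<close> some monomial b of f is diagonal in the first
  \<open>min m N\<close> rows and columns. If N \<le> m, nothing else is left of b. Otherwise the
  Casimir identity makes its odd block a \<open>staircase\<close>. Either way b is
  \<open>lead \<nu>\<close>; an odd column of zeros and ones has at most n ones, which is the hook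
  condition.\<close>

lemma jhw_leading:
 assumes f: "jhw (m + n) \<mu> \<nu> f" and nz: "f \<noteq> 0"
 shows "f (lead \<nu>) \<noteq> 0" "\<nu> m \<le> n" "\<nu> N = 0"
  "\<And>i. i < m + n ==> \<mu> i = (if i < m then \<nu> i else card {r. m \<le> r \<and> i - m < \<nu> r})"
proof -
 let ?M = "m + n"
 define k where "k = min m N"
 obtain b where b: "f b \<noteq> 0" "blk k b"
  using res_nz[OF f nz, of k] by (auto simp: res_apply k_def split: if_splits)
 have val: "valid ?M b" and rd: "rdeg b = \<mu>" and cd: "cdeg ?M b = \<nu>"
  using jhwD[OF f] b by auto
 have b0: "b (i, r) = 0" if "\<not> (i < ?M \<and> r < N)" for i r
  using valid_box[OF val, of "(i, r)"] that by auto
 have b1: "b (i, r) \<le> 1" if "m \<le> i" for i r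
  using valid_odd[OF val, of "(i, r)"] that by auto
 have nu0: "\<nu> r = 0" if "N \<le> r" for r
  unfolding cd[symmetric] cdeg_def by (rule sum.neutral) (use that b0 in auto)
 have nuN: "r < N" if "x < \<nu> r" for r x using nu0[of r] that by (cases "r < N") auto
 have diagc: "\<nu> r = b (r, r)" if "r < k" for r
  unfolding cd[symmetric] cdeg_def using that blkD[OF b(2)]
  by (intro sum_single) (auto simp: k_def)
 have diagr: "\<mu> i = b (i, i)" if "i < k" for i
  unfolding rd[symmetric] rdeg_def using that blkD[OF b(2)]
  by (intro sum_single) (auto simp: k_def)
 have main: "b = lead \<nu> \<and> \<nu> m \<le> n \<and>
  (\<forall>i<m + n. \<mu> i = (if i < m then \<nu> i else card {r. m \<le> r \<and> i - m < \<nu> r}))"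
 proof (cases "N \<le> m")
  case True
  hence k: "k = N" by (simp add: k_def)
  have "b (i, r) = lead \<nu> (i, r)" for i r
  proof (cases "r < N")
   case True
   thus ?thesis using k \<open>N \<le> m\<close> diagc[of r] blkD[OF b(2), of i r] by (auto simp: lead_def)
  next
   case False
   thus ?thesis using \<open>N \<le> m\<close> b0[of i r] nu0[of r] by (auto simp: lead_def)
  qed
  moreover have "\<mu> i = (if i < m then \<nu> i else card {r. m \<le> r \<and> i - m < \<nu> r})" for i
  proof (cases "i < N")
   case True
   thus ?thesis using k \<open>N \<le> m\<close> diagc[of i] diagr[of i] by auto
  next
   case False
   have "b (i, r) = 0" if "r < N" for r using blkD[OF b(2), of i r] that False k by auto
   hence "\<mu> i = 0" by (auto simp: rd[symmetric] rdeg_def)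
   moreover have "{r. m \<le> r \<and> i - m < \<nu> r} = {}" using nu0 \<open>N \<le> m\<close> by auto
   ultimately show ?thesis using nu0[of i] False by (auto simp: not_less simp del: Collect_empty_eq)
  qed
  ultimately show ?thesis using nu0[of m] True by (auto simp: fun_eq_iff)
 next
  case False
  hence k: "k = m" by (simp add: k_def)
  define c where "c i r = b (m + i, m + r)" for i r
  let ?N = "N - m"
  have c1: "c i r \<le> 1" for i r using b1 by (simp add: c_def)
  have mu: "\<mu> (m + i) = (\<Sum>r<?N. c i r)" for i
  proof -
   have "\<mu> (m + i) = (\<Sum>r\<in>{m..<N}. b (m + i, r))"
    unfolding rd[symmetric] rdeg_def using blkD[OF b(2)] k
    by (intro sum.mono_neutral_right) auto
   thus ?thesis by (simp add: sum_shift c_def)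
  qed
  have nu: "\<nu> (m + r) = (\<Sum>i<n. c i r)" for r
  proof -
   have "\<nu> (m + r) = (\<Sum>i\<in>{m..<?M}. b (i, m + r))"
    unfolding cd[symmetric] cdeg_def using blkD[OF b(2)] k
    by (intro sum.mono_neutral_right) auto
   thus ?thesis by (simp add: sum_shift c_def)
  qed
  have tot: "(\<Sum>i<n. \<mu> (m + i)) = (\<Sum>r<?N. \<nu> (m + r))"
   unfolding mu nu by (rule sum.swap)
  have "(\<Sum>i<n. int (\<mu> (m + i)) * int (\<mu> (m + i))) + (\<Sum>i<n. int (\<mu> (m + i)) * (int n - 1 - 2 * int i))
   + ((\<Sum>r<?N. int (\<nu> (m + r)) * int (\<nu> (m + r))) + (\<Sum>r<?N. int (\<nu> (m + r)) * (int ?N - 1 - 2 * int r)))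
   = int n * (\<Sum>i<n. int (\<mu> (m + i))) + int ?N * (\<Sum>i<n. int (\<mu> (m + i)))"
   using casimir_odd_block[OF f _ _ b(1), unfolded sum_shift sum_shift_gt sum_pairwise_differences] b(2) k False
   by simp
  moreover have "(\<Sum>i<n. int (\<mu> (m + i))) = (\<Sum>r<?N. int (\<nu> (m + r)))"
   using tot by (metis of_nat_sum)
  \<comment> \<open>Both weights have the same total on the odd block, so the multiples of n and of
    N - m cancel.\<close>
  moreover have "A + B = 2 * P + 2 * Q + d + e"
   if "A + ((n' - 1) * d - 2 * P) + (B + ((N' - 1) * e - 2 * Q)) = n' * d + N' * d" "d = e"
   for A B P Q d e n' N' :: int
   using that by (simp add: algebra_simps)
  ultimately have "(\<Sum>i<n. int (\<mu> (m + i)) * int (\<mu> (m + i)))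
    + (\<Sum>r<?N. int (\<nu> (m + r)) * int (\<nu> (m + r)))
    = 2 * (\<Sum>i<n. int i * int (\<mu> (m + i))) + 2 * (\<Sum>r<?N. int r * int (\<nu> (m + r)))
     + (\<Sum>i<n. int (\<mu> (m + i))) + (\<Sum>r<?N. int (\<nu> (m + r)))"
   unfolding sum_affine_weight by blast
  hence "int ((\<Sum>i<n. \<mu> (m + i) * \<mu> (m + i)) + (\<Sum>r<?N. \<nu> (m + r) * \<nu> (m + r)))
   = int (2 * (\<Sum>i<n. i * \<mu> (m + i)) + 2 * (\<Sum>r<?N. r * \<nu> (m + r))
    + (\<Sum>i<n. \<mu> (m + i)) + (\<Sum>r<?N. \<nu> (m + r)))"
   by simp
  hence "(\<Sum>i<n. \<mu> (m + i) * \<mu> (m + i)) + (\<Sum>r<?N. \<nu> (m + r) * \<nu> (m + r))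
   = 2 * (\<Sum>i<n. i * \<mu> (m + i)) + 2 * (\<Sum>r<?N. r * \<nu> (m + r))
    + (\<Sum>i<n. \<mu> (m + i)) + (\<Sum>r<?N. \<nu> (m + r))"
   by (simp only: of_nat_eq_iff)
  note stair = staircase[where c = c and n = n and k = ?N, OF c1 this[unfolded mu nu], folded nu]
  have nu_le: "\<nu> (m + r) \<le> n" for r
   unfolding nu using sum_mono[of "{..<n}" "\<lambda>i. c i r" "\<lambda>_. 1"] c1 by simp
  have odd: "b (i, r) = lead \<nu> (i, r)" if i: "m \<le> i" for i r
  proof (cases "m \<le> r \<and> r < N \<and> i < ?M")
   case True
   hence "i - m < n" "r - m < ?N" using i by auto
   hence "c (i - m) (r - m) \<noteq> 0 \<longleftrightarrow> i - m < \<nu> r"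
    using stair[of "i - m" "r - m"] True by simp
   thus ?thesis using True i c1[of "i - m" "r - m"] by (auto simp: c_def lead_def)
  next
   case F: False
   have "b (i, r) = 0"
   proof (cases "r < m")
    case True
    thus ?thesis using blkD[OF b(2), of i r] k i by auto
   next
    case False
    thus ?thesis using F b0[of i r] by auto
   qed
   moreover have "\<not> (m \<le> r \<and> i - m < \<nu> r)"
    using F nu_le[of "r - m"] nu0[of r] i by auto
   ultimately show ?thesis using i by (auto simp: lead_def)
  qed
  have "b (i, r) = lead \<nu> (i, r)" for i r
  proof (cases "m \<le> i")
   case False
   thus ?thesis using k diagc[of r] blkD[OF b(2), of i r] by (auto simp: lead_def)
  qed (rule odd)
  moreover have "\<mu> i = (if i < m then \<nu> i else card {r. m \<le> r \<and> i - m < \<nu> r})" if "i < ?M" for i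
  proof (cases "i < m")
   case True
   thus ?thesis using k diagc[of i] diagr[of i] by auto
  next
   case F: False
   have "\<mu> i = (\<Sum>r<N. if m \<le> r \<and> i - m < \<nu> r then 1 else 0)"
    unfolding rd[symmetric] rdeg_def using odd[of i] F by (simp add: lead_def)
   also have "\<dots> = card {r\<in>{..<N}. m \<le> r \<and> i - m < \<nu> r}"
    by (simp add: sum.inter_filter[symmetric])
   also have "{r\<in>{..<N}. m \<le> r \<and> i - m < \<nu> r} = {r. m \<le> r \<and> i - m < \<nu> r}"
    using nuN by auto
   finally show ?thesis using F by simp
  qed
  ultimately show ?thesis using nu_le[of 0] by (auto simp: fun_eq_iff)
 qed
 show "f (lead \<nu>) \<noteq> 0" using main b by simp
 show "\<nu> m \<le> n" using main by simp
 show "\<nu> N = 0" using nu0 by simp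
 show "\<And>i. i < m + n ==> \<mu> i = (if i < m then \<nu> i else card {r. m \<le> r \<and> i - m < \<nu> r})"
  using main by blast
qed

text \<open>The lowered vector \<open>h\<close> has squared length
  \<open>\<nu> r - \<nu> (Suc r)\<close> times that of f, and squared lengths are not
  negative.\<close>

lemma jhw_antimono:
 assumes f: "jhw M \<mu> \<nu> f" and nz: "f \<noteq> 0"
 shows "antimono \<nu>"
proof -
 obtain b where b: "f b \<noteq> 0" using nz by (auto simp: fun_eq_iff)
 have fB: "f \<in> B M" using jhwD(1)[OF f] .
 have "\<nu> (Suc r) \<le> \<nu> r" for r
 proof (cases "Suc r < N")
  case False
  have "\<nu> (Suc r) = 0"
   unfolding jhwD(8)[OF f b, symmetric] cdeg_def
   using valid_box[OF jhwD(6)[OF f b]] False by (intro sum.neutral) fastforce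
  thus ?thesis by simp
 next
  case True
  define h where "h = F M (Suc r) r f"
  have hB: "h \<in> B M" unfolding h_def using F_B[OF fB] True by simp
  have Fd: "F M s s f = sc (of_nat (\<nu> s)) f" for s
   using F_diag[OF fB, of s] jhwD(8)[OF f] by (auto simp: fun_eq_iff)
  have Fh0: "F M r (Suc r) h = F M (Suc r) r (F M r (Suc r) f) + F M r r f - F M (Suc r) (Suc r) f"
   unfolding h_def using F_F[OF fB, of r "Suc r" "Suc r" r] True by simp
  have F0: "F M r (Suc r) f = 0" using jhwD(3)[OF f, of r "Suc r"] True by simp
  have Fh: "F M r (Suc r) h = sc (of_nat (\<nu> r) - of_nat (\<nu> (Suc r))) f"
   unfolding Fh0 by (simp add: F0 F_lin Fd sc_diff)
  have "ip h h = ip f (F M r (Suc r) h)"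
   using F_adjoint[OF fB hB, of "Suc r" r] by (simp add: h_def)
  also have "\<dots> = of_real (real (\<nu> r) - real (\<nu> (Suc r))) * ip f f"
   unfolding Fh by (subst ip_sc_right[OF B_FS[OF fB]]) simp
  finally have 1: "ip h h = of_real (real (\<nu> r) - real (\<nu> (Suc r))) * ip f f" .
  obtain c where c: "c > 0" "ip f f = of_real c"
   using ip_self[OF B_FS[OF fB]] ip_definite[OF B_FS[OF fB]] nz by blast
  have "ip h h = of_real ((real (\<nu> r) - real (\<nu> (Suc r))) * c)" unfolding 1 c(2) by simp
  moreover obtain d where "d \<ge> 0" "ip h h = of_real d"
   using ip_self[OF B_FS[OF hB]] by (metis less_imp_le of_real_0 order_refl)
  ultimately have "(real (\<nu> r) - real (\<nu> (Suc r))) * c \<ge> 0" by (metis of_real_eq_iff)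
  thus ?thesis using c(1) by (simp add: zero_le_mult_iff)
 qed
 thus ?thesis by (simp add: antimono_iff_le_Suc)
qed

text \<open>If some part from index m on exceeds i - m, then so do the first m parts, and the
  transposed part counts m more than the remainder. If none does, the transposed part is at most m
  and the truncated subtraction gives 0.\<close>

lemma jhw_partition:
 assumes f: "jhw (m + n) \<mu> \<nu> f" and nz: "f \<noteq> 0"
 shows "\<nu> \<in> hook_partitions m n N" "\<And>i. i < m + n ==> \<mu> i = sharp m \<nu> i"
proof -
 have anti: "antimono \<nu>" by (rule jhw_antimono[OF f nz])
 show "\<nu> \<in> hook_partitions m n N"
  using anti jhw_leading[OF f nz] by (simp add: hook_partitions_def)
 fix i assume i: "i < m + n"
 show "\<mu> i = sharp m \<nu> i"
 proof (cases "i < m")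
  case True
  thus ?thesis using jhw_leading(4)[OF f nz i] by (simp add: sharp_def)
 next
  case False
  have "transpose_part \<nu> (i - m) - m = card {r. m \<le> r \<and> i - m < \<nu> r}"
  proof (cases "{r. m \<le> r \<and> i - m < \<nu> r} = {}")
   case True
   hence "{r. i - m < \<nu> r} \<subseteq> {..<m}" by (auto simp: not_le[symmetric])
   hence "card {r. i - m < \<nu> r} \<le> m" using card_mono[of "{..<m}"] by fastforce
   thus ?thesis unfolding True transpose_part_def by simp
  next
   case False
   then obtain s where s: "m \<le> s" "i - m < \<nu> s" by blast
   have le: "i - m < \<nu> r" if "r < m" for r
    using antimonoD[OF anti, of r s] s that by simp
   have fin: "finite {r. m \<le> r \<and> i - m < \<nu> r}"
   proof (rule finite_subset)
    show "{r. m \<le> r \<and> i - m < \<nu> r} \<subseteq> {..<N}"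
    proof
     fix r assume "r \<in> {r. m \<le> r \<and> i - m < \<nu> r}"
     thus "r \<in> {..<N}"
      using antimonoD[OF anti, of N r] jhw_leading(3)[OF f nz] by (cases "r < N") auto
    qed
   qed simp
   have "{r. i - m < \<nu> r} = {..<m} \<union> {r. m \<le> r \<and> i - m < \<nu> r}"
    using le by auto
   hence "card {r. i - m < \<nu> r} = m + card {r. m \<le> r \<and> i - m < \<nu> r}"
    using card_Un_disjoint[OF _ fin, of "{..<m}"] by (simp add: disjoint_iff)
   thus ?thesis unfolding transpose_part_def by simp
  qed
  thus ?thesis using jhw_leading(4)[OF f nz i] False by (simp add: sharp_def)
 qed
qed

text \<open>The row weight is determined by \<nu>. Subtracting the multiple of f that cancels the
  coefficient at \<open>lead \<nu>\<close> leaves a vector of the same kind, which must be zero by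
  \<open>jhw_leading\<close>.\<close>

lemma jhw_unique:
 assumes "jhw (m + n) \<mu> \<nu> f" "jhw (m + n) \<mu>' \<nu> g" "f \<noteq> 0" "g \<noteq> 0"
 shows "\<exists>c. g = sc c f"
proof -
 have "\<mu> = \<mu>'"
 proof
  fix i
  show "\<mu> i = \<mu>' i"
  proof (cases "i < m + n")
   case True
   thus ?thesis using jhw_partition(2) assms by metis
  next
   case False
   have *: "\<rho> i = 0" if "jhw (m + n) \<rho> \<nu> h" "h \<noteq> 0" for \<rho> h
   proof -
    have "\<exists>b. h b \<noteq> 0" using that(2) by (auto simp: fun_eq_iff)
    then obtain b where b: "h b \<noteq> 0" ..
    have "rdeg b i = 0" unfolding rdeg_def
     using valid_box[OF jhwD(6)[OF that(1) b]] False by (intro sum.neutral) fastforce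
    thus ?thesis using jhwD(7)[OF that(1) b] by simp
   qed
   show ?thesis using *[OF assms(1,3)] *[OF assms(2,4)] by simp
  qed
 qed
 define c where "c = g (lead \<nu>) / f (lead \<nu>)"
 define h where "h = g - sc c f"
 have sub: "homog \<delta> d (g - sc c f)" if "homog \<delta> d f" "homog \<delta> d g" for \<delta> :: "mon => nat => nat" and d
  using that subsp_diff[OF subsp_supported, of g "{a. \<delta> a = d}" "sc c f"]
   subsp_sc[OF subsp_supported, of f "{a. \<delta> a = d}" c] by simp
 have "jhw (m + n) \<mu> \<nu> h"
  using assms(1,2) unfolding jhw_def h_def \<open>\<mu> = \<mu>'\<close>
  by (simp add: subsp_diff subsp_sc E_lin F_lin sub)
 moreover have "h (lead \<nu>) = 0"
  using jhw_leading(1)[OF assms(1,3)] by (simp add: h_def c_def)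
 ultimately have "h = 0" using jhw_leading(1) by metis
 hence "g = sc c f" by (simp add: h_def)
 thus ?thesis ..
qed

end

section \<open>Orthogonal decomposition\<close>

context oscillator
begin

text \<open>Raising operators carry weight to smaller indices and therefore decrease this
  height.\<close>

definition ht :: "nat => (nat => nat) => nat" where
 "ht M \<rho> = (\<Sum>i<M. i * \<rho> i)"

lemma ht_upd: "i < M ==> ht M (\<rho>(i := k)) + i * \<rho> i = ht M \<rho> + i * k"
 unfolding ht_def by (subst (1 2) sum.remove[of _ i]) (auto intro!: sum.cong)

lemma ht_move:
 assumes "i < j" "j < M" "\<rho> j \<noteq> 0"
 shows "ht M (move i j \<rho>) < ht M \<rho>"
proof -
 define \<sigma> where "\<sigma> = \<rho>(j := \<rho> j - 1)"
 have "ht M \<sigma> + j * \<rho> j = ht M \<rho> + j * (\<rho> j - 1)"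
  unfolding \<sigma>_def using assms by (intro ht_upd)
 moreover have "j * \<rho> j = j * (\<rho> j - 1) + j" using assms(3) by (cases "\<rho> j") auto
 ultimately have 1: "ht M \<sigma> + j = ht M \<rho>" by simp
 have "ht M (\<sigma>(i := Suc (\<sigma> i))) + i * \<sigma> i = ht M \<sigma> + i * Suc (\<sigma> i)"
  using assms by (intro ht_upd) auto
 hence "ht M (\<sigma>(i := Suc (\<sigma> i))) = ht M \<sigma> + i" by simp
 thus ?thesis using 1 assms unfolding move_def \<sigma>_def by simp
qed

text \<open>Minimise the sum of both heights over the nonzero bihomogeneous vectors of Y: a raising
  operator that did not kill the minimiser would produce a smaller one.\<close>

lemma jhw_in_subspace:
 assumes Y: "Y \<subseteq> B M"
  and E: "\<And>i j x. i < j ==> j < M ==> x \<in> Y ==> E i j x \<in> Y"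
  and F: "\<And>r s x. r < s ==> s < N ==> x \<in> Y ==> F M r s x \<in> Y"
  and x: "x \<in> Y" "x \<noteq> 0" "homog rdeg \<rho> x" "homog (cdeg M) \<nu> x"
 shows "\<exists>y \<mu> \<nu>. y \<in> Y \<and> y \<noteq> 0 \<and> jhw M \<mu> \<nu> y"
proof -
 define Q where "Q z \<longleftrightarrow> (case z of (y, \<mu>, \<nu>) => y \<in> Y \<and> y \<noteq> 0 \<and> homog rdeg \<mu> y \<and> homog (cdeg M) \<nu> y)" for z
 define h where "h z = (case z of (y :: vec, \<mu>, \<nu>) => ht M \<mu> + ht N \<nu>)" for z
 have "Q (x, \<rho>, \<nu>)" using x by (simp add: Q_def)
 then obtain z where z: "Q z" and min: "\<And>z'. Q z' ==> h z \<le> h z'"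
  using arg_min_nat_lemma[of Q "(x, \<rho>, \<nu>)" h] by blast
 obtain y \<mu> \<nu>' where zy: "z = (y, \<mu>, \<nu>')" by (cases z)
 have y: "y \<in> Y" "y \<noteq> 0" "homog rdeg \<mu> y" "homog (cdeg M) \<nu>' y"
  using z by (auto simp: Q_def zy)
 have yB: "y \<in> B M" using y Y by blast
 have "E i j y = 0" if ij: "i < j" "j < M" for i j
 proof (rule ccontr)
  assume nz: "E i j y \<noteq> 0"
  then obtain a where "E i j y a \<noteq> 0" by (auto simp: fun_eq_iff)
  then obtain b where "y b \<noteq> 0" "rdeg b j \<noteq> 0" using rdeg_E by blast
  hence "\<mu> j \<noteq> 0" using y(3) by (auto simp: supported_def)
  hence "ht M (move i j \<mu>) < ht M \<mu>" using ij by (intro ht_move)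
  moreover have "Q (E i j y, move i j \<mu>, \<nu>')"
   unfolding Q_def using nz E[OF ij y(1)] homog_E[OF y(3)] homog_E_cdeg[OF _ _ y(4)] ij by simp
  ultimately show False using min[of "(E i j y, move i j \<mu>, \<nu>')"] by (simp add: h_def zy)
 qed
 moreover have "F M r s y = 0" if rs: "r < s" "s < N" for r s
 proof (rule ccontr)
  assume nz: "F M r s y \<noteq> 0"
  then obtain a where "F M r s y a \<noteq> 0" by (auto simp: fun_eq_iff)
  then obtain b where "y b \<noteq> 0" "cdeg M b s \<noteq> 0" using cdeg_F by blast
  hence "\<nu>' s \<noteq> 0" using y(4) by (auto simp: supported_def)
  hence "ht N (move r s \<nu>') < ht N \<nu>'" using rs by (intro ht_move)
  moreover have "Q (F M r s y, \<mu>, move r s \<nu>')"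
   unfolding Q_def using nz F[OF rs y(1)] homog_F[OF _ _ y(3)] homog_F_cdeg[OF y(4)] rs by simp
  ultimately show False using min[of "(F M r s y, \<mu>, move r s \<nu>')"] by (simp add: h_def zy)
 qed
 ultimately have "jhw M \<mu> \<nu>' y" using y yB by (simp add: jhw_def)
 thus ?thesis using y by blast
qed

text \<open>Allows a vector found in a larger number of rows to be read in m + n rows.\<close>

lemma F_cong_rows:
 assumes "f \<in> B M" "M \<le> M'"
 shows "F M' r s f = F M r s f"
proof -
 have "dd (i, s) f = 0" if "M \<le> i" for i
 proof (rule ccontr)
  assume "dd (i, s) f \<noteq> 0"
  then obtain a where "dd (i, s) f a \<noteq> 0" by (auto simp: fun_eq_iff)
  then obtain b where b: "f b \<noteq> 0" "b (i, s) \<noteq> 0" using dd_nz by blast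
  thus False using valid_box[OF B_valid[OF assms(1) b(1)] b(2)] that by simp
 qed
 thus ?thesis
  unfolding F_def using assms(2) by (intro sum.mono_neutral_right) (auto simp: X_lin not_less)
qed

text \<open>
 Highest weight vectors for the column action: start with the monomial of the Young diagram in
 sufficiently many odd rows, and convert the rows from \<open>m + n\<close> on into even ones by row operators.
\<close>

lemma column_highest_weight_vector_exists:
 assumes nu: "\<nu> \<in> hook_partitions m n N"
 shows "\<exists>f \<rho>. f \<in> B (m + n) \<and> f \<noteq> 0 \<and> homog rdeg \<rho> f \<and> homog (cdeg (m + n)) \<nu> f \<and>
  (\<forall>r s. r < s \<longrightarrow> s < N \<longrightarrow> F (m + n) r s f = 0)"
proof -
 have anti: "\<nu> s \<le> \<nu> r" if "r \<le> s" for r s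
  using nu that by (auto simp: hook_partitions_def antimono_def)
 have nuN: "r < N" if "j < \<nu> r" for r j
  using anti[of N r] nu that by (cases "r < N") (auto simp: hook_partitions_def)
 have num: "r < m" if "j < \<nu> r" "n \<le> j" for r j
  using anti[of m r] nu that by (cases "r < m") (auto simp: hook_partitions_def)
 \<comment> \<open>The summand \<open>\<nu> 0\<close> makes room for all columns of the diagram; the
   summand n keeps m + n within the rows considered.\<close>
 define K where "K = n + \<nu> 0"
 have nuK: "\<nu> r \<le> K" for r using anti[of 0 r] by (simp add: K_def)
 let ?M = "m + K"
 \<comment> \<open>The cells that do not fit into n odd rows. By the hook condition they belong to
   the first m parts.\<close>
 define P where "P = {(i, j). n \<le> j \<and> j < \<nu> i}"
 have finP: "finite P"
 proof (rule finite_subset)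
  show "P \<subseteq> {..<N} \<times> {..<K}"
  proof
   fix p assume "p \<in> P"
   then obtain i j where "p = (i, j)" "j < \<nu> i" by (auto simp: P_def)
   thus "p \<in> {..<N} \<times> {..<K}" using nuN[of j i] nuK[of i] by simp
  qed
 qed simp
 \<comment> \<open>The monomial followed through the conversion: the cells in Q have already been
   moved to the diagonal, all others are still ones in odd rows.\<close>
 define t :: "(nat \<times> nat) set => mon" where
  "t Q = (\<lambda>(i, r). if i < m then (if i = r then card {j. (i, j) \<in> Q} else 0)
   else if i - m < \<nu> r \<and> (r, i - m) \<notin> Q then 1 else 0)" for Q
 define G where "G Q \<longleftrightarrow> (\<exists>f \<rho>. f \<in> B ?M \<and> f (t Q) \<noteq> 0 \<and> homog rdeg \<rho> f \<and> homog (cdeg ?M) \<nu> f \<and>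
  (\<forall>r s. r < s \<longrightarrow> s < N \<longrightarrow> F ?M r s f = 0))" for Q
 have "G {}"
 proof -
  define f :: vec where "f = (\<lambda>a. if a = t {} then 1 else 0)"
  have f0: "f a \<noteq> 0 \<longleftrightarrow> a = t {}" for a by (simp add: f_def)
  have val: "valid ?M (t {})"
  proof (rule validI)
   show "fst p < ?M \<and> snd p < N" if "t {} p \<noteq> 0" for p
    using that nuN[of "fst p - m" "snd p"] nuK[of "snd p"]
    by (cases p) (auto simp: t_def split: if_splits)
   show "t {} p \<le> 1" if "m \<le> fst p" for p using that by (cases p) (auto simp: t_def)
  qed
  have fB: "f \<in> B ?M"
   by (rule BI) (use val f0 in \<open>auto simp: FS_def\<close>)
  have "cdeg ?M (t {}) = \<nu>"
  proof
   fix r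
   have "cdeg ?M (t {}) r = (\<Sum>i\<in>{m..<?M}. t {} (i, r))"
    unfolding cdeg_def by (rule sum.mono_neutral_right) (auto simp: t_def)
   also have "\<dots> = (\<Sum>j<K. if j < \<nu> r then 1 else 0)"
    by (simp add: sum_shift t_def)
   also have "\<dots> = card {j\<in>{..<K}. j < \<nu> r}" by (simp add: sum.inter_filter[symmetric])
   also have "{j\<in>{..<K}. j < \<nu> r} = {..<\<nu> r}" using nuK[of r] by auto
   finally show "cdeg ?M (t {}) r = \<nu> r" by simp
  qed
  \<comment> \<open>A unit moved from column s to an earlier column in an odd row meets a one that
    is already there, because \<nu> decreases.\<close>
  moreover have "F ?M r s f = 0" if rs: "r < s" "s < N" for r s
  proof (rule ccontr)
   assume "F ?M r s f \<noteq> 0"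
   then obtain a where "F ?M r s f a \<noteq> 0" by (auto simp: fun_eq_iff)
   then obtain i where i: "xx (i, r) (dd (i, s) f) a \<noteq> 0"
    unfolding F_def by (auto elim: sum.not_neutral_contains_not_neutral)
   then obtain c where c: "dd (i, s) f c \<noteq> 0" "a = c((i, r) := Suc (c (i, r)))" using xx_nz by blast
   hence tc: "t {} (i, s) \<noteq> 0" "c = (t {})((i, s) := t {} (i, s) - 1)"
    using dd_nz[OF c(1)] f0 by auto
   hence im: "m \<le> i" "i - m < \<nu> s" by (auto simp: t_def split: if_splits)
   hence "t {} (i, r) = 1" using anti[of r s] rs by (auto simp: t_def)
   hence "a (i, r) = 2" using c(2) tc(2) rs by auto
   thus False using i im by (simp add: xx_def)
  qed
  ultimately show ?thesis
   unfolding G_def using fB f0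
   by (intro exI[of _ f] exI[of _ "rdeg (t {})"]) (auto simp: supported_def)
 qed
 have step: "G (insert p Q)" if Q: "p \<notin> Q" "insert p Q \<subseteq> P" "finite Q" "G Q" for p Q
 proof -
  obtain i j where p: "p = (i, j)" by (cases p)
  have ij: "n \<le> j" "j < \<nu> i" using Q(2) by (auto simp: P_def p)
  have im: "i < m" and iN: "i < N" using num[OF ij(2,1)] nuN[OF ij(2)] by auto
  have jK: "j < K" using ij nuK[of i] by simp
  obtain f \<rho> where f: "f \<in> B ?M" "f (t Q) \<noteq> 0" "homog rdeg \<rho> f" "homog (cdeg ?M) \<nu> f"
   "\<And>r s. r < s ==> s < N ==> F ?M r s f = 0"
   using Q(4) unfolding G_def by blast
  let ?t = "t (insert p Q)"
  have fin: "finite {j. (i, j) \<in> Q}"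
  proof -
   have "{j. (i, j) \<in> Q} = snd ` (Q \<inter> {i} \<times> UNIV)" by force
   thus ?thesis using Q(3) by simp
  qed
  have "{j'. (i, j') \<in> insert p Q} = insert j {j. (i, j) \<in> Q}" by (auto simp: p)
  hence tii: "?t (i, i) = Suc (t Q (i, i))"
   using im Q(1) fin by (simp add: t_def p)
  have tji: "?t (m + j, i) = 0" by (simp add: t_def p)
  have tQ: "?t((i, i) := t Q (i, i), (m + j, i) := 1) = t Q"
  proof
   fix z :: "nat \<times> nat"
   obtain x y where z: "z = (x, y)" by (cases z)
   show "(?t((i, i) := t Q (i, i), (m + j, i) := 1)) z = t Q z"
    using im ij Q(1) by (auto simp: z t_def p)
  qed
  \<comment> \<open>Row i is even and occupied only on the diagonal, so one summand feeds the
    coefficient at the next monomial.\<close>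
  have "E i (m + j) f ?t = xx (i, i) (dd (m + j, i) f) ?t"
  proof -
   have "xx (i, r) (dd (m + j, r) f) ?t = 0" if "r \<noteq> i" for r
    using that im by (simp add: xx_def t_def)
   thus ?thesis unfolding E_def using iN by (simp add: sum.remove[of "{..<N}" i])
  qed
  also have "\<dots> = sg (i, i) ?t * (1 / sg (m + j, i) (?t((i, i) := t Q (i, i))) * f (t Q))"
   using im tii tji tQ by (simp add: xx_def dd_def)
  finally have nz: "E i (m + j) f ?t \<noteq> 0" using f(2) by simp
  have "F ?M r s (E i (m + j) f) = 0" if "r < s" "s < N" for r s
   using E_F_commute[OF f(1), of i "m + j" r s] f(5)[OF that] that im jK by (simp add: E_lin)
  thus ?thesis
   unfolding G_def using nz E_B[OF f(1)] homog_E[OF f(3)] homog_E_cdeg[OF _ _ f(4)] im jK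
   by (intro exI[of _ "E i (m + j) f"] exI[of _ "move i (m + j) \<rho>"]) auto
 qed
 have "Q \<subseteq> P \<longrightarrow> G Q" if "finite Q" for Q
  using that by (induction Q) (use \<open>G {}\<close> step in auto)
 hence "G P" using finP by blast
 then obtain f \<rho> where f: "f \<in> B ?M" "f (t P) \<noteq> 0" "homog rdeg \<rho> f" "homog (cdeg ?M) \<nu> f"
  "\<And>r s. r < s ==> s < N ==> F ?M r s f = 0"
  unfolding G_def by blast
 have rho: "rdeg a = \<rho>" if "f a \<noteq> 0" for a using f(3) that by (auto simp: supported_def)
 \<comment> \<open>The row degree is read off at \<open>t P\<close>, where the rows from m + n on
   are empty; by homogeneity they are empty in every monomial of f.\<close>
 have rho0: "\<rho> i = 0" if "m + n \<le> i" for i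
  unfolding rho[OF f(2), symmetric] rdeg_def
  by (rule sum.neutral) (use that in \<open>auto simp: t_def P_def\<close>)
 have a0: "a (i, r) = 0" if "f a \<noteq> 0" "m + n \<le> i" for a i r
 proof (cases "r < N")
  case True
  thus ?thesis using rdeg_ge[of r a i] rho[OF that(1)] rho0[OF that(2)] by simp
 next
  case False
  thus ?thesis using valid_box[OF B_valid[OF f(1) that(1)], of "(i, r)"] by auto
 qed
 have fB: "f \<in> B (m + n)"
 proof (rule BI)
  show "f \<in> FS" using f(1) by (rule B_FS)
  fix a assume a: "f a \<noteq> 0"
  have val: "valid ?M a" using B_valid[OF f(1) a] .
  show "valid (m + n) a"
  proof (rule validI)
   show "fst p < m + n \<and> snd p < N" if "a p \<noteq> 0" for p
    using that a0[OF a, of "fst p" "snd p"] valid_box[OF val that] by (cases "fst p < m + n") auto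
   show "a p \<le> 1" if "m \<le> fst p" for p using valid_odd[OF val that] .
  qed
 qed
 have "cdeg (m + n) a = cdeg ?M a" if "f a \<noteq> 0" for a
  unfolding cdeg_def using a0[OF that] by (intro ext sum.mono_neutral_left) (auto simp: K_def)
 hence "homog (cdeg (m + n)) \<nu> f" using f(4) by (auto simp: supported_def)
 moreover have "F (m + n) r s f = 0" if "r < s" "s < N" for r s
  using F_cong_rows[OF fB, of ?M r s] f(5)[OF that] by (simp add: K_def)
 moreover have "f \<noteq> 0" using f(2) by auto
 ultimately show ?thesis using fB f(3) by blast
qed

text \<open>The vectors of column weight \<nu> killed by the raising column operators form a space
  stable under row operators, as both kinds commute; minimising the height there makes the row
  condition hold as well.\<close>

lemma jhw_exists:
 assumes nu: "\<nu> \<in> hook_partitions m n N"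
 shows "\<exists>f \<mu>. jhw (m + n) \<mu> \<nu> f \<and> f \<noteq> 0"
proof -
 let ?M = "m + n"
 obtain f \<rho> where f: "f \<in> B ?M" "f \<noteq> 0" "homog rdeg \<rho> f" "homog (cdeg ?M) \<nu> f"
  "\<And>r s. r < s ==> s < N ==> F ?M r s f = 0"
  using column_highest_weight_vector_exists[OF nu] by blast
 define Y where "Y = {f \<in> B ?M. homog (cdeg ?M) \<nu> f \<and> (\<forall>r s. r < s \<longrightarrow> s < N \<longrightarrow> F ?M r s f = 0)}"
 have "\<exists>y \<mu> \<nu>. y \<in> Y \<and> y \<noteq> 0 \<and> jhw ?M \<mu> \<nu> y"
 proof (rule jhw_in_subspace[OF _ _ _ _ f(2,3,4)])
  show "Y \<subseteq> B ?M" by (auto simp: Y_def)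
  show "f \<in> Y" using f by (simp add: Y_def)
  show "E i j x \<in> Y" if "i < j" "j < ?M" "x \<in> Y" for i j x
   using that E_B[of x ?M i j] homog_E_cdeg[of i ?M j \<nu> x] E_F_commute[of x ?M i j, symmetric]
   by (simp add: Y_def E_lin)
  show "F ?M r s x \<in> Y" if "r < s" "s < N" "x \<in> Y" for r s x
   using that by (simp add: Y_def F_lin subsp_0)
 qed
 then obtain y \<mu> \<nu>' where y: "y \<in> Y" "y \<noteq> 0" "jhw ?M \<mu> \<nu>' y" by blast
 obtain a where "y a \<noteq> 0" using y(2) by (auto simp: fun_eq_iff)
 hence "\<nu>' = \<nu>" using jhwD(8)[OF y(3)] y(1) by (auto simp: Y_def supported_def)
 thus ?thesis using y by blast
qed

end


lemma subsp_preimage: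
 assumes "linop T" "subsp S"
 shows "subsp {x. T x \<in> S}"
 using assms(2) unfolding subsp_def
 by (simp add: linop_0[OF assms(1)] linop_add[OF assms(1)] linop_sc[OF assms(1)])

lemma subsp_Ball: "(\<And>i. i \<in> I ==> subsp (S i)) ==> subsp {x. \<forall>i\<in>I. x \<in> S i}"
 unfolding subsp_def by simp


section \<open>Submodules generated by joint highest weight vectors\<close>

locale howe = oscillator +
 fixes n :: nat
begin

abbreviation "M \<equiv> m + n"

abbreviation "P \<equiv> hook_partitions m n N"

definition fv :: "(nat => nat) => vec" where
 "fv \<nu> = (SOME f. \<exists>\<mu>. jhw M \<mu> \<nu> f \<and> f \<noteq> 0)"

lemma fv: "\<nu> \<in> P ==> \<exists>\<mu>. jhw M \<mu> \<nu> (fv \<nu>)" "\<nu> \<in> P ==> fv \<nu> \<noteq> 0"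
 using someI_ex[OF jhw_exists[of \<nu> n]] unfolding fv_def by blast+

definition Eops :: "(vec => vec) set" where
 "Eops = {E i j |i j. i < M \<and> j < M}"

definition Fops :: "(vec => vec) set" where
 "Fops = {F M r s |r s. r < N \<and> s < N}"

text \<open>Row operators, column operators and both together are treated at once, so that
  simplicity of all three kinds of modules has a single proof.\<close>

definition admissible :: "(vec => vec) set => bool" where
 "admissible O' \<longleftrightarrow> O' = Eops \<or> O' = Fops \<or> O' = Eops \<union> Fops"

lemma admissible_cases:
 assumes "admissible O'" "T \<in> O'"
 obtains i j where "T = E i j" "i < M" "j < M" "Eops \<subseteq> O'"
 | r s where "T = F M r s" "r < N" "s < N" "Fops \<subseteq> O'"
proof (cases "T \<in> Eops \<and> Eops \<subseteq> O'")
 case True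
 thus ?thesis using that unfolding Eops_def by blast
next
 case False
 hence "T \<in> Fops \<and> Fops \<subseteq> O'" using assms unfolding admissible_def by blast
 thus ?thesis using that unfolding Fops_def by blast
qed

lemma admissible_both [simp]: "admissible (Eops \<union> Fops)"
 and admissible_E [simp]: "admissible Eops" and admissible_F [simp]: "admissible Fops"
 by (auto simp: admissible_def)

lemma admissible_sub: "admissible O' ==> O' \<subseteq> Eops \<union> Fops"
 by (auto simp: admissible_def)

lemma E_Eops: "i < M ==> j < M ==> E i j \<in> Eops"
 and F_Fops: "r < N ==> s < N ==> F M r s \<in> Fops"
 unfolding Eops_def Fops_def by blast+

lemma ops_lin: "admissible O' ==> T \<in> O' ==> linop T"
 by (erule (1) admissible_cases) auto

lemma ops_B: "admissible O' ==> T \<in> O' ==> x \<in> B M ==> T x \<in> B M"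
 by (erule (1) admissible_cases) (simp_all add: E_B F_B)

lemma orb_B:
 assumes "admissible O'" "f \<in> B M"
 shows "orb O' f \<subseteq> B M"
 using assms(2) subsp_B ops_B[OF assms(1)] by (intro orb_least)

text \<open>All that is needed of the bracket below: exchanging two operators costs a scalar and
  terms with a single operator of the same family.\<close>

lemma ops_commutation:
 assumes "admissible O'" "T \<in> O'" "U \<in> O'" "x \<in> B M"
 shows "\<exists>c d1 T1 d2 T2. T1 \<in> O' \<and> T2 \<in> O' \<and> T (U x) = sc c (U (T x)) + sc d1 (T1 x) + sc d2 (T2 x)"
proof (rule admissible_cases[OF assms(1,2)])
 fix i j assume T: "T = E i j" "i < M" "j < M" "Eops \<subseteq> O'"
 show ?thesis
 proof (rule admissible_cases[OF assms(1,3)])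
  fix k l assume U: "U = E k l" "k < M" "l < M"
  let ?c = "om i k * om l i * om k j * om j l"
  have "E i j (E k l x) = sc ?c (E k l (E i j x)) + (if j = k then E i l x else 0)
    - sc ?c (if l = i then E k j x else 0)"
   using T U assms(4) by (intro E_E) auto
  hence "T (U x) = sc ?c (U (T x)) + sc (if j = k then 1 else 0) (E i l x)
    + sc (if l = i then - ?c else 0) (E k j x)"
   unfolding T(1) U(1) by (auto simp: fun_eq_iff)
  moreover have "E i l \<in> O'" "E k j \<in> O'" using T U E_Eops by blast+
  ultimately show ?thesis by blast
 next
  fix r s assume U: "U = F M r s" "r < N" "s < N"
  have "T (U x) = sc 1 (U (T x)) + sc 0 (T x) + sc 0 (T x)"
   unfolding T(1) U(1) using E_F_commute[OF assms(4)] T U by simp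
  thus ?thesis using assms(2) by blast
 qed
next
 fix r s assume T: "T = F M r s" "r < N" "s < N" "Fops \<subseteq> O'"
 show ?thesis
 proof (rule admissible_cases[OF assms(1,3)])
  fix k l assume U: "U = E k l" "k < M" "l < M"
  have "T (U x) = sc 1 (U (T x)) + sc 0 (T x) + sc 0 (T x)"
   unfolding T(1) U(1) using E_F_commute[OF assms(4)] T U by simp
  thus ?thesis using assms(2) by blast
 next
  fix t u assume U: "U = F M t u" "t < N" "u < N"
  have "F M r s (F M t u x) = F M t u (F M r s x) + (if s = t then F M r u x else 0)
   - (if u = r then F M t s x else 0)"
   using T U assms(4) by (intro F_F) auto
  hence "T (U x) = sc 1 (U (T x)) + sc (if s = t then 1 else 0) (F M r u x)
    + sc (if u = r then - 1 else 0) (F M t s x)"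
   unfolding T(1) U(1) by (auto simp: fun_eq_iff)
  moreover have "F M r u \<in> O'" "F M t s \<in> O'" using T U F_Fops by blast+
  ultimately show ?thesis by blast
 qed
qed

definition Low :: "(vec => vec) set" where
 "Low = {E i j |i j. j < i \<and> i < M} \<union> {F M r s |r s. s < r \<and> r < N}"

lemma jhw_eigen:
 assumes f: "jhw M \<mu> \<nu> f" and T: "T \<in> Eops \<union> Fops" "T \<notin> Low"
 shows "\<exists>c. T f = sc c f"
proof (rule admissible_cases[OF admissible_both T(1)])
 fix i j assume E: "T = E i j" "i < M" "j < M"
 hence "\<not> j < i" using T(2) unfolding Low_def by blast
 then consider "i = j" | "i < j" by linarith
 thus ?thesis
 proof cases
  case 1
  have "E i i f = sc (of_nat (\<mu> i)) f"
   using E_diag[OF jhwD(1)[OF f], of i] jhwD(7)[OF f] by (auto simp: fun_eq_iff)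
  thus ?thesis unfolding E using 1 by blast
 next
  case 2
  hence "T f = sc 0 f" using E jhwD(2)[OF f] by simp
  thus ?thesis by blast
 qed
next
 fix r s assume F: "T = F M r s" "r < N" "s < N"
 hence "\<not> s < r" using T(2) unfolding Low_def by blast
 then consider "r = s" | "r < s" by linarith
 thus ?thesis
 proof cases
  case 1
  have "F M r r f = sc (of_nat (\<nu> r)) f"
   using F_diag[OF jhwD(1)[OF f], of r] jhwD(8)[OF f] by (auto simp: fun_eq_iff)
  thus ?thesis unfolding F using 1 by blast
 next
  case 2
  hence "T f = sc 0 f" using F jhwD(3)[OF f] by simp
  thus ?thesis by blast
 qed
qed

text \<open>A substitute for the triangular decomposition. The x all of whose images under O' stay
  in the lowered orbit include f, whose images under the other operators are multiples of f. They
  are stable under a lowering U, because \<open>T (U x)\<close> is a combination of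
  \<open>U (T x)\<close> and of two vectors \<open>T1 x\<close>, \<open>T2 x\<close>.\<close>

lemma orb_lowering:
 assumes f: "jhw M \<mu> \<nu> f" and O': "admissible O'"
 shows "orb O' f = orb (O' \<inter> Low) f"
proof
 show "orb (O' \<inter> Low) f \<subseteq> orb O' f" by (rule orb_mono) blast
 let ?L = "orb (O' \<inter> Low) f"
 let ?S = "{x \<in> B M. \<forall>T\<in>O'. T x \<in> ?L}"
 have "?L \<subseteq> ?S"
 proof (rule orb_subset)
  have "T f \<in> ?L" if T: "T \<in> O'" for T
  proof (cases "T \<in> Low")
   case True
   hence "T \<in> O' \<inter> Low" using T by simp
   thus ?thesis by (rule orb_step[OF orb_base])
  next
   case False
   then obtain c where "T f = sc c f" using jhw_eigen[OF f] T admissible_sub[OF O'] by blast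
   thus ?thesis using subsp_sc[OF subsp_orb orb_base] by simp
  qed
  thus "f \<in> ?S" using jhwD(1)[OF f] by blast
  have "subsp {x. \<forall>T\<in>O'. x \<in> {x. T x \<in> ?L}}"
   by (intro subsp_Ball subsp_preimage ops_lin[OF O'] subsp_orb)
  from subsp_Int[OF subsp_B this] show "subsp ?S" by (simp add: Collect_conj_eq)
  fix x U assume x: "x \<in> ?S" "x \<in> ?L" and U: "U \<in> O' \<inter> Low"
  have "T (U x) \<in> ?L" if T: "T \<in> O'" for T
  proof -
   obtain c d1 T1 d2 T2 where *: "T1 \<in> O'" "T2 \<in> O'"
    "T (U x) = sc c (U (T x)) + sc d1 (T1 x) + sc d2 (T2 x)"
    using ops_commutation[OF O' T, of U x] U x by blast
   have "T x \<in> ?L" using x T by blast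
   hence "U (T x) \<in> ?L" by (rule orb_step[OF _ U])
   moreover have "T1 x \<in> ?L" "T2 x \<in> ?L" using x(1) *(1,2) by simp_all
   ultimately show ?thesis unfolding *(3) by (intro subsp_add subsp_sc subsp_orb)
  qed
  thus "U x \<in> ?S" using x U ops_B[OF O'] by blast
 qed
 thus "orb O' f \<subseteq> ?L"
  by (intro orb_least orb_base subsp_orb) blast
qed

lemma orb_graded_rdeg:
 assumes f: "jhw M \<mu> \<nu> f" and O': "admissible O'"
 shows "graded_by rdeg (orb O' f)" "graded_by (cdeg M) (orb O' f)"
proof -
 have FS: "T x \<in> FS" if "T \<in> O'" "x \<in> FS" for T x
 proof -
  have *: "xx p y \<in> FS" "dd p y \<in> FS" if "y \<in> FS" for p and y :: vec
  proof -
   have "{a. xx p y a \<noteq> 0} \<subseteq> (\<lambda>b. b(p := Suc (b p))) ` {a. y a \<noteq> 0}" using xx_nz[of p y] by blast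
   moreover have "{a. dd p y a \<noteq> 0} \<subseteq> (\<lambda>b. b(p := b p - 1)) ` {a. y a \<noteq> 0}" using dd_nz[of p y] by blast
   ultimately show "xx p y \<in> FS" "dd p y \<in> FS"
    using that finite_surj unfolding FS_def by blast+
  qed
  show ?thesis
   by (rule admissible_cases[OF O' that(1)])
     (use that(2) * in \<open>auto simp: E_def F_def intro!: subsp_sum[OF subsp_FS]\<close>)
 qed
 have "hop rdeg T" "hop (cdeg M) T" if "T \<in> O'" for T
  by (rule admissible_cases[OF O' that]; simp add: hop_E hop_F hop_E_cdeg hop_F_cdeg)+
 note hop = this
 show "graded_by rdeg (orb O' f)"
  by (rule orb_graded[of rdeg \<mu> f O'])
    (simp_all add: jhwD(4)[OF f] B_FS[OF jhwD(1)[OF f]] ops_lin[OF O'] hop FS)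
 show "graded_by (cdeg M) (orb O' f)"
  by (rule orb_graded[of "cdeg M" \<nu> f O'])
    (simp_all add: jhwD(5)[OF f] B_FS[OF jhwD(1)[OF f]] ops_lin[OF O'] hop FS)
qed

text \<open>Each family contains with an operator the transposed one, its adjoint up to nonzero
  factors on homogeneous vectors.\<close>

lemma perp_closed:
 assumes O': "admissible O'" and S: "S \<subseteq> B M" "graded_by rdeg S"
  and cl: "\<And>T x. T \<in> O' ==> x \<in> S ==> T x \<in> S" and T: "T \<in> O'" and y: "y \<in> perp M S"
 shows "T y \<in> perp M S"
proof (rule admissible_cases[OF O' T])
 fix i j assume T: "T = E i j" "i < M" "j < M" "Eops \<subseteq> O'"
 have "E j i \<in> O'" using T E_Eops by blast
 thus "T y \<in> perp M S"
  unfolding T(1) using perp_E[OF S _ y T(2), of j] cl by blast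
next
 fix r s assume T: "T = F M r s" "r < N" "s < N" "Fops \<subseteq> O'"
 have "F M s r \<in> O'" using T F_Fops by blast
 thus "T y \<in> perp M S"
  unfolding T(1) using perp_F[OF S(1) _ y T(2), of s] cl by blast
qed

lemma perp_inter: "S \<subseteq> B M ==> y \<in> S ==> y \<in> perp M S ==> y = 0"
 using ip_definite[OF B_FS] by (auto simp: perp_def)

text \<open>Project inside the finite-dimensional component of row degree \<rho>; orthogonality to
  the other components is automatic, as their supports are disjoint.\<close>

lemma graded_projection:
 assumes S: "S \<subseteq> B M" "subsp S" "graded_by rdeg S" and h: "h \<in> B M" "homog rdeg \<rho> h"
 shows "\<exists>s\<in>S. homog rdeg \<rho> s \<and> h - s \<in> perp M S"
proof -
 let ?K = "{a. valid M a \<and> rdeg a = \<rho>}"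
 let ?S = "S \<inter> {f. supported ?K f}"
 have "supported ?K h" using h B_valid[OF h(1)] by (auto simp: supported_def)
 moreover have "subsp ?S" by (rule subsp_Int[OF S(2) subsp_supported])
 ultimately have "\<exists>s\<in>?S. \<forall>x\<in>?S. ip x (h - s) = 0"
  by (intro orthogonal_projection[OF finite_rdeg[of M \<rho>]]) simp_all
 then obtain s where s: "s \<in> ?S" "\<forall>x\<in>?S. ip x (h - s) = 0" by blast
 have sh: "homog rdeg \<rho> s" using s(1) by (auto simp: supported_def)
 have hs: "homog rdeg \<rho> (h - s)"
  using subsp_diff[OF subsp_supported, of h "{a. rdeg a = \<rho>}" s] h(2) sh by simp
 have "ip x (h - s) = 0" if x: "x \<in> S" for x
 proof -
  have "prj rdeg \<rho> x \<in> S" using S(3) x by (auto simp: graded_by_def)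
  moreover have "supported ?K (prj rdeg \<rho> x)"
   using S(1) x B_valid[of x M] by (auto simp: supported_def prj_def split: if_splits)
  ultimately have "ip (prj rdeg \<rho> x) (h - s) = 0" using s(2) by blast
  thus ?thesis using hs by (simp add: ip_prj prj_homog)
 qed
 moreover have "h - s \<in> B M" using subsp_diff[OF subsp_B h(1)] s(1) S(1) by blast
 ultimately have "h - s \<in> perp M S" by (simp add: perp_def)
 thus ?thesis using s(1) sh by blast
qed

text \<open>G belongs to the other family and commutes with O', so its eigenvalue equation spreads
  from f to everything generated from f.\<close>

lemma orb_eigen:
 assumes O': "O' = Eops \<and> G \<in> Fops \<or> O' = Fops \<and> G \<in> Eops" and f: "f \<in> B M" "G f = sc c f"
  and x: "x \<in> orb O' f"
 shows "G x = sc c x"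
proof -
 have lG: "linop G" using O' ops_lin[of "Eops \<union> Fops" G] by auto
 let ?S = "{x \<in> B M. G x = sc c x}"
 have "orb O' f \<subseteq> ?S"
 proof (rule orb_least)
  show "f \<in> ?S" using f by simp
  show "subsp ?S" unfolding subsp_def using lG
   by (auto simp: linop_0 linop_add linop_sc subsp_0 subsp_add subsp_sc sc_add mult.commute)
  fix x T assume x: "x \<in> ?S" and T: "T \<in> O'"
  have "admissible O'" using O' by auto
  hence TB: "T x \<in> B M" and lT: "linop T" using x T ops_B ops_lin by blast+
  have comm: "U (V x) = V (U x)" if UV: "U \<in> Eops" "V \<in> Fops" for U V
  proof -
   obtain i j where U: "U = E i j" "i < M" "j < M" using UV(1) unfolding Eops_def by blast
   obtain r s where V: "V = F M r s" "r < N" "s < N" using UV(2) unfolding Fops_def by blast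
   show ?thesis unfolding U(1) V(1) using E_F_commute[of x M i j r s] x U V by blast
  qed
  have "G (T x) = T (G x)"
   using O' comm[of T G] comm[of G T] T by auto
  also have "\<dots> = sc c (T x)" using x linop_sc[OF lT] by simp
  finally show "T x \<in> ?S" using TB by blast
 qed
 thus ?thesis using x by blast
qed

text \<open>Split f into s in T and f - s in the complement. Whenever G f = c f, the vectors
  \<open>G s - sc c s\<close> and \<open>G (f - s) - sc c (f - s)\<close> lie in T and in the
  complement and add up to zero, so both vanish. Thus s satisfies all highest weight equations of f,
  and by uniqueness either s = 0 or f is a multiple of s.\<close>

lemma orb_simple:
 assumes f: "jhw M \<mu> \<nu> f" "f \<noteq> 0" and O': "admissible O'"
  and T: "T \<subseteq> orb O' f" "subsp T" "graded_by rdeg T" "\<And>U x. U \<in> O' ==> x \<in> T ==> U x \<in> T"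
  and ne: "T \<noteq> {0}"
 shows "T = orb O' f"
proof -
 have fB: "f \<in> B M" using jhwD(1)[OF f(1)] .
 have TB: "T \<subseteq> B M" using T(1) orb_B[OF O' fB] by blast
 obtain s where s: "s \<in> T" "homog rdeg \<mu> s" "f - s \<in> perp M T"
  using graded_projection[OF TB T(2,3) fB jhwD(4)[OF f(1)]] by blast
 have sB: "s \<in> B M" using s TB by blast
 have clp: "U x \<in> perp M T" if "U \<in> O'" "x \<in> perp M T" for U x
  using O' TB T(3,4) that by (intro perp_closed[of O' T U x])
 have eigen: "G s = sc c s" if G: "G \<in> Eops \<union> Fops" "G f = sc c f" for G c
 proof (cases "G \<in> O'")
  case True
  have lG: "linop G" using True ops_lin O' by blast
  have 1: "G s - sc c s \<in> T" using T(4)[OF True s(1)] s(1) T(2) by (intro subsp_diff subsp_sc)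
  have sub: "subsp (perp M T)" using TB by (rule subsp_perp)
  have "G (f - s) - sc c (f - s) \<in> perp M T"
   by (rule subsp_diff[OF sub clp[OF True s(3)] subsp_sc[OF sub s(3)]])
  moreover have "G (f - s) - sc c (f - s) = sc (-1) (G s - sc c s)"
   using G(2) by (simp add: linop_diff[OF lG] sc_diff fun_eq_iff)
  ultimately have "sc (-1) (sc (-1) (G s - sc c s)) \<in> perp M T"
   using subsp_sc[OF sub] by metis
  hence "G s - sc c s \<in> perp M T" by simp
  hence "G s - sc c s = 0" using perp_inter[OF TB 1] by blast
  thus ?thesis by simp
 next
  case False
  hence "O' = Eops \<and> G \<in> Fops \<or> O' = Fops \<and> G \<in> Eops"
   using O' G(1) by (auto simp: admissible_def)
  moreover have "s \<in> orb O' f" using s(1) T(1) by blast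
  ultimately show ?thesis using orb_eigen[of O' G f c s] fB G(2) by simp
 qed
 have "E i j s = 0" if "i < j" "j < M" for i j
  using eigen[of "E i j" 0] jhwD(2)[OF f(1) that] E_Eops[of i j] that by auto
 moreover have "F M r q s = 0" if "r < q" "q < N" for r q
  using eigen[of "F M r q" 0] jhwD(3)[OF f(1) that] F_Fops[of r q] that by auto
 moreover have "homog (cdeg M) \<nu> s"
 proof -
  have "cdeg M a = \<nu>" if a: "s a \<noteq> 0" for a
  proof
   fix r
   show "cdeg M a r = \<nu> r"
   proof (cases "r < N")
    case True
    have "F M r r f = sc (of_nat (\<nu> r)) f"
     using F_diag[OF fB, of r] jhwD(8)[OF f(1)] by (auto simp: fun_eq_iff)
    hence "F M r r s = sc (of_nat (\<nu> r)) s" using F_Fops True by (intro eigen) auto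
    hence "F M r r s a = of_nat (\<nu> r) * s a" by simp
    thus ?thesis using a by (simp add: F_diag[OF sB])
   next
    case False
    have *: "cdeg M b r = 0" if "valid M b" for b
     unfolding cdeg_def using valid_box[OF that] False by (intro sum.neutral) fastforce
    obtain b where "f b \<noteq> 0" using f(2) by (auto simp: fun_eq_iff)
    thus ?thesis using *[OF B_valid[OF sB a]] *[OF jhwD(6)[OF f(1)]] jhwD(8)[OF f(1)] by metis
   qed
  qed
  thus ?thesis by (auto simp: supported_def)
 qed
 ultimately have js: "jhw M \<mu> \<nu> s" using sB s(2) by (simp add: jhw_def)
 show ?thesis
 proof (cases "s = 0")
  case True
  hence "f \<in> perp M T" using s(3) by simp
  hence "orb O' f \<subseteq> perp M T"
   using subsp_perp[OF TB] clp by (intro orb_least)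
  hence "T \<subseteq> {0}" using perp_inter[OF TB] T(1) by blast
  thus ?thesis using ne subsp_0[OF T(2)] by blast
 next
  case False
  then obtain c where c: "f = sc c s" using jhw_unique[OF js f(1)] f(2) by blast
  hence "f \<in> T" using subsp_sc[OF T(2) s(1)] by simp
  hence "orb O' f \<subseteq> T" using T(2,4) by (intro orb_least)
  thus ?thesis using T(1) by blast
 qed
qed

definition AA :: "(nat => nat) => vec set" where
 "AA \<nu> = orb (Eops \<union> Fops) (fv \<nu>)"

lemma AA_B: "\<nu> \<in> P ==> AA \<nu> \<subseteq> B M"
 unfolding AA_def using fv(1) jhwD(1) by (blast intro: orb_B[OF admissible_both, THEN subsetD])

lemma subsp_AA [simp]: "subsp (AA \<nu>)"
 by (simp add: AA_def)

lemma AA_closed: "T \<in> Eops \<union> Fops ==> x \<in> AA \<nu> ==> T x \<in> AA \<nu>"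
 unfolding AA_def by (rule orb_step)

lemma AA_graded: "\<nu> \<in> P ==> graded_by rdeg (AA \<nu>)" "\<nu> \<in> P ==> graded_by (cdeg M) (AA \<nu>)"
 unfolding AA_def using fv(1) orb_graded_rdeg[OF _ admissible_both] by blast+

text \<open>The two generators have disjoint supports by their column weights. Lowering the first
  keeps it orthogonal to \<open>fv \<kappa>\<close>, because the adjoint raises and kills
  \<open>fv \<kappa>\<close>. So \<open>fv \<kappa>\<close>, and with it everything it generates,
  lies in the stable complement.\<close>

lemma AA_perp:
 assumes "\<nu> \<in> P" "\<kappa> \<in> P" "\<nu> \<noteq> \<kappa>"
 shows "AA \<kappa> \<subseteq> perp M (AA \<nu>)"
proof -
 obtain \<mu> where f: "jhw M \<mu> \<nu> (fv \<nu>)" using fv assms by blast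
 obtain \<mu>' where g: "jhw M \<mu>' \<kappa> (fv \<kappa>)" using fv assms by blast
 let ?S = "{x \<in> B M. ip x (fv \<kappa>) = 0}"
 have gFS: "fv \<kappa> \<in> FS" using B_FS[OF jhwD(1)[OF g]] .
 have "orb ((Eops \<union> Fops) \<inter> Low) (fv \<nu>) \<subseteq> ?S"
 proof (rule orb_least)
  have "ip (fv \<nu>) (fv \<kappa>) = 0"
   unfolding ip_def using jhwD(8)[OF f] jhwD(8)[OF g] assms(3) by (intro sum.neutral) auto
  thus "fv \<nu> \<in> ?S" using jhwD(1)[OF f] by blast
  show "subsp ?S" unfolding subsp_def
   by (auto simp: ip_add_left[OF gFS] ip_sc_left[OF gFS] subsp_0 subsp_add subsp_sc)
  fix x T assume x: "x \<in> ?S" and T: "T \<in> (Eops \<union> Fops) \<inter> Low"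
  hence TB: "T x \<in> B M" using ops_B[OF admissible_both] by blast
  have "T \<in> Low" using T by blast
  then consider i j where "T = E i j" "j < i" "i < M" | r s where "T = F M r s" "s < r" "r < N"
   unfolding Low_def by blast
  hence "ip (T x) (fv \<kappa>) = 0"
  proof cases
   case 1
   obtain c where "ip (E i j x) (fv \<kappa>) = c * ip x (E j i (fv \<kappa>))"
    using E_adjoint[OF _ jhwD(1,4)[OF g], of x i j] x by blast
   thus ?thesis using 1 jhwD(2)[OF g, of j i] by simp
  next
   case 2
   thus ?thesis using F_adjoint[OF _ jhwD(1)[OF g], of x r s] x jhwD(3)[OF g, of s r] by simp
  qed
  thus "T x \<in> ?S" using TB by blast
 qed
 hence "AA \<nu> \<subseteq> ?S" unfolding AA_def using orb_lowering[OF f admissible_both] by simp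
 hence gp: "fv \<kappa> \<in> perp M (AA \<nu>)" using jhwD(1)[OF g] by (auto simp: perp_def)
 have B: "AA \<nu> \<subseteq> B M" using AA_B assms by blast
 have cl: "T x \<in> perp M (AA \<nu>)" if "x \<in> perp M (AA \<nu>)" "T \<in> Eops \<union> Fops" for x T
  using perp_closed[OF admissible_both B AA_graded(1)[OF assms(1)] _ that(2,1)] AA_closed by blast
 show ?thesis unfolding AA_def[of \<kappa>] using gp subsp_perp[OF B] cl by (intro orb_least)
qed

text \<open>The sum of all \<open>AA\<close>. The family g is total and vanishes off the finite
  index set, so two representations can be added termwise.\<close>

definition TT :: "vec set" where
 "TT = {h. \<exists>g I. finite I \<and> I \<subseteq> P \<and> (\<forall>\<nu>. g \<nu> \<in> AA \<nu> \<and> (\<nu> \<notin> I \<longrightarrow> g \<nu> = 0)) \<and> h = (\<Sum>\<nu>\<in>I. g \<nu>)}"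

lemma TT_linop:
 assumes "h \<in> TT" "linop T" "\<And>\<nu> x. \<nu> \<in> P ==> x \<in> AA \<nu> ==> T x \<in> AA \<nu>"
 shows "T h \<in> TT"
proof -
 obtain g I where g: "finite I" "I \<subseteq> P" "\<And>\<nu>. g \<nu> \<in> AA \<nu>" "\<And>\<nu>. \<nu> \<notin> I ==> g \<nu> = 0" "h = (\<Sum>\<nu>\<in>I. g \<nu>)"
  using assms(1) unfolding TT_def by blast
 have "T (g \<nu>) \<in> AA \<nu>" for \<nu>
 proof (cases "\<nu> \<in> I")
  case True
  thus ?thesis using assms(3) g by blast
 next
  case False
  thus ?thesis using g(4) linop_0[OF assms(2)] subsp_0[OF subsp_AA] by simp
 qed
 moreover have "T (g \<nu>) = 0" if "\<nu> \<notin> I" for \<nu> using g(4)[OF that] linop_0[OF assms(2)] by simp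
 moreover have "T h = (\<Sum>\<nu>\<in>I. T (g \<nu>))" unfolding g(5) by (rule linop_sum[OF assms(2)])
 ultimately show ?thesis
  unfolding TT_def using g(1,2) by (intro CollectI exI[of _ "\<lambda>\<nu>. T (g \<nu>)"] exI[of _ I]) blast
qed

lemma AA_TT: "\<nu> \<in> P ==> x \<in> AA \<nu> ==> x \<in> TT"
 unfolding TT_def
 by (intro CollectI exI[of _ "\<lambda>\<kappa>. if \<kappa> = \<nu> then x else 0"] exI[of _ "{\<nu>}"])
   (auto simp: subsp_0)

lemma subsp_TT: "subsp TT"
proof -
 have "0 \<in> TT"
  unfolding TT_def by (intro CollectI exI[of _ "\<lambda>_. 0"] exI[of _ "{}"]) (auto simp: subsp_0)
 moreover have "h + h' \<in> TT" if h: "h \<in> TT" and h': "h' \<in> TT" for h h'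
 proof -
  obtain g I where g: "finite I" "I \<subseteq> P" "\<And>\<nu>. g \<nu> \<in> AA \<nu>" "\<And>\<nu>. \<nu> \<notin> I ==> g \<nu> = 0" "h = (\<Sum>\<nu>\<in>I. g \<nu>)"
   using h unfolding TT_def by blast
  obtain g' I' where g': "finite I'" "I' \<subseteq> P" "\<And>\<nu>. g' \<nu> \<in> AA \<nu>" "\<And>\<nu>. \<nu> \<notin> I' ==> g' \<nu> = 0" "h' = (\<Sum>\<nu>\<in>I'. g' \<nu>)"
   using h' unfolding TT_def by blast
  have "h = (\<Sum>\<nu>\<in>I \<union> I'. g \<nu>)" unfolding g(5) by (rule sum.mono_neutral_left) (use g g' in auto)
  moreover have "h' = (\<Sum>\<nu>\<in>I \<union> I'. g' \<nu>)" unfolding g'(5) by (rule sum.mono_neutral_left) (use g g' in auto)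
  ultimately have "h + h' = (\<Sum>\<nu>\<in>I \<union> I'. g \<nu> + g' \<nu>)" by (simp add: sum.distrib)
  moreover have "g \<nu> + g' \<nu> \<in> AA \<nu>" for \<nu> using g(3) g'(3) by (intro subsp_add subsp_AA)
  moreover have "g \<nu> + g' \<nu> = 0" if "\<nu> \<notin> I \<union> I'" for \<nu> using g(4) g'(4) that by simp
  moreover have "finite (I \<union> I')" "I \<union> I' \<subseteq> P" using g g' by auto
  ultimately show ?thesis
   unfolding TT_def by (intro CollectI exI[of _ "\<lambda>\<nu>. g \<nu> + g' \<nu>"] exI[of _ "I \<union> I'"]) blast
 qed
 moreover have "sc c h \<in> TT" if "h \<in> TT" for c h
 proof (rule TT_linop[OF that])
  show "linop (sc c :: vec => vec)" by (auto simp: linop_def fun_eq_iff algebra_simps)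
  show "sc c x \<in> AA \<nu>" if "x \<in> AA \<nu>" for \<nu> x using that by (rule subsp_sc[OF subsp_AA])
 qed
 ultimately show ?thesis unfolding subsp_def by blast
qed

lemma TT_B: "TT \<subseteq> B M"
proof
 fix h assume "h \<in> TT"
 then obtain g I where g: "finite I" "I \<subseteq> P" "\<And>\<nu>. g \<nu> \<in> AA \<nu>" "h = (\<Sum>\<nu>\<in>I. g \<nu>)"
  unfolding TT_def by blast
 show "h \<in> B M" unfolding g(4) using AA_B g by (intro subsp_sum) auto
qed

text \<open>The complement of \<open>TT\<close> is stable and bigraded. If it were nonzero it would
  contain a joint highest weight vector, which by uniqueness is a multiple of some
  \<open>fv \<nu>\<close> and hence orthogonal to itself.\<close>

theorem TT_eq_B: "TT = B M"
proof
 show "TT \<subseteq> B M" by (rule TT_B)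
 have gr: "graded_by rdeg TT" "graded_by (cdeg M) TT"
 proof -
  have "prj rdeg d h \<in> TT" if "h \<in> TT" for d h
   using AA_graded(1) by (intro TT_linop[OF that linop_prj]) (simp add: graded_by_def)
  thus "graded_by rdeg TT" by (simp add: graded_by_def)
  have "prj (cdeg M) d h \<in> TT" if "h \<in> TT" for d h
   using AA_graded(2) by (intro TT_linop[OF that linop_prj]) (simp add: graded_by_def)
  thus "graded_by (cdeg M) TT" by (simp add: graded_by_def)
 qed
 have cl: "T x \<in> TT" if T: "T \<in> Eops \<union> Fops" and x: "x \<in> TT" for T x
  by (rule TT_linop[OF x ops_lin[OF admissible_both T]]) (rule AA_closed[OF T])
 have clp: "T x \<in> perp M TT" if "T \<in> Eops \<union> Fops" "x \<in> perp M TT" for T x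
  using admissible_both TT_B gr(1) cl that by (intro perp_closed[of "Eops \<union> Fops" TT T x])
 have hom: "h \<in> TT" if h: "h \<in> B M" "homog rdeg \<rho> h" for h \<rho>
 proof -
  obtain s where s: "s \<in> TT" "homog rdeg \<rho> s" "h - s \<in> perp M TT"
   using graded_projection[OF TT_B subsp_TT gr(1) h] by blast
  have "h - s = 0"
  proof (rule ccontr)
   assume nz: "h - s \<noteq> 0"
   then obtain a where a: "(h - s) a \<noteq> 0" by (auto simp: fun_eq_iff)
   \<comment> \<open>Already homogeneous by rows; projecting to one column degree as well gives the
     starting vector for \<open>jhw_in_subspace\<close>.\<close>
   define y where "y = prj (cdeg M) (cdeg M a) (h - s)"
   have "y a \<noteq> 0" using a by (simp add: y_def prj_def)
   hence ynz: "y \<noteq> 0" by auto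
   have yp: "y \<in> perp M TT" using perp_graded[OF gr(2), of M] s(3) by (simp add: y_def graded_by_def)
   have "homog rdeg \<rho> (h - s)"
    using subsp_diff[OF subsp_supported, of h "{a. rdeg a = \<rho>}" s] h(2) s(2) by simp
   hence yr: "homog rdeg \<rho> y" by (auto simp: y_def supported_def prj_def)
   have yc: "homog (cdeg M) (cdeg M a) y" by (simp add: y_def)
   have "\<exists>z \<mu> \<nu>. z \<in> perp M TT \<and> z \<noteq> 0 \<and> jhw M \<mu> \<nu> z"
   proof (rule jhw_in_subspace[OF _ _ _ yp ynz yr yc])
    show "perp M TT \<subseteq> B M" by (auto simp: perp_def)
    show "E i j x \<in> perp M TT" if "i < j" "j < M" "x \<in> perp M TT" for i j x
     using clp[of "E i j" x] E_Eops[of i j] that by simp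
    show "F M r s x \<in> perp M TT" if "r < s" "s < N" "x \<in> perp M TT" for r s x
     using clp[of "F M r s" x] F_Fops[of r s] that by simp
   qed
   then obtain z \<mu> \<nu> where z: "z \<in> perp M TT" "z \<noteq> 0" "jhw M \<mu> \<nu> z" by blast
   have nu: "\<nu> \<in> P" using jhw_partition(1)[OF z(3,2)] .
   then obtain \<mu>' where "jhw M \<mu>' \<nu> (fv \<nu>)" "fv \<nu> \<noteq> 0" using fv by blast
   then obtain c where "z = sc c (fv \<nu>)" using jhw_unique z by blast
   hence "z \<in> AA \<nu>" unfolding AA_def using subsp_sc[OF subsp_orb orb_base] by simp
   hence "z \<in> TT" using AA_TT nu by blast
   thus False using perp_inter[OF TT_B _ z(1)] z(2) by blast
  qed
  hence "h = s" by simp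
  thus ?thesis using s(1) by simp
 qed
 show "B M \<subseteq> TT"
 proof
  fix h assume h: "h \<in> B M"
  have "(\<Sum>d\<in>rdeg ` {a. h a \<noteq> 0}. prj rdeg d h) \<in> TT"
   using hom[OF prj_B[OF h] homog_prj] by (intro subsp_sum subsp_TT)
  thus "h \<in> TT" using sum_prj_FS[OF B_FS[OF h], of rdeg] by simp
 qed
qed

end

section \<open>Presented algebras and their representations\<close>

definition lext :: "('k => 'a => complex) => ('k \<Rightarrow>\<^sub>0 complex) => 'a => complex" where
 "lext h f = (\<Sum>k\<in>keys f. sc (lookup f k) (h k))"

lemma lext_superset:
 "finite K ==> keys f \<subseteq> K ==> lext h f = (\<Sum>k\<in>K. sc (lookup f k) (h k))"
 unfolding lext_def by (rule sum.mono_neutral_left) (auto simp: in_keys_iff)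

lemma lext_0 [simp]: "lext h 0 = 0"
 by (simp add: lext_def)

lemma lext_single [simp]: "lext h (single k c) = sc c (h k)"
 by (simp add: lext_def)

lemma lext_add: "lext h (f + g) = lext h f + lext h g"
proof -
 let ?K = "keys f \<union> keys g"
 have "lext h (f + g) = (\<Sum>k\<in>?K. sc (lookup (f + g) k) (h k))"
  by (rule lext_superset) (use keys_add[of f g] in auto)
 also have "\<dots> = (\<Sum>k\<in>?K. sc (lookup f k) (h k)) + (\<Sum>k\<in>?K. sc (lookup g k) (h k))"
  by (simp add: lookup_add sc_add sum.distrib)
 also have "\<dots> = lext h f + lext h g"
  by (subst (1 2) lext_superset[of ?K]) auto
 finally show ?thesis .
qed

abbreviation pscale :: "complex => ('k \<Rightarrow>\<^sub>0 complex) => 'k \<Rightarrow>\<^sub>0 complex" where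
 "pscale c \<equiv> Poly_Mapping.map ((*) c)"

lemma lookup_pscale [simp]: "lookup (pscale c f) k = c * lookup f k"
 by transfer (auto simp: when_def)

lemma keys_pscale: "keys (pscale c f) \<subseteq> keys f"
 by (auto simp: in_keys_iff)

lemma lext_pscale: "lext h (pscale c f) = sc c (lext h f)"
 by (subst lext_superset[of "keys f"]) (simp_all add: keys_pscale lext_def sc_sum)

lemma lext_uminus: "lext h (- f) = - lext h f"
 by (metis add.inverse_unique add.right_inverse lext_0 lext_add)

lemma lext_diff: "lext h (f - g) = lext h f - lext h g"
 using lext_add[of h f "- g"] by (simp add: lext_uminus)

lemma lext_sum: "lext h (\<Sum>i\<in>A. f i) = (\<Sum>i\<in>A. lext h (f i))"
proof
 show "lext h (\<Sum>i\<in>A. f i) a = (\<Sum>i\<in>A. lext h (f i)) a" for a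
  by (induction A rule: infinite_finite_induct) (simp_all add: lext_add)
qed

lemma lext_cong: "(\<And>k. k \<in> keys f ==> h k = h' k) ==> lext h f = lext h' f"
 unfolding lext_def by (rule sum.cong) auto

lemma lext_in: "subsp S ==> (\<And>k. k \<in> keys f ==> h k \<in> S) ==> lext h f \<in> S"
 unfolding lext_def by (intro subsp_sum subsp_sc) auto

lemma lext_linop:
 assumes "linop T"
 shows "T (lext h f) = lext (\<lambda>k. T (h k)) f"
 unfolding lext_def linop_sum[OF assms] linop_sc[OF assms] ..

lemma linop_lext: "(\<And>k. k \<in> keys f ==> linop (T k)) ==> linop (\<lambda>v. lext (\<lambda>k. T k v) f)"
 unfolding linop_def lext_def by (simp add: sc_add sum.distrib sc_sum mult.commute)

lemma poly_mapping_expand: "f = (\<Sum>k\<in>keys f. single k (lookup f k))"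
 by (rule poly_mapping_eqI) (auto simp: lookup_sum lookup_single when_def in_keys_iff)

text \<open>The action of the free algebra in which a word acts as the composition of its
  letters.\<close>

definition ev :: "('g => 'a fn => 'a => complex) => 'g free => 'a fn => 'a => complex" where
 "ev \<rho> f v = lext (\<lambda>w. foldr \<rho> w v) f"

lemma ev_0 [simp]: "ev \<rho> 0 v = 0"
 and ev_add: "ev \<rho> (f + g) v = ev \<rho> f v + ev \<rho> g v"
 and ev_diff: "ev \<rho> (f - g) v = ev \<rho> f v - ev \<rho> g v"
 and ev_sum: "ev \<rho> (\<Sum>i\<in>A. h i) v = (\<Sum>i\<in>A. ev \<rho> (h i) v)"
 and ev_single: "ev \<rho> (single w c) v = sc c (foldr \<rho> w v)"
 and ev_gen [simp]: "ev \<rho> (gen x) v = \<rho> x v"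
 by (simp_all add: ev_def lext_add lext_diff lext_sum gen_def)

lemma one_free: "(1 :: 'g free) = single [] 1"
 by (metis single_one zero_list_def)

lemma ev_one [simp]: "ev \<rho> 1 v = v"
 by (simp add: one_free ev_single)

lemma linop_foldr: "(\<And>x. linop (\<rho> x)) ==> linop (foldr \<rho> w)"
proof (induction w)
 case Nil
 thus ?case by (simp add: linop_def)
next
 case (Cons x w)
 have "linop (\<lambda>v. \<rho> x (foldr \<rho> w v))" by (rule linop_comp[OF Cons.prems Cons.IH[OF Cons.prems]])
 thus ?case by (simp add: comp_def)
qed

lemma linop_ev: "(\<And>x. linop (\<rho> x)) ==> linop (ev \<rho> f)"
 unfolding ev_def[abs_def] by (rule linop_lext) (rule linop_foldr)

lemma single_mult_free: "single w c * single w' d = single (w @ w') (c * d)"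
 by (simp add: mult_single plus_list_def)

lemma ev_mult:
 assumes lin: "\<And>x. linop (\<rho> x)"
 shows "ev \<rho> (f * g) v = ev \<rho> f (ev \<rho> g v)"
proof -
 have "ev \<rho> (f * g) v = ev \<rho> ((\<Sum>w\<in>keys f. single w (lookup f w)) *
   (\<Sum>w\<in>keys g. single w (lookup g w))) v"
  using poly_mapping_expand[of f] poly_mapping_expand[of g] by metis
 also have "\<dots> = (\<Sum>w\<in>keys f. \<Sum>w'\<in>keys g.
   sc (lookup f w * lookup g w') (foldr \<rho> w (foldr \<rho> w' v)))"
  by (simp only: sum_product single_mult_free ev_sum ev_single foldr_append comp_apply)
 also have "\<dots> = (\<Sum>w\<in>keys f. sc (lookup f w) (foldr \<rho> w (ev \<rho> g v)))"
  unfolding ev_def lext_def linop_sum[OF linop_foldr[OF lin]] linop_sc[OF linop_foldr[OF lin]] sc_sum sc_simps ..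
 also have "\<dots> = ev \<rho> f (ev \<rho> g v)" by (simp add: ev_def lext_def)
 finally show ?thesis .
qed

lemma ev_scal: "ev \<rho> (scal c * f) v = sc c (ev \<rho> f v)"
proof -
 have "scal c * f = pscale c f"
  by (simp add: scal_def mult_map_scale_conv_mult zero_list_def)
 thus ?thesis by (simp add: ev_def lext_pscale)
qed

lemma ev_scal_alone: "ev \<rho> (scal c) v = sc c v"
 using ev_scal[of \<rho> c 1 v] by simp

lemma ev_in:
 assumes "subsp S" "\<And>x v. x \<in> G ==> v \<in> S ==> \<rho> x v \<in> S" "keys f \<subseteq> lists G" "v \<in> S"
 shows "ev \<rho> f v \<in> S"
proof -
 have "foldr \<rho> w v \<in> S" if "w \<in> lists G" for w
  using that
 proof (induction w)
  case (Cons x w)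
  thus ?case using assms(2)[of x "foldr \<rho> w v"] by simp
 qed (use assms(4) in simp)
 thus ?thesis unfolding ev_def using assms(1,3) by (intro lext_in) auto
qed

lemma carrier_free_algebra [simp]: "f \<in> carrier (free_algebra G) \<longleftrightarrow> keys f \<subseteq> lists G"
 by (simp add: free_algebra_def)

lemma free_algebra_simps [simp]:
 "monoid.mult (free_algebra G) = (*)" "one (free_algebra G) = 1" "ring.zero (free_algebra G) = 0"
 "add (free_algebra G) = (+)"
 by (simp_all add: free_algebra_def)

abbreviation frees :: "'g set => 'g free set" where
 "frees G \<equiv> carrier (free_algebra G)"

lemma frees_add: "f \<in> frees G ==> g \<in> frees G ==> f + g \<in> frees G"
 using keys_add[of f g] by auto

lemma frees_uminus: "f \<in> frees G ==> - f \<in> frees G"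
 by (simp add: keys_def)

lemma frees_diff: "f \<in> frees G ==> g \<in> frees G ==> f - g \<in> frees G"
 using frees_add[OF _ frees_uminus, of f G g] by simp

lemma frees_mult: "f \<in> frees G ==> g \<in> frees G ==> f * g \<in> frees G"
 using keys_mult[of f g] by (fastforce simp: plus_list_def)

lemma frees_0: "0 \<in> frees G" and frees_1: "1 \<in> frees G" and frees_scal: "scal c \<in> frees G"
 by (simp_all add: one_free scal_def)

lemma frees_gen: "x \<in> G ==> gen x \<in> frees G"
 by (simp add: gen_def)

lemma frees_single: "w \<in> lists G ==> single w c \<in> frees G"
 by simp

lemma frees_sum: "(\<And>i. i \<in> A ==> f i \<in> frees G) ==> (\<Sum>i\<in>A. f i) \<in> frees G"
 by (induction A rule: infinite_finite_induct) (auto simp: frees_add frees_0 simp del: carrier_free_algebra)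

lemma ring_free_algebra: "ring (free_algebra G)"
proof (rule ringI)
 show "abelian_group (free_algebra G)"
 proof (rule abelian_groupI)
  fix x assume "x \<in> frees G"
  thus "\<exists>y\<in>frees G. y \<oplus>\<^bsub>free_algebra G\<^esub> x = \<zero>\<^bsub>free_algebra G\<^esub>"
   using frees_uminus by (intro bexI[of _ "- x"]) auto
 qed (auto simp: frees_add frees_0 add_ac simp del: carrier_free_algebra)
 show "monoid (free_algebra G)"
  by (rule monoidI) (auto simp: frees_mult frees_1 mult.assoc simp del: carrier_free_algebra)
qed (auto simp: algebra_simps)

section \<open>Quotients of free algebras and actions on which the relations vanish\<close>

locale presented =
 fixes G :: "'g set" and R :: "'g free set"
 assumes R: "R \<subseteq> frees G"
begin

definition I :: "'g free set" where
 "I = Idl\<^bsub>free_algebra G\<^esub> R"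

abbreviation "cls \<equiv> presented_class G R"

lemma ideal_I: "ideal I (free_algebra G)"
 unfolding I_def by (rule ring.genideal_ideal[OF ring_free_algebra R])

lemma I_R: "r \<in> R ==> r \<in> I"
 using ring.genideal_self[OF ring_free_algebra R] unfolding I_def by blast

lemma I_0: "0 \<in> I"
 using additive_subgroup.zero_closed[OF ideal.axioms(1)[OF ideal_I]] by simp

lemma I_add: "f \<in> I ==> g \<in> I ==> f + g \<in> I"
 using additive_subgroup.a_closed[OF ideal.axioms(1)[OF ideal_I]] by simp

lemma I_left: "f \<in> I ==> g \<in> frees G ==> g * f \<in> I"
 using ideal.I_l_closed[OF ideal_I] by simp

lemma I_right: "f \<in> I ==> g \<in> frees G ==> f * g \<in> I"
 using ideal.I_r_closed[OF ideal_I] by simp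

lemma I_uminus: "f \<in> I ==> - f \<in> I"
 using I_left[OF _ frees_uminus[OF frees_1], of f] by simp

lemma I_diff: "f \<in> I ==> g \<in> I ==> f - g \<in> I"
 using I_add[of f "- g"] I_uminus[of g] by simp

lemma I_least:
 assumes "J \<subseteq> frees G" "R \<subseteq> J" "0 \<in> J" "\<And>f g. f \<in> J ==> g \<in> J ==> f + g \<in> J"
  and l: "\<And>f g. f \<in> J ==> g \<in> frees G ==> g * f \<in> J" and r: "\<And>f g. f \<in> J ==> g \<in> frees G ==> f * g \<in> J"
 shows "I \<subseteq> J"
proof -
 have neg: "- f \<in> J" if "f \<in> J" for f using l[OF that frees_uminus[OF frees_1]] by simp
 interpret F: ring "free_algebra G" by (rule ring_free_algebra)
 have "ideal J (free_algebra G)"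
 proof (rule idealI)
  show "subgroup J (add_monoid (free_algebra G))"
  proof (rule group.subgroupI)
   show "group (add_monoid (free_algebra G))" by (rule F.a_group)
   show "inv\<^bsub>add_monoid (free_algebra G)\<^esub> f \<in> J" if "f \<in> J" for f
   proof -
    have fG: "f \<in> frees G" using that assms(1) by blast
    have "\<ominus>\<^bsub>free_algebra G\<^esub> f = - f"
     by (rule F.minus_equality) (use fG frees_uminus[OF fG] in auto)
    thus ?thesis using neg[OF that] by (simp add: a_inv_def)
   qed
  qed (use assms in auto)
 qed (use l r ring_free_algebra in auto)
 thus ?thesis unfolding I_def by (rule F.genideal_minimal) (rule assms(2))
qed

lemma cls_def: "cls f = (\<lambda>i. i + f) ` I"
 by (auto simp: presented_class_def I_def[symmetric] a_r_coset_def r_coset_def)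

lemma cls_eq: "cls f = cls g \<longleftrightarrow> f - g \<in> I"
proof
 assume eq: "cls f = cls g"
 have "f \<in> cls f" unfolding cls_def using I_0 by force
 then obtain i where "i \<in> I" "f = i + g" unfolding eq unfolding cls_def by blast
 thus "f - g \<in> I" by simp
next
 assume fg: "f - g \<in> I"
 have 1: "i + f \<in> cls g" if "i \<in> I" for i
  unfolding cls_def using I_add[OF that fg] by (intro image_eqI[of _ _ "i + (f - g)"]) auto
 have 2: "i + g \<in> cls f" if "i \<in> I" for i
  unfolding cls_def using I_diff[OF that fg] by (intro image_eqI[of _ _ "i - (f - g)"]) auto
 show "cls f = cls g" using 1 2 unfolding cls_def by blast
qed

lemma cls_mem: "f \<in> cls g \<longleftrightarrow> f - g \<in> I"
 unfolding cls_def by (auto simp: image_iff) (metis diff_add_cancel)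

abbreviation (input) "Alg d \<equiv> presented_algebra G d R"

lemma Alg_carrier: "carrier (Alg d) = cls ` frees G"
 by (auto simp: presented_algebra_def Let_def FactRing_def A_RCOSETS_def' presented_class_def)

lemma cls_carrier: "f \<in> frees G ==> cls f \<in> carrier (Alg d)"
 by (simp add: Alg_carrier)

lemma Alg_mult: "f \<in> frees G ==> g \<in> frees G ==> cls f \<otimes>\<^bsub>Alg d\<^esub> cls g = cls (f * g)"
 using ideal.rcoset_mult_add[OF ideal_I, of f g]
 by (simp add: presented_algebra_def Let_def FactRing_def presented_class_def I_def)

lemma Alg_add: "f \<in> frees G ==> g \<in> frees G ==> cls f \<oplus>\<^bsub>Alg d\<^esub> cls g = cls (f + g)"
 using abelian_subgroup.a_rcos_sum[OF abelian_subgroupI3[OF ideal.axioms(1)[OF ideal_I]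
   ring.is_abelian_group[OF ring_free_algebra]], of f g]
 by (simp add: presented_algebra_def Let_def FactRing_def presented_class_def I_def)

lemma Alg_one: "\<one>\<^bsub>Alg d\<^esub> = cls 1"
 by (simp add: presented_algebra_def Let_def FactRing_def presented_class_def)

lemma Alg_zero: "\<zero>\<^bsub>Alg d\<^esub> = cls 0"
 unfolding cls_def by (simp add: presented_algebra_def Let_def FactRing_def I_def)

lemma Alg_smult:
 assumes "f \<in> frees G"
 shows "c \<odot>\<^bsub>Alg d\<^esub> cls f = cls (scal c * f)"
proof -
 have "cls (scal c * g) = cls (scal c * f)" if "g \<in> cls f" for g
 proof -
  have "scal c * (g - f) \<in> I" using that by (intro I_left frees_scal) (simp add: cls_mem)
  thus ?thesis by (simp add: cls_eq right_diff_distrib)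
 qed
 moreover have "f \<in> cls f" by (simp add: cls_mem I_0)
 ultimately have "(\<Union>g\<in>cls f. cls (scal c * g)) = cls (scal c * f)" by blast
 thus ?thesis by (simp add: presented_algebra_def Let_def)
qed

lemma Alg_hcomp: "hcomp (Alg d) \<alpha> = {cls f |f. keys f \<subseteq> {w \<in> lists G. (\<Sum>g\<leftarrow>w. d g) = \<alpha>}}"
 by (simp add: presented_algebra_def Let_def)

text \<open>A class acts through a chosen representative; by \<open>pev_cls\<close> the choice is
  immaterial on a stable subspace annihilated by the relations.\<close>

definition pev :: "('g => 'a fn => 'a => complex) => 'g free set => 'a fn => 'a => complex" where
 "pev \<rho> a v = ev \<rho> (SOME f. f \<in> frees G \<and> a = cls f) v"

text \<open>The elements of the free algebra that annihilate S form a two-sided ideal; stability of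
  S gives closure under right multiplication.\<close>

lemma ev_I:
 assumes lin: "\<And>x. linop (\<rho> x)" and S: "subsp S" "\<And>x v. x \<in> G ==> v \<in> S ==> \<rho> x v \<in> S"
  and rel: "\<And>r v. r \<in> R ==> v \<in> S ==> ev \<rho> r v = 0"
  and f: "f \<in> I" and v: "v \<in> S"
 shows "ev \<rho> f v = 0"
proof -
 let ?J = "{f \<in> frees G. \<forall>v\<in>S. ev \<rho> f v = 0}"
 have "I \<subseteq> ?J"
 proof (rule I_least)
  show "?J \<subseteq> frees G" by blast
  show "R \<subseteq> ?J" using R rel by blast
  show "0 \<in> ?J" using frees_0 by simp
  show "f + g \<in> ?J" if "f \<in> ?J" "g \<in> ?J" for f g
   using that frees_add[of f G g] by (simp add: ev_add)
  show "g * f \<in> ?J" if "f \<in> ?J" "g \<in> frees G" for f g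
   using that frees_mult[of g G f] by (simp add: ev_mult[OF lin] linop_0[OF linop_ev[OF lin]])
  show "f * g \<in> ?J" if "f \<in> ?J" "g \<in> frees G" for f g
  proof -
   have "ev \<rho> g v \<in> S" if "v \<in> S" for v
    using ev_in[OF S _ that, where f = g] \<open>g \<in> frees G\<close> by simp
   thus ?thesis using that frees_mult[of f G g] by (simp add: ev_mult[OF lin])
  qed
 qed
 thus ?thesis using f v by blast
qed

lemma pev_cls:
 assumes lin: "\<And>x. linop (\<rho> x)" and S: "subsp S" "\<And>x v. x \<in> G ==> v \<in> S ==> \<rho> x v \<in> S"
  and rel: "\<And>r v. r \<in> R ==> v \<in> S ==> ev \<rho> r v = 0"
  and f: "f \<in> frees G" and v: "v \<in> S"
 shows "pev \<rho> (cls f) v = ev \<rho> f v"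
proof -
 define g where "g = (SOME g. g \<in> frees G \<and> cls f = cls g)"
 have "g \<in> frees G \<and> cls f = cls g" unfolding g_def by (rule someI[of _ f]) (use f in simp)
 hence "f - g \<in> I" by (simp add: cls_eq)
 hence "ev \<rho> (f - g) v = 0" using lin S rel v by (intro ev_I[of \<rho> S "f - g" v])
 hence "ev \<rho> f v = ev \<rho> g v" by (simp add: ev_diff)
 thus ?thesis by (simp add: pev_def g_def)
qed

end

text \<open>The module axioms relative to a subspace S: an action by chosen representatives need not
  behave well elsewhere.\<close>

definition rep :: "('r, 'y) graded_scheme => ('r => 'a fn => 'a => complex) => 'a fn set => bool" where
 "rep A r S \<longleftrightarrow>
   (\<forall>a\<in>carrier A. \<forall>v\<in>S. r a v \<in> S) \<and>
   (\<forall>a\<in>carrier A. \<forall>v\<in>S. \<forall>w\<in>S. r a (v + w) = r a v + r a w) \<and>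
   (\<forall>c. \<forall>a\<in>carrier A. \<forall>v\<in>S. r a (sc c v) = sc c (r a v)) \<and>
   (\<forall>a\<in>carrier A. \<forall>b\<in>carrier A. \<forall>v\<in>S. r (a \<oplus>\<^bsub>A\<^esub> b) v = r a v + r b v) \<and>
   (\<forall>c. \<forall>a\<in>carrier A. \<forall>v\<in>S. r (c \<odot>\<^bsub>A\<^esub> a) v = sc c (r a v)) \<and>
   (\<forall>a\<in>carrier A. \<forall>b\<in>carrier A. \<forall>v\<in>S. r (a \<otimes>\<^bsub>A\<^esub> b) v = r a (r b v)) \<and>
   (\<forall>v\<in>S. r \<one>\<^bsub>A\<^esub> v = v)"

lemma repD:
 assumes "rep A r S"
 shows "\<And>a v. a \<in> carrier A ==> v \<in> S ==> r a v \<in> S"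
  "\<And>a v w. a \<in> carrier A ==> v \<in> S ==> w \<in> S ==> r a (v + w) = r a v + r a w"
  "\<And>c a v. a \<in> carrier A ==> v \<in> S ==> r a (sc c v) = sc c (r a v)"
  "\<And>a b v. a \<in> carrier A ==> b \<in> carrier A ==> v \<in> S ==> r (a \<oplus>\<^bsub>A\<^esub> b) v = r a v + r b v"
  "\<And>c a v. a \<in> carrier A ==> v \<in> S ==> r (c \<odot>\<^bsub>A\<^esub> a) v = sc c (r a v)"
  "\<And>a b v. a \<in> carrier A ==> b \<in> carrier A ==> v \<in> S ==> r (a \<otimes>\<^bsub>A\<^esub> b) v = r a (r b v)"
  "\<And>v. v \<in> S ==> r \<one>\<^bsub>A\<^esub> v = v"
 using assms unfolding rep_def by simp_all

lemma rep_subspace: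
 assumes "rep A r S" "T \<subseteq> S" "\<And>a v. a \<in> carrier A ==> v \<in> T ==> r a v \<in> T"
 shows "rep A r T"
 using assms unfolding rep_def by (simp add: subset_iff)

lemma (in presented) rep_pev:
 assumes lin: "\<And>x. linop (\<rho> x)" and S: "subsp S" "\<And>x v. x \<in> G ==> v \<in> S ==> \<rho> x v \<in> S"
  and rel: "\<And>r v. r \<in> R ==> v \<in> S ==> ev \<rho> r v = 0"
 shows "rep (presented_algebra G d R) (pev \<rho>) S"
proof -
 note pc = pev_cls[OF lin S rel]
 have evS: "ev \<rho> f v \<in> S" if "f \<in> frees G" "v \<in> S" for f v
  using ev_in[OF S _ that(2), where f = f] that(1) by simp
 show ?thesis
  unfolding rep_def Alg_carrier
  by (simp add: pc evS Alg_add Alg_mult Alg_smult Alg_one frees_add frees_mult frees_scal frees_1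
    linop_add[OF linop_ev[OF lin]] linop_sc[OF linop_ev[OF lin]] ev_add ev_mult[OF lin] ev_scal_alone
    subsp_add[OF S(1)] subsp_sc[OF S(1)] del: carrier_free_algebra)
qed

section \<open>Linear models of graded modules\<close>

lemma CC_simps [simp]:
 "carrier CC = UNIV" "monoid.mult CC = (*)" "one CC = 1" "ring.zero CC = 0" "add CC = (+)"
 by (simp_all add: ring_of_type_algebra_def)

text \<open>Coordinates for an abstract vector space: \<phi> identifies W with a space S of
  functions, and equations in W are checked after applying \<phi>.\<close>

definition lin_model :: "('w, 'z) graded_scheme => ('w => 'a => complex) => 'a fn set => bool" where
 "lin_model W \<phi> S \<longleftrightarrow> subsp S \<and> bij_betw \<phi> (carrier W) S \<and> \<zero>\<^bsub>W\<^esub> \<in> carrier W \<and> \<phi> \<zero>\<^bsub>W\<^esub> = 0 \<and>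
  (\<forall>v\<in>carrier W. \<forall>w\<in>carrier W. v \<oplus>\<^bsub>W\<^esub> w \<in> carrier W \<and> \<phi> (v \<oplus>\<^bsub>W\<^esub> w) = \<phi> v + \<phi> w) \<and>
  (\<forall>c. \<forall>v\<in>carrier W. c \<odot>\<^bsub>W\<^esub> v \<in> carrier W \<and> \<phi> (c \<odot>\<^bsub>W\<^esub> v) = sc c (\<phi> v))"

lemma lin_modelD:
 assumes "lin_model W \<phi> S"
 shows "subsp S" "bij_betw \<phi> (carrier W) S" "\<zero>\<^bsub>W\<^esub> \<in> carrier W" "\<phi> \<zero>\<^bsub>W\<^esub> = 0"
  "\<And>v w. v \<in> carrier W ==> w \<in> carrier W ==> v \<oplus>\<^bsub>W\<^esub> w \<in> carrier W"
  "\<And>v w. v \<in> carrier W ==> w \<in> carrier W ==> \<phi> (v \<oplus>\<^bsub>W\<^esub> w) = \<phi> v + \<phi> w"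
  "\<And>c v. v \<in> carrier W ==> c \<odot>\<^bsub>W\<^esub> v \<in> carrier W"
  "\<And>c v. v \<in> carrier W ==> \<phi> (c \<odot>\<^bsub>W\<^esub> v) = sc c (\<phi> v)"
  "\<And>v w. v \<in> carrier W ==> w \<in> carrier W ==> \<phi> v = \<phi> w ==> v = w"
  "\<And>v. v \<in> carrier W ==> \<phi> v \<in> S"
 using assms unfolding lin_model_def by (auto dest: bij_betw_imp_inj_on inj_onD bij_betwE)

lemma lin_model_inv:
 assumes "lin_model W \<phi> S" "s \<in> S"
 shows "inv_into (carrier W) \<phi> s \<in> carrier W" "\<phi> (inv_into (carrier W) \<phi> s) = s"
 using assms(2) lin_modelD(2)[OF assms(1)]
 by (auto simp: bij_betw_def intro: inv_into_into f_inv_into_f)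

lemma lin_model_module:
 assumes "lin_model W \<phi> S"
 shows "Module.module CC W"
proof (rule moduleI)
 note m = lin_modelD[OF assms]
 show "cring CC" by (rule cring_from_type_algebra)
 show "abelian_group W"
 proof (rule abelian_groupI)
  fix x assume x: "x \<in> carrier W"
  show "\<exists>y\<in>carrier W. y \<oplus>\<^bsub>W\<^esub> x = \<zero>\<^bsub>W\<^esub>"
  proof (rule bexI[of _ "(-1) \<odot>\<^bsub>W\<^esub> x"])
   show "(-1) \<odot>\<^bsub>W\<^esub> x \<oplus>\<^bsub>W\<^esub> x = \<zero>\<^bsub>W\<^esub>"
    by (rule m(9)) (use x m in \<open>auto simp: fun_eq_iff\<close>)
  qed (use x m in auto)
  show "\<zero>\<^bsub>W\<^esub> \<oplus>\<^bsub>W\<^esub> x = x" by (rule m(9)) (use x m in auto)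
  fix y assume y: "y \<in> carrier W"
  show "x \<oplus>\<^bsub>W\<^esub> y = y \<oplus>\<^bsub>W\<^esub> x" by (rule m(9)) (use x y m in \<open>auto simp: add_ac\<close>)
  fix z assume z: "z \<in> carrier W"
  show "x \<oplus>\<^bsub>W\<^esub> y \<oplus>\<^bsub>W\<^esub> z = x \<oplus>\<^bsub>W\<^esub> (y \<oplus>\<^bsub>W\<^esub> z)"
   by (rule m(9)) (use x y z m in \<open>auto simp: add_ac\<close>)
 qed (use m in auto)
 show "(a \<oplus>\<^bsub>CC\<^esub> b) \<odot>\<^bsub>W\<^esub> x = a \<odot>\<^bsub>W\<^esub> x \<oplus>\<^bsub>W\<^esub> b \<odot>\<^bsub>W\<^esub> x" if "x \<in> carrier W" for a b x
  by (rule m(9)) (use that m in \<open>auto simp: sc_add\<close>)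
 show "a \<odot>\<^bsub>W\<^esub> (x \<oplus>\<^bsub>W\<^esub> y) = a \<odot>\<^bsub>W\<^esub> x \<oplus>\<^bsub>W\<^esub> a \<odot>\<^bsub>W\<^esub> y" if "x \<in> carrier W" "y \<in> carrier W" for a x y
  by (rule m(9)) (use that m in \<open>auto simp: sc_add\<close>)
 show "(a \<otimes>\<^bsub>CC\<^esub> b) \<odot>\<^bsub>W\<^esub> x = a \<odot>\<^bsub>W\<^esub> (b \<odot>\<^bsub>W\<^esub> x)" if "x \<in> carrier W" for a b x
  by (rule m(9)) (use that m in auto)
 show "\<one>\<^bsub>CC\<^esub> \<odot>\<^bsub>W\<^esub> x = x" if "x \<in> carrier W" for x
  by (rule m(9)) (use that m in auto)
qed (use lin_modelD[OF assms] in auto)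

lemma lin_model_finsum:
 assumes "lin_model W \<phi> S" "finite A" "\<And>i. i \<in> A ==> f i \<in> carrier W"
 shows "finsum W f A \<in> carrier W \<and> \<phi> (finsum W f A) = (\<Sum>i\<in>A. \<phi> (f i))"
 using assms(2,3)
proof (induction A)
 interpret M: Module.module CC W by (rule lin_model_module[OF assms(1)])
 case empty
 show ?case using lin_modelD(3,4)[OF assms(1)] by auto
next
 interpret M: Module.module CC W by (rule lin_model_module[OF assms(1)])
 case (insert i A)
 have "finsum W f (insert i A) = f i \<oplus>\<^bsub>W\<^esub> finsum W f A"
  by (rule M.M.finsum_insert) (use insert in auto)
 thus ?case using insert lin_modelD(5,6)[OF assms(1)] by auto
qed

definition gr :: "degree set => 'a fn set => (degree => 'a fn set) => bool" where
 "gr \<Gamma> S H \<longleftrightarrow> (\<forall>\<alpha>. subsp (H \<alpha>) \<and> H \<alpha> \<subseteq> S) \<and> (\<forall>\<alpha>. \<alpha> \<notin> \<Gamma> \<longrightarrow> H \<alpha> = {0}) \<and>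
  (\<forall>v\<in>S. \<exists>!f. (\<forall>\<alpha>. f \<alpha> \<in> H \<alpha>) \<and> finite {\<alpha>. f \<alpha> \<noteq> 0} \<and> v = (\<Sum>\<alpha> | f \<alpha> \<noteq> 0. f \<alpha>))"

definition hmodel :: "('w, 'z) graded_scheme => ('w => 'a => complex) => (degree => 'a fn set) => bool" where
 "hmodel W \<phi> H \<longleftrightarrow> (\<forall>\<alpha>. hcomp W \<alpha> \<subseteq> carrier W \<and> \<phi> ` hcomp W \<alpha> = H \<alpha>)"

lemma hmodel_iff:
 assumes "lin_model W \<phi> S" "hmodel W \<phi> H" "v \<in> carrier W"
 shows "v \<in> hcomp W \<alpha> \<longleftrightarrow> \<phi> v \<in> H \<alpha>"
proof
 assume "v \<in> hcomp W \<alpha>"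
 thus "\<phi> v \<in> H \<alpha>" using assms(2) unfolding hmodel_def by blast
next
 assume "\<phi> v \<in> H \<alpha>"
 then obtain w where "w \<in> hcomp W \<alpha>" "\<phi> v = \<phi> w" "w \<in> carrier W"
  using assms(2) unfolding hmodel_def by blast
 thus "v \<in> hcomp W \<alpha>" using lin_modelD(9)[OF assms(1)] assms(3) by metis
qed

text \<open>The unique decomposition is transported through \<phi>; zero components correspond to
  each other, so the finite index sets agree.\<close>

lemma is_grading_model:
 assumes lm: "lin_model W \<phi> S" and hm: "hmodel W \<phi> H" and gr: "gr \<Gamma> S H"
 shows "is_grading \<Gamma> W"
 unfolding is_grading_def
proof (intro conjI allI impI ballI)
 note m = lin_modelD[OF lm]
 interpret M: Module.module CC W by (rule lin_model_module[OF lm])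
 have sub: "hcomp W \<alpha> \<subseteq> carrier W" for \<alpha> using hm by (simp add: hmodel_def)
 have H: "subsp (H \<alpha>)" "H \<alpha> \<subseteq> S" for \<alpha> using gr by (simp_all add: gr_def)
 have iff: "v \<in> hcomp W \<alpha> \<longleftrightarrow> \<phi> v \<in> H \<alpha>" if "v \<in> carrier W" for v \<alpha>
  using hmodel_iff[OF lm hm that] .
 show "submodule (hcomp W \<alpha>) CC W" for \<alpha>
 proof (rule M.submoduleI)
  show "\<zero>\<^bsub>W\<^esub> \<in> hcomp W \<alpha>" using iff[OF m(3)] m(4) subsp_0[OF H(1)] by simp
  show "a \<oplus>\<^bsub>W\<^esub> b \<in> hcomp W \<alpha>" if "a \<in> hcomp W \<alpha>" "b \<in> hcomp W \<alpha>" for a b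
  proof -
   have "a \<in> carrier W" "b \<in> carrier W" using that sub by blast+
   thus ?thesis using that iff m(5,6) subsp_add[OF H(1)] by simp
  qed
  show smult: "c \<odot>\<^bsub>W\<^esub> a \<in> hcomp W \<alpha>" if "a \<in> hcomp W \<alpha>" for c a
  proof -
   have "a \<in> carrier W" using that sub by blast
   thus ?thesis using that iff m(7,8) subsp_sc[OF H(1)] by simp
  qed
  show "\<ominus>\<^bsub>W\<^esub> a \<in> hcomp W \<alpha>" if "a \<in> hcomp W \<alpha>" for a
  proof -
   have a: "a \<in> carrier W" using that sub by blast
   have "\<ominus>\<^bsub>W\<^esub> a = (-1) \<odot>\<^bsub>W\<^esub> a"
   proof (rule M.M.minus_equality)
    show "(-1) \<odot>\<^bsub>W\<^esub> a \<oplus>\<^bsub>W\<^esub> a = \<zero>\<^bsub>W\<^esub>"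
     by (rule m(9)) (use a m in \<open>auto simp: fun_eq_iff\<close>)
   qed (use a m in auto)
   thus ?thesis using smult[OF that] by simp
  qed
 qed (rule sub)
 show "hcomp W \<alpha> = {\<zero>\<^bsub>W\<^esub>}" if "\<alpha> \<notin> \<Gamma>" for \<alpha>
 proof -
  have "H \<alpha> = {0}" using gr that by (simp add: gr_def)
  hence "v \<in> hcomp W \<alpha> \<longleftrightarrow> v = \<zero>\<^bsub>W\<^esub>" if "v \<in> carrier W" for v
   using iff[OF that] m(9)[OF that m(3)] m(4) by auto
  thus ?thesis using sub m(3) by blast
 qed
 fix w assume w: "w \<in> carrier W"
 define Q where "Q f \<longleftrightarrow> (\<forall>\<alpha>. f \<alpha> \<in> H \<alpha>) \<and> finite {\<alpha>. f \<alpha> \<noteq> 0} \<and> \<phi> w = (\<Sum>\<alpha> | f \<alpha> \<noteq> 0. f \<alpha>)" for f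
 define Q' where "Q' f \<longleftrightarrow> (\<forall>\<alpha>. f \<alpha> \<in> hcomp W \<alpha>) \<and> finite {\<alpha>. f \<alpha> \<noteq> \<zero>\<^bsub>W\<^esub>} \<and>
  w = finsum W f {\<alpha>. f \<alpha> \<noteq> \<zero>\<^bsub>W\<^esub>}" for f
 have "\<exists>!f. Q f" using gr m(10)[OF w] by (simp add: gr_def Q_def)
 then obtain f where f: "Q f" "\<And>g. Q g ==> g = f" by blast
 have QQ: "Q' g \<longleftrightarrow> Q (\<lambda>\<alpha>. \<phi> (g \<alpha>))" if g: "\<And>\<alpha>. g \<alpha> \<in> carrier W" for g
 proof -
  have z: "{\<alpha>. g \<alpha> \<noteq> \<zero>\<^bsub>W\<^esub>} = {\<alpha>. \<phi> (g \<alpha>) \<noteq> 0}"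
   using m(4) m(9)[OF g m(3)] by auto
  have "w = finsum W g {\<alpha>. \<phi> (g \<alpha>) \<noteq> 0} \<longleftrightarrow> \<phi> w = (\<Sum>\<alpha> | \<phi> (g \<alpha>) \<noteq> 0. \<phi> (g \<alpha>))"
   if "finite {\<alpha>. \<phi> (g \<alpha>) \<noteq> 0}"
   using lin_model_finsum[OF lm that, of g] g m(9)[OF w, of "finsum W g {\<alpha>. \<phi> (g \<alpha>) \<noteq> 0}"] by auto
  thus ?thesis unfolding Q_def Q'_def z using iff[OF g] by blast
 qed
 define h where "h \<alpha> = inv_into (carrier W) \<phi> (f \<alpha>)" for \<alpha>
 have fS: "f \<alpha> \<in> S" for \<alpha> using f(1) H(2) unfolding Q_def by blast
 have h: "h \<alpha> \<in> carrier W" "\<phi> (h \<alpha>) = f \<alpha>" for \<alpha>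
  unfolding h_def using lin_model_inv[OF lm fS] by blast+
 have "Q' h" using QQ[of h] h f(1) by simp
 moreover have "g = h" if "Q' g" for g
 proof -
  have gc: "g \<alpha> \<in> carrier W" for \<alpha> using that sub unfolding Q'_def by blast
  have "(\<lambda>\<alpha>. \<phi> (g \<alpha>)) = f" using f(2) QQ[of g] gc that by blast
  hence "\<phi> (g \<alpha>) = \<phi> (h \<alpha>)" for \<alpha> using h(2) by metis
  thus ?thesis using m(9) gc h(1) by blast
 qed
 ultimately have "\<exists>!f. Q' f" by blast
 thus "\<exists>!f. (\<forall>\<alpha>. f \<alpha> \<in> hcomp W \<alpha>) \<and> finite {\<alpha>. f \<alpha> \<noteq> \<zero>\<^bsub>W\<^esub>} \<and> w = finsum W f {\<alpha>. f \<alpha> \<noteq> \<zero>\<^bsub>W\<^esub>}"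
  unfolding Q'_def .
qed

lemma graded_submodule_model:
 assumes lm: "lin_model W \<phi> S" and hm: "hmodel W \<phi> H" and T: "is_graded_submodule \<Gamma> R W T"
 shows "T \<subseteq> carrier W" "subsp (\<phi> ` T)"
  "\<And>v. v \<in> \<phi> ` T ==> \<exists>f. (\<forall>\<alpha>. f \<alpha> \<in> \<phi> ` T \<inter> H \<alpha>) \<and> finite {\<alpha>. f \<alpha> \<noteq> 0} \<and> v = (\<Sum>\<alpha> | f \<alpha> \<noteq> 0. f \<alpha>)"
proof -
 note m = lin_modelD[OF lm]
 interpret M: Module.module CC W by (rule lin_model_module[OF lm])
 have sm: "submodule T CC W" using T by (simp add: is_graded_submodule_def)
 have Tc: "T \<subseteq> carrier W" by (rule M.submoduleE(1)[OF sm])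
 have T0: "\<zero>\<^bsub>W\<^esub> \<in> T" using subgroup.one_closed[OF submodule.axioms(1)[OF sm]] by simp
 have Tadd: "a \<oplus>\<^bsub>W\<^esub> b \<in> T" if "a \<in> T" "b \<in> T" for a b using M.submoduleE(5)[OF sm that] .
 have Tsm: "c \<odot>\<^bsub>W\<^esub> b \<in> T" if "b \<in> T" for c b using M.submoduleE(4)[OF sm _ that, of c] by simp
 show "T \<subseteq> carrier W" by (rule Tc)
 show sT: "subsp (\<phi> ` T)"
  unfolding subsp_def
 proof (intro conjI ballI allI)
  show "0 \<in> \<phi> ` T" using T0 m(4) by force
  fix x assume "x \<in> \<phi> ` T"
  then obtain a where a: "a \<in> T" "x = \<phi> a" by blast
  show "sc c x \<in> \<phi> ` T" for c
   by (rule image_eqI[OF _ Tsm[OF a(1), of c]]) (use a Tc m(8) in auto)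
  fix y assume "y \<in> \<phi> ` T"
  then obtain b where b: "b \<in> T" "y = \<phi> b" by blast
  show "x + y \<in> \<phi> ` T"
  proof (rule image_eqI[OF _ Tadd[OF a(1) b(1)]])
   have "a \<in> carrier W" "b \<in> carrier W" using a b Tc by blast+
   thus "x + y = \<phi> (a \<oplus>\<^bsub>W\<^esub> b)" using m(6) a b by simp
  qed
 qed
 let ?W = "W\<lparr>carrier := T, hcomp := (\<lambda>\<alpha>. T \<inter> hcomp W \<alpha>)\<rparr>"
 have lm': "lin_model ?W \<phi> (\<phi> ` T)"
  unfolding lin_model_def using T0 Tadd Tsm Tc m sT
  by (auto simp: bij_betw_def inj_on_def subset_iff)
 fix v assume "v \<in> \<phi> ` T"
 then obtain w where w: "w \<in> T" "v = \<phi> w" by blast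
 have "is_grading \<Gamma> ?W" using T by (simp add: is_graded_submodule_def)
 hence "\<exists>!f. (\<forall>\<alpha>. f \<alpha> \<in> hcomp ?W \<alpha>) \<and> finite {\<alpha>. f \<alpha> \<noteq> \<zero>\<^bsub>?W\<^esub>} \<and> w = finsum ?W f {\<alpha>. f \<alpha> \<noteq> \<zero>\<^bsub>?W\<^esub>}"
  unfolding is_grading_def using w(1) by simp
 then obtain f where f: "\<And>\<alpha>. f \<alpha> \<in> T \<inter> hcomp W \<alpha>" "finite {\<alpha>. f \<alpha> \<noteq> \<zero>\<^bsub>W\<^esub>}"
  "w = finsum ?W f {\<alpha>. f \<alpha> \<noteq> \<zero>\<^bsub>W\<^esub>}" by auto
 have z: "{\<alpha>. f \<alpha> \<noteq> \<zero>\<^bsub>W\<^esub>} = {\<alpha>. \<phi> (f \<alpha>) \<noteq> 0}"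
 proof -
  have "f \<alpha> \<in> carrier W" for \<alpha> using f(1)[of \<alpha>] Tc by blast
  thus ?thesis using m(4) m(9)[OF _ m(3)] by force
 qed
 have "v = (\<Sum>\<alpha> | \<phi> (f \<alpha>) \<noteq> 0. \<phi> (f \<alpha>))"
  unfolding w(2) f(3) z[symmetric] using lin_model_finsum[OF lm' f(2), of f] f(1) by simp
 moreover have "\<phi> (f \<alpha>) \<in> \<phi> ` T \<inter> H \<alpha>" for \<alpha>
  using f(1)[of \<alpha>] hm unfolding hmodel_def by blast
 ultimately show "\<exists>f. (\<forall>\<alpha>. f \<alpha> \<in> \<phi> ` T \<inter> H \<alpha>) \<and> finite {\<alpha>. f \<alpha> \<noteq> 0} \<and> v = (\<Sum>\<alpha> | f \<alpha> \<noteq> 0. f \<alpha>)"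
  using f(2) unfolding z by (intro exI[of _ "\<lambda>\<alpha>. \<phi> (f \<alpha>)"]) blast
qed

text \<open>Coordinates for a graded module: S, H and r are the space, the components and the action
  on the side of functions. By \<open>iso_model\<close> they determine the module up to
  isomorphism.\<close>

definition gmod_model :: "('r, 'y) graded_scheme => ('r, 'w, 'z) gmodule_scheme => ('w => 'a => complex) =>
  'a fn set => (degree => 'a fn set) => ('r => 'a fn => 'a => complex) => bool" where
 "gmod_model R W \<phi> S H r \<longleftrightarrow> lin_model W \<phi> S \<and> hmodel W \<phi> H \<and>
   (\<forall>a\<in>carrier R. \<forall>w\<in>carrier W. act W a w \<in> carrier W \<and> \<phi> (act W a w) = r a (\<phi> w))"

lemma gmod_modelD:
 assumes "gmod_model R W \<phi> S H r"
 shows "lin_model W \<phi> S" "hmodel W \<phi> H"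
  "\<And>a w. a \<in> carrier R ==> w \<in> carrier W ==> act W a w \<in> carrier W"
  "\<And>a w. a \<in> carrier R ==> w \<in> carrier W ==> \<phi> (act W a w) = r a (\<phi> w)"
 using assms by (auto simp: gmod_model_def)

definition alg_closed :: "('r, 'y) graded_scheme => bool" where
 "alg_closed R \<longleftrightarrow> \<one>\<^bsub>R\<^esub> \<in> carrier R \<and>
  (\<forall>a\<in>carrier R. \<forall>b\<in>carrier R. a \<oplus>\<^bsub>R\<^esub> b \<in> carrier R \<and> a \<otimes>\<^bsub>R\<^esub> b \<in> carrier R) \<and>
  (\<forall>c. \<forall>a\<in>carrier R. c \<odot>\<^bsub>R\<^esub> a \<in> carrier R)"

lemma graded_module_model:
 assumes gm: "gmod_model R W \<phi> S H r" and rep: "rep R r S" and ac: "alg_closed R" and gr: "gr \<Gamma> S H"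
  and hR: "\<And>\<alpha>. hcomp R \<alpha> \<subseteq> carrier R"
  and deg: "\<And>\<alpha> \<beta> a v. a \<in> hcomp R \<alpha> ==> v \<in> H \<beta> ==> r a v \<in> H (\<alpha> + \<beta>)"
 shows "is_graded_module \<Gamma> R W"
proof -
 note g = gmod_modelD[OF gm]
 note m = lin_modelD[OF g(1)]
 note R = repD[OF rep]
 have "is_left_module R W"
  unfolding is_left_module_def
 proof (intro conjI ballI allI)
  show "Module.module CC W" by (rule lin_model_module[OF g(1)])
  fix a w assume a: "a \<in> carrier R" and w: "w \<in> carrier W"
  show "act W a w \<in> carrier W" by (rule g(3)[OF a w])
  show "act W (c \<odot>\<^bsub>R\<^esub> a) w = c \<odot>\<^bsub>W\<^esub> act W a w" for c
   by (rule m(9)) (use a w g m R ac in \<open>auto simp: alg_closed_def\<close>)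
  show "act W a (c \<odot>\<^bsub>W\<^esub> w) = c \<odot>\<^bsub>W\<^esub> act W a w" for c
   by (rule m(9)) (use a w g m R in auto)
  show "act W a (w \<oplus>\<^bsub>W\<^esub> v) = act W a w \<oplus>\<^bsub>W\<^esub> act W a v" if "v \<in> carrier W" for v
   by (rule m(9)) (use a w that g m R in auto)
  fix b assume b: "b \<in> carrier R"
  show "act W (a \<oplus>\<^bsub>R\<^esub> b) w = act W a w \<oplus>\<^bsub>W\<^esub> act W b w"
   by (rule m(9)) (use a b w g m R ac in \<open>auto simp: alg_closed_def\<close>)
  show "act W (a \<otimes>\<^bsub>R\<^esub> b) w = act W a (act W b w)"
   by (rule m(9)) (use a b w g m R ac in \<open>auto simp: alg_closed_def\<close>)
 next
  fix w assume w: "w \<in> carrier W"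
  show "act W \<one>\<^bsub>R\<^esub> w = w"
   by (rule m(9)) (use w g m R ac in \<open>auto simp: alg_closed_def\<close>)
 qed
 moreover have "act W a w \<in> hcomp W (\<alpha> + \<beta>)" if a: "a \<in> hcomp R \<alpha>" and w: "w \<in> hcomp W \<beta>" for a w \<alpha> \<beta>
 proof -
  have ac: "a \<in> carrier R" using a hR by blast
  have wc: "w \<in> carrier W" using w g(2) unfolding hmodel_def by blast
  have "\<phi> w \<in> H \<beta>" using hmodel_iff[OF g(1,2) wc] w by blast
  thus ?thesis using deg[OF a] hmodel_iff[OF g(1,2) g(3)[OF ac wc]] g(4)[OF ac wc] by simp
 qed
 ultimately show ?thesis
  unfolding is_graded_module_def using is_grading_model[OF g(1,2) gr] by simp
qed

lemma simple_model:
 assumes gm: "gmod_model R W \<phi> S H r" and gmod: "is_graded_module \<Gamma> R W" and nz: "S \<noteq> {0}"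
  and simple: "\<And>T. T \<subseteq> S ==> subsp T ==> (\<And>a v. a \<in> carrier R ==> v \<in> T ==> r a v \<in> T) ==>
   (\<And>v. v \<in> T ==> \<exists>f. (\<forall>\<alpha>. f \<alpha> \<in> T \<inter> H \<alpha>) \<and> finite {\<alpha>. f \<alpha> \<noteq> 0} \<and> v = (\<Sum>\<alpha> | f \<alpha> \<noteq> 0. f \<alpha>)) ==>
   T = {0} \<or> T = S"
 shows "is_simple \<Gamma> R W"
 unfolding is_simple_def
proof (intro conjI allI impI)
 note g = gmod_modelD[OF gm]
 note m = lin_modelD[OF g(1)]
 have im: "\<phi> ` carrier W = S" using m(2) by (simp add: bij_betw_def)
 show "is_graded_module \<Gamma> R W" by (rule gmod)
 show "carrier W \<noteq> {\<zero>\<^bsub>W\<^esub>}" using im m(4) nz by auto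
 fix T assume T: "is_graded_submodule \<Gamma> R W T"
 note t = graded_submodule_model[OF g(1,2) T]
 have "\<phi> ` T = {0} \<or> \<phi> ` T = S"
 proof (rule simple)
  show "\<phi> ` T \<subseteq> S" using t(1) m(10) by blast
  show "r a v \<in> \<phi> ` T" if "a \<in> carrier R" "v \<in> \<phi> ` T" for a v
  proof -
   obtain w where w: "w \<in> T" "v = \<phi> w" using \<open>v \<in> \<phi> ` T\<close> by blast
   hence "act W a w \<in> T" using T that(1) by (auto simp: is_graded_submodule_def)
   moreover have "\<phi> (act W a w) = r a v" using g(4)[OF that(1)] w t(1) by auto
   ultimately show ?thesis by (metis imageI)
  qed
  show "subsp (\<phi> ` T)" by (rule t(2))
  show "\<exists>f. (\<forall>\<alpha>. f \<alpha> \<in> \<phi> ` T \<inter> H \<alpha>) \<and> finite {\<alpha>. f \<alpha> \<noteq> 0} \<and> v = (\<Sum>\<alpha> | f \<alpha> \<noteq> 0. f \<alpha>)"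
   if "v \<in> \<phi> ` T" for v by (rule t(3)[OF that])
 qed
 thus "T = {\<zero>\<^bsub>W\<^esub>} \<or> T = carrier W"
 proof
  assume z: "\<phi> ` T = {0}"
  have "w = \<zero>\<^bsub>W\<^esub>" if "w \<in> T" for w
  proof (rule m(9))
   have "\<phi> w \<in> {0}" unfolding z[symmetric] using that by (rule imageI)
   thus "\<phi> w = \<phi> \<zero>\<^bsub>W\<^esub>" using m(4) by simp
  qed (use that t(1) m(3) in auto)
  hence "T \<subseteq> {\<zero>\<^bsub>W\<^esub>}" by auto
  moreover have "T \<noteq> {}" using z by auto
  ultimately show ?thesis by (simp add: subset_singleton_iff)
 next
  assume eq: "\<phi> ` T = S"
  have "w \<in> T" if w: "w \<in> carrier W" for w
  proof -
   have "\<phi> w \<in> \<phi> ` T" using eq m(10)[OF w] by simp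
   then obtain v where "v \<in> T" "\<phi> w = \<phi> v" by blast
   thus ?thesis using m(9)[OF w, of v] t(1) by auto
  qed
  thus ?thesis using t(1) by blast
 qed
qed

lemma iso_model:
 assumes V: "gmod_model R V \<phi> S H r" and W: "gmod_model R W \<psi> S H r"
 shows "\<exists>\<theta>. is_graded_module_iso R V W \<theta>"
proof -
 note gv = gmod_modelD[OF V] and gw = gmod_modelD[OF W]
 note v = lin_modelD[OF gv(1)] and w = lin_modelD[OF gw(1)]
 define \<theta> where "\<theta> x = inv_into (carrier W) \<psi> (\<phi> x)" for x
 have \<theta>: "\<theta> x \<in> carrier W" "\<psi> (\<theta> x) = \<phi> x" if "x \<in> carrier V" for x
  unfolding \<theta>_def using lin_model_inv[OF gw(1) v(10)[OF that]] by blast+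
 have "bij_betw \<theta> (carrier V) (carrier W)"
 proof -
  have "bij_betw (inv_into (carrier W) \<psi> \<circ> \<phi>) (carrier V) (carrier W)"
   using v(2) bij_betw_inv_into[OF w(2)] by (rule bij_betw_trans)
  thus ?thesis by (simp add: \<theta>_def[abs_def] comp_def)
 qed
 hence "is_module_iso R V W \<theta>"
  unfolding is_module_iso_def
 proof (intro conjI ballI allI)
  fix x assume x: "x \<in> carrier V"
  show "\<theta> (c \<odot>\<^bsub>V\<^esub> x) = c \<odot>\<^bsub>W\<^esub> \<theta> x" for c
   by (rule w(9)) (use x \<theta> v w in auto)
  show "\<theta> (x \<oplus>\<^bsub>V\<^esub> y) = \<theta> x \<oplus>\<^bsub>W\<^esub> \<theta> y" if "y \<in> carrier V" for y
   by (rule w(9)) (use x that \<theta> v w in auto)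
  show "\<theta> (act V a x) = act W a (\<theta> x)" if "a \<in> carrier R" for a
   by (rule w(9)) (use x that \<theta> gv gw in auto)
 qed
 moreover have "\<theta> ` hcomp V \<alpha> = hcomp W \<alpha>" for \<alpha>
 proof
  have sub: "hcomp V \<alpha> \<subseteq> carrier V" "hcomp W \<alpha> \<subseteq> carrier W"
   using gv(2) gw(2) by (auto simp: hmodel_def)
  show "\<theta> ` hcomp V \<alpha> \<subseteq> hcomp W \<alpha>"
  proof
   fix y assume "y \<in> \<theta> ` hcomp V \<alpha>"
   then obtain x where x: "x \<in> hcomp V \<alpha>" "y = \<theta> x" by blast
   hence xc: "x \<in> carrier V" using sub by blast
   show "y \<in> hcomp W \<alpha>"
    using hmodel_iff[OF gw(1,2) \<theta>(1)[OF xc]] hmodel_iff[OF gv(1,2) xc] x \<theta>(2)[OF xc] by simp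
  qed
  show "hcomp W \<alpha> \<subseteq> \<theta> ` hcomp V \<alpha>"
  proof
   fix y assume y: "y \<in> hcomp W \<alpha>"
   hence yc: "y \<in> carrier W" using sub by blast
   define x where "x = inv_into (carrier V) \<phi> (\<psi> y)"
   have x: "x \<in> carrier V" "\<phi> x = \<psi> y"
    unfolding x_def using lin_model_inv[OF gv(1) w(10)[OF yc]] by blast+
   have "\<theta> x = y" by (rule w(9)) (use \<theta>[OF x(1)] x yc in auto)
   moreover have "x \<in> hcomp V \<alpha>"
    using hmodel_iff[OF gv(1,2) x(1)] hmodel_iff[OF gw(1,2) yc] y x(2) by simp
   ultimately show "y \<in> \<theta> ` hcomp V \<alpha>" by blast
  qed
 qed
 ultimately show ?thesis unfolding is_graded_module_iso_def by blast
qed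

lemma gr_homog:
 fixes \<delta> :: "'a => degree"
 assumes S: "subsp S" "S \<subseteq> FS" "graded_by \<delta> S" and \<Gamma>: "\<And>v a. v \<in> S ==> v a \<noteq> 0 ==> \<delta> a \<in> \<Gamma>"
 shows "gr \<Gamma> S (\<lambda>\<alpha>. S \<inter> {v. homog \<delta> \<alpha> v})"
 unfolding gr_def
proof (intro conjI allI impI ballI)
 show "subsp (S \<inter> {v. homog \<delta> \<alpha> v})" for \<alpha> by (rule subsp_Int[OF S(1) subsp_supported])
 show "S \<inter> {v. homog \<delta> \<alpha> v} \<subseteq> S" for \<alpha> by blast
 show "S \<inter> {v. homog \<delta> \<alpha> v} = {0}" if "\<alpha> \<notin> \<Gamma>" for \<alpha>
 proof -
  have "v = 0" if "v \<in> S" "homog \<delta> \<alpha> v" for v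
  proof
   fix a show "v a = 0 a"
    using \<Gamma>[OF \<open>v \<in> S\<close>, of a] \<open>homog \<delta> \<alpha> v\<close> \<open>\<alpha> \<notin> \<Gamma>\<close> by (auto simp: supported_def)
  qed
  thus ?thesis using subsp_0[OF S(1)] by auto
 qed
 fix v assume v: "v \<in> S"
 have vFS: "v \<in> FS" using v S(2) by blast
 let ?Q = "\<lambda>f. (\<forall>\<alpha>. f \<alpha> \<in> S \<inter> {v. homog \<delta> \<alpha> v}) \<and> finite {\<alpha>. f \<alpha> \<noteq> 0} \<and> v = (\<Sum>\<alpha> | f \<alpha> \<noteq> 0. f \<alpha>)"
 have sub: "{\<alpha>. prj \<delta> \<alpha> v \<noteq> 0} \<subseteq> \<delta> ` {a. v a \<noteq> 0}"
 proof
  fix \<alpha> assume "\<alpha> \<in> {\<alpha>. prj \<delta> \<alpha> v \<noteq> 0}"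
  then obtain a where "prj \<delta> \<alpha> v a \<noteq> 0" by (auto simp: fun_eq_iff)
  thus "\<alpha> \<in> \<delta> ` {a. v a \<noteq> 0}" by (auto simp: prj_def split: if_splits)
 qed
 have fin: "finite (\<delta> ` {a. v a \<noteq> 0})" using vFS by (simp add: FS_def)
 have "v = (\<Sum>\<alpha> | prj \<delta> \<alpha> v \<noteq> 0. prj \<delta> \<alpha> v)"
  using sum_prj_FS[OF vFS, of \<delta>] sum.mono_neutral_left[OF fin sub, of "\<lambda>\<alpha>. prj \<delta> \<alpha> v"] by auto
 hence ex: "?Q (\<lambda>\<alpha>. prj \<delta> \<alpha> v)"
  using finite_subset[OF sub fin] S(3) v by (auto simp: graded_by_def)
 have uniq: "f = (\<lambda>\<alpha>. prj \<delta> \<alpha> v)" if f: "?Q f" for f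
 proof
  fix \<beta>
  have fin: "finite {\<alpha>. f \<alpha> \<noteq> 0}" using f by blast
  have h: "prj \<delta> \<beta> (f \<alpha>) = (if \<alpha> = \<beta> then f \<alpha> else 0)" for \<alpha>
   using f prj_homog[of \<delta> \<alpha> "f \<alpha>" \<beta>] by auto
  have "v = (\<Sum>\<alpha> | f \<alpha> \<noteq> 0. f \<alpha>)" using f by blast
  hence "prj \<delta> \<beta> v = prj \<delta> \<beta> (\<Sum>\<alpha> | f \<alpha> \<noteq> 0. f \<alpha>)" by (rule arg_cong)
  also have "\<dots> = (\<Sum>\<alpha> | f \<alpha> \<noteq> 0. prj \<delta> \<beta> (f \<alpha>))" by (rule linop_sum[OF linop_prj])
  also have "\<dots> = (\<Sum>\<alpha> | f \<alpha> \<noteq> 0. if \<alpha> = \<beta> then f \<alpha> else 0)" by (simp only: h)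
  also have "\<dots> = f \<beta>" using fin by (cases "f \<beta> = 0") auto
  finally show "f \<beta> = prj \<delta> \<beta> v" ..
 qed
 show "\<exists>!f. ?Q f" by (rule ex1I[of ?Q, OF ex]) (rule uniq)
qed

text \<open>Bridges the two notions of a graded subspace, by decompositions of its elements and by
  stability under \<open>prj\<close>: the projections of the given decomposition are its own terms
  or zero.\<close>

lemma graded_decomposition:
 fixes \<delta> :: "'a => degree"
 assumes "\<And>v. v \<in> T ==> \<exists>f. (\<forall>\<alpha>. f \<alpha> \<in> T \<inter> (S \<inter> {v. homog \<delta> \<alpha> v})) \<and> finite {\<alpha>. f \<alpha> \<noteq> 0} \<and> v = (\<Sum>\<alpha> | f \<alpha> \<noteq> 0. f \<alpha>)"
  and "subsp T"
 shows "graded_by \<delta> T"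
 unfolding graded_by_def
proof (intro ballI allI)
 fix v \<beta> assume "v \<in> T"
 from assms(1)[OF this] obtain f where f: "\<And>\<alpha>. f \<alpha> \<in> T" "\<And>\<alpha>. homog \<delta> \<alpha> (f \<alpha>)"
  "v = (\<Sum>\<alpha> | f \<alpha> \<noteq> 0. f \<alpha>)" by blast
 have "prj \<delta> \<beta> v = (\<Sum>\<alpha> | f \<alpha> \<noteq> 0. prj \<delta> \<beta> (f \<alpha>))"
  unfolding f(3) by (rule linop_sum[OF linop_prj])
 moreover have "prj \<delta> \<beta> (f \<alpha>) \<in> T" for \<alpha>
  using f(1) prj_homog[OF f(2), of \<beta> \<alpha>] subsp_0[OF assms(2)] by simp
 ultimately show "prj \<delta> \<beta> v \<in> T" by (simp only:) (rule subsp_sum[OF assms(2)])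
qed

text \<open>The grading of a module over the ungraded gl_N, placed in degree zero.\<close>

lemma gr_trivial:
 assumes "subsp S" "0 \<in> \<Gamma>"
 shows "gr \<Gamma> S (\<lambda>\<alpha>. if \<alpha> = 0 then S else {0})"
 unfolding gr_def
proof (intro conjI allI impI ballI)
 show "subsp (if \<alpha> = 0 then S else {0})" for \<alpha> :: degree
  using assms by (auto simp: subsp_def)
 show "(if \<alpha> = 0 then S else {0}) \<subseteq> S" for \<alpha> :: degree using subsp_0[OF assms(1)] by auto
 show "(if \<alpha> = 0 then S else {0}) = {0}" if "\<alpha> \<notin> \<Gamma>" for \<alpha> using that assms by auto
 fix v assume v: "v \<in> S"
 let ?Q = "\<lambda>f. (\<forall>\<alpha>::degree. f \<alpha> \<in> (if \<alpha> = 0 then S else {0})) \<and> finite {\<alpha>. f \<alpha> \<noteq> 0} \<and> v = (\<Sum>\<alpha> | f \<alpha> \<noteq> 0. f \<alpha>)"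
 define g :: "degree => 'a => complex" where "g \<alpha> = (if \<alpha> = 0 then v else 0)" for \<alpha>
 have sub: "{\<alpha>. f \<alpha> \<noteq> 0} \<subseteq> {0}" if "\<forall>\<alpha>::degree. f \<alpha> \<in> (if \<alpha> = 0 then S else {0})" for f
 proof
  fix \<alpha> assume nz: "\<alpha> \<in> {\<alpha>. f \<alpha> \<noteq> 0}"
  have "f \<alpha> \<in> (if \<alpha> = 0 then S else {0})" using that by (rule spec)
  thus "\<alpha> \<in> {0}" using nz by (cases "\<alpha> = 0") simp_all
 qed
 have sum: "(\<Sum>\<alpha> | f \<alpha> \<noteq> 0. f \<alpha>) = f 0" if "\<forall>\<alpha>::degree. f \<alpha> \<in> (if \<alpha> = 0 then S else {0})" for f
 proof -
  have "{\<alpha>. f \<alpha> \<noteq> 0} = (if f 0 = 0 then {} else {0})"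
   using sub[OF that] by (cases "f 0 = 0") (auto simp only: subset_singleton_iff if_True if_False mem_Collect_eq, auto)
  thus ?thesis by (cases "f 0 = 0") simp_all
 qed
 have g: "\<forall>\<alpha>. g \<alpha> \<in> (if \<alpha> = 0 then S else {0})" using v by (simp add: g_def)
 have "g 0 = v" by (simp add: g_def)
 hence "?Q g" using g sum[OF g] finite_subset[OF sub[OF g]] by simp
 moreover have uniq: "f = g" if f: "?Q f" for f
 proof
  fix \<alpha>
  have "f 0 = v" using sum[OF conjunct1[OF f]] conjunct2[OF conjunct2[OF f]] by (rule trans[OF sym sym])
  moreover have "f \<alpha> = 0" if "\<alpha> \<noteq> 0"
  proof -
   have "f \<alpha> \<in> (if \<alpha> = 0 then S else {0})" using conjunct1[OF f] by (rule spec)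
   thus ?thesis using that by simp
  qed
  ultimately show "f \<alpha> = g \<alpha>" by (simp add: g_def)
 qed
 ultimately show "\<exists>!f. ?Q f" by (intro ex1I[of ?Q g])
qed

section \<open>Tensor products of algebras and modules\<close>

interpretation pm: Modules.module pscale
 by standard (auto intro!: poly_mapping_eqI simp: lookup_add algebra_simps)

abbreviation "tspan V W \<equiv> pm.span (tensor_relations V W)"

lemma tensor_class_eq: "tensor_class V W t = {s. s - t \<in> tspan V W}"
 by (simp add: tensor_class_def)

lemma tensor_class_mem: "s \<in> tensor_class V W t \<longleftrightarrow> s - t \<in> tspan V W"
 by (simp add: tensor_class_eq)

lemma tensor_class_self: "t \<in> tensor_class V W t"
 by (simp add: tensor_class_eq pm.span_zero)

lemma tensor_class_iff: "tensor_class V W s = tensor_class V W t \<longleftrightarrow> s - t \<in> tspan V W"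
proof
 assume "tensor_class V W s = tensor_class V W t"
 thus "s - t \<in> tspan V W" using tensor_class_self[of s V W] by (simp add: tensor_class_mem)
next
 assume st: "s - t \<in> tspan V W"
 have "u - s \<in> tspan V W \<longleftrightarrow> u - t \<in> tspan V W" for u
 proof
  assume "u - s \<in> tspan V W"
  from pm.span_add[OF this st] show "u - t \<in> tspan V W" by simp
 next
  assume "u - t \<in> tspan V W"
  from pm.span_diff[OF this st] show "u - s \<in> tspan V W" by simp
 qed
 thus "tensor_class V W s = tensor_class V W t" by (simp add: tensor_class_eq)
qed

lemma UN_const: "(\<And>x. x \<in> A ==> f x = c) ==> A \<noteq> {} ==> (\<Union>x\<in>A. f x) = c"
 by auto

lemma tensor_class_ne: "tensor_class V W t \<noteq> {}"
 using tensor_class_self[of t V W] by blast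

lemma tensor_zero: "\<zero>\<^bsub>tensor_product V W\<^esub> = tensor_class V W 0"
 by (simp add: tensor_product_def)

lemma tensor_add: "tensor_class V W s \<oplus>\<^bsub>tensor_product V W\<^esub> tensor_class V W t = tensor_class V W (s + t)"
proof -
 have "tensor_class V W (s' + t') = tensor_class V W (s + t)"
  if "s' \<in> tensor_class V W s" "t' \<in> tensor_class V W t" for s' t'
  using pm.span_add[of "s' - s" _ "t' - t"] that unfolding tensor_class_iff tensor_class_mem
  by (simp add: algebra_simps)
 thus ?thesis
  unfolding tensor_product_def by (simp add: UN_const tensor_class_ne)
qed

lemma tensor_smult: "c \<odot>\<^bsub>tensor_product V W\<^esub> tensor_class V W t = tensor_class V W (pscale c t)"
proof -
 have "tensor_class V W (pscale c t') = tensor_class V W (pscale c t)" if "t' \<in> tensor_class V W t" for t'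
  using pm.span_scale[of "t' - t" _ c] that unfolding tensor_class_iff tensor_class_mem
  by (simp add: pm.scale_right_diff_distrib)
 thus ?thesis
  unfolding tensor_product_def by (simp add: UN_const tensor_class_ne)
qed

lemma tensor_carrier:
 "carrier (tensor_product V W) = {tensor_class V W t |t. keys t \<subseteq> carrier V \<times> carrier W}"
 by (simp add: tensor_product_def)

lemma keys_diff_sub: "keys s \<subseteq> A ==> keys t \<subseteq> A ==> keys (s - t) \<subseteq> A"
 by (auto simp: in_keys_iff lookup_minus) (metis diff_zero in_keys_iff subsetD)

lemma keys_add_sub: "keys s \<subseteq> A ==> keys t \<subseteq> A ==> keys (s + t) \<subseteq> A"
 using keys_add[of s t] by auto

lemma keys_sum_sub: "(\<And>i. i \<in> B ==> keys (f i) \<subseteq> A) ==> keys (\<Sum>i\<in>B. f i) \<subseteq> A"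
 by (induction B rule: infinite_finite_induct) (auto dest: subsetD[OF keys_add])

lemma keys_pscale_sub: "keys s \<subseteq> A ==> keys (pscale c s) \<subseteq> A"
 using keys_pscale[of c s] by auto

lemma keys_single_sub: "k \<in> A ==> keys (single k c) \<subseteq> A"
 by simp

lemma tensor_relationsE:
 assumes "r \<in> tensor_relations V W"
 obtains v v' w where "v \<in> carrier V" "v' \<in> carrier V" "w \<in> carrier W"
   "r = single (v \<oplus>\<^bsub>V\<^esub> v', w) 1 - single (v, w) 1 - single (v', w) 1"
  | v w w' where "v \<in> carrier V" "w \<in> carrier W" "w' \<in> carrier W"
   "r = single (v, w \<oplus>\<^bsub>W\<^esub> w') 1 - single (v, w) 1 - single (v, w') 1"
  | c v w where "v \<in> carrier V" "w \<in> carrier W"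
   "r = single (c \<odot>\<^bsub>V\<^esub> v, w) 1 - single (v, w) c"
  | c v w where "v \<in> carrier V" "w \<in> carrier W"
   "r = single (v, c \<odot>\<^bsub>W\<^esub> w) 1 - single (v, w) c"
 using assms unfolding tensor_relations_def by blast

lemma tspan_keys:
 assumes V: "\<And>v w. v \<in> carrier V ==> w \<in> carrier V ==> v \<oplus>\<^bsub>V\<^esub> w \<in> carrier V" "\<And>c v. v \<in> carrier V ==> c \<odot>\<^bsub>V\<^esub> v \<in> carrier V"
  and W: "\<And>v w. v \<in> carrier W ==> w \<in> carrier W ==> v \<oplus>\<^bsub>W\<^esub> w \<in> carrier W" "\<And>c v. v \<in> carrier W ==> c \<odot>\<^bsub>W\<^esub> v \<in> carrier W"
  and t: "t \<in> tspan V W"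
 shows "keys t \<subseteq> carrier V \<times> carrier W"
proof -
 let ?A = "carrier V \<times> carrier W"
 have "pm.subspace {t. keys t \<subseteq> ?A}"
  by (rule pm.subspaceI) (simp_all add: keys_add_sub keys_pscale_sub)
 moreover have "keys r \<subseteq> ?A" if "r \<in> tensor_relations V W" for r
  using that
  by (cases rule: tensor_relationsE)
    (simp_all only:, (intro keys_diff_sub keys_single_sub; simp add: V W)+)
 hence "tensor_relations V W \<subseteq> {t. keys t \<subseteq> ?A}" by blast
 ultimately have "tspan V W \<subseteq> {t. keys t \<subseteq> ?A}" by (rule pm.span_minimal[rotated])
 thus ?thesis using t by blast
qed

text \<open>The universal property of the tensor product: bilinearity of h says that its extension
  kills each defining relation.\<close>

lemma lext_tspan:
 assumes add1: "\<And>v v' w. v \<in> carrier V ==> v' \<in> carrier V ==> w \<in> carrier W ==> h (v \<oplus>\<^bsub>V\<^esub> v', w) = h (v, w) + h (v', w)"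
  and add2: "\<And>v w w'. v \<in> carrier V ==> w \<in> carrier W ==> w' \<in> carrier W ==> h (v, w \<oplus>\<^bsub>W\<^esub> w') = h (v, w) + h (v, w')"
  and sc1: "\<And>c v w. v \<in> carrier V ==> w \<in> carrier W ==> h (c \<odot>\<^bsub>V\<^esub> v, w) = sc c (h (v, w))"
  and sc2: "\<And>c v w. v \<in> carrier V ==> w \<in> carrier W ==> h (v, c \<odot>\<^bsub>W\<^esub> w) = sc c (h (v, w))"
  and t: "t \<in> tspan V W"
 shows "lext h t = 0"
proof -
 have "pm.subspace {t. lext h t = 0}"
  by (rule pm.subspaceI) (simp_all add: lext_add lext_pscale)
 moreover have "tensor_relations V W \<subseteq> {t. lext h t = 0}"
  unfolding tensor_relations_def using assms(1-4) by (auto simp: lext_diff)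
 ultimately have "tspan V W \<subseteq> {t. lext h t = 0}" by (rule pm.span_minimal[rotated])
 thus ?thesis using t by blast
qed

lemma bilinear_extension_superset:
 assumes "finite A" "keys s \<subseteq> A" "finite B" "keys t \<subseteq> B"
 shows "bilinear_extension h s t =
  (\<Sum>a\<in>A. \<Sum>b\<in>B. single (h a b) (lookup s a * lookup t b))"
proof -
 have "(\<Sum>a\<in>keys s. \<Sum>b\<in>B. single (h a b) (lookup s a * lookup t b))
   = (\<Sum>a\<in>A. \<Sum>b\<in>B. single (h a b) (lookup s a * lookup t b))"
  by (rule sum.mono_neutral_left) (use assms in \<open>auto simp: in_keys_iff\<close>)
 moreover have "(\<Sum>b\<in>keys t. single (h a b) (lookup s a * lookup t b))
   = (\<Sum>b\<in>B. single (h a b) (lookup s a * lookup t b))" for a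
  by (rule sum.mono_neutral_left) (use assms in \<open>auto simp: in_keys_iff\<close>)
 ultimately show ?thesis by (simp add: bilinear_extension_def)
qed

lemma bilinear_extension_add_left: "bilinear_extension h (s + s') t = bilinear_extension h s t + bilinear_extension h s' t"
proof -
 let ?A = "keys s \<union> keys s'" and ?B = "keys t"
 have *: "bilinear_extension h u t = (\<Sum>a\<in>?A. \<Sum>b\<in>?B. single (h a b) (lookup u a * lookup t b))"
  if "keys u \<subseteq> ?A" for u using that by (intro bilinear_extension_superset) auto
 show ?thesis using keys_add[of s s'] by (simp add: * lookup_add distrib_right single_add sum.distrib)
qed

lemma bilinear_extension_add_right: "bilinear_extension h s (t + t') = bilinear_extension h s t + bilinear_extension h s t'"
proof -
 let ?A = "keys s" and ?B = "keys t \<union> keys t'"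
 have *: "bilinear_extension h s u = (\<Sum>a\<in>?A. \<Sum>b\<in>?B. single (h a b) (lookup s a * lookup u b))"
  if "keys u \<subseteq> ?B" for u using that by (intro bilinear_extension_superset) auto
 show ?thesis using keys_add[of t t'] by (simp add: * lookup_add distrib_left single_add sum.distrib)
qed

lemma pscale_single: "pscale c (single k d) = single k (c * d)"
 by (rule poly_mapping_eqI) (auto simp: lookup_single when_def)

lemma pscale_sum: "pscale c (\<Sum>i\<in>A. f i) = (\<Sum>i\<in>A. pscale c (f i))"
 by (rule poly_mapping_eqI) (simp add: lookup_sum sum_distrib_left)

lemma bilinear_extension_scale_left: "bilinear_extension h (pscale c s) t = pscale c (bilinear_extension h s t)"
 using keys_pscale[of c s]
 by (simp add: bilinear_extension_superset[of "keys s" _ "keys t"] pscale_sum pscale_single mult.assoc)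

lemma bilinear_extension_scale_right: "bilinear_extension h s (pscale c t) = pscale c (bilinear_extension h s t)"
 using keys_pscale[of c t]
 by (simp add: bilinear_extension_superset[of "keys s" _ "keys t"] pscale_sum pscale_single mult_ac)

lemma bilinear_extension_single [simp]:
 "bilinear_extension h (single a c) (single b d) = single (h a b) (c * d)"
 by (simp add: bilinear_extension_superset[of "{a}" _ "{b}"])

lemma bilinear_extension_0 [simp]: "bilinear_extension h 0 t = 0" "bilinear_extension h s 0 = 0"
 by (simp_all add: bilinear_extension_def)

lemma bilinear_extension_diff_left: "bilinear_extension h (s - s') t = bilinear_extension h s t - bilinear_extension h s' t"
 using bilinear_extension_add_left[of h "s - s'" s' t] by (simp add: algebra_simps)

lemma bilinear_extension_diff_right: "bilinear_extension h s (t - t') = bilinear_extension h s t - bilinear_extension h s t'"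
 using bilinear_extension_add_right[of h s "t - t'" t'] by (simp add: algebra_simps)

lemma bilinear_extension_keys:
 assumes "\<And>a b. a \<in> keys s ==> b \<in> keys t ==> h a b \<in> A"
 shows "keys (bilinear_extension h s t) \<subseteq> A"
 unfolding bilinear_extension_def using assms by (intro keys_sum_sub keys_single_sub)

lemma lext_bilinear_extension:
 "lext g (bilinear_extension h s t) = lext (\<lambda>a. lext (\<lambda>b. g (h a b)) t) s"
 unfolding bilinear_extension_def lext_sum lext_single by (simp add: lext_def sc_sum)

text \<open>Linearity in both arguments reduces well-definedness of a product of tensors to a
  defining relation times a single basis element.\<close>

lemma bilinear_extension_induct_left:
 assumes s: "s \<in> tspan V W"
  and rel: "\<And>r k. r \<in> tensor_relations V W ==> k \<in> keys t ==>
   bilinear_extension h r (single k 1) \<in> tspan V' W'"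
 shows "bilinear_extension h s t \<in> tspan V' W'"
proof -
 have "pm.subspace {s. bilinear_extension h s t \<in> tspan V' W'}"
  by (rule pm.subspaceI)
    (simp_all add: bilinear_extension_add_left bilinear_extension_scale_left pm.span_zero pm.span_add pm.span_scale)
 moreover have "bilinear_extension h r t \<in> tspan V' W'" if r: "r \<in> tensor_relations V W" for r
 proof -
  have "bilinear_extension h r t = bilinear_extension h r
    (\<Sum>k\<in>keys t. pscale (lookup t k) (single k 1))"
   using poly_mapping_expand[of t] by (simp add: pscale_single)
  also have "\<dots> = (\<Sum>k\<in>keys t. pscale (lookup t k) (bilinear_extension h r (single k 1)))"
  proof -
   have "bilinear_extension h r (\<Sum>k\<in>K. pscale (c k) (single k 1))
    = (\<Sum>k\<in>K. pscale (c k) (bilinear_extension h r (single k 1)))" for K c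
    by (induction K rule: infinite_finite_induct)
      (simp_all add: bilinear_extension_add_right bilinear_extension_scale_right[symmetric])
   thus ?thesis .
  qed
  also have "\<dots> \<in> tspan V' W'" using rel[OF r] by (intro pm.span_sum pm.span_scale)
  finally show ?thesis .
 qed
 hence "tensor_relations V W \<subseteq> {s. bilinear_extension h s t \<in> tspan V' W'}" by blast
 ultimately have "tspan V W \<subseteq> {s. bilinear_extension h s t \<in> tspan V' W'}" by (rule pm.span_minimal[rotated])
 thus ?thesis using s by blast
qed

lemma bilinear_extension_swap: "bilinear_extension h s t = bilinear_extension (\<lambda>b a. h a b) t s"
 unfolding bilinear_extension_def by (subst sum.swap) (simp add: mult.commute)

lemma bilinear_extension_induct_right:
 assumes "t \<in> tspan V W"
  and "\<And>r k. r \<in> tensor_relations V W ==> k \<in> keys s ==>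
   bilinear_extension h (single k 1) r \<in> tspan V' W'"
 shows "bilinear_extension h s t \<in> tspan V' W'"
 using bilinear_extension_induct_left[of t V W s "\<lambda>b a. h a b" V' W'] assms
 by (simp add: bilinear_extension_swap[of h])

lemma tensor_relationsI:
 "v \<in> carrier V ==> v' \<in> carrier V ==> w \<in> carrier W ==>
  single (v \<oplus>\<^bsub>V\<^esub> v', w) 1 - single (v, w) 1 - single (v', w) 1 \<in> tensor_relations V W"
 "v \<in> carrier V ==> w \<in> carrier W ==> w' \<in> carrier W ==>
  single (v, w \<oplus>\<^bsub>W\<^esub> w') 1 - single (v, w) 1 - single (v, w') 1 \<in> tensor_relations V W"
 "v \<in> carrier V ==> w \<in> carrier W ==> single (c \<odot>\<^bsub>V\<^esub> v, w) 1 - single (v, w) c \<in> tensor_relations V W"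
 "v \<in> carrier V ==> w \<in> carrier W ==> single (v, c \<odot>\<^bsub>W\<^esub> w) 1 - single (v, w) c \<in> tensor_relations V W"
 unfolding tensor_relations_def by blast+

text \<open>The part of the algebra axioms that makes the product of \<open>U \<otimes> U'\<close> well defined.\<close>

definition distr_algebra :: "('r, 'y) graded_scheme => bool" where
 "distr_algebra U \<longleftrightarrow> alg_closed U \<and>
  (\<forall>a\<in>carrier U. \<forall>b\<in>carrier U. \<forall>c\<in>carrier U.
   (a \<oplus>\<^bsub>U\<^esub> b) \<otimes>\<^bsub>U\<^esub> c = a \<otimes>\<^bsub>U\<^esub> c \<oplus>\<^bsub>U\<^esub> b \<otimes>\<^bsub>U\<^esub> c \<and> c \<otimes>\<^bsub>U\<^esub> (a \<oplus>\<^bsub>U\<^esub> b) = c \<otimes>\<^bsub>U\<^esub> a \<oplus>\<^bsub>U\<^esub> c \<otimes>\<^bsub>U\<^esub> b) \<and>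
  (\<forall>k. \<forall>a\<in>carrier U. \<forall>c\<in>carrier U.
   (k \<odot>\<^bsub>U\<^esub> a) \<otimes>\<^bsub>U\<^esub> c = k \<odot>\<^bsub>U\<^esub> (a \<otimes>\<^bsub>U\<^esub> c) \<and> c \<otimes>\<^bsub>U\<^esub> (k \<odot>\<^bsub>U\<^esub> a) = k \<odot>\<^bsub>U\<^esub> (c \<otimes>\<^bsub>U\<^esub> a))"

lemma distr_algebraD:
 assumes "distr_algebra U"
 shows "\<one>\<^bsub>U\<^esub> \<in> carrier U" "\<And>a b. a \<in> carrier U ==> b \<in> carrier U ==> a \<oplus>\<^bsub>U\<^esub> b \<in> carrier U"
  "\<And>a b. a \<in> carrier U ==> b \<in> carrier U ==> a \<otimes>\<^bsub>U\<^esub> b \<in> carrier U"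
  "\<And>c a. a \<in> carrier U ==> c \<odot>\<^bsub>U\<^esub> a \<in> carrier U"
  "\<And>a b c. a \<in> carrier U ==> b \<in> carrier U ==> c \<in> carrier U ==> (a \<oplus>\<^bsub>U\<^esub> b) \<otimes>\<^bsub>U\<^esub> c = a \<otimes>\<^bsub>U\<^esub> c \<oplus>\<^bsub>U\<^esub> b \<otimes>\<^bsub>U\<^esub> c"
  "\<And>a b c. a \<in> carrier U ==> b \<in> carrier U ==> c \<in> carrier U ==> c \<otimes>\<^bsub>U\<^esub> (a \<oplus>\<^bsub>U\<^esub> b) = c \<otimes>\<^bsub>U\<^esub> a \<oplus>\<^bsub>U\<^esub> c \<otimes>\<^bsub>U\<^esub> b"
  "\<And>k a c. a \<in> carrier U ==> c \<in> carrier U ==> (k \<odot>\<^bsub>U\<^esub> a) \<otimes>\<^bsub>U\<^esub> c = k \<odot>\<^bsub>U\<^esub> (a \<otimes>\<^bsub>U\<^esub> c)"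
  "\<And>k a c. a \<in> carrier U ==> c \<in> carrier U ==> c \<otimes>\<^bsub>U\<^esub> (k \<odot>\<^bsub>U\<^esub> a) = k \<odot>\<^bsub>U\<^esub> (c \<otimes>\<^bsub>U\<^esub> a)"
 using assms unfolding distr_algebra_def alg_closed_def by simp_all

locale tensor_algebra =
 fixes U :: "'r graded" and U' :: "'s graded"
 assumes U: "distr_algebra U" and U': "distr_algebra U'"
begin

abbreviation "UT \<equiv> tensor_product U U'"

abbreviation "cl \<equiv> tensor_class U U'"

definition good :: "('r \<times> 's \<Rightarrow>\<^sub>0 complex) => bool" where
 "good s \<longleftrightarrow> keys s \<subseteq> carrier U \<times> carrier U'"

abbreviation "mm \<equiv> (\<lambda>(a, b) (a', b'). (a \<otimes>\<^bsub>U\<^esub> a', b \<otimes>\<^bsub>U'\<^esub> b'))"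

lemma good_add: "good s ==> good t ==> good (s + t)"
 and good_scale: "good s ==> good (pscale c s)"
 and good_single: "a \<in> carrier U ==> b \<in> carrier U' ==> good (single (a, b) c)"
 unfolding good_def by (simp_all add: keys_add_sub keys_pscale_sub)

lemma goodD: "good s ==> (a, b) \<in> keys s ==> a \<in> carrier U \<and> b \<in> carrier U'"
 unfolding good_def by blast

lemma good_mult:
 assumes "good s" "good t"
 shows "good (bilinear_extension mm s t)"
 unfolding good_def
proof (rule bilinear_extension_keys)
 fix x y assume "x \<in> keys s" "y \<in> keys t"
 thus "mm x y \<in> carrier U \<times> carrier U'"
  using goodD[OF assms(1)] goodD[OF assms(2)] distr_algebraD(3)[OF U] distr_algebraD(3)[OF U']
  by (cases x; cases y) simp
qed

lemma good_mem: "good t ==> s \<in> cl t ==> good s"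
 using tspan_keys[of U U' "s - t"] distr_algebraD(2,4)[OF U] distr_algebraD(2,4)[OF U']
  keys_add_sub[of "s - t" "carrier U \<times> carrier U'" t]
 by (simp add: tensor_class_mem good_def)

lemma UT_carrier: "carrier UT = {cl t |t. good t}"
 by (simp add: tensor_carrier good_def)

lemma UT_mult_left:
 assumes "s \<in> tspan U U'" "good t"
 shows "bilinear_extension mm s t \<in> tspan U U'"
proof (rule bilinear_extension_induct_left[OF assms(1)])
 fix r k assume r: "r \<in> tensor_relations U U'" and k: "k \<in> keys t"
 obtain c d where k: "k = (c, d)" "c \<in> carrier U" "d \<in> carrier U'"
  using assms(2) k by (cases k) (auto simp: good_def)
 from r show "bilinear_extension mm r (single k 1) \<in> tspan U U'"
  by (cases rule: tensor_relationsE)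
    (use k distr_algebraD[OF U] distr_algebraD[OF U'] in
    \<open>auto simp: bilinear_extension_diff_left intro!: pm.span_base tensor_relationsI\<close>)
qed

lemma UT_mult_right:
 assumes "t \<in> tspan U U'" "good s"
 shows "bilinear_extension mm s t \<in> tspan U U'"
proof (rule bilinear_extension_induct_right[OF assms(1)])
 fix r k assume r: "r \<in> tensor_relations U U'" and k: "k \<in> keys s"
 obtain c d where k: "k = (c, d)" "c \<in> carrier U" "d \<in> carrier U'"
  using assms(2) k by (cases k) (auto simp: good_def)
 from r show "bilinear_extension mm (single k 1) r \<in> tspan U U'"
  by (cases rule: tensor_relationsE)
    (use k distr_algebraD[OF U] distr_algebraD[OF U'] in
    \<open>auto simp: bilinear_extension_diff_right intro!: pm.span_base tensor_relationsI\<close>)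
qed

lemma UT_mult:
 assumes "good s" "good t"
 shows "cl s \<otimes>\<^bsub>UT\<^esub> cl t = cl (bilinear_extension mm s t)"
proof -
 have "cl (bilinear_extension mm s' t') = cl (bilinear_extension mm s t)" if s': "s' \<in> cl s" and t': "t' \<in> cl t" for s' t'
 proof -
  have "bilinear_extension mm (s' - s) t' \<in> tspan U U'"
   using s' good_mem[OF assms(2) t'] by (intro UT_mult_left) (auto simp: tensor_class_mem)
  moreover have "bilinear_extension mm s (t' - t) \<in> tspan U U'"
   using t' assms by (intro UT_mult_right) (auto simp: tensor_class_mem)
  ultimately have "bilinear_extension mm (s' - s) t' + bilinear_extension mm s (t' - t) \<in> tspan U U'"
   by (rule pm.span_add)
  thus ?thesis
   by (simp add: tensor_class_iff bilinear_extension_diff_left bilinear_extension_diff_right)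
 qed
 thus ?thesis
  unfolding tensor_product_def by (simp add: UN_const tensor_class_ne)
qed

lemma UT_alg_closed: "alg_closed UT"
proof -
 have "\<one>\<^bsub>UT\<^esub> = cl (single (\<one>\<^bsub>U\<^esub>, \<one>\<^bsub>U'\<^esub>) 1)"
  by (simp add: tensor_product_def pure_tensor_def)
 moreover have "good (single (\<one>\<^bsub>U\<^esub>, \<one>\<^bsub>U'\<^esub>) 1)"
  using distr_algebraD(1)[OF U] distr_algebraD(1)[OF U'] by (rule good_single)
 ultimately have "\<one>\<^bsub>UT\<^esub> \<in> carrier UT" unfolding UT_carrier by blast
 moreover have "cl s \<oplus>\<^bsub>UT\<^esub> cl t \<in> carrier UT" "cl s \<otimes>\<^bsub>UT\<^esub> cl t \<in> carrier UT" "c \<odot>\<^bsub>UT\<^esub> cl s \<in> carrier UT"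
  if "good s" "good t" for s t c
  using that good_add good_mult good_scale unfolding tensor_add UT_mult[OF that] tensor_smult UT_carrier by blast+
 ultimately show ?thesis unfolding alg_closed_def UT_carrier by blast
qed

lemma UT_hcomp: "hcomp UT \<gamma> \<subseteq> carrier UT"
 unfolding tensor_product_def by auto

end

text \<open>Two commuting actions on one space S, which combine into an action of the tensor product
  of the algebras.\<close>

locale tensor_rep = tensor_algebra U U' for U :: "'r graded" and U' :: "'s graded" +
 fixes \<rho> :: "'r => 'a fn => 'a => complex" and \<rho>' :: "'s => 'a fn => 'a => complex"
  and S :: "'a fn set"
 assumes S: "subsp S" and rep: "rep U \<rho> S" and rep': "rep U' \<rho>' S"
  and comm: "\<And>a b v. a \<in> carrier U ==> b \<in> carrier U' ==> v \<in> S ==> \<rho> a (\<rho>' b v) = \<rho>' b (\<rho> a v)"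
begin

definition rhat :: "('r \<times> 's \<Rightarrow>\<^sub>0 complex) => 'a fn => 'a => complex" where
 "rhat s v = lext (\<lambda>(a, b). \<rho> a (\<rho>' b v)) s"

definition rr :: "('r \<times> 's \<Rightarrow>\<^sub>0 complex) set => 'a fn => 'a => complex" where
 "rr A = rhat (SOME s. s \<in> A)"

lemma rhat_span: "s \<in> tspan U U' ==> v \<in> S ==> rhat s v = 0"
 unfolding rhat_def by (rule lext_tspan) (auto simp: repD[OF rep] repD[OF rep'])

lemma rhat_mem: "s \<in> cl t ==> v \<in> S ==> rhat s v = rhat t v"
 using rhat_span[of "s - t" v] by (simp add: tensor_class_mem rhat_def lext_diff)

lemma rr_cl: "v \<in> S ==> rr (cl s) v = rhat s v"
 unfolding rr_def by (rule rhat_mem, rule someI[of _ s], rule tensor_class_self)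

lemma rhat_in: "good s ==> v \<in> S ==> rhat s v \<in> S"
 unfolding rhat_def good_def by (rule lext_in[OF S]) (auto simp: repD[OF rep] repD[OF rep'])

lemma rhat_in_sub:
 assumes "good s" "v \<in> T" "subsp T" "\<And>a v. a \<in> carrier U ==> v \<in> T ==> \<rho> a v \<in> T"
  "\<And>b v. b \<in> carrier U' ==> v \<in> T ==> \<rho>' b v \<in> T"
 shows "rhat s v \<in> T"
 unfolding rhat_def using assms(1,2,4,5) by (intro lext_in[OF assms(3)]) (auto simp: good_def)

lemma rhat_mult:
 assumes "good s" "good t" "v \<in> S"
 shows "rhat (bilinear_extension mm s t) v = rhat s (rhat t v)"
proof -
 have "rhat (bilinear_extension mm s t) v
  = lext (\<lambda>x. lext (\<lambda>y. (case mm x y of (a, b) => \<rho> a (\<rho>' b v))) t) s"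
  unfolding rhat_def by (rule lext_bilinear_extension)
 also have "\<dots> = lext (\<lambda>(a, b). \<rho> a (\<rho>' b (rhat t v))) s"
 proof (rule lext_cong)
  fix x assume "x \<in> keys s"
  then obtain a b where x: "x = (a, b)" "a \<in> carrier U" "b \<in> carrier U'"
   using assms(1) by (cases x) (auto simp: good_def)
  \<comment> \<open>Additivity is known on S only, so the induction over K has to carry along that
    the partial sums stay in S.\<close>
  have lin: "\<rho> a (\<rho>' b (\<Sum>k\<in>K. sc (c k) (h k))) = (\<Sum>k\<in>K. sc (c k) (\<rho> a (\<rho>' b (h k))))"
   if "finite K" "\<And>k. k \<in> K ==> h k \<in> S" for K :: "('r \<times> 's) set" and c h
  proof -
   have z: "\<rho> a (\<rho>' b 0) = 0"
    using repD(3)[OF rep x(2), of "\<rho>' b 0" 0] repD(3)[OF rep' x(3), of 0 0] repD(1)[OF rep' x(3)] subsp_0[OF S] by simp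
   define V where "V K = (\<Sum>k\<in>K. sc (c k) (h k))" for K
   have V0: "V {} = 0" by (simp add: V_def)
   have V1: "V (insert k K) = sc (c k) (h k) + V K" if "finite K" "k \<notin> K" for k K
    using that by (simp add: V_def)
   define Q where "Q K \<longleftrightarrow> V K \<in> S \<and> \<rho> a (\<rho>' b (V K)) = (\<Sum>k\<in>K. sc (c k) (\<rho> a (\<rho>' b (h k))))" for K
   have Q0: "Q {}" unfolding Q_def V0 using subsp_0[OF S] z by simp
   have Q1: "Q (insert k K)" if "finite K" "k \<notin> K" "h k \<in> S" "Q K" for k K
   proof -
    have T: "V K \<in> S" using that by (simp add: Q_def)
    have "\<rho> a (\<rho>' b (sc (c k) (h k) + V K)) = sc (c k) (\<rho> a (\<rho>' b (h k))) + \<rho> a (\<rho>' b (V K))"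
     using T that x repD[OF rep] repD[OF rep'] subsp_sc[OF S] by simp
    thus ?thesis
     unfolding Q_def V1[OF that(1,2)] using that(1,2,4) subsp_add[OF S subsp_sc[OF S that(3)] T]
     by (simp add: Q_def)
   qed
   have "Q K" using that by (induction K) (use Q0 Q1 in auto)
   thus ?thesis by (simp add: Q_def V_def)
  qed
  have "\<rho> a (\<rho>' b (rhat t v)) = lext (\<lambda>y. \<rho> a (\<rho>' b (case y of (a', b') => \<rho> a' (\<rho>' b' v)))) t"
   unfolding rhat_def lext_def using assms(2,3) repD(1)[OF rep] repD(1)[OF rep']
   by (intro lin) (auto simp: good_def)
  also have "\<dots> = lext (\<lambda>y. (case mm x y of (a, b) => \<rho> a (\<rho>' b v))) t"
  proof (rule lext_cong)
   fix y assume "y \<in> keys t"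
   then obtain a' b' where y: "y = (a', b')" "a' \<in> carrier U" "b' \<in> carrier U'"
    using assms(2) by (cases y) (auto simp: good_def)
   show "\<rho> a (\<rho>' b (case y of (a', b') => \<rho> a' (\<rho>' b' v))) = (case mm x y of (a, b) => \<rho> a (\<rho>' b v))"
    unfolding x(1) y(1) using x y assms(3) repD[OF rep] repD[OF rep'] comm[of a' b "\<rho>' b' v"] by simp
  qed
  finally show "lext (\<lambda>y. (case mm x y of (a, b) => \<rho> a (\<rho>' b v))) t = (case x of (a, b) => \<rho> a (\<rho>' b (rhat t v)))"
   by (simp add: x(1))
 qed
 finally show ?thesis by (simp add: rhat_def)
qed

lemma rep_rr: "rep UT rr S"
proof -
 have addv: "rhat s (v + w) = rhat s v + rhat s w" if "good s" "v \<in> S" "w \<in> S" for s v w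
 proof -
  have "rhat s (v + w) = lext (\<lambda>k. (case k of (a, b) => \<rho> a (\<rho>' b v)) + (case k of (a, b) => \<rho> a (\<rho>' b w))) s"
   unfolding rhat_def using that repD[OF rep] repD[OF rep'] by (intro lext_cong) (auto simp: good_def)
  thus ?thesis by (simp add: rhat_def lext_def sc_add sum.distrib)
 qed
 have scv: "rhat s (sc c v) = sc c (rhat s v)" if "good s" "v \<in> S" for s c v
 proof -
  have "rhat s (sc c v) = lext (\<lambda>k. sc c (case k of (a, b) => \<rho> a (\<rho>' b v))) s"
   unfolding rhat_def using that repD[OF rep] repD[OF rep'] by (intro lext_cong) (auto simp: good_def)
  thus ?thesis by (simp add: rhat_def lext_def sc_sum mult.commute)
 qed
 have adds: "rhat (s + t) v = rhat s v + rhat t v" and scs: "rhat (pscale c s) v = sc c (rhat s v)" for s t v c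
  by (simp_all add: rhat_def lext_add lext_pscale)
 have one: "rr \<one>\<^bsub>UT\<^esub> v = v" if "v \<in> S" for v
 proof -
  have "\<one>\<^bsub>UT\<^esub> = cl (single (\<one>\<^bsub>U\<^esub>, \<one>\<^bsub>U'\<^esub>) 1)"
   by (simp add: tensor_product_def pure_tensor_def)
  thus ?thesis using that by (simp add: rr_cl rhat_def repD(7)[OF rep] repD(7)[OF rep'])
 qed
 show ?thesis
  unfolding rep_def UT_carrier using one
  by (auto simp: rr_cl rhat_in addv scv tensor_add adds tensor_smult scs UT_mult rhat_mult
    subsp_add[OF S] subsp_sc[OF S])
qed

end

lemma with_action_simps [simp]:
 "carrier (with_action W \<rho>) = carrier W" "monoid.mult (with_action W \<rho>) = monoid.mult W"
 "one (with_action W \<rho>) = one W" "ring.zero (with_action W \<rho>) = ring.zero W"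
 "add (with_action W \<rho>) = add W" "module.smult (with_action W \<rho>) = module.smult W"
 "hcomp (with_action W \<rho>) = hcomp W" "act (with_action W \<rho>) = \<rho>"
 by (simp_all add: with_action_def graded.defs gmodule.defs)

section \<open>Recognising a tensor product of modules by a bilinear map\<close>

context tensor_rep
begin

text \<open>The map \<Phi> is to induce an isomorphism from the tensor product onto Y. Injectivity
  is encoded without bases by \<open>nd\<close>: in a vanishing sum of values of \<Phi>, a left
  vector whose partner is nonzero depends linearly on the other left vectors. The index type of
  \<open>nd\<close> is that of the keys of a tensor.\<close>

context
 fixes V :: "('r, 'v) gmodule" and W :: "('s, 'w) gmodule"
  and \<phi>V :: "'v => 'a => complex" and SV and \<phi>W :: "'w => 'a => complex" and SW
  and \<Phi> :: "'a fn => 'a fn => 'a => complex" and Y :: "'a fn set"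
  and \<delta> :: "'a => degree"
 assumes V: "gmod_model U V \<phi>V SV (\<lambda>\<alpha>. SV \<inter> {v. homog \<delta> \<alpha> v}) \<rho>"
  and W: "gmod_model U' W \<phi>W SW (\<lambda>\<beta>. if \<beta> = 0 then SW else {0}) \<rho>'"
  and add1: "\<And>v v' w. v \<in> SV ==> v' \<in> SV ==> w \<in> SW ==> \<Phi> (v + v') w = \<Phi> v w + \<Phi> v' w"
  and add2: "\<And>v w w'. v \<in> SV ==> w \<in> SW ==> w' \<in> SW ==> \<Phi> v (w + w') = \<Phi> v w + \<Phi> v w'"
  and sc1: "\<And>c v w. v \<in> SV ==> w \<in> SW ==> \<Phi> (sc c v) w = sc c (\<Phi> v w)"
  and sc2: "\<And>c v w. v \<in> SV ==> w \<in> SW ==> \<Phi> v (sc c w) = sc c (\<Phi> v w)"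
  and equiv: "\<And>a b v w. a \<in> carrier U ==> b \<in> carrier U' ==> v \<in> SV ==> w \<in> SW ==>
   \<Phi> (\<rho> a v) (\<rho>' b w) = \<rho> a (\<rho>' b (\<Phi> v w))"
  and nd: "\<And>(I :: ('v \<times> 'w) set) v w j. finite I ==> (\<And>i. i \<in> I ==> v i \<in> SV \<and> w i \<in> SW) ==>
   (\<Sum>i\<in>I. \<Phi> (v i) (w i)) = 0 ==> j \<in> I ==> w j \<noteq> 0 ==> \<exists>c. v j = (\<Sum>i\<in>I - {j}. sc (c i) (v i))"
  and Y: "subsp Y" "Y \<subseteq> S" "\<And>v w. v \<in> SV ==> w \<in> SW ==> \<Phi> v w \<in> Y"
  and Y_least: "\<And>T. subsp T ==> (\<And>v w. v \<in> SV ==> w \<in> SW ==> \<Phi> v w \<in> T) ==> Y \<subseteq> T"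
  and grV: "graded_by \<delta> SV"
  and prj: "\<And>\<alpha> v w. v \<in> SV ==> w \<in> SW ==> prj \<delta> \<alpha> (\<Phi> v w) = \<Phi> (prj \<delta> \<alpha> v) w"
begin

lemmas gV = gmod_modelD[OF V] and gW = gmod_modelD[OF W]
lemmas mV = lin_modelD[OF gV(1)] and mW = lin_modelD[OF gW(1)]

definition "hh = (\<lambda>(v, w). \<Phi> (\<phi>V v) (\<phi>W w))"

definition "phat = lext hh"

lemma phat_span: "t \<in> tspan V W ==> phat t = 0"
 unfolding phat_def hh_def by (rule lext_tspan) (auto simp: mV mW add1 add2 sc1 sc2)

lemma zero_right: "v \<in> carrier V ==> single (v, \<zero>\<^bsub>W\<^esub>) c \<in> tspan V W"
proof -
 assume v: "v \<in> carrier V"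
 have "0 \<odot>\<^bsub>W\<^esub> \<zero>\<^bsub>W\<^esub> = \<zero>\<^bsub>W\<^esub>" by (rule mW(9)) (simp_all add: mW)
 hence "single (v, \<zero>\<^bsub>W\<^esub>) 1 - single (v, \<zero>\<^bsub>W\<^esub>) 0 \<in> tspan V W"
  using tensor_relationsI(4)[OF v mW(3), of 0] by (auto intro: pm.span_base)
 from pm.span_scale[OF this, of c] show ?thesis by (simp add: pscale_single)
qed

text \<open>Permits a linearly dependent left factor to be exchanged for the others modulo the
  relations, as \<open>sum_zero\<close> does.\<close>

lemma combination:
 assumes "finite J" "\<And>i. i \<in> J ==> v i \<in> carrier V" "w \<in> carrier W"
 shows "\<exists>u\<in>carrier V. \<phi>V u = (\<Sum>i\<in>J. sc (c i) (\<phi>V (v i))) \<and>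
  single (u, w) 1 - (\<Sum>i\<in>J. single (v i, w) (c i)) \<in> tspan V W"
proof -
 define Q where "Q J \<longleftrightarrow> (\<exists>u\<in>carrier V. \<phi>V u = (\<Sum>i\<in>J. sc (c i) (\<phi>V (v i))) \<and>
  single (u, w) 1 - (\<Sum>i\<in>J. single (v i, w) (c i)) \<in> tspan V W)" for J
 have Q0: "Q {}"
 proof -
  have "0 \<odot>\<^bsub>V\<^esub> \<zero>\<^bsub>V\<^esub> = \<zero>\<^bsub>V\<^esub>" by (rule mV(9)) (simp_all add: mV)
  hence "single (\<zero>\<^bsub>V\<^esub>, w) 1 - single (\<zero>\<^bsub>V\<^esub>, w) 0 \<in> tspan V W"
   using tensor_relationsI(3)[OF mV(3) assms(3), of 0] by (auto intro: pm.span_base)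
  thus ?thesis unfolding Q_def using mV(3,4) by (intro bexI[of _ "\<zero>\<^bsub>V\<^esub>"]) simp_all
 qed
 have Q1: "Q (insert i J)" if i: "finite J" "i \<notin> J" "v i \<in> carrier V" "Q J" for i J
 proof -
  obtain u where u: "u \<in> carrier V" "\<phi>V u = (\<Sum>i\<in>J. sc (c i) (\<phi>V (v i)))"
   "single (u, w) 1 - (\<Sum>i\<in>J. single (v i, w) (c i)) \<in> tspan V W"
   using i(4) unfolding Q_def by blast
  let ?x = "c i \<odot>\<^bsub>V\<^esub> v i"
  have x: "?x \<in> carrier V" by (rule mV(7)[OF i(3)])
  have a: "single (?x \<oplus>\<^bsub>V\<^esub> u, w) 1 - single (?x, w) 1 - single (u, w) 1 \<in> tspan V W"
   by (rule pm.span_base, rule tensor_relationsI(1)[OF x u(1) assms(3)])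
  have b: "single (?x, w) 1 - single (v i, w) (c i) \<in> tspan V W"
   by (rule pm.span_base, rule tensor_relationsI(3)[OF i(3) assms(3)])
  have "single (?x \<oplus>\<^bsub>V\<^esub> u, w) 1 - (\<Sum>i\<in>insert i J. single (v i, w) (c i)) \<in> tspan V W"
   using pm.span_add[OF pm.span_add[OF a b] u(3)] i(1,2) by (simp add: algebra_simps)
  moreover have "\<phi>V (?x \<oplus>\<^bsub>V\<^esub> u) = (\<Sum>i\<in>insert i J. sc (c i) (\<phi>V (v i)))"
   using i(1,2,3) u(1,2) x by (simp add: mV)
  ultimately show ?thesis unfolding Q_def using mV(5)[OF x u(1)] by blast
 qed
 have "Q J" using assms(1,2) by (induction J) (use Q0 Q1 in auto)
 thus ?thesis by (simp add: Q_def)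
qed

lemma SV_sum: "finite J ==> (\<And>i. i \<in> J ==> v i \<in> SV) ==> w \<in> SW ==>
 \<Phi> (\<Sum>i\<in>J. sc (c i) (v i)) w = (\<Sum>i\<in>J. sc (c i) (\<Phi> (v i) w))"
proof -
 assume J: "finite J" "\<And>i. i \<in> J ==> v i \<in> SV" and w: "w \<in> SW"
 have z: "\<Phi> 0 w = 0" using sc1[of 0 w 0] subsp_0[OF mV(1)] w by simp
 define Q where "Q J \<longleftrightarrow> \<Phi> (\<Sum>i\<in>J. sc (c i) (v i)) w = (\<Sum>i\<in>J. sc (c i) (\<Phi> (v i) w))" for J
 have Q1: "Q (insert i J)" if "finite J" "i \<notin> J" "\<forall>i\<in>insert i J. v i \<in> SV" "Q J" for i J
 proof -
  have "(\<Sum>i\<in>J. sc (c i) (v i)) \<in> SV" using that by (intro subsp_sum subsp_sc mV(1)) auto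
  thus ?thesis using that w add1 sc1 subsp_sc[OF mV(1)] by (simp add: Q_def)
 qed
 have "(\<forall>i\<in>J. v i \<in> SV) \<longrightarrow> Q J" using J(1)
  by (induction J) (use z Q1 in \<open>auto simp: Q_def\<close>)
 thus ?thesis using J(2) by (simp add: Q_def)
qed

text \<open>Induction on the number of summands. If all right factors vanish, the claim is clear.
  Otherwise \<open>nd\<close> expresses one \<open>v j\<close> by the other left factors, and its
  summand is absorbed by them.\<close>

lemma sum_zero:
 fixes v :: "'v \<times> 'w => 'v" and w :: "'v \<times> 'w => 'w"
 assumes "finite I" "\<And>i. i \<in> I ==> v i \<in> carrier V" "\<And>i. i \<in> I ==> w i \<in> carrier W"
  "(\<Sum>i\<in>I. hh (v i, w i)) = 0"
 shows "(\<Sum>i\<in>I. single (v i, w i) 1) \<in> tspan V W"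
proof -
 define Q where "Q I w \<longleftrightarrow> (finite I \<longrightarrow> (\<forall>i\<in>I. v i \<in> carrier V \<and> w i \<in> carrier W) \<longrightarrow>
  (\<Sum>i\<in>I. hh (v i, w i)) = 0 \<longrightarrow> (\<Sum>i\<in>I. single (v i, w i) 1) \<in> tspan V W)"
  for I and w :: "'v \<times> 'w => 'w"
 have step: "Q I w" if IH: "\<And>I w. card I = k ==> Q I w" and card: "card I = Suc k" for I w k
  unfolding Q_def
 proof (intro impI)
  assume fin: "finite I" and car: "\<forall>i\<in>I. v i \<in> carrier V \<and> w i \<in> carrier W" and z: "(\<Sum>i\<in>I. hh (v i, w i)) = 0"
  show "(\<Sum>i\<in>I. single (v i, w i) 1) \<in> tspan V W"
  proof (cases "\<forall>i\<in>I. w i = \<zero>\<^bsub>W\<^esub>")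
   case True
   thus ?thesis using car zero_right by (intro pm.span_sum) simp
  next
   case False
   then obtain j where j: "j \<in> I" "w j \<noteq> \<zero>\<^bsub>W\<^esub>" by blast
   have wj: "w j \<in> carrier W" "v j \<in> carrier V" using car j by auto
   have "\<phi>W (w j) \<noteq> 0" using j(2) mW(9)[OF wj(1) mW(3)] mW(4) by auto
   moreover have "(\<Sum>i\<in>I. \<Phi> (\<phi>V (v i)) (\<phi>W (w i))) = 0" using z by (simp add: hh_def)
   ultimately obtain c where c: "\<phi>V (v j) = (\<Sum>i\<in>I - {j}. sc (c i) (\<phi>V (v i)))"
    using nd[OF fin, of "\<lambda>i. \<phi>V (v i)" "\<lambda>i. \<phi>W (w i)" j] j car mV(10) mW(10) by blast
   let ?J = "I - {j}"
   \<comment> \<open>The right factors after substituting the expression of \<open>v j\<close> and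
     collecting by left factors.\<close>
   define w' where "w' i = w i \<oplus>\<^bsub>W\<^esub> (c i \<odot>\<^bsub>W\<^esub> w j)" for i
   have finJ: "finite ?J" and carJ: "\<And>i. i \<in> ?J ==> v i \<in> carrier V" using fin car by auto
   have w'c: "w' i \<in> carrier W" if "i \<in> ?J" for i
    unfolding w'_def using that car wj by (intro mW(5,7)) auto
   obtain u where u: "u \<in> carrier V" "\<phi>V u = (\<Sum>i\<in>?J. sc (c i) (\<phi>V (v i)))"
    "single (u, w j) 1 - (\<Sum>i\<in>?J. single (v i, w j) (c i)) \<in> tspan V W"
    using combination[where J = ?J and v = v and w = "w j" and c = c, OF finJ carJ wj(1)] by blast
   have uv: "u = v j" using mV(9)[OF u(1) wj(2)] u(2) c by simp
   have hw': "hh (v i, w' i) = hh (v i, w i) + sc (c i) (hh (v i, w j))" if "i \<in> ?J" for i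
   proof -
    have "v i \<in> carrier V" "w i \<in> carrier W" using that car by auto
    hence "\<phi>V (v i) \<in> SV" "\<phi>W (w i) \<in> SW" "\<phi>W (w j) \<in> SW" "\<phi>W (w' i) = \<phi>W (w i) + sc (c i) (\<phi>W (w j))"
     using mV(10) mW(10) wj mW(6)[of "w i" "c i \<odot>\<^bsub>W\<^esub> w j"] mW(7,8)[OF wj(1), of "c i"] by (simp_all add: w'_def)
    thus ?thesis
     unfolding hh_def using add2[OF _ _ subsp_sc[OF mW(1)]] sc2 by simp
   qed
   have "hh (v j, w j) = (\<Sum>i\<in>?J. sc (c i) (hh (v i, w j)))"
    unfolding hh_def using SV_sum[OF finJ, where v = "\<lambda>i. \<phi>V (v i)" and w = "\<phi>W (w j)" and c = c] carJ wj mV(10) mW(10) c by simp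
   hence "(\<Sum>i\<in>?J. hh (v i, w' i)) = (\<Sum>i\<in>?J. hh (v i, w i)) + hh (v j, w j)"
    using hw' by (simp add: sum.distrib)
   also have "\<dots> = (\<Sum>i\<in>I. hh (v i, w i))" using sum.remove[OF fin j(1), of "\<lambda>i. hh (v i, w i)"] by (simp add: add.commute)
   finally have "(\<Sum>i\<in>?J. hh (v i, w' i)) = 0" using z by simp
   moreover have "card ?J = k" using card j fin by simp
   ultimately have A: "(\<Sum>i\<in>?J. single (v i, w' i) 1) \<in> tspan V W"
    using IH[of ?J w'] finJ carJ w'c by (simp add: Q_def)
   have "single (v i, w' i) 1 - single (v i, w i) 1 - single (v i, w j) (c i) \<in> tspan V W"
    if "i \<in> ?J" for i
   proof -
    have vi: "v i \<in> carrier V" "w i \<in> carrier W" using that car by auto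
    have "single (v i, w' i) 1 - single (v i, w i) 1 - single (v i, c i \<odot>\<^bsub>W\<^esub> w j) 1 \<in> tspan V W"
     unfolding w'_def by (rule pm.span_base, rule tensor_relationsI(2)[OF vi mW(7)[OF wj(1)]])
    moreover have "single (v i, c i \<odot>\<^bsub>W\<^esub> w j) 1 - single (v i, w j) (c i) \<in> tspan V W"
     by (rule pm.span_base, rule tensor_relationsI(4)[OF vi(1) wj(1)])
    ultimately have "single (v i, w' i) 1 - single (v i, w i) 1 - single (v i, c i \<odot>\<^bsub>W\<^esub> w j) 1
      + (single (v i, c i \<odot>\<^bsub>W\<^esub> w j) 1 - single (v i, w j) (c i)) \<in> tspan V W"
     by (rule pm.span_add)
    thus ?thesis by simp
   qed
   hence Bq: "(\<Sum>i\<in>?J. single (v i, w' i) 1 - single (v i, w i) 1 - single (v i, w j) (c i)) \<in> tspan V W"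
    by (rule pm.span_sum)
   have "(\<Sum>i\<in>I. single (v i, w i) 1) = single (v j, w j) 1 + (\<Sum>i\<in>?J. single (v i, w i) 1)"
    using fin j(1) by (rule sum.remove)
   also have "\<dots> = (\<Sum>i\<in>?J. single (v i, w' i) 1)
    - (\<Sum>i\<in>?J. single (v i, w' i) 1 - single (v i, w i) 1 - single (v i, w j) (c i))
    + (single (v j, w j) 1 - (\<Sum>i\<in>?J. single (v i, w j) (c i)))"
    by (simp add: sum_subtractf)
   also have "\<dots> \<in> tspan V W"
    by (rule pm.span_add[OF pm.span_diff[OF A Bq] u(3)[unfolded uv]])
   finally show ?thesis .
  qed
 qed
 have "\<forall>I w. card I = k \<longrightarrow> Q I w" for k
 proof (induction k)
  case 0
  have "Q I w" if "card I = 0" for I w using that by (auto simp: Q_def pm.span_zero)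
  thus ?case by blast
 next
  case (Suc k)
  thus ?case using step by blast
 qed
 hence "Q I w" by blast
 thus ?thesis using assms by (simp add: Q_def)
qed

definition tgood :: "('v \<times> 'w \<Rightarrow>\<^sub>0 complex) => bool" where
 "tgood t \<longleftrightarrow> keys t \<subseteq> carrier V \<times> carrier W"

lemma tgoodD: "tgood t ==> k \<in> keys t ==> fst k \<in> carrier V \<and> snd k \<in> carrier W"
 by (auto simp: tgood_def)

text \<open>Absorbing the coefficients of t into the left factors changes it by relations only and
  produces a sum of pure tensors as in \<open>sum_zero\<close>.\<close>

lemma phat_inj:
 assumes t: "tgood t" and z: "phat t = 0"
 shows "t \<in> tspan V W"
proof -
 let ?K = "keys t" and ?l = "lookup t"
 define v where "v k = ?l k \<odot>\<^bsub>V\<^esub> fst k" for k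
 have vc: "v k \<in> carrier V" "snd k \<in> carrier W" "fst k \<in> carrier V" if "k \<in> ?K" for k
  unfolding v_def using tgoodD[OF t that] mV(7) by auto
 let ?s = "\<Sum>k\<in>?K. single (v k, snd k) 1"
 have "single (v k, snd k) 1 - single k (?l k) \<in> tspan V W" if "k \<in> ?K" for k
  using pm.span_base[OF tensor_relationsI(3)[OF vc(3,2)[OF that], of "?l k"]] by (simp add: v_def)
 hence "(\<Sum>k\<in>?K. single (v k, snd k) 1 - single k (?l k)) \<in> tspan V W"
  by (rule pm.span_sum)
 hence st: "?s - t \<in> tspan V W"
  using poly_mapping_expand[of t] by (simp add: sum_subtractf)
 from phat_span[OF this] have "phat ?s = phat t" by (simp add: phat_def lext_diff)
 hence "(\<Sum>k\<in>?K. hh (v k, snd k)) = 0" using z by (simp add: phat_def lext_sum)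
 hence "?s \<in> tspan V W" by (intro sum_zero) (use vc in auto)
 from pm.span_diff[OF this st] show ?thesis by simp
qed

lemma phat_in: "tgood t ==> phat t \<in> Y"
 unfolding phat_def using tgoodD[of t] Y(3) mV(10) mW(10) by (intro lext_in[OF Y(1)]) (auto simp: hh_def)

definition "ph A = phat (SOME t. t \<in> A)"

lemma phat_mem: "s \<in> tensor_class V W t ==> phat s = phat t"
 using phat_span[of "s - t"] by (simp add: tensor_class_mem phat_def lext_diff)

lemma ph_class: "ph (tensor_class V W t) = phat t"
 unfolding ph_def by (rule phat_mem, rule someI[of _ t], rule tensor_class_self)

lemma tgood_diff: "tgood s ==> tgood t ==> tgood (s - t)"
 and tgood_add: "tgood s ==> tgood t ==> tgood (s + t)"
 and tgood_scale: "tgood s ==> tgood (pscale c s)"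
 unfolding tgood_def by (simp_all add: keys_diff_sub keys_add_sub keys_pscale_sub)

lemma class_eq: "tgood s ==> tgood t ==> phat s = phat t ==> tensor_class V W s = tensor_class V W t"
 unfolding tensor_class_iff by (rule phat_inj[OF tgood_diff]) (simp_all add: phat_def lext_diff)

lemma tgood_mem: "tgood t ==> s \<in> tensor_class V W t ==> tgood s"
 using tspan_keys[of V W "s - t"] mV(5,7) mW(5,7)
  keys_add_sub[of "s - t" "carrier V \<times> carrier W" t]
 by (simp add: tensor_class_mem tgood_def)

lemma Y_phat: "Y = {phat t |t. tgood t}"
proof
 show "{phat t |t. tgood t} \<subseteq> Y" using phat_in by blast
 show "Y \<subseteq> {phat t |t. tgood t}"
 proof (rule Y_least)
  show "subsp {phat t |t. tgood t}"
   unfolding subsp_def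
  proof (intro conjI ballI allI)
   have "tgood 0" by (simp add: tgood_def)
   thus "0 \<in> {phat t |t. tgood t}" by (intro CollectI exI[of _ 0]) (simp add: phat_def)
   fix x assume "x \<in> {phat t |t. tgood t}"
   then obtain s where s: "x = phat s" "tgood s" by blast
   show "sc c x \<in> {phat t |t. tgood t}" for c
    using s tgood_scale[OF s(2)] by (intro CollectI exI[of _ "pscale c s"]) (simp add: phat_def lext_pscale)
   fix y assume "y \<in> {phat t |t. tgood t}"
   then obtain t where t: "y = phat t" "tgood t" by blast
   show "x + y \<in> {phat t |t. tgood t}"
    using s t tgood_add[OF s(2) t(2)] by (intro CollectI exI[of _ "s + t"]) (simp add: phat_def lext_add)
  qed
  fix v w assume v: "v \<in> SV" and w: "w \<in> SW"
  let ?v = "inv_into (carrier V) \<phi>V v" and ?w = "inv_into (carrier W) \<phi>W w"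
  have i: "?v \<in> carrier V" "?w \<in> carrier W" "\<phi>V ?v = v" "\<phi>W ?w = w"
   using lin_model_inv[OF gV(1) v] lin_model_inv[OF gW(1) w] by auto
  show "\<Phi> v w \<in> {phat t |t. tgood t}"
   by (intro CollectI exI[of _ "single (?v, ?w) 1"])
     (use i in \<open>simp add: phat_def hh_def tgood_def\<close>)
 qed
qed

lemma tensor_lin_model: "lin_model (tensor_product V W) ph Y"
proof -
 have car: "carrier (tensor_product V W) = {tensor_class V W t |t. tgood t}"
  by (simp add: tensor_carrier tgood_def)
 have "bij_betw ph {tensor_class V W t |t. tgood t} Y"
  unfolding bij_betw_def
 proof
  show "inj_on ph {tensor_class V W t |t. tgood t}"
  proof (rule inj_onI)
   fix x y assume "x \<in> {tensor_class V W t |t. tgood t}" "y \<in> {tensor_class V W t |t. tgood t}" and eq: "ph x = ph y"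
   then obtain s t where st: "x = tensor_class V W s" "y = tensor_class V W t" "tgood s" "tgood t" by blast
   show "x = y" unfolding st(1,2) using eq st by (intro class_eq) (simp_all add: ph_class)
  qed
  show "ph ` {tensor_class V W t |t. tgood t} = Y"
  proof
   show "ph ` {tensor_class V W t |t. tgood t} \<subseteq> Y" using phat_in by (auto simp: ph_class)
   show "Y \<subseteq> ph ` {tensor_class V W t |t. tgood t}"
   proof
    fix y assume "y \<in> Y"
    then obtain t where "y = phat t" "tgood t" unfolding Y_phat by blast
    thus "y \<in> ph ` {tensor_class V W t |t. tgood t}" using ph_class[of t] by (metis (mono_tags, lifting) image_eqI mem_Collect_eq)
   qed
  qed
 qed
 moreover have "tgood 0" by (simp add: tgood_def)
 ultimately show ?thesis
  unfolding lin_model_def car tensor_zero using Y(1)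
  by (auto simp: ph_class tensor_add tensor_smult phat_def lext_add lext_pscale intro: tgood_add tgood_scale)
qed

text \<open>W sits in degree zero, so the degree of a tensor is carried by its left factor and a
  projection acts on that factor alone.\<close>

lemma tensor_hmodel: "hmodel (tensor_product V W) ph (\<lambda>\<gamma>. Y \<inter> {v. homog \<delta> \<gamma> v})"
 unfolding hmodel_def
proof (intro allI conjI)
 fix \<gamma>
 let ?K = "{(v, w). v \<in> carrier V \<and> w \<in> carrier W \<and> (\<exists>\<alpha> \<beta>. v \<in> hcomp V \<alpha> \<and> w \<in> hcomp W \<beta> \<and> \<alpha> + \<beta> = \<gamma>)}"
 have hc: "hcomp (tensor_product V W) \<gamma> = {tensor_class V W t |t. keys t \<subseteq> ?K}"
  by (simp add: tensor_product_def)
 have K: "?K \<subseteq> carrier V \<times> carrier W" by blast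
 thus "hcomp (tensor_product V W) \<gamma> \<subseteq> carrier (tensor_product V W)"
  unfolding hc tensor_carrier by blast
 have hV: "\<phi>V v \<in> SV \<inter> {v. homog \<delta> \<alpha> v} \<longleftrightarrow> v \<in> hcomp V \<alpha>" if "v \<in> carrier V" for v \<alpha>
  using hmodel_iff[OF gV(1,2) that] by simp
 have hW: "\<phi>W w \<in> (if \<beta> = 0 then SW else {0}) \<longleftrightarrow> w \<in> hcomp W \<beta>" if "w \<in> carrier W" for w \<beta>
  using hmodel_iff[OF gW(1,2) that] by simp
 have z2: "\<Phi> v 0 = 0" if "v \<in> SV" for v using sc2[OF that subsp_0[OF mW(1)], of 0] by simp
 have sub: "subsp (Y \<inter> {v. homog \<delta> \<gamma> v})" by (rule subsp_Int[OF Y(1) subsp_supported])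
 show "ph ` hcomp (tensor_product V W) \<gamma> = Y \<inter> {v. homog \<delta> \<gamma> v}"
 proof
  show "ph ` hcomp (tensor_product V W) \<gamma> \<subseteq> Y \<inter> {v. homog \<delta> \<gamma> v}"
  proof
   fix x assume "x \<in> ph ` hcomp (tensor_product V W) \<gamma>"
   then obtain t where t: "x = phat t" "keys t \<subseteq> ?K" unfolding hc by (auto simp: ph_class)
   have "hh k \<in> Y \<inter> {v. homog \<delta> \<gamma> v}" if kK: "k \<in> keys t" for k
   proof -
    obtain v w \<alpha> \<beta> where k: "k = (v, w)" "v \<in> carrier V" "w \<in> carrier W" "v \<in> hcomp V \<alpha>" "w \<in> hcomp W \<beta>" "\<alpha> + \<beta> = \<gamma>"
     using kK t(2) by blast
    have v: "\<phi>V v \<in> SV" "homog \<delta> \<alpha> (\<phi>V v)" using hV[OF k(2)] k(4) by auto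
    have w: "\<phi>W w \<in> (if \<beta> = 0 then SW else {0})" using hW[OF k(3)] k(5) by auto
    show ?thesis
    proof (cases "\<beta> = 0")
     case True
     have "prj \<delta> \<alpha> (\<phi>V v) = \<phi>V v" using prj_homog[OF v(2), of \<alpha>] by simp
     hence "prj \<delta> \<alpha> (\<Phi> (\<phi>V v) (\<phi>W w)) = \<Phi> (\<phi>V v) (\<phi>W w)" using prj[OF v(1) mW(10)[OF k(3)], of \<alpha>] by simp
     hence "homog \<delta> \<alpha> (\<Phi> (\<phi>V v) (\<phi>W w))" by (metis homog_prj)
     thus ?thesis using k(6) True Y(3)[OF v(1) mW(10)[OF k(3)]] by (simp add: k(1) hh_def)
    next
     case False
     hence "hh k = 0" using w z2[OF v(1)] by (simp add: k(1) hh_def)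
     thus ?thesis using subsp_0[OF sub] by simp
    qed
   qed
   thus "x \<in> Y \<inter> {v. homog \<delta> \<gamma> v}" unfolding t(1) phat_def by (rule lext_in[OF sub])
  qed
  show "Y \<inter> {v. homog \<delta> \<gamma> v} \<subseteq> ph ` hcomp (tensor_product V W) \<gamma>"
  proof
   fix x assume x: "x \<in> Y \<inter> {v. homog \<delta> \<gamma> v}"
   then obtain t where t: "x = phat t" "tgood t" using Y_phat by blast
   define pv where "pv v = inv_into (carrier V) \<phi>V (prj \<delta> \<gamma> (\<phi>V v))" for v
   have pv: "pv v \<in> carrier V" "\<phi>V (pv v) = prj \<delta> \<gamma> (\<phi>V v)" if "v \<in> carrier V" for v
   proof -
    have "prj \<delta> \<gamma> (\<phi>V v) \<in> SV" using grV mV(10)[OF that] by (simp add: graded_by_def)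
    thus "pv v \<in> carrier V" "\<phi>V (pv v) = prj \<delta> \<gamma> (\<phi>V v)"
     unfolding pv_def using lin_model_inv[OF gV(1)] by blast+
   qed
   define s where "s = (\<Sum>k\<in>keys t. single (pv (fst k), snd k) (lookup t k))"
   have "keys s \<subseteq> ?K"
    unfolding s_def
   proof (intro keys_sum_sub keys_single_sub)
    fix k assume k: "k \<in> keys t"
    hence kc: "fst k \<in> carrier V" "snd k \<in> carrier W" using tgoodD[OF t(2)] by auto
    have "pv (fst k) \<in> hcomp V \<gamma>"
     using hV[OF pv(1)[OF kc(1)], of \<gamma>] pv(2)[OF kc(1)] mV(10)[OF pv(1)[OF kc(1)]] by simp
    moreover have "snd k \<in> hcomp W 0" using hW[OF kc(2), of 0] mW(10)[OF kc(2)] by simp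
    ultimately show "(pv (fst k), snd k) \<in> ?K" using pv(1)[OF kc(1)] kc(2) by force
   qed
   hence "tensor_class V W s \<in> hcomp (tensor_product V W) \<gamma>" unfolding hc by blast
   moreover have "phat s = x"
   proof -
    have "phat s = (\<Sum>k\<in>keys t. sc (lookup t k) (prj \<delta> \<gamma> (hh k)))"
     unfolding s_def phat_def lext_sum lext_single
    proof (rule sum.cong[OF refl])
     fix k assume k: "k \<in> keys t"
     hence kc: "fst k \<in> carrier V" "snd k \<in> carrier W" using tgoodD[OF t(2)] by auto
     have "hh (pv (fst k), snd k) = prj \<delta> \<gamma> (hh k)"
      using prj[OF mV(10)[OF kc(1)] mW(10)[OF kc(2)]] pv(2)[OF kc(1)] by (simp add: hh_def split_beta)
     thus "sc (lookup t k) (hh (pv (fst k), snd k)) = sc (lookup t k) (prj \<delta> \<gamma> (hh k))"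
      by simp
    qed
    also have "\<dots> = prj \<delta> \<gamma> (phat t)"
     unfolding phat_def lext_def linop_sum[OF linop_prj] linop_sc[OF linop_prj] ..
    also have "\<dots> = x" using x prj_homog[of \<delta> \<gamma> "phat t" \<gamma>] unfolding t(1) by simp
    finally show ?thesis .
   qed
   ultimately show "x \<in> ph ` hcomp (tensor_product V W) \<gamma>" using ph_class[of s] by (metis imageI)
  qed
 qed
qed

theorem tensor_module_model:
 "gmod_model UT (tensor_module V W) ph Y (\<lambda>\<gamma>. Y \<inter> {v. homog \<delta> \<gamma> v}) rr"
proof -
 let ?a = "\<lambda>(a, b) (v, w). (act V a v, act W b w)"
 have good: "tgood (bilinear_extension ?a s t)" if "good s" "tgood t" for s t
  unfolding tgood_def
 proof (rule bilinear_extension_keys)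
  fix x y assume "x \<in> keys s" "y \<in> keys t"
  thus "?a x y \<in> carrier V \<times> carrier W"
   using goodD[OF that(1)] tgoodD[OF that(2)] gV(3) gW(3) by (cases x; cases y) force
 qed
 have eq: "phat (bilinear_extension ?a s t) = rhat s (phat t)" if s: "good s" and t: "tgood t" for s t
 proof -
  have "phat (bilinear_extension ?a s t) = lext (\<lambda>x. lext (\<lambda>y. hh (?a x y)) t) s"
   unfolding phat_def by (rule lext_bilinear_extension)
  also have "\<dots> = lext (\<lambda>x. rhat (single x 1) (phat t)) s"
  proof (rule lext_cong)
   fix x assume "x \<in> keys s"
   then obtain a b where x: "x = (a, b)" "a \<in> carrier U" "b \<in> carrier U'"
    using goodD[OF s] by (cases x) auto
   have g1: "good (single x 1)" using x by (simp add: good_single)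
   have lin: "rhat (single x 1) (v + v') = rhat (single x 1) v + rhat (single x 1) v'"
    "rhat (single x 1) (sc c v) = sc c (rhat (single x 1) v)" if "v \<in> S" "v' \<in> S" for v v' c
    using that x repD[OF rep] repD[OF rep'] by (simp_all add: rhat_def)
   have z: "rhat (single x 1) 0 = 0" using lin(2)[of 0 0 0] subsp_0[OF S] by simp
   define Q where "Q K \<longleftrightarrow> rhat (single x 1) (\<Sum>k\<in>K. sc (lookup t k) (hh k))
     = (\<Sum>k\<in>K. sc (lookup t k) (rhat (single x 1) (hh k)))" for K
   have hS: "hh k \<in> S" if "k \<in> keys t" for k
    using tgoodD[OF t that] Y(2,3) mV(10) mW(10) by (auto simp: hh_def split_beta)
   have "K \<subseteq> keys t \<longrightarrow> Q K" if "finite K" for K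
    using that
   proof (induction K)
    case empty
    thus ?case using z by (simp add: Q_def)
   next
    case (insert k K)
    show ?case
    proof
     assume sub: "insert k K \<subseteq> keys t"
     hence "(\<Sum>k\<in>K. sc (lookup t k) (hh k)) \<in> S" "hh k \<in> S"
      using hS by (auto intro!: subsp_sum[OF S] subsp_sc[OF S])
     thus "Q (insert k K)"
      using insert sub lin subsp_sc[OF S] by (simp add: Q_def)
    qed
   qed
   hence "Q (keys t)" by simp
   hence "rhat (single x 1) (phat t) = lext (\<lambda>y. rhat (single x 1) (hh y)) t"
    by (simp add: Q_def phat_def lext_def)
   also have "\<dots> = lext (\<lambda>y. hh (?a x y)) t"
   proof (rule lext_cong)
    fix y assume "y \<in> keys t"
    then obtain v w where y: "y = (v, w)" "v \<in> carrier V" "w \<in> carrier W"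
     using tgoodD[OF t] by (cases y) auto
    show "rhat (single x 1) (hh y) = hh (?a x y)"
     using equiv[OF x(2,3) mV(10)[OF y(2)] mW(10)[OF y(3)]] gV(4)[OF x(2) y(2)] gW(4)[OF x(3) y(3)]
     by (simp add: rhat_def hh_def x(1) y(1))
   qed
   finally show "lext (\<lambda>y. hh (?a x y)) t = rhat (single x 1) (phat t)" ..
  qed
  also have "\<dots> = rhat s (phat t)" by (simp add: rhat_def)
  finally show ?thesis .
 qed
 \<comment> \<open>Independence of the representatives is read off in coordinates, because
   \<open>phat\<close> is injective modulo the relations.\<close>
 have actt: "act (tensor_module V W) (cl s) (tensor_class V W t) = tensor_class V W (bilinear_extension ?a s t)"
  if s: "good s" and t: "tgood t" for s t
 proof -
  have "tensor_class V W (bilinear_extension ?a s' t') = tensor_class V W (bilinear_extension ?a s t)"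
   if s': "s' \<in> cl s" and t': "t' \<in> tensor_class V W t" for s' t'
  proof (rule class_eq)
   have gs': "good s'" "tgood t'" using good_mem[OF s s'] tgood_mem[OF t t'] by auto
   thus "tgood (bilinear_extension ?a s' t')" by (rule good)
   show "tgood (bilinear_extension ?a s t)" by (rule good[OF s t])
   have "phat t \<in> S" using phat_in[OF t] Y(2) by blast
   thus "phat (bilinear_extension ?a s' t') = phat (bilinear_extension ?a s t)"
    using eq[OF gs'] eq[OF s t] phat_mem[OF t'] rhat_mem[OF s'] by simp
  qed
  thus ?thesis
   unfolding tensor_module_def by (simp add: UN_const tensor_class_ne)
 qed
 have lm: "lin_model (tensor_module V W) ph Y"
  using tensor_lin_model unfolding lin_model_def tensor_module_def by simp
 moreover have "hmodel (tensor_module V W) ph (\<lambda>\<gamma>. Y \<inter> {v. homog \<delta> \<gamma> v})"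
  using tensor_hmodel unfolding hmodel_def tensor_module_def by simp
 moreover have "act (tensor_module V W) a w \<in> carrier (tensor_module V W) \<and> ph (act (tensor_module V W) a w) = rr a (ph w)"
  if a: "a \<in> carrier UT" and w: "w \<in> carrier (tensor_module V W)" for a w
 proof -
  obtain s where s: "a = cl s" "good s" using a unfolding UT_carrier by blast
  obtain t where t: "w = tensor_class V W t" "tgood t" using w by (auto simp: tensor_module_def tensor_carrier tgood_def)
  have "phat t \<in> S" using phat_in[OF t(2)] Y(2) by blast
  hence "ph (act (tensor_module V W) a w) = rr a (ph w)"
   using eq[OF s(2) t(2)] by (simp add: s(1) t(1) actt[OF s(2) t(2)] ph_class rr_cl)
  moreover have "act (tensor_module V W) a w \<in> carrier (tensor_module V W)"
   using good[OF s(2) t(2)] unfolding s(1) t(1) actt[OF s(2) t(2)]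
   by (auto simp: tensor_module_def tensor_carrier tgood_def)
  ultimately show ?thesis by blast
 qed
 ultimately show ?thesis unfolding gmod_model_def by blast
qed

end

end

lemma rep_sum:
 assumes rep: "rep A r S" and S: "subsp S" and a: "a \<in> carrier A"
  and fin: "finite J" and v: "\<And>i. i \<in> J ==> v i \<in> S"
 shows "r a (\<Sum>i\<in>J. v i) = (\<Sum>i\<in>J. r a (v i))"
proof -
 define Q where "Q J \<longleftrightarrow> r a (\<Sum>i\<in>J. v i) = (\<Sum>i\<in>J. r a (v i))" for J
 have "r a (sc 0 0) = sc 0 (r a 0)" by (rule repD(3)[OF rep a subsp_0[OF S]])
 hence Q0: "Q {}" by (simp add: Q_def)
 have Q1: "Q (insert i J)" if "finite J" "i \<notin> J" "\<forall>i\<in>insert i J. v i \<in> S" "Q J" for i J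
 proof -
  have "(\<Sum>i\<in>J. v i) \<in> S" using that by (intro subsp_sum[OF S]) auto
  thus ?thesis using that repD(2)[OF rep a] by (simp add: Q_def)
 qed
 have "(\<forall>i\<in>J. v i \<in> S) \<longrightarrow> Q J" using fin by (induction J) (use Q0 Q1 in auto)
 thus ?thesis using v by (simp add: Q_def)
qed

text \<open>The coordinates of a family are the sum of the coordinates of its members:
  \<open>gen\<close> makes this map surjective, \<open>ind\<close> makes it injective.\<close>

lemma direct_sum_model:
 fixes W :: "'i => ('r, 'w) gmodule" and S :: "'i => 'a fn set" and \<delta> :: "'a => degree"
 assumes W: "\<And>i. i \<in> I ==> gmod_model R (W i) (\<phi> i) (S i) (\<lambda>\<alpha>. S i \<inter> {v. homog \<delta> \<alpha> v}) r"
  and rep: "rep R r B" and B: "subsp B" and SB: "\<And>i. i \<in> I ==> S i \<subseteq> B"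
  and gen: "\<And>v. v \<in> B ==> \<exists>J g. finite J \<and> J \<subseteq> I \<and> (\<forall>i\<in>J. g i \<in> S i) \<and> v = (\<Sum>i\<in>J. g i)"
  and ind: "\<And>J g. finite J ==> J \<subseteq> I ==> (\<And>i. i \<in> J ==> g i \<in> S i) ==> (\<Sum>i\<in>J. g i) = 0 ==> \<forall>i\<in>J. g i = 0"
  and grS: "\<And>i. i \<in> I ==> graded_by \<delta> (S i)"
 shows "\<exists>\<psi>. gmod_model R (direct_sum I W) \<psi> B (\<lambda>\<alpha>. B \<inter> {v. homog \<delta> \<alpha> v}) r"
proof -
 define su where "su f = {i \<in> I. f i \<noteq> \<zero>\<^bsub>W i\<^esub>}" for f
 define C where "C = {f \<in> (\<Pi>\<^sub>E i\<in>I. carrier (W i)). finite (su f)}"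
 define ps where "ps f = (\<Sum>i\<in>su f. \<phi> i (f i))" for f
 have ds: "carrier (direct_sum I W) = C" "\<zero>\<^bsub>direct_sum I W\<^esub> = (\<lambda>i\<in>I. \<zero>\<^bsub>W i\<^esub>)"
  "\<And>f g. f \<oplus>\<^bsub>direct_sum I W\<^esub> g = (\<lambda>i\<in>I. f i \<oplus>\<^bsub>W i\<^esub> g i)"
  "\<And>c f. c \<odot>\<^bsub>direct_sum I W\<^esub> f = (\<lambda>i\<in>I. c \<odot>\<^bsub>W i\<^esub> f i)"
  "\<And>\<alpha>. hcomp (direct_sum I W) \<alpha> = {f \<in> C. \<forall>i\<in>I. f i \<in> hcomp (W i) \<alpha>}"
  "\<And>a f. act (direct_sum I W) a f = (\<lambda>i\<in>I. act (W i) a (f i))"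
  by (simp_all add: direct_sum_def Let_def C_def su_def)
 note g = gmod_modelD[OF W]
 note m = lin_modelD[OF g(1)]
 have su_sub: "su f \<subseteq> I" for f by (auto simp: su_def)
 have CD: "f i \<in> carrier (W i)" if "f \<in> C" "i \<in> I" for f i using that by (auto simp: C_def)
 have Cfin: "finite (su f)" if "f \<in> C" for f using that by (simp add: C_def)
 have CI: "(\<lambda>i\<in>I. h i) \<in> C" "su (\<lambda>i\<in>I. h i) \<subseteq> J"
  if "\<And>i. i \<in> I ==> h i \<in> carrier (W i)" "finite J" "\<And>i. i \<in> I ==> i \<notin> J ==> h i = \<zero>\<^bsub>W i\<^esub>" for h J
 proof -
  show "su (\<lambda>i\<in>I. h i) \<subseteq> J" using that(3) by (auto simp: su_def)
  thus "(\<lambda>i\<in>I. h i) \<in> C" using that(1) finite_subset[OF _ that(2)] by (simp add: C_def)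
 qed
 have ps: "ps f = (\<Sum>i\<in>J. \<phi> i (f i))" if "finite J" "su f \<subseteq> J" "J \<subseteq> I" for f J
  unfolding ps_def by (rule sum.mono_neutral_left) (use that m(4) in \<open>auto simp: su_def\<close>)
 have psI: "ps (\<lambda>i\<in>I. h i) = (\<Sum>i\<in>J. \<phi> i (h i))"
  if "\<And>i. i \<in> I ==> h i \<in> carrier (W i)" "finite J" "\<And>i. i \<in> I ==> i \<notin> J ==> h i = \<zero>\<^bsub>W i\<^esub>" "J \<subseteq> I" for h J
  using ps[OF that(2) CI(2)[OF that(1-3)] that(4)] that(4) by (auto intro!: sum.cong)
 have z: "i \<notin> su f ==> i \<in> I ==> f i = \<zero>\<^bsub>W i\<^esub>" for f i by (simp add: su_def)
 have add: "(\<lambda>i\<in>I. f i \<oplus>\<^bsub>W i\<^esub> h i) \<in> C \<and> ps (\<lambda>i\<in>I. f i \<oplus>\<^bsub>W i\<^esub> h i) = ps f + ps h"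
  if f: "f \<in> C" and h: "h \<in> C" for f h
 proof -
  let ?J = "su f \<union> su h"
  have J: "finite ?J" "?J \<subseteq> I" using f h Cfin su_sub by auto
  have car: "f i \<oplus>\<^bsub>W i\<^esub> h i \<in> carrier (W i)" if "i \<in> I" for i
   by (rule m(5)[OF that CD[OF f that] CD[OF h that]])
  have zz: "f i \<oplus>\<^bsub>W i\<^esub> h i = \<zero>\<^bsub>W i\<^esub>" if i: "i \<in> I" "i \<notin> ?J" for i
  proof -
   have e: "f i = \<zero>\<^bsub>W i\<^esub>" "h i = \<zero>\<^bsub>W i\<^esub>" using i z by auto
   show ?thesis unfolding e
    by (rule m(9)[OF i(1) m(5)[OF i(1) m(3)[OF i(1)] m(3)[OF i(1)]] m(3)[OF i(1)]])
      (simp add: m(6)[OF i(1) m(3)[OF i(1)] m(3)[OF i(1)]] m(4)[OF i(1)])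
  qed
  have "ps (\<lambda>i\<in>I. f i \<oplus>\<^bsub>W i\<^esub> h i) = (\<Sum>i\<in>?J. \<phi> i (f i \<oplus>\<^bsub>W i\<^esub> h i))"
   by (rule psI[OF car J(1) zz J(2)])
  also have "\<dots> = (\<Sum>i\<in>?J. \<phi> i (f i) + \<phi> i (h i))"
   using J(2) by (intro sum.cong refl m(6) CD[OF f] CD[OF h]) auto
  also have "\<dots> = ps f + ps h"
   using ps[OF J(1) _ J(2), of f] ps[OF J(1) _ J(2), of h] by (simp add: sum.distrib)
  finally show ?thesis using CI(1)[OF car J(1) zz] by blast
 qed
 have smult: "(\<lambda>i\<in>I. c \<odot>\<^bsub>W i\<^esub> f i) \<in> C \<and> ps (\<lambda>i\<in>I. c \<odot>\<^bsub>W i\<^esub> f i) = sc c (ps f)" if f: "f \<in> C" for f c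
 proof -
  have car: "c \<odot>\<^bsub>W i\<^esub> f i \<in> carrier (W i)" if "i \<in> I" for i by (rule m(7)[OF that CD[OF f that]])
  have zz: "c \<odot>\<^bsub>W i\<^esub> f i = \<zero>\<^bsub>W i\<^esub>" if i: "i \<in> I" "i \<notin> su f" for i
   unfolding z[OF i(2,1)]
   by (rule m(9)[OF i(1) m(7)[OF i(1) m(3)[OF i(1)]] m(3)[OF i(1)]])
     (simp add: m(8)[OF i(1) m(3)[OF i(1)]] m(4)[OF i(1)])
  have "ps (\<lambda>i\<in>I. c \<odot>\<^bsub>W i\<^esub> f i) = (\<Sum>i\<in>su f. \<phi> i (c \<odot>\<^bsub>W i\<^esub> f i))"
   by (rule psI[OF car Cfin[OF f] zz su_sub])
  also have "\<dots> = (\<Sum>i\<in>su f. sc c (\<phi> i (f i)))"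
   using su_sub[of f] by (intro sum.cong refl m(8) CD[OF f]) auto
  finally show ?thesis using CI(1)[OF car Cfin[OF f] zz] by (simp add: ps_def sc_sum)
 qed
 have actC: "(\<lambda>i\<in>I. act (W i) a (f i)) \<in> C \<and> ps (\<lambda>i\<in>I. act (W i) a (f i)) = r a (ps f)"
  if f: "f \<in> C" and a: "a \<in> carrier R" for f a
 proof -
  have r0: "r a 0 = 0" using repD(3)[OF rep a subsp_0[OF B], of 0] by simp
  have car: "act (W i) a (f i) \<in> carrier (W i)" if "i \<in> I" for i by (rule g(3)[OF that a CD[OF f that]])
  have zz: "act (W i) a (f i) = \<zero>\<^bsub>W i\<^esub>" if i: "i \<in> I" "i \<notin> su f" for i
   unfolding z[OF i(2,1)]
   by (rule m(9)[OF i(1) g(3)[OF i(1) a m(3)[OF i(1)]] m(3)[OF i(1)]])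
     (simp add: g(4)[OF i(1) a m(3)[OF i(1)]] m(4)[OF i(1)] r0)
  have "ps (\<lambda>i\<in>I. act (W i) a (f i)) = (\<Sum>i\<in>su f. \<phi> i (act (W i) a (f i)))"
   by (rule psI[OF car Cfin[OF f] zz su_sub])
  also have "\<dots> = (\<Sum>i\<in>su f. r a (\<phi> i (f i)))"
   using su_sub[of f] by (intro sum.cong refl g(4) CD[OF f] a) auto
  also have "\<dots> = r a (ps f)"
  proof -
   have "\<phi> i (f i) \<in> B" if "i \<in> su f" for i
   proof -
    have i: "i \<in> I" using that su_sub by blast
    show ?thesis using m(10)[OF i CD[OF f i]] SB[OF i] by blast
   qed
   from rep_sum[OF rep B a Cfin[OF f] this] show ?thesis by (simp add: ps_def)
  qed
  finally show ?thesis using CI(1)[OF car Cfin[OF f] zz] by blast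
 qed
 have psB: "ps f \<in> B" if f: "f \<in> C" for f
  unfolding ps_def
 proof (rule subsp_sum[OF B])
  fix i assume "i \<in> su f"
  hence i: "i \<in> I" using su_sub by blast
  show "\<phi> i (f i) \<in> B" using m(10)[OF i CD[OF f i]] SB[OF i] by blast
 qed
 have inj: "f = h" if f: "f \<in> C" and h: "h \<in> C" and eq: "ps f = ps h" for f h
 proof -
  let ?J = "su f \<union> su h"
  have J: "finite ?J" "?J \<subseteq> I" using f h Cfin su_sub by auto
  have "(\<Sum>i\<in>?J. \<phi> i (f i) - \<phi> i (h i)) = 0"
   using eq ps[OF J(1) _ J(2), of f] ps[OF J(1) _ J(2), of h] by (simp add: sum_subtractf)
  moreover have "\<phi> i (f i) - \<phi> i (h i) \<in> S i" if "i \<in> ?J" for i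
  proof -
   have i: "i \<in> I" using that J(2) by blast
   show ?thesis by (rule subsp_diff[OF m(1)[OF i] m(10)[OF i CD[OF f i]] m(10)[OF i CD[OF h i]]])
  qed
  ultimately have d: "\<forall>i\<in>?J. \<phi> i (f i) - \<phi> i (h i) = 0"
   using J by (intro ind[where g = "\<lambda>i. \<phi> i (f i) - \<phi> i (h i)"])
  have "f i = h i" if i: "i \<in> I" for i
  proof (cases "i \<in> ?J")
   case True
   hence "\<phi> i (f i) = \<phi> i (h i)" using d by simp
   thus ?thesis by (rule m(9)[OF i CD[OF f i] CD[OF h i]])
  next
   case False
   thus ?thesis using z[OF _ i, of f] z[OF _ i, of h] by simp
  qed
  thus ?thesis using f h unfolding C_def by (intro PiE_ext[of f I "\<lambda>i. carrier (W i)" h]) auto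
 qed
 have surj: "\<exists>f\<in>C. ps f = v" if v: "v \<in> B" for v
 proof -
  obtain J k where J: "finite J" "J \<subseteq> I" "\<forall>i\<in>J. k i \<in> S i" "v = (\<Sum>i\<in>J. k i)" using gen[OF v] by blast
  define h where "h i = (if i \<in> J then inv_into (carrier (W i)) (\<phi> i) (k i) else \<zero>\<^bsub>W i\<^esub>)" for i
  have inv: "inv_into (carrier (W i)) (\<phi> i) (k i) \<in> carrier (W i)" "\<phi> i (inv_into (carrier (W i)) (\<phi> i) (k i)) = k i"
   if "i \<in> J" for i
   using lin_model_inv[OF g(1), of i "k i"] that J by auto
  have car: "h i \<in> carrier (W i)" if "i \<in> I" for i using inv(1) m(3)[OF that] by (simp add: h_def)
  have zz: "h i = \<zero>\<^bsub>W i\<^esub>" if "i \<in> I" "i \<notin> J" for i using that by (simp add: h_def)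
  have "ps (\<lambda>i\<in>I. h i) = (\<Sum>i\<in>J. \<phi> i (h i))" by (rule psI[OF car J(1) zz J(2)])
  also have "\<dots> = v" unfolding J(4) using inv(2) by (intro sum.cong refl) (simp add: h_def)
  finally show ?thesis using CI(1)[OF car J(1) zz] by blast
 qed
 have lm: "lin_model (direct_sum I W) ps B"
  unfolding lin_model_def ds
 proof (intro conjI ballI allI)
  show "bij_betw ps C B" unfolding bij_betw_def
  proof
   show "inj_on ps C" by (rule inj_onI) (rule inj)
   show "ps ` C = B" using psB surj by (auto simp: image_iff)
  qed
  show "(\<lambda>i\<in>I. \<zero>\<^bsub>W i\<^esub>) \<in> C" by (rule CI(1)[of _ "{}"]) (use m(3) in auto)
  show "ps (\<lambda>i\<in>I. \<zero>\<^bsub>W i\<^esub>) = 0" using psI[of "\<lambda>i. \<zero>\<^bsub>W i\<^esub>" "{}"] m(3) by simp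
 qed (use B add smult in blast)+
 have "hmodel (direct_sum I W) ps (\<lambda>\<alpha>. B \<inter> {v. homog \<delta> \<alpha> v})"
  unfolding hmodel_def ds
 proof (intro allI conjI)
  fix \<alpha>
  show "{f \<in> C. \<forall>i\<in>I. f i \<in> hcomp (W i) \<alpha>} \<subseteq> C" by blast
  have h: "v \<in> hcomp (W i) \<alpha> \<longleftrightarrow> homog \<delta> \<alpha> (\<phi> i v)" if i: "i \<in> I" "v \<in> carrier (W i)" for i v
   using hmodel_iff[OF g(1)[OF i(1)] g(2)[OF i(1)] i(2), of \<alpha>] m(10)[OF i] by simp
  have "(\<forall>i\<in>I. f i \<in> hcomp (W i) \<alpha>) \<longleftrightarrow> homog \<delta> \<alpha> (ps f)" if f: "f \<in> C" for f
  proof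
   assume a: "\<forall>i\<in>I. f i \<in> hcomp (W i) \<alpha>"
   have "ps f \<in> {v. homog \<delta> \<alpha> v}" unfolding ps_def
   proof (rule subsp_sum[OF subsp_supported])
    fix i assume "i \<in> su f"
    hence i: "i \<in> I" using su_sub by blast
    show "\<phi> i (f i) \<in> {v. homog \<delta> \<alpha> v}" using h[OF i CD[OF f i]] a i by blast
   qed
   thus "homog \<delta> \<alpha> (ps f)" by blast
  next
   assume a: "homog \<delta> \<alpha> (ps f)"
   \<comment> \<open>The parts of the members outside degree \<alpha> add up to zero and lie in
     independent subspaces, so each member is homogeneous.\<close>
   have "(\<Sum>i\<in>su f. \<phi> i (f i) - prj \<delta> \<alpha> (\<phi> i (f i))) = ps f - prj \<delta> \<alpha> (ps f)"
    unfolding ps_def linop_sum[OF linop_prj] sum_subtractf ..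
   also have "\<dots> = 0" using prj_homog[OF a, of \<alpha>] by simp
   finally have s0: "(\<Sum>i\<in>su f. \<phi> i (f i) - prj \<delta> \<alpha> (\<phi> i (f i))) = 0" .
   have sS: "\<phi> i (f i) - prj \<delta> \<alpha> (\<phi> i (f i)) \<in> S i" if "i \<in> su f" for i
   proof -
    have i: "i \<in> I" using that su_sub by blast
    have "prj \<delta> \<alpha> (\<phi> i (f i)) \<in> S i" using grS[OF i] m(10)[OF i CD[OF f i]] by (simp add: graded_by_def)
    thus ?thesis by (rule subsp_diff[OF m(1)[OF i] m(10)[OF i CD[OF f i]]])
   qed
   have d: "\<forall>i\<in>su f. \<phi> i (f i) - prj \<delta> \<alpha> (\<phi> i (f i)) = 0"
    using Cfin[OF f] su_sub sS s0 by (rule ind[where g = "\<lambda>i. \<phi> i (f i) - prj \<delta> \<alpha> (\<phi> i (f i))"])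
   show "\<forall>i\<in>I. f i \<in> hcomp (W i) \<alpha>"
   proof
    fix i assume i: "i \<in> I"
    have "homog \<delta> \<alpha> (\<phi> i (f i))"
    proof (cases "i \<in> su f")
     case True
     hence "\<phi> i (f i) = prj \<delta> \<alpha> (\<phi> i (f i))" using d by simp
     thus ?thesis by (metis homog_prj)
    next
     case False
     have "\<phi> i (f i) = 0" unfolding z[OF False i] by (rule m(4)[OF i])
     thus ?thesis by (simp add: supported_def)
    qed
    thus "f i \<in> hcomp (W i) \<alpha>" using h[OF i CD[OF f i]] by blast
   qed
  qed
  hence "{f \<in> C. \<forall>i\<in>I. f i \<in> hcomp (W i) \<alpha>} = {f \<in> C. homog \<delta> \<alpha> (ps f)}" by blast
  moreover have "ps ` {f \<in> C. homog \<delta> \<alpha> (ps f)} = B \<inter> {v. homog \<delta> \<alpha> v}"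
  proof
   show "ps ` {f \<in> C. homog \<delta> \<alpha> (ps f)} \<subseteq> B \<inter> {v. homog \<delta> \<alpha> v}" using psB by auto
   show "B \<inter> {v. homog \<delta> \<alpha> v} \<subseteq> ps ` {f \<in> C. homog \<delta> \<alpha> (ps f)}"
   proof
    fix v assume v: "v \<in> B \<inter> {v. homog \<delta> \<alpha> v}"
    then obtain f where "f \<in> C" "ps f = v" using surj by blast
    thus "v \<in> ps ` {f \<in> C. homog \<delta> \<alpha> (ps f)}" using v by blast
   qed
  qed
  ultimately show "ps ` {f \<in> C. \<forall>i\<in>I. f i \<in> hcomp (W i) \<alpha>} = B \<inter> {v. homog \<delta> \<alpha> v}" by simp
 qed
 hence "gmod_model R (direct_sum I W) ps B (\<lambda>\<alpha>. B \<inter> {v. homog \<delta> \<alpha> v}) r"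
  using lm actC unfolding gmod_model_def ds by blast
 thus ?thesis by blast
qed

section \<open>The polynomial algebra as a space of monomials\<close>

lemma sym_form_add: "sym_form m n (\<alpha> + \<beta>) \<gamma> = sym_form m n \<alpha> \<gamma> + sym_form m n \<beta> \<gamma>"
  "sym_form m n \<gamma> (\<alpha> + \<beta>) = sym_form m n \<gamma> \<alpha> + sym_form m n \<gamma> \<beta>"
 and skew_form_add: "skew_form m n (\<alpha> + \<beta>) \<gamma> = skew_form m n \<alpha> \<gamma> + skew_form m n \<beta> \<gamma>"
  "skew_form m n \<gamma> (\<alpha> + \<beta>) = skew_form m n \<gamma> \<alpha> + skew_form m n \<gamma> \<beta>"
 unfolding sym_form_def skew_form_def by (simp_all add: lookup_add algebra_simps sum.distrib sum_subtractf)

text \<open>Used to exchange the natural-number row degree \<open>rdeg\<close> for the degree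
  \<open>mdeg\<close> in the grading group, which separates the same valid monomials.\<close>

lemma graded_by_refine:
 assumes S: "subsp S" "graded_by \<delta> S"
  and eq: "\<And>f a b. f \<in> S ==> f a \<noteq> 0 ==> f b \<noteq> 0 ==> \<delta> a = \<delta> b \<longleftrightarrow> \<delta>' a = \<delta>' b"
 shows "graded_by \<delta>' S"
 unfolding graded_by_def
proof (intro ballI allI)
 fix f d assume f: "f \<in> S"
 show "prj \<delta>' d f \<in> S"
 proof (cases "\<exists>a. f a \<noteq> 0 \<and> \<delta>' a = d")
  case True
  then obtain a where a: "f a \<noteq> 0" "\<delta>' a = d" by blast
  have "prj \<delta>' d f = prj \<delta> (\<delta> a) f"
  proof
   fix b show "prj \<delta>' d f b = prj \<delta> (\<delta> a) f b"
    using eq[OF f, of b a] a by (cases "f b = 0") (auto simp: prj_def)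
  qed
  thus ?thesis using S(2) f by (simp add: graded_by_def)
 next
  case False
  hence "prj \<delta>' d f = 0" by (auto simp: prj_def fun_eq_iff)
  thus ?thesis using subsp_0[OF S(1)] by simp
 qed
qed

definition ind :: "'a => 'a => complex" where
 "ind a = (\<lambda>b. if b = a then 1 else 0)"

lemma ind_expand: "finite {a. f a \<noteq> 0} ==> f = (\<Sum>a | f a \<noteq> 0. sc (f a) (ind a))"
 by (rule ext) (simp add: ind_def if_distrib[where f = "\<lambda>x. _ * x"] sum.delta cong: if_cong)

definition wdeg :: "(nat \<times> nat) list => degree" where
 "wdeg w = (\<Sum>x\<leftarrow>w. case x of (i, r) => eps i)"

lemma wdeg_simps [simp]: "wdeg [] = 0" "wdeg (x # w) = eps (fst x) + wdeg w"
 by (simp_all add: wdeg_def split_beta)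

section \<open>The commutative factor and the degrees of monomials\<close>

context howe
begin

abbreviation "om' \<equiv> omega m n q"

lemma omega_add_left: "om' (\<alpha> + \<beta>) \<gamma> = om' \<alpha> \<gamma> * om' \<beta> \<gamma>"
 and omega_add_right: "om' \<gamma> (\<alpha> + \<beta>) = om' \<gamma> \<alpha> * om' \<gamma> \<beta>"
 unfolding omega_def sym_form_add skew_form_add using q0 by (simp_all add: power_int_add)

lemma omega_0 [simp]: "om' 0 \<gamma> = 1" "om' \<gamma> 0 = 1"
 by (simp_all add: omega_def sym_form_def skew_form_def)

lemma omega_uminus_left: "om' \<alpha> \<gamma> * om' (- \<alpha>) \<gamma> = 1"
 and omega_uminus_right: "om' \<gamma> \<alpha> * om' \<gamma> (- \<alpha>) = 1"
 using omega_add_left[of \<alpha> "- \<alpha>" \<gamma>] omega_add_right[of \<gamma> \<alpha> "- \<alpha>"] by simp_all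

lemma omega_eps:
 assumes "i < M" "j < M"
 shows "om' (eps i) (eps j) = om i j"
proof -
 have l: "lookup (eps i) k = (if k = i then 1 else 0)" for i k
  by (auto simp: eps_def lookup_single when_def)
 have if_mult: "(if b then (1::int) else 0) * x = (if b then x else 0)" for b x by simp
 have "sym_form m n (eps i) (eps j) = (\<Sum>k<M. \<Sum>l<M. if l = j then (if k = i then int (par m k * par m l) else 0) else 0)"
  unfolding sym_form_def l by (intro sum.cong refl) auto
 also have "\<dots> = (\<Sum>k<M. if k = i then int (par m k * par m j) else 0)"
  using assms by (simp add: sum.delta)
 also have "\<dots> = int (par m i * par m j)" using assms by (simp add: sum.delta)
 finally have s: "sym_form m n (eps i) (eps j) = int (par m i * par m j)" .
 have "skew_form m n (eps i) (eps j) = (\<Sum>l<M. (\<Sum>k<l. if k = i then (if l = j then 1 else 0) else 0)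
   - (\<Sum>k<l. if k = j then (if l = i then 1 else 0) else 0))"
  unfolding skew_form_def l sum_subtractf[symmetric] by (intro sum.cong refl) auto
 also have "\<dots> = (\<Sum>l<M. (if l = j then (if i < l then 1 else 0) else 0) - (if l = i then (if j < l then 1 else 0) else 0))"
  by (intro sum.cong refl) (auto simp: sum.delta)
 also have "\<dots> = (if i < j then 1 else 0) - (if j < i then 1 else 0)"
  using assms by (simp add: sum_subtractf sum.delta)
 finally show ?thesis unfolding omega_def s om_def
  by (auto simp del: of_nat_mult simp: power_int_minus)
qed

lemma omega_neg_eps: "i < M ==> j < M ==> om' (- eps i) (eps j) = om j i"
 using omega_uminus_left[of "eps i" "eps j"] om_inverse[of j i] omega_eps[of i j]
 by (metis mult.commute mult_cancel_left om_nz)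

lemma omega_glq_degree:
 assumes "i < M" "j < M" "k < M" "l < M"
 shows "om' (glq_degree (i, j)) (glq_degree (k, l)) = om i k * om l i * om k j * om j l"
proof -
 have neg: "om' (\<gamma>) (- eps l) = inverse (om' \<gamma> (eps l))" for \<gamma>
  using omega_uminus_right[of \<gamma> "eps l"] by (metis inverse_unique)
 have "om' (eps i - eps j) (eps k - eps l) = om' (eps i + - eps j) (eps k + - eps l)" by simp
 also have "\<dots> = om i k * om k j * (inverse (om i l) * inverse (om l j))"
  unfolding omega_add_left omega_add_right neg using assms by (simp add: omega_eps omega_neg_eps)
 also have "\<dots> = om i k * om l i * om k j * om j l" by (simp add: om_inverse'[symmetric] mult_ac)
 finally show ?thesis by (simp add: glq_degree_def)
qed

definition mdeg :: "mon => degree" where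
 "mdeg a = (\<Sum>i<M. single i (int (rdeg a i)))"

lemma lookup_mdeg: "lookup (mdeg a) i = (if i < M then int (rdeg a i) else 0)"
 by (simp add: mdeg_def lookup_sum lookup_single when_def sum.delta)

lemma mdeg_Gamma: "mdeg a \<in> \<Gamma>grp m n"
 by (auto simp: \<Gamma>grp_def in_keys_iff lookup_mdeg split: if_splits)

lemma valid_rdeg: "valid M a ==> \<not> i < M ==> rdeg a i = 0"
 unfolding rdeg_def using valid_box[of M a] by (fastforce intro!: sum.neutral)

lemma mdeg_eq_iff: "valid M a ==> valid M b ==> mdeg a = mdeg b \<longleftrightarrow> rdeg a = rdeg b"
proof
 assume v: "valid M a" "valid M b" and "mdeg a = mdeg b"
 hence "(if i < M then int (rdeg a i) else 0) = (if i < M then int (rdeg b i) else 0)" for i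
  using lookup_mdeg[of a i] lookup_mdeg[of b i] by simp
 thus "rdeg a = rdeg b" using valid_rdeg[OF v(1)] valid_rdeg[OF v(2)] by (intro ext) (metis of_nat_eq_iff)
qed (simp add: mdeg_def)

lemma graded_mdeg:
 assumes S: "S \<subseteq> B M" "subsp S"
 shows "graded_by mdeg S \<longleftrightarrow> graded_by rdeg S"
proof -
 have eq: "mdeg a = mdeg b \<longleftrightarrow> rdeg a = rdeg b" if "f \<in> S" "f a \<noteq> 0" "f b \<noteq> 0" for f a b
  using that S(1) by (intro mdeg_eq_iff) (blast intro: B_valid)+
 show ?thesis
 proof
  assume "graded_by mdeg S"
  thus "graded_by rdeg S" by (rule graded_by_refine[OF S(2)]) (rule eq)
 next
  assume "graded_by rdeg S"
  thus "graded_by mdeg S" by (rule graded_by_refine[OF S(2)]) (rule eq[symmetric])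
 qed
qed

lemma homog_mdeg:
 assumes "f \<in> B M" "homog rdeg \<rho> f"
 shows "\<exists>\<alpha>. homog mdeg \<alpha> f"
proof (cases "f = 0")
 case True
 thus ?thesis by (simp add: supported_def)
next
 case False
 then obtain a where "f a \<noteq> 0" by (auto simp: fun_eq_iff)
 hence "homog mdeg (mdeg a) f" using assms(2) by (auto simp: supported_def mdeg_def)
 thus ?thesis by blast
qed

lemma mdeg_Suc:
 assumes "fst p < M" "snd p < N"
 shows "mdeg (a(p := Suc (a p))) = eps (fst p) + mdeg a"
proof (rule poly_mapping_eqI)
 fix i
 have "rdeg (a(p := Suc (a p))) = (rdeg a)(fst p := Suc (rdeg a (fst p)))"
  using rdeg_Suc[of "snd p" a "fst p"] assms by simp
 thus "lookup (mdeg (a(p := Suc (a p)))) i = lookup (eps (fst p) + mdeg a) i"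
  using assms by (auto simp: lookup_mdeg lookup_add eps_def lookup_single when_def)
qed

lemma homog_xx:
 assumes "fst p < M" "snd p < N" "homog mdeg \<alpha> f"
 shows "homog mdeg (eps (fst p) + \<alpha>) (xx p f)"
 unfolding supported_def
proof (intro allI impI)
 fix a assume "xx p f a \<noteq> 0"
 then obtain b where b: "f b \<noteq> 0" "a = b(p := Suc (b p))" using xx_nz by blast
 thus "a \<in> {a. mdeg a = eps (fst p) + \<alpha>}"
  using mdeg_Suc[OF assms(1,2), of b] assms(3) by (auto simp: supported_def)
qed

lemma homog_dd_mdeg:
 assumes "fst p < M" "snd p < N" "homog mdeg \<alpha> f"
 shows "homog mdeg (\<alpha> - eps (fst p)) (dd p f)"
 unfolding supported_def
proof (intro allI impI)
 fix a assume "dd p f a \<noteq> 0"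
 then obtain b where b: "f b \<noteq> 0" "b p \<noteq> 0" "a = b(p := b p - 1)" using dd_nz by blast
 hence "b = a(p := Suc (a p))" by (auto simp: fun_eq_iff)
 thus "a \<in> {a. mdeg a = \<alpha> - eps (fst p)}"
  using mdeg_Suc[OF assms(1,2), of a] b(1) assms(3) by (auto simp: supported_def)
qed

lemma homog_E_mdeg:
 assumes "i < M" "j < M" "homog mdeg \<alpha> f"
 shows "homog mdeg (glq_degree (i, j) + \<alpha>) (E i j f)"
proof -
 have "E i j f \<in> {v. homog mdeg (glq_degree (i, j) + \<alpha>) v}"
  unfolding E_def
 proof (rule subsp_sum[OF subsp_supported])
  fix r assume r: "r \<in> {..<N}"
  show "xx (i, r) (dd (j, r) f) \<in> {v. homog mdeg (glq_degree (i, j) + \<alpha>) v}"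
   using homog_xx[OF _ _ homog_dd_mdeg[OF _ _ assms(3)], of "(i, r)" "(j, r)"] assms r
   by (simp add: glq_degree_def algebra_simps)
 qed
 thus ?thesis by simp
qed

lemma homog_F_mdeg:
 assumes "r < N" "s < N" "homog mdeg \<alpha> f"
 shows "homog mdeg \<alpha> (F M r s f)"
proof -
 have "F M r s f \<in> {v. homog mdeg \<alpha> v}"
  unfolding F_def
 proof (rule subsp_sum[OF subsp_supported])
  fix i assume i: "i \<in> {..<M}"
  show "xx (i, r) (dd (i, s) f) \<in> {v. homog mdeg \<alpha> v}"
   using homog_xx[OF _ _ homog_dd_mdeg[OF _ _ assms(3)], of "(i, r)" "(i, s)"] assms i
   by simp
 qed
 thus ?thesis by simp
qed

abbreviation "GX \<equiv> {..<m + n} \<times> {..<N}"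

abbreviation "RX \<equiv> x_relations m n N q"

text \<open>Both kinds of relations take one shape, because \<open>om i i\<close> is the sign of row
  i.\<close>

lemma RX_cases:
 assumes "r \<in> RX"
 obtains p p' where "p \<in> GX" "p' \<in> GX" "r = gen p * gen p' - scal (om (fst p) (fst p')) * gen p' * gen p"
proof -
 have par: "om i i = (-1) ^ par m i" for i by (simp add: om_def par_def)
 have om: "om i j = (-1) ^ (par m i * par m j) * q" if "i < j" for i j using that by (simp add: om_def)
 from assms consider
  (1) i t s where "i < M" "t < N" "s < N" "r = gen (i, t) * gen (i, s) - scal ((-1) ^ par m i) * gen (i, s) * gen (i, t)"
 | (2) i j t s where "i < j" "j < M" "t < N" "s < N"
   "r = gen (i, t) * gen (j, s) - scal ((-1) ^ (par m i * par m j) * q) * gen (j, s) * gen (i, t)"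
  unfolding x_relations_def by blast
 thus ?thesis
 proof cases
  case 1
  show ?thesis by (rule that[of "(i, t)" "(i, s)"]) (simp_all add: 1 par)
 next
  case 2
  have "i < M" using 2 by simp
  thus ?thesis by (intro that[of "(i, t)" "(j, s)"]) (simp_all add: 2 om)
 qed
qed

lemma RX_intro:
 assumes "p \<in> GX" "p' \<in> GX" "fst p \<le> fst p'"
 shows "gen p * gen p' - scal (om (fst p) (fst p')) * gen p' * gen p \<in> RX"
proof (cases p; cases p')
 fix i r j s assume p: "p = (i, r)" "p' = (j, s)"
 have par: "om i i = (-1) ^ par m i" by (simp add: om_def par_def)
 have om: "om i j = (-1) ^ (par m i * par m j) * q" if "i < j" using that by (simp add: om_def)
 show ?thesis
 proof (cases "i = j")
  case True
  thus ?thesis using assms p par unfolding x_relations_def by auto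
 next
  case False
  hence "i < j" using assms p by simp
  thus ?thesis using assms p om unfolding x_relations_def by auto
 qed
qed

lemma presented_X: "presented GX RX"
proof
 show "RX \<subseteq> frees GX"
 proof
  fix r assume "r \<in> RX"
  then obtain p p' where p: "p \<in> GX" "p' \<in> GX" and r: "r = gen p * gen p' - scal (om (fst p) (fst p')) * gen p' * gen p"
   by (rule RX_cases)
  show "r \<in> frees GX" unfolding r by (intro frees_diff frees_mult frees_gen frees_scal p)
 qed
qed

interpretation CX: presented GX RX by (rule presented_X)

lemma GX_D: "p \<in> GX ==> fst p < M \<and> snd p < N" by auto

lemma xx_closed: "p \<in> GX ==> v \<in> B M ==> xx p v \<in> B M"
 using X_B[of v M p] by auto

lemma ev_RX: "r \<in> RX ==> ev xx r v = 0"
proof (erule RX_cases)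
 fix p p' assume p: "p \<in> GX" "p' \<in> GX" and r: "r = gen p * gen p' - scal (om (fst p) (fst p')) * gen p' * gen p"
 have "xx p (xx p' v) = sc (om (fst p) (fst p')) (xx p' (xx p v))" using p by (intro X_X) auto
 thus "ev xx r v = 0"
  unfolding r by (simp only: ev_diff ev_mult[OF linop_xx] ev_gen ev_scal_alone diff_self)
qed

text \<open>For rows in the wrong order, multiply the opposite relation by \<open>om\<close> and
  change the sign; the two factors \<open>om\<close> are inverse to each other.\<close>

lemma I_comm: 
 assumes "p \<in> GX" "p' \<in> GX"
 shows "gen p * gen p' - scal (om (fst p) (fst p')) * gen p' * gen p \<in> CX.I"
proof (cases "fst p \<le> fst p'")
 case True
 thus ?thesis using assms by (intro CX.I_R RX_intro)
next
 case False
 hence a: "gen p' * gen p - scal (om (fst p') (fst p)) * gen p * gen p' \<in> CX.I"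
  using assms by (intro CX.I_R RX_intro) auto
 have ss: "scal (om (fst p) (fst p')) * scal (om (fst p') (fst p)) = (1 :: (nat \<times> nat) free)"
  by (simp add: scal_def single_mult_free om_inverse one_free)
 have "gen p * gen p' - scal (om (fst p) (fst p')) * gen p' * gen p
  = - (scal (om (fst p) (fst p')) * (gen p' * gen p - scal (om (fst p') (fst p)) * gen p * gen p'))"
  using ss by (simp add: algebra_simps flip: mult.assoc)
 thus ?thesis using CX.I_uminus[OF CX.I_left[OF a frees_scal]] by simp
qed

lemma word_comm:
 assumes "p \<in> GX" "u \<in> lists GX"
 shows "\<exists>c. gen p * single u 1 - scal c * single u 1 * gen p \<in> CX.I"
 using assms(2)
proof (induction u)
 case Nil
 show ?case by (rule exI[of _ 1]) (simp add: one_free[symmetric] scal_def CX.I_0)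
next
 case (Cons x u)
 then obtain c where c: "gen p * single u 1 - scal c * single u 1 * gen p \<in> CX.I" by auto
 have x: "x \<in> GX" "u \<in> lists GX" using Cons by auto
 let ?s = "scal (om (fst p) (fst x))" and ?u = "single u 1 :: (nat \<times> nat) free"
 have a: "(gen p * gen x - ?s * gen x * gen p) * ?u \<in> CX.I"
  by (rule CX.I_right[OF I_comm[OF assms(1) x(1)] frees_single[OF x(2)]])
 have b: "(?s * gen x) * (gen p * ?u - scal c * ?u * gen p) \<in> CX.I"
  by (rule CX.I_left[OF c frees_mult[OF frees_scal frees_gen[OF x(1)]]])
 have xu: "single (x # u) 1 = gen x * ?u" by (simp add: gen_def single_mult_free)
 have s: "scal (om (fst p) (fst x) * c) = ?s * (scal c :: (nat \<times> nat) free)"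
  by (simp add: scal_def single_mult_free)
 have cg: "?s * gen x * (scal c * ?u * gen p) = ?s * scal c * (gen x * ?u) * gen p"
  by (simp add: scal_def gen_def single_mult_free mult.assoc mult_ac)
 have "gen p * single (x # u) 1 - scal (om (fst p) (fst x) * c) * single (x # u) 1 * gen p
  = (gen p * gen x - ?s * gen x * gen p) * ?u + (?s * gen x) * (gen p * ?u - scal c * ?u * gen p)"
  unfolding xu s using cg by (simp add: algebra_simps)
 thus ?case using CX.I_add[OF a b] by metis
qed

text \<open>For an odd row the relation of a generator with itself reads 2 x^2 = 0.\<close>

lemma square_I:
 assumes "p \<in> GX" "m \<le> fst p"
 shows "gen p * gen p \<in> CX.I"
proof -
 have a: "gen p * gen p - scal (om (fst p) (fst p)) * gen p * gen p \<in> CX.I" by (rule I_comm[OF assms(1,1)])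
 have "gen p * gen p = scal (1 / 2) * (gen p * gen p - scal (om (fst p) (fst p)) * gen p * gen p)"
 proof -
  have "scal (om (fst p) (fst p)) = (- 1 :: (nat \<times> nat) free)"
   using assms(2) by (simp add: scal_def one_free om_same single_uminus[symmetric])
  hence "gen p * gen p - scal (om (fst p) (fst p)) * gen p * gen p = gen p * gen p + gen p * gen p" by simp
  thus ?thesis by (simp add: scal_def gen_def single_mult_free distrib_left single_add[symmetric])
 qed
 thus ?thesis using CX.I_left[OF a frees_scal, of "1 / 2"] by metis
qed

section \<open>Normal words form a basis of the algebra\<close>

definition W :: "mon => (nat \<times> nat) list => (nat \<times> nat) list" where
 "W a L = concat (map (\<lambda>p. replicate (a p) p) L)"

definition KX :: "(nat \<times> nat) list" where
 "KX = List.product [0..<M] [0..<N]"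

lemma KX: "distinct KX" "set KX = GX"
 by (auto simp: KX_def distinct_product)

lemma W_lists: "set L \<subseteq> GX ==> W a L \<in> lists GX"
 by (auto simp: W_def)

lemma W_append: "W a (L @ L') = W a L @ W a L'" and W_Cons: "W a (p # L) = replicate (a p) p @ W a L"
 by (simp_all add: W_def)

lemma W_upd: "p \<notin> set L ==> W (a(p := k)) L = W a L"
 unfolding W_def by (rule arg_cong[of _ _ concat]) auto

definition nw :: "mon => (nat \<times> nat) free" where
 "nw a = single (W a KX) 1"

lemma nw_frees: "nw a \<in> frees GX"
 unfolding nw_def using W_lists[of KX] KX(2) by (intro frees_single) simp

text \<open>Move the generator past the word of the smaller positions. It arrives at its own power,
  where in an odd row it may complete a square and vanish modulo the ideal.\<close>

lemma gen_nw:
 assumes p: "p \<in> GX" and a: "valid M a"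
 shows "gen p * nw a \<in> CX.I \<or>
  (\<exists>c. gen p * nw a - scal c * nw (a(p := Suc (a p))) \<in> CX.I \<and> valid M (a(p := Suc (a p))))"
proof -
 obtain K1 K2 where K: "KX = K1 @ p # K2" using p KX(2) by (metis split_list)
 have np: "p \<notin> set K1" "p \<notin> set K2" using KX(1) unfolding K by auto
 have sub: "set K1 \<subseteq> GX" "set K2 \<subseteq> GX" using KX(2) unfolding K by auto
 let ?s = "\<lambda>w. single w 1 :: (nat \<times> nat) free"
 let ?R = "?s (replicate (a p) p)" and ?U = "?s (W a K1)" and ?V = "?s (W a K2)"
 have nw: "nw a = ?U * ?R * ?V" unfolding nw_def K W_append W_Cons by (simp add: single_mult_free)
 have nw': "nw (a(p := Suc (a p))) = ?U * (gen p * ?R) * ?V"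
  unfolding nw_def K W_append W_Cons using np by (simp add: single_mult_free gen_def W_upd)
 obtain c where c: "gen p * ?U - scal c * ?U * gen p \<in> CX.I"
  using word_comm[OF p W_lists[OF sub(1)]] by blast
 have rf: "?R \<in> frees GX" "?V \<in> frees GX" "?U \<in> frees GX"
  using p W_lists[OF sub(1), of a] W_lists[OF sub(2), of a] by (intro frees_single; auto)+
 have d: "(gen p * ?U - scal c * ?U * gen p) * (?R * ?V) \<in> CX.I"
  by (rule CX.I_right[OF c frees_mult[OF rf(1,2)]])
 have e: "gen p * nw a - scal c * nw (a(p := Suc (a p))) = (gen p * ?U - scal c * ?U * gen p) * (?R * ?V)"
  unfolding nw nw' by (simp add: algebra_simps)
 show ?thesis
 proof (cases "m \<le> fst p \<and> a p \<noteq> 0")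
  case True
  hence ap: "a p = 1" using valid_odd[OF a, of p] by simp
  hence R: "gen p * ?R = gen p * gen p" by (simp add: gen_def)
  have "gen p * gen p \<in> CX.I" using square_I[OF p] True by simp
  hence f: "(scal c * ?U) * ((gen p * gen p) * ?V) \<in> CX.I"
   using CX.I_left[OF CX.I_right[OF _ rf(2)] frees_mult[OF frees_scal rf(3)]] by blast
  have "gen p * nw a = (gen p * ?U - scal c * ?U * gen p) * (?R * ?V) + (scal c * ?U) * ((gen p * gen p) * ?V)"
   unfolding nw R[symmetric] by (simp add: algebra_simps)
  thus ?thesis using CX.I_add[OF d f] by metis
 next
  case False
  have "valid M (a(p := Suc (a p)))"
  proof (rule validI)
   show "fst p' < M \<and> snd p' < N" if "(a(p := Suc (a p))) p' \<noteq> 0" for p'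
    using that valid_box[OF a, of p'] p by (cases "p' = p") auto
   show "(a(p := Suc (a p))) p' \<le> 1" if "m \<le> fst p'" for p'
    using that valid_odd[OF a, of p'] False by (cases "p' = p") auto
  qed
  thus ?thesis using d e by metis
 qed
qed

lemma xx_ind:
 "xx p (ind b) = (if m \<le> fst p \<and> b p \<noteq> 0 then 0 else sc (sg p (b(p := Suc (b p)))) (ind (b(p := Suc (b p)))))"
proof
 fix a
 show "xx p (ind b) a = (if m \<le> fst p \<and> b p \<noteq> 0 then 0 else sc (sg p (b(p := Suc (b p)))) (ind (b(p := Suc (b p))))) a"
 proof (cases "a = b(p := Suc (b p))")
  case True
  thus ?thesis by (auto simp: xx_def ind_def)
 next
  case False
  have "xx p (ind b) a = 0"
  proof (rule ccontr)
   assume "xx p (ind b) a \<noteq> 0"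
   then obtain c where "ind b c \<noteq> 0" "a = c(p := Suc (c p))" using xx_nz by blast
   thus False using False by (auto simp: ind_def split: if_splits)
  qed
  thus ?thesis using False by (simp add: ind_def)
 qed
qed

text \<open>The coordinates of the unit of the algebra.\<close>

definition vac :: vec where
 "vac = ind (\<lambda>_. 0)"

lemma xx_power_ind:
 assumes "b p = 0" "m \<le> fst p ==> k \<le> 1"
 shows "\<exists>d. d \<noteq> 0 \<and> foldr xx (replicate k p) (ind b) = sc d (ind (b(p := k)))"
 using assms(2)
proof (induction k)
 case 0
 thus ?case using assms(1) by (intro exI[of _ 1]) (simp add: fun_upd_idem)
next
 case (Suc k)
 have "m \<le> fst p ==> k \<le> 1" using Suc.prems by simp
 from Suc.IH[OF this] obtain d where d: "d \<noteq> 0" "foldr xx (replicate k p) (ind b) = sc d (ind (b(p := k)))" by blast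
 have nc: "\<not> (m \<le> fst p \<and> (b(p := k)) p \<noteq> 0)" using Suc.prems by auto
 have x: "xx p (ind (b(p := k))) = sc (sg p (b(p := Suc k))) (ind (b(p := Suc k)))"
  unfolding xx_ind if_not_P[OF nc] by simp
 hence "foldr xx (replicate (Suc k) p) (ind b) = sc (d * sg p (b(p := Suc k))) (ind (b(p := Suc k)))"
  unfolding replicate_Suc foldr_Cons comp_def d(2) X_lin x by simp
 thus ?case using d(1) by (metis mult_eq_0_iff sg_nz)
qed

lemma W_vac:
 assumes a: "valid M a" and L: "distinct L"
 shows "\<exists>d. d \<noteq> 0 \<and> foldr xx (W a L) vac = sc d (ind (\<lambda>p. if p \<in> set L then a p else 0))"
 using L
proof (induction L)
 case Nil
 thus ?case by (intro exI[of _ 1]) (simp add: W_def vac_def)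
next
 case (Cons p L)
 have "distinct L" using Cons.prems by simp
 from Cons.IH[OF this] obtain d where d: "d \<noteq> 0" "foldr xx (W a L) vac = sc d (ind (\<lambda>p. if p \<in> set L then a p else 0))" by blast
 let ?b = "\<lambda>p. if p \<in> set L then a p else 0"
 obtain e where e: "e \<noteq> 0" "foldr xx (replicate (a p) p) (ind ?b) = sc e (ind (?b(p := a p)))"
  using xx_power_ind[of ?b p "a p"] valid_odd[OF a, of p] Cons.prems by auto
 have eq: "?b(p := a p) = (\<lambda>x. if x \<in> set (p # L) then a x else 0)" by auto
 hence "foldr xx (W a (p # L)) vac = sc (d * e) (ind (\<lambda>x. if x \<in> set (p # L) then a x else 0))"
  unfolding W_Cons foldr_append comp_def d(2) linop_sc[OF linop_foldr[OF linop_xx]] e(2) eq by simp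
 thus ?case using d(1) e(1) by (metis mult_eq_0_iff)
qed

lemma ev_nw:
 assumes a: "valid M a"
 shows "\<exists>d. d \<noteq> 0 \<and> ev xx (nw a) vac = sc d (ind a)"
proof -
 have "(\<lambda>p. if p \<in> set KX then a p else 0) = a"
 proof
  fix p show "(if p \<in> set KX then a p else 0) = a p"
   using valid_box[OF a, of p] by (cases "a p = 0"; cases p) (auto simp: KX(2))
 qed
 thus ?thesis using W_vac[OF a KX(1)] by (simp add: nw_def ev_single)
qed

text \<open>Of this scalar only its being nonzero enters the argument.\<close>

definition dn :: "mon => complex" where
 "dn a = (SOME d. d \<noteq> 0 \<and> ev xx (nw a) vac = sc d (ind a))"

lemma dn: "valid M a ==> dn a \<noteq> 0" "valid M a ==> ev xx (nw a) vac = sc (dn a) (ind a)"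
 using someI_ex[OF ev_nw[of a]] unfolding dn_def by blast+

definition lin :: "vec => (nat \<times> nat) free" where
 "lin v = (\<Sum>a | v a \<noteq> 0. scal (v a) * nw a)"

lemma scal_add: "scal (c + d) = scal c + scal d" and scal_0: "scal 0 = 0"
 and scal_scal: "scal c * (scal d * f) = scal (c * d) * f"
 by (simp_all add: scal_def single_add single_mult_free flip: mult.assoc)

lemma lin_superset: "finite A ==> {a. v a \<noteq> 0} \<subseteq> A ==> lin v = (\<Sum>a\<in>A. scal (v a) * nw a)"
 unfolding lin_def by (rule sum.mono_neutral_left) (auto simp: scal_0)

lemma lin_add:
 assumes "v \<in> B M" "w \<in> B M"
 shows "lin (v + w) = lin v + lin w"
proof -
 let ?A = "{a. v a \<noteq> 0} \<union> {a. w a \<noteq> 0}"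
 have A: "finite ?A" using B_finite assms by blast
 have "lin (v + w) = (\<Sum>a\<in>?A. scal ((v + w) a) * nw a)" by (rule lin_superset[OF A]) auto
 also have "\<dots> = (\<Sum>a\<in>?A. scal (v a) * nw a) + (\<Sum>a\<in>?A. scal (w a) * nw a)"
  by (simp add: scal_add distrib_right sum.distrib)
 also have "\<dots> = lin v + lin w" using lin_superset[OF A, of v] lin_superset[OF A, of w] by auto
 finally show ?thesis .
qed

lemma lin_sc: "v \<in> B M ==> lin (sc c v) = scal c * lin v"
proof -
 assume "v \<in> B M"
 hence A: "finite {a. v a \<noteq> 0}" by (rule B_finite)
 have "lin (sc c v) = (\<Sum>a | v a \<noteq> 0. scal (sc c v a) * nw a)" by (rule lin_superset[OF A]) auto
 thus ?thesis by (simp add: lin_def sum_distrib_left scal_scal)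
qed

lemma ind_B: "valid M a ==> ind a \<in> B M"
 by (rule BI) (auto simp: ind_def FS_def split: if_splits)

lemma lin_ind: "lin (ind a) = nw a"
proof -
 have "lin (ind a) = (\<Sum>b\<in>{a}. scal (ind a b) * nw b)" by (rule lin_superset) (auto simp: ind_def)
 thus ?thesis by (simp add: ind_def scal_def one_free[symmetric])
qed

text \<open>Induction on the length of a word: multiplication by a generator maps combinations of
  normal words to such combinations modulo the ideal, by \<open>gen_nw\<close>.\<close>

lemma nw_spans:
 assumes "f \<in> frees GX"
 shows "\<exists>v\<in>B M. f - lin v \<in> CX.I"
proof -
 define Sp where "Sp f \<longleftrightarrow> (\<exists>v\<in>B M. f - lin v \<in> CX.I)" for f
 have Sp_add: "Sp (f + g)" if f: "Sp f" and g: "Sp g" for f g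
 proof -
  obtain v w where v: "v \<in> B M" "f - lin v \<in> CX.I" and w: "w \<in> B M" "g - lin w \<in> CX.I"
   using f g unfolding Sp_def by blast
  have "f + g - lin (v + w) = (f - lin v) + (g - lin w)" by (simp add: lin_add v w)
  thus ?thesis unfolding Sp_def using CX.I_add[OF v(2) w(2)] subsp_add[OF subsp_B v(1) w(1)] by metis
 qed
 have Sp_scal: "Sp (scal c * f)" if f: "Sp f" for c f
 proof -
  obtain v where v: "v \<in> B M" "f - lin v \<in> CX.I" using f unfolding Sp_def by blast
  have "scal c * f - lin (sc c v) = scal c * (f - lin v)" by (simp add: lin_sc v right_diff_distrib)
  hence "scal c * f - lin (sc c v) \<in> CX.I" using CX.I_left[OF v(2) frees_scal] by simp
  thus ?thesis unfolding Sp_def using subsp_sc[OF subsp_B v(1)] by blast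
 qed
 have Sp_I: "Sp f" if fg: "f - g \<in> CX.I" and g: "Sp g" for f g
 proof -
  obtain v where v: "v \<in> B M" "g - lin v \<in> CX.I" using g unfolding Sp_def by blast
  have "f - lin v = (f - g) + (g - lin v)" by simp
  thus ?thesis unfolding Sp_def using CX.I_add[OF fg v(2)] v(1) by metis
 qed
 have Sp_0: "Sp 0" unfolding Sp_def using subsp_0[OF subsp_B] CX.I_0
  by (intro bexI[of _ 0]) (simp_all add: lin_def)
 have Sp_sum: "Sp (\<Sum>i\<in>A. h i)" if "\<And>i. i \<in> A ==> Sp (h i)" for A :: "'i set" and h
  using that by (induction A rule: infinite_finite_induct) (auto simp: Sp_0 Sp_add)
 have Sp_nw: "Sp (nw a)" if "valid M a" for a
  unfolding Sp_def using ind_B[OF that] CX.I_0 by (intro bexI[of _ "ind a"]) (simp_all add: lin_ind)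
 have Sp_word: "Sp (single w 1)" if "w \<in> lists GX" for w
  using that
 proof (induction w)
  case Nil
  have "W (\<lambda>_. 0) L = []" for L by (simp add: W_def concat_eq_Nil_conv)
  hence "nw (\<lambda>_. 0) = single [] 1" by (simp add: nw_def)
  thus ?case using Sp_nw[of "\<lambda>_. 0"] by (simp add: valid_def)
 next
  case (Cons p w)
  hence p: "p \<in> GX" and "Sp (single w 1)" by auto
  then obtain v where v: "v \<in> B M" "single w 1 - lin v \<in> CX.I" unfolding Sp_def by blast
  have "Sp (gen p * nw a)" if a: "valid M a" for a
   using gen_nw[OF p a]
  proof (elim disjE exE conjE)
   assume "gen p * nw a \<in> CX.I"
   thus ?thesis using Sp_I[of "gen p * nw a" 0] Sp_0 by simp
  next
   fix c assume "gen p * nw a - scal c * nw (a(p := Suc (a p))) \<in> CX.I" "valid M (a(p := Suc (a p)))"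
   thus ?thesis using Sp_I Sp_scal[OF Sp_nw] by blast
  qed
  hence "Sp (\<Sum>a | v a \<noteq> 0. scal (v a) * (gen p * nw a))"
   using B_valid[OF v(1)] by (intro Sp_sum Sp_scal) auto
  moreover have "gen p * lin v = (\<Sum>a | v a \<noteq> 0. scal (v a) * (gen p * nw a))"
   unfolding lin_def sum_distrib_left
   by (intro sum.cong refl) (simp add: scal_def gen_def nw_def single_mult_free)
  ultimately have a: "Sp (gen p * lin v)" by simp
  have "gen p * (single w 1 - lin v) \<in> CX.I" by (rule CX.I_left[OF v(2) frees_gen[OF p]])
  moreover have "gen p * (single w 1 - lin v) = single (p # w) 1 - gen p * lin v"
   by (simp add: right_diff_distrib gen_def single_mult_free)
  ultimately show ?case using Sp_I[OF _ a] by simp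
 qed
 have e: "(\<Sum>w\<in>keys f. scal (lookup f w) * single w 1) = f"
  using poly_mapping_expand[of f] by (simp add: scal_def single_mult_free)
 have "Sp (\<Sum>w\<in>keys f. scal (lookup f w) * single w 1)"
  by (rule Sp_sum, rule Sp_scal, rule Sp_word) (use assms in auto)
 thus ?thesis unfolding e Sp_def .
qed

lemma vac_B: "vac \<in> B M"
 unfolding vac_def by (rule ind_B) (simp add: valid_def)

text \<open>Modulo the ideal f is a combination of normal words, and their values at the vacuum are
  nonzero multiples of distinct monomials. Hence evaluation at the vacuum loses nothing.\<close>

lemma ev_xx_inj:
 assumes f: "f \<in> frees GX" and z: "ev xx f vac = 0"
 shows "f \<in> CX.I"
proof -
 obtain v where v: "v \<in> B M" "f - lin v \<in> CX.I" using nw_spans[OF f] by blast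
 have "ev xx (f - lin v) vac = 0"
  using CX.ev_I[OF linop_xx subsp_B xx_closed ev_RX v(2) vac_B] .
 hence "ev xx (lin v) vac = 0" using z by (simp add: ev_diff)
 moreover have "ev xx (lin v) vac = (\<Sum>a | v a \<noteq> 0. sc (v a * dn a) (ind a))"
  unfolding lin_def ev_sum ev_scal
 proof (intro sum.cong refl)
  fix a assume "a \<in> {a. v a \<noteq> 0}"
  hence "valid M a" using B_valid[OF v(1)] by blast
  thus "sc (v a) (ev xx (nw a) vac) = sc (v a * dn a) (ind a)" unfolding dn(2)[OF \<open>valid M a\<close>] by simp
 qed
 ultimately have s0: "(\<Sum>a | v a \<noteq> 0. sc (v a * dn a) (ind a)) = 0" by (simp only:)
 have "v b = 0" for b
 proof (rule ccontr)
  assume nb: "v b \<noteq> 0"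
  have "v b * dn b = (\<Sum>a | v a \<noteq> 0. sc (v a * dn a) (ind a)) b"
   using B_finite[OF v(1)] nb by (simp add: ind_def if_distrib[where f = "\<lambda>x. _ * x"] sum.delta cong: if_cong)
  also have "\<dots> = 0" unfolding s0 by simp
  finally show False using nb dn(1)[OF B_valid[OF v(1) nb]] by simp
 qed
 hence "lin v = 0" by (simp add: lin_def)
 thus ?thesis using v(2) by simp
qed

definition nf :: "vec => (nat \<times> nat) free" where
 "nf v = (\<Sum>a | v a \<noteq> 0. scal (v a / dn a) * nw a)"

lemma nf:
 assumes "v \<in> B M"
 shows "nf v \<in> frees GX" "ev xx (nf v) vac = v"
proof -
 show "nf v \<in> frees GX" unfolding nf_def by (intro frees_sum frees_mult frees_scal nw_frees)
 have "ev xx (nf v) vac = (\<Sum>a | v a \<noteq> 0. sc (v a) (ind a))"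
  unfolding nf_def ev_sum ev_scal
 proof (intro sum.cong refl)
  fix a assume "a \<in> {a. v a \<noteq> 0}"
  hence a: "valid M a" using B_valid[OF assms] by blast
  show "sc (v a / dn a) (ev xx (nw a) vac) = sc (v a) (ind a)" unfolding dn(2)[OF a] using dn(1)[OF a] by simp
 qed
 thus "ev xx (nf v) vac = v" by (rule trans[OF _ ind_expand[OF B_finite[OF assms], symmetric]])
qed

lemma homog_vac: "homog mdeg 0 vac"
proof -
 have "mdeg (\<lambda>_. 0) = 0" by (rule poly_mapping_eqI) (simp add: lookup_mdeg rdeg_def)
 thus ?thesis by (auto simp: vac_def supported_def ind_def split: if_splits)
qed

lemma homog_word: "w \<in> lists GX ==> homog mdeg (wdeg w) (foldr xx w vac)"
proof (induction w)
 case Nil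
 thus ?case using homog_vac by simp
next
 case (Cons x w)
 hence "x \<in> GX" "homog mdeg (wdeg w) (foldr xx w vac)" by auto
 hence "homog mdeg (eps (fst x) + wdeg w) (xx x (foldr xx w vac))" using GX_D by (intro homog_xx) auto
 thus ?case by simp
qed

lemma wdeg_W:
 assumes "valid M a"
 shows "wdeg (W a KX) = mdeg a"
proof -
 have "foldr xx (W a KX) vac = sc (dn a) (ind a)"
  using dn(2)[OF assms] by (simp add: nw_def ev_single)
 hence "foldr xx (W a KX) vac a \<noteq> 0" using dn(1)[OF assms] by (simp add: ind_def)
 thus ?thesis using homog_word[OF W_lists[of KX a]] KX(2) by (auto simp: supported_def)
qed

section \<open>Coordinates on the algebra and twisted derivations\<close>

abbreviation "Cw \<equiv> C_omega m n N q"

lemma Cw: "Cw = presented_algebra GX (\<lambda>(i, r). eps i) RX"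
 by (simp add: C_omega_def)

definition psi :: "(nat \<times> nat) free set => vec" where
 "psi A = CX.pev xx A vac"

lemma psi_cls: "f \<in> frees GX ==> psi (CX.cls f) = ev xx f vac"
 unfolding psi_def by (rule CX.pev_cls[OF linop_xx subsp_B xx_closed ev_RX _ vac_B])

lemma ev_xx_B: "f \<in> frees GX ==> v \<in> B M ==> ev xx f v \<in> B M"
 by (rule ev_in[where S = "B M" and G = GX]) (simp_all add: xx_closed)

lemma psi_lin_model: "lin_model Cw psi (B M)"
 unfolding lin_model_def Cw CX.Alg_zero
proof (intro conjI ballI allI)
 let ?C = "presented_algebra GX (\<lambda>(i, r). eps i) RX"
 show "bij_betw psi (carrier ?C) (B M)"
  unfolding CX.Alg_carrier bij_betw_def
 proof
  show "inj_on psi (CX.cls ` frees GX)"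
  proof (rule inj_onI)
   fix x y assume "x \<in> CX.cls ` frees GX" "y \<in> CX.cls ` frees GX" and eq: "psi x = psi y"
   then obtain f g where fg: "x = CX.cls f" "y = CX.cls g" "f \<in> frees GX" "g \<in> frees GX" by blast
   have "ev xx (f - g) vac = 0" using eq unfolding fg(1,2) psi_cls[OF fg(3)] psi_cls[OF fg(4)] by (simp add: ev_diff)
   thus "x = y" unfolding fg(1,2) CX.cls_eq by (rule ev_xx_inj[OF frees_diff[OF fg(3,4)]])
  qed
  show "psi ` CX.cls ` frees GX = B M"
  proof
   show "psi ` CX.cls ` frees GX \<subseteq> B M" using psi_cls ev_xx_B[OF _ vac_B] by (auto simp del: carrier_free_algebra)
   show "B M \<subseteq> psi ` CX.cls ` frees GX"
   proof
    fix v assume v: "v \<in> B M"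
    have "psi (CX.cls (nf v)) = v" using psi_cls[OF nf(1)[OF v]] nf(2)[OF v] by simp
    thus "v \<in> psi ` CX.cls ` frees GX" using nf(1)[OF v] by (metis imageI)
   qed
  qed
 qed
 show "CX.cls 0 \<in> carrier ?C" by (rule CX.cls_carrier[OF frees_0])
 show "psi (CX.cls 0) = 0" by (simp add: psi_cls[OF frees_0])
 fix x assume "x \<in> carrier ?C"
 then obtain f where f: "f \<in> frees GX" "x = CX.cls f" unfolding CX.Alg_carrier by blast
 show "c \<odot>\<^bsub>?C\<^esub> x \<in> carrier ?C" for c
  unfolding f(2) CX.Alg_smult[OF f(1)] by (rule CX.cls_carrier[OF frees_mult[OF frees_scal f(1)]])
 show "psi (c \<odot>\<^bsub>?C\<^esub> x) = sc c (psi x)" for c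
  unfolding f(2) CX.Alg_smult[OF f(1)] psi_cls[OF f(1)] psi_cls[OF frees_mult[OF frees_scal f(1)]] by (rule ev_scal)
 fix y assume "y \<in> carrier ?C"
 then obtain g where g: "g \<in> frees GX" "y = CX.cls g" unfolding CX.Alg_carrier by blast
 show "x \<oplus>\<^bsub>?C\<^esub> y \<in> carrier ?C"
  unfolding f(2) g(2) CX.Alg_add[OF f(1) g(1)] by (rule CX.cls_carrier[OF frees_add[OF f(1) g(1)]])
 show "psi (x \<oplus>\<^bsub>?C\<^esub> y) = psi x + psi y"
  unfolding f(2) g(2) CX.Alg_add[OF f(1) g(1)] psi_cls[OF f(1)] psi_cls[OF g(1)] psi_cls[OF frees_add[OF f(1) g(1)]]
  by (rule ev_add)
qed simp

lemma psi_mult: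
 assumes "f \<in> frees GX" "y \<in> carrier Cw"
 shows "CX.cls f \<otimes>\<^bsub>Cw\<^esub> y \<in> carrier Cw" "psi (CX.cls f \<otimes>\<^bsub>Cw\<^esub> y) = ev xx f (psi y)"
proof -
 obtain g where g: "g \<in> frees GX" "y = CX.cls g" using assms(2) unfolding Cw CX.Alg_carrier by blast
 show "CX.cls f \<otimes>\<^bsub>Cw\<^esub> y \<in> carrier Cw"
  unfolding g(2) Cw CX.Alg_mult[OF assms(1) g(1)] by (rule CX.cls_carrier[OF frees_mult[OF assms(1) g(1)]])
 show "psi (CX.cls f \<otimes>\<^bsub>Cw\<^esub> y) = ev xx f (psi y)"
  unfolding g(2) Cw CX.Alg_mult[OF assms(1) g(1)] psi_cls[OF frees_mult[OF assms(1) g(1)]] psi_cls[OF g(1)]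
  by (rule ev_mult) simp
qed

lemma Cw_hcomp: "hcomp Cw \<alpha> = {CX.cls f |f. keys f \<subseteq> {w \<in> lists GX. wdeg w = \<alpha>}}"
 unfolding Cw CX.Alg_hcomp wdeg_def ..

lemma psi_hmodel: "hmodel Cw psi (\<lambda>\<alpha>. B M \<inter> {v. homog mdeg \<alpha> v})"
 unfolding hmodel_def Cw_hcomp
proof (intro allI conjI)
 fix \<alpha>
 let ?H = "{CX.cls f |f. keys f \<subseteq> {w \<in> lists GX. wdeg w = \<alpha>}}"
 have fr: "f \<in> frees GX" if "keys f \<subseteq> {w \<in> lists GX. wdeg w = \<alpha>}" for f
  using that by auto
 show "?H \<subseteq> carrier Cw" unfolding Cw using CX.cls_carrier[OF fr] by blast
 show "psi ` ?H = B M \<inter> {v. homog mdeg \<alpha> v}"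
 proof
  show "psi ` ?H \<subseteq> B M \<inter> {v. homog mdeg \<alpha> v}"
  proof
   fix v assume "v \<in> psi ` ?H"
   then obtain f where f: "keys f \<subseteq> {w \<in> lists GX. wdeg w = \<alpha>}" "v = psi (CX.cls f)" by blast
   have v: "v = ev xx f vac" unfolding f(2) by (rule psi_cls[OF fr[OF f(1)]])
   have "v \<in> {v. homog mdeg \<alpha> v}"
    unfolding v ev_def
   proof (rule lext_in[OF subsp_supported])
    fix k assume "k \<in> keys f"
    hence "k \<in> lists GX" "wdeg k = \<alpha>" using f(1) by blast+
    thus "foldr xx k vac \<in> {v. homog mdeg \<alpha> v}" using homog_word by blast
   qed
   thus "v \<in> B M \<inter> {v. homog mdeg \<alpha> v}" using ev_xx_B[OF fr[OF f(1)] vac_B] v by simp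
  qed
  show "B M \<inter> {v. homog mdeg \<alpha> v} \<subseteq> psi ` ?H"
  proof
   fix v assume v: "v \<in> B M \<inter> {v. homog mdeg \<alpha> v}"
   have "keys (nf v) \<subseteq> {w \<in> lists GX. wdeg w = \<alpha>}"
    unfolding nf_def
   proof (rule keys_sum_sub)
    fix a assume "a \<in> {a. v a \<noteq> 0}"
    hence a: "valid M a" "mdeg a = \<alpha>" using v B_valid by (auto simp: supported_def)
    show "keys (scal (v a / dn a) * nw a) \<subseteq> {w \<in> lists GX. wdeg w = \<alpha>}"
     using wdeg_W[OF a(1)] W_lists[of KX a] KX(2) a(2) by (simp add: scal_def nw_def single_mult_free)
   qed
   moreover have "psi (CX.cls (nf v)) = v" using v psi_cls[OF nf(1)] nf(2) by simp
   ultimately show "v \<in> psi ` ?H" by (metis (mono_tags, lifting) image_eqI mem_Collect_eq)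
  qed
 qed
qed

text \<open>The twisted Leibniz rule for words. The element d plays the part of T applied to the
  word; if T kills the vacuum, evaluating there identifies it, see \<open>leib_Cw\<close>.\<close>

definition leib :: "(vec => vec) => (degree => complex) => bool" where
 "leib T \<chi> \<longleftrightarrow> (\<forall>w\<in>lists GX. \<exists>d\<in>frees GX. \<forall>v\<in>B M.
   T (foldr xx w v) = ev xx d v + sc (\<chi> (wdeg w)) (foldr xx w (T v)))"

lemma foldr_xx_B: "w \<in> lists GX ==> v \<in> B M ==> foldr xx w v \<in> B M"
 by (induction w) (auto intro: X_B)

lemma leib_dd:
 assumes p: "p \<in> GX"
 shows "leib (dd p) (om' (- eps (fst p)))"
 unfolding leib_def
proof
 fix w assume "w \<in> lists GX"
 thus "\<exists>d\<in>frees GX. \<forall>v\<in>B M. dd p (foldr xx w v) = ev xx d v + sc (om' (- eps (fst p)) (wdeg w)) (foldr xx w (dd p v))"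
 proof (induction w)
  case Nil
  show ?case by (rule bexI[OF _ frees_0]) simp
 next
  case (Cons x w)
  hence x: "x \<in> GX" and w: "w \<in> lists GX" by auto
  from Cons.IH obtain d where d: "d \<in> frees GX"
   "\<And>v. v \<in> B M ==> dd p (foldr xx w v) = ev xx d v + sc (om' (- eps (fst p)) (wdeg w)) (foldr xx w (dd p v))" by blast
  let ?c = "om (fst x) (fst p)"
  \<comment> \<open>The derivative of the word x w: the word w if x is the generator at p, plus x
    times the twisted derivative of w.\<close>
  let ?d = "(if p = x then single w 1 else 0) + scal ?c * (gen x * d)"
  have c: "om' (- eps (fst p)) (eps (fst x)) = ?c" using omega_neg_eps p x by auto
  have "?d \<in> frees GX"
   using d(1) x w frees_0 frees_single[OF w, of 1] by (intro frees_add frees_mult frees_gen frees_scal) auto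
  moreover have "dd p (foldr xx (x # w) v) = ev xx ?d v + sc (om' (- eps (fst p)) (wdeg (x # w))) (foldr xx (x # w) (dd p v))"
   if v: "v \<in> B M" for v
  proof -
   have "dd p (xx x (foldr xx w v)) = (if p = x then foldr xx w v else 0) + sc ?c (xx x (dd p (foldr xx w v)))"
    using p x by (intro dd_X[OF foldr_xx_B[OF w v]]) auto
   also have "\<dots> = (if p = x then foldr xx w v else 0) + sc ?c (xx x (ev xx d v))
     + sc (?c * om' (- eps (fst p)) (wdeg w)) (xx x (foldr xx w (dd p v)))"
    unfolding d(2)[OF v] X_lin sc_add sc_simps by (simp only: add.assoc)
   also have "\<dots> = ev xx ?d v + sc (om' (- eps (fst p)) (wdeg (x # w))) (foldr xx (x # w) (dd p v))"
    by (simp add: ev_add ev_single ev_scal ev_mult omega_add_right c)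
   finally show ?thesis by simp
  qed
  ultimately show ?case by (intro bexI[of _ ?d] ballI)
 qed
qed

lemma foldr_xx_commute:
 assumes p: "p \<in> GX" and w: "w \<in> lists GX"
 shows "xx p (foldr xx w v) = sc (om' (eps (fst p)) (wdeg w)) (foldr xx w (xx p v))"
 using w
proof (induction w)
 case Nil
 show ?case by simp
next
 case (Cons x w)
 hence x: "x \<in> GX" and w: "w \<in> lists GX" by auto
 have c: "om' (eps (fst p)) (eps (fst x)) = om (fst p) (fst x)" using omega_eps p x by auto
 have xp: "xx p (xx x (foldr xx w v)) = sc (om (fst p) (fst x)) (xx x (xx p (foldr xx w v)))"
  using p x by (intro X_X) auto
 have IH: "xx p (foldr xx w v) = sc (om' (eps (fst p)) (wdeg w)) (foldr xx w (xx p v))" by (rule Cons.IH)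
 have "xx p (foldr xx (x # w) v) = sc (om' (eps (fst p)) (wdeg (x # w))) (foldr xx (x # w) (xx p v))"
  unfolding foldr_Cons comp_def xp IH X_lin wdeg_simps omega_add_right c by simp
 thus ?case .
qed

text \<open>To reach the second term the generator must pass the word, which multiplies the factor
  by \<omega> at its own degree.\<close>

lemma leib_xx:
 assumes T: "leib T \<chi>" and p: "p \<in> GX"
 shows "leib (\<lambda>v. xx p (T v)) (\<lambda>\<alpha>. om' (eps (fst p)) \<alpha> * \<chi> \<alpha>)"
 unfolding leib_def
proof
 fix w assume w: "w \<in> lists GX"
 then obtain d where d: "d \<in> frees GX"
  "\<And>v. v \<in> B M ==> T (foldr xx w v) = ev xx d v + sc (\<chi> (wdeg w)) (foldr xx w (T v))"
  using T unfolding leib_def by blast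
 have "xx p (T (foldr xx w v)) = ev xx (gen p * d) v + sc (om' (eps (fst p)) (wdeg w) * \<chi> (wdeg w)) (foldr xx w (xx p (T v)))"
  if v: "v \<in> B M" for v
  unfolding d(2)[OF v] X_lin foldr_xx_commute[OF p w] by (simp add: ev_mult mult.commute)
 thus "\<exists>d\<in>frees GX. \<forall>v\<in>B M. xx p (T (foldr xx w v)) = ev xx d v
   + sc (om' (eps (fst p)) (wdeg w) * \<chi> (wdeg w)) (foldr xx w (xx p (T v)))"
  using frees_mult[OF frees_gen[OF p] d(1)] by blast
qed

lemma leib_sum:
 assumes "\<And>r. r \<in> A ==> leib (T r) \<chi>"
 shows "leib (\<lambda>v. \<Sum>r\<in>A. T r v) \<chi>"
 unfolding leib_def
proof
 fix w assume w: "w \<in> lists GX"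
 have "\<forall>r\<in>A. \<exists>d. d \<in> frees GX \<and> (\<forall>v\<in>B M. T r (foldr xx w v) = ev xx d v + sc (\<chi> (wdeg w)) (foldr xx w (T r v)))"
  using assms w unfolding leib_def by blast
 then obtain d where d: "\<And>r. r \<in> A ==> d r \<in> frees GX"
  "\<And>r v. r \<in> A ==> v \<in> B M ==> T r (foldr xx w v) = ev xx (d r) v + sc (\<chi> (wdeg w)) (foldr xx w (T r v))"
  by metis
 have "(\<Sum>r\<in>A. T r (foldr xx w v)) = ev xx (\<Sum>r\<in>A. d r) v + sc (\<chi> (wdeg w)) (foldr xx w (\<Sum>r\<in>A. T r v))"
  if v: "v \<in> B M" for v
 proof -
  have "(\<Sum>r\<in>A. T r (foldr xx w v)) = (\<Sum>r\<in>A. ev xx (d r) v + sc (\<chi> (wdeg w)) (foldr xx w (T r v)))"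
   using d(2) v by (intro sum.cong refl)
  thus ?thesis
   unfolding ev_sum linop_sum[OF linop_foldr[OF linop_xx]] sc_sum sum.distrib .
 qed
 moreover have "(\<Sum>r\<in>A. d r) \<in> frees GX" by (rule frees_sum[OF d(1)])
 ultimately show "\<exists>d\<in>frees GX. \<forall>v\<in>B M. (\<Sum>r\<in>A. T r (foldr xx w v)) = ev xx d v
   + sc (\<chi> (wdeg w)) (foldr xx w (\<Sum>r\<in>A. T r v))" by blast
qed

lemma leib_E:
 assumes "i < M" "j < M"
 shows "leib (E i j) (om' (eps i - eps j))"
proof -
 have "om' (eps i - eps j) = (\<lambda>\<alpha>. om' (eps i) \<alpha> * om' (- eps j) \<alpha>)"
  using omega_add_left[of "eps i" "- eps j"] by (intro ext) simp
 hence "leib (\<lambda>v. xx (i, r) (dd (j, r) v)) (om' (eps i - eps j))" if "r < N" for r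
  using leib_xx[OF leib_dd[of "(j, r)"], of "(i, r)"] assms that by simp
 thus ?thesis unfolding E_def[abs_def] by (intro leib_sum) simp
qed

lemma leib_F:
 assumes "r < N" "s < N"
 shows "leib (F M r s) (om' 0)"
proof -
 \<comment> \<open>Creation and annihilation in one row have opposite degrees, so their factors
   cancel and column operators are ordinary derivations.\<close>
 have eq: "(\<lambda>\<alpha>. om' (eps i) \<alpha> * om' (- eps i) \<alpha>) = om' 0" for i
  using omega_add_left[of "eps i" "- eps i"] by (intro ext) simp
 have "leib (\<lambda>v. xx (i, r) (dd (i, s) v)) (om' 0)" if "i < M" for i
 proof -
  have G: "(i, s) \<in> GX" "(i, r) \<in> GX" using assms that by auto
  show ?thesis using leib_xx[OF leib_dd[OF G(1)] G(2)] unfolding fst_conv eq .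
 qed
 thus ?thesis unfolding F_def[abs_def] by (intro leib_sum) simp
qed

lemma leib_ev:
 assumes T: "leib T \<chi>" "linop T" and f: "keys f \<subseteq> {w \<in> lists GX. wdeg w = \<alpha>}"
 shows "\<exists>d\<in>frees GX. \<forall>v\<in>B M. T (ev xx f v) = ev xx d v + sc (\<chi> \<alpha>) (ev xx f (T v))"
proof -
 have "\<forall>w\<in>lists GX. \<exists>d. d \<in> frees GX \<and> (\<forall>v\<in>B M. T (foldr xx w v) = ev xx d v + sc (\<chi> (wdeg w)) (foldr xx w (T v)))"
  using T(1) unfolding leib_def by blast
 then obtain D where D: "\<And>w. w \<in> lists GX ==> D w \<in> frees GX"
  "\<And>w v. w \<in> lists GX ==> v \<in> B M ==> T (foldr xx w v) = ev xx (D w) v + sc (\<chi> (wdeg w)) (foldr xx w (T v))"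
  by metis
 let ?d = "\<Sum>w\<in>keys f. scal (lookup f w) * D w"
 have "?d \<in> frees GX" using D(1) f by (intro frees_sum frees_mult frees_scal) auto
 moreover have "T (ev xx f v) = ev xx ?d v + sc (\<chi> \<alpha>) (ev xx f (T v))" if v: "v \<in> B M" for v
 proof -
  have "T (ev xx f v) = lext (\<lambda>w. T (foldr xx w v)) f" unfolding ev_def by (rule lext_linop[OF T(2)])
  also have "\<dots> = lext (\<lambda>w. ev xx (D w) v + sc (\<chi> \<alpha>) (foldr xx w (T v))) f"
  proof (rule lext_cong)
   fix k assume "k \<in> keys f"
   hence k: "k \<in> lists GX" "wdeg k = \<alpha>" using f by blast+
   show "T (foldr xx k v) = ev xx (D k) v + sc (\<chi> \<alpha>) (foldr xx k (T v))"
    using D(2)[OF k(1) v] unfolding k(2) .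
  qed
  also have "\<dots> = (\<Sum>w\<in>keys f. sc (lookup f w) (ev xx (D w) v))
    + sc (\<chi> \<alpha>) (\<Sum>w\<in>keys f. sc (lookup f w) (foldr xx w (T v)))"
   unfolding lext_def sc_add sum.distrib sc_sum by (simp add: mult.commute)
  also have "\<dots> = ev xx ?d v + sc (\<chi> \<alpha>) (ev xx f (T v))"
   unfolding ev_sum ev_scal by (simp add: ev_def lext_def)
  finally show ?thesis .
 qed
 ultimately show ?thesis by blast
qed

definition tr :: "(vec => vec) => (nat \<times> nat) free set => (nat \<times> nat) free set" where
 "tr T A = inv_into (carrier Cw) psi (T (psi A))"

lemmas Cm = lin_modelD[OF psi_lin_model]

lemma tr:
 assumes "T ` B M \<subseteq> B M" "A \<in> carrier Cw"
 shows "tr T A \<in> carrier Cw" "psi (tr T A) = T (psi A)"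
 unfolding tr_def using lin_model_inv[OF psi_lin_model subsetD[OF assms(1) imageI[OF Cm(10)[OF assms(2)]]]] by blast+

lemma leib_Cw:
 assumes T: "leib T \<chi>" "linop T" "T ` B M \<subseteq> B M" "T vac = 0"
  and f: "x \<in> hcomp Cw \<alpha>" and y: "y \<in> carrier Cw"
 shows "tr T (x \<otimes>\<^bsub>Cw\<^esub> y) = (tr T x \<otimes>\<^bsub>Cw\<^esub> y) \<oplus>\<^bsub>Cw\<^esub> (\<chi> \<alpha> \<odot>\<^bsub>Cw\<^esub> (x \<otimes>\<^bsub>Cw\<^esub> tr T y))"
proof -
 obtain g where g: "x = CX.cls g" "keys g \<subseteq> {w \<in> lists GX. wdeg w = \<alpha>}"
  using f unfolding Cw_hcomp by blast
 have gf: "g \<in> frees GX" using g(2) by auto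
 have xc: "x \<in> carrier Cw" unfolding g(1) Cw by (rule CX.cls_carrier[OF gf])
 obtain d where d: "d \<in> frees GX" "\<And>v. v \<in> B M ==> T (ev xx g v) = ev xx d v + sc (\<chi> \<alpha>) (ev xx g (T v))"
  using leib_ev[OF T(1,2) g(2)] by blast
 have dc: "CX.cls d \<in> carrier Cw" unfolding Cw by (rule CX.cls_carrier[OF d(1)])
 have "ev xx g 0 = 0" by (rule linop_0[OF linop_ev[OF linop_xx]])
 hence "psi (tr T x) = psi (CX.cls d)"
  using tr(2)[OF T(3) xc] d(2)[OF vac_B] T(4) unfolding g(1) psi_cls[OF gf] psi_cls[OF d(1)] by simp
 hence td: "tr T x = CX.cls d" by (rule Cm(9)[OF tr(1)[OF T(3) xc] dc])
 note ty = tr[OF T(3) y]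
 note 1 = psi_mult[OF gf y] and 2 = psi_mult[OF gf ty(1)] and 3 = psi_mult[OF d(1) y]
 show ?thesis
  unfolding td unfolding g(1)
 proof (rule Cm(9))
  show "tr T (CX.cls g \<otimes>\<^bsub>Cw\<^esub> y) \<in> carrier Cw" by (rule tr(1)[OF T(3) 1(1)])
  show "(CX.cls d \<otimes>\<^bsub>Cw\<^esub> y) \<oplus>\<^bsub>Cw\<^esub> (\<chi> \<alpha> \<odot>\<^bsub>Cw\<^esub> (CX.cls g \<otimes>\<^bsub>Cw\<^esub> tr T y)) \<in> carrier Cw"
   by (rule Cm(5)[OF 3(1) Cm(7)[OF 2(1)]])
  show "psi (tr T (CX.cls g \<otimes>\<^bsub>Cw\<^esub> y)) = psi ((CX.cls d \<otimes>\<^bsub>Cw\<^esub> y) \<oplus>\<^bsub>Cw\<^esub> (\<chi> \<alpha> \<odot>\<^bsub>Cw\<^esub> (CX.cls g \<otimes>\<^bsub>Cw\<^esub> tr T y)))"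
   unfolding tr(2)[OF T(3) 1(1)] Cm(6)[OF 3(1) Cm(7)[OF 2(1)]] Cm(8)[OF 2(1)] 1(2) 2(2) 3(2) ty(2)
   by (rule d(2)[OF Cm(10)[OF y]])
 qed
qed

lemma dd_vac: "dd p vac = 0"
proof
 fix a
 have "a(p := Suc (a p)) \<noteq> (\<lambda>_. 0)" by (metis fun_upd_same nat.distinct(1))
 thus "dd p vac a = 0 a" by (simp add: dd_def vac_def ind_def)
qed

lemma E_vac: "E i j vac = 0" and F_vac: "F M r s vac = 0"
 by (simp_all add: E_def F_def dd_vac X_lin)

lemma psi_one: "\<one>\<^bsub>Cw\<^esub> \<in> carrier Cw" "psi \<one>\<^bsub>Cw\<^esub> = vac"
 unfolding Cw CX.Alg_one using CX.cls_carrier[OF frees_1] psi_cls[OF frees_1] by simp_all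

lemma psi_x_gen:
 assumes "p \<in> GX"
 shows "x_gen m n N q (fst p) (snd p) \<in> carrier Cw" "psi (x_gen m n N q (fst p) (snd p)) = xx p vac"
  "\<And>y. y \<in> carrier Cw ==> x_gen m n N q (fst p) (snd p) \<otimes>\<^bsub>Cw\<^esub> y \<in> carrier Cw \<and>
   psi (x_gen m n N q (fst p) (snd p) \<otimes>\<^bsub>Cw\<^esub> y) = xx p (psi y)"
proof -
 have x: "x_gen m n N q (fst p) (snd p) = CX.cls (gen p)" by (simp add: x_gen_def)
 show "x_gen m n N q (fst p) (snd p) \<in> carrier Cw" "psi (x_gen m n N q (fst p) (snd p)) = xx p vac"
  unfolding x Cw using CX.cls_carrier[OF frees_gen[OF assms]] psi_cls[OF frees_gen[OF assms]] by simp_all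
 show "x_gen m n N q (fst p) (snd p) \<otimes>\<^bsub>Cw\<^esub> y \<in> carrier Cw \<and>
   psi (x_gen m n N q (fst p) (snd p) \<otimes>\<^bsub>Cw\<^esub> y) = xx p (psi y)" if "y \<in> carrier Cw" for y
  unfolding x using psi_mult[OF frees_gen[OF assms] that] by simp
qed

lemma is_partial_dd:
 assumes i: "i < M" "r < N"
 shows "is_partial m n N q i r (tr (dd (i, r)))"
proof -
 have G: "(i, r) \<in> GX" using i by simp
 have dB: "dd (i, r) ` B M \<subseteq> B M" using dd_B by blast
 note t = tr[OF dB]
 show ?thesis
  unfolding is_partial_def Let_def
 proof (intro conjI ballI allI impI)
  fix f assume f: "f \<in> carrier Cw"
  show "tr (dd (i, r)) (c \<odot>\<^bsub>Cw\<^esub> f) = c \<odot>\<^bsub>Cw\<^esub> tr (dd (i, r)) f" for c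
   by (rule Cm(9)[OF t(1)[OF Cm(7)[OF f]] Cm(7)[OF t(1)[OF f]]])
     (simp only: t(2)[OF Cm(7)[OF f]] Cm(8)[OF f] Cm(8)[OF t(1)[OF f]] t(2)[OF f] dd_lin)
  fix g assume g: "g \<in> carrier Cw"
  show "tr (dd (i, r)) (f \<oplus>\<^bsub>Cw\<^esub> g) = tr (dd (i, r)) f \<oplus>\<^bsub>Cw\<^esub> tr (dd (i, r)) g"
   by (rule Cm(9)[OF t(1)[OF Cm(5)[OF f g]] Cm(5)[OF t(1)[OF f] t(1)[OF g]]])
     (simp only: t(2)[OF Cm(5)[OF f g]] Cm(6)[OF f g] Cm(6)[OF t(1)[OF f] t(1)[OF g]] t(2)[OF f] t(2)[OF g] dd_lin)
 next
  fix \<alpha> f assume f: "f \<in> hcomp Cw \<alpha>"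
  have fc: "f \<in> carrier Cw" using psi_hmodel f unfolding hmodel_def by blast
  have "homog mdeg \<alpha> (psi f)" using hmodel_iff[OF psi_lin_model psi_hmodel fc] f by blast
  hence "homog mdeg (\<alpha> - eps i) (dd (i, r) (psi f))" using homog_dd_mdeg[of "(i, r)"] i by simp
  thus "tr (dd (i, r)) f \<in> hcomp Cw (\<alpha> - eps i)"
   using hmodel_iff[OF psi_lin_model psi_hmodel t(1)[OF fc]] t(2)[OF fc] dd_B[OF Cm(10)[OF fc]] by simp
 next
  show "tr (dd (i, r)) \<one>\<^bsub>Cw\<^esub> = \<zero>\<^bsub>Cw\<^esub>"
   by (rule Cm(9)[OF t(1)[OF psi_one(1)] Cm(3)]) (simp only: t(2)[OF psi_one(1)] psi_one(2) dd_vac Cm(4))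
 next
  fix j s assume js: "j < M" "s < N"
  hence p: "(j, s) \<in> GX" by simp
  note x = psi_x_gen[OF p, unfolded fst_conv snd_conv]
  have "dd (i, r) (xx (j, s) vac) = (if (i, r) = (j, s) then vac else 0)"
   using dd_X[OF vac_B, of "(i, r)" "(j, s)"] i js by (simp add: dd_vac X_lin)
  hence e: "psi (tr (dd (i, r)) (x_gen m n N q j s)) = (if i = j \<and> r = s then vac else 0)"
   unfolding t(2)[OF x(1)] x(2) by simp
  show "tr (dd (i, r)) (x_gen m n N q j s) = (if i = j \<and> r = s then \<one>\<^bsub>Cw\<^esub> else \<zero>\<^bsub>Cw\<^esub>)"
  proof (rule Cm(9)[OF t(1)[OF x(1)]])
   show "(if i = j \<and> r = s then \<one>\<^bsub>Cw\<^esub> else \<zero>\<^bsub>Cw\<^esub>) \<in> carrier Cw" using psi_one Cm(3) by simp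
   show "psi (tr (dd (i, r)) (x_gen m n N q j s)) = psi (if i = j \<and> r = s then \<one>\<^bsub>Cw\<^esub> else \<zero>\<^bsub>Cw\<^esub>)"
    unfolding e using psi_one Cm(4) by simp
  qed
 next
  fix \<alpha> f g assume f: "f \<in> hcomp Cw \<alpha>" and g: "g \<in> carrier Cw"
  show "tr (dd (i, r)) (f \<otimes>\<^bsub>Cw\<^esub> g) = (tr (dd (i, r)) f \<otimes>\<^bsub>Cw\<^esub> g) \<oplus>\<^bsub>Cw\<^esub>
    (om' (- eps i) \<alpha> \<odot>\<^bsub>Cw\<^esub> (f \<otimes>\<^bsub>Cw\<^esub> tr (dd (i, r)) g))"
   using leib_dd[OF G] by (intro leib_Cw[OF _ linop_dd dB dd_vac f g]) simp_all
 qed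
qed

end

section \<open>The two actions and the pairing of their highest weight modules\<close>

lemma scal_comm: "f * scal c = scal c * f"
proof -
 have "(\<Sum>k\<in>K. single k (l k)) * scal c = scal c * (\<Sum>k\<in>K. single k (l k))" for K and l :: "'a list => complex"
  by (simp add: sum_distrib_left sum_distrib_right scal_def single_mult_free mult.commute)
 from this[of "lookup f" "keys f"] show ?thesis
  unfolding poly_mapping_expand[of f, symmetric] .
qed

context presented
begin

lemma Alg_hcomp_carrier: "hcomp (presented_algebra G d R) \<alpha> \<subseteq> carrier (presented_algebra G d R)"
proof
 fix x assume "x \<in> hcomp (presented_algebra G d R) \<alpha>"
 then obtain f where f: "x = cls f" "keys f \<subseteq> {w \<in> lists G. (\<Sum>g\<leftarrow>w. d g) = \<alpha>}"
  unfolding Alg_hcomp by blast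
 have "f \<in> frees G" using f(2) by auto
 thus "x \<in> carrier (presented_algebra G d R)" unfolding f(1) by (rule cls_carrier)
qed

lemma Alg_distr: "distr_algebra (presented_algebra G d R)"
proof -
 have "scal c * f = f * scal c" for c and f :: "'a free" by (rule scal_comm[symmetric])
 hence s: "f * (scal k * g) = scal k * (f * g)" for k and f g :: "'a free"
  by (metis mult.assoc)
 show ?thesis
  unfolding distr_algebra_def alg_closed_def Alg_carrier Alg_one
  by (simp add: Alg_add Alg_mult Alg_smult frees_add frees_mult frees_scal frees_1 distrib_left distrib_right
    s mult.assoc del: carrier_free_algebra)
qed

end

lemma gl_relations_frees: "gl_relations r d \<omega> \<subseteq> frees ({..<r} \<times> {..<r})"
proof
 fix z assume "z \<in> gl_relations r d \<omega>"
 then obtain x y where xy: "x \<in> {..<r} \<times> {..<r}" "y \<in> {..<r} \<times> {..<r}"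
  and z: "z = gen x * gen y - scal (\<omega> (d x) (d y)) * gen y * gen x - gl_bracket d \<omega> x y"
  unfolding gl_relations_def by blast
 have if_frees: "(if b then gen k else 0) \<in> frees ({..<r} \<times> {..<r})" if "k \<in> {..<r} \<times> {..<r}" for b k
  using frees_gen[OF that] frees_0 by simp
 obtain i j k l where ijkl: "x = (i, j)" "y = (k, l)" by (cases x; cases y)
 have "gl_bracket d \<omega> x y \<in> frees ({..<r} \<times> {..<r})"
  unfolding gl_bracket_def ijkl split using xy
  by (intro frees_diff frees_mult frees_scal if_frees) (auto simp: ijkl)
 thus "z \<in> frees ({..<r} \<times> {..<r})"
  unfolding z by (intro frees_diff frees_mult frees_gen frees_scal xy)
qed

lemma presented_gl: "presented ({..<r} \<times> {..<r}) (gl_relations r d \<omega>)"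
 by standard (rule gl_relations_frees)

lemma ev_commute:
 assumes lin: "\<And>x. linop (\<rho> x)" "\<And>y. linop (\<rho>' y)"
  and S: "subsp S" "\<And>x v. x \<in> G ==> v \<in> S ==> \<rho> x v \<in> S" "\<And>y v. y \<in> G' ==> v \<in> S ==> \<rho>' y v \<in> S"
  and comm: "\<And>x y v. x \<in> G ==> y \<in> G' ==> v \<in> S ==> \<rho> x (\<rho>' y v) = \<rho>' y (\<rho> x v)"
  and f: "f \<in> frees G" and g: "g \<in> frees G'" and v: "v \<in> S"
 shows "ev \<rho> f (ev \<rho>' g v) = ev \<rho>' g (ev \<rho> f v)"
proof -
 have evS: "ev \<rho> f v \<in> S" if "v \<in> S" for v
  by (rule ev_in[where G = G]) (use S that f in auto)
 have 1: "foldr \<rho> w (\<rho>' y v) = \<rho>' y (foldr \<rho> w v) \<and> foldr \<rho> w v \<in> S" if "y \<in> G'" "v \<in> S" "w \<in> lists G" for y v w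
  using that(3) by (induction w) (use S comm that(1,2) in auto)
 have 2: "ev \<rho> f (\<rho>' y v) = \<rho>' y (ev \<rho> f v)" if y: "y \<in> G'" and v: "v \<in> S" for y v
  unfolding ev_def lext_linop[OF lin(2)]
 proof (rule lext_cong)
  fix w assume "w \<in> keys f"
  hence "w \<in> lists G" using f by auto
  thus "foldr \<rho> w (\<rho>' y v) = \<rho>' y (foldr \<rho> w v)" using 1[OF y v] by blast
 qed
 define Q where "Q w \<longleftrightarrow> ev \<rho> f (foldr \<rho>' w v) = foldr \<rho>' w (ev \<rho> f v) \<and> foldr \<rho>' w v \<in> S" for w
 have Q0: "Q []" using v by (simp add: Q_def)
 have Q1: "Q (y # w)" if "y \<in> G'" "Q w" for y w
  using that 2[OF that(1), of "foldr \<rho>' w v"] S(3) by (simp add: Q_def)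
 have 3: "Q w" if "w \<in> lists G'" for w
  using that by (induction w) (use Q0 Q1 in auto)
 show ?thesis
  unfolding ev_def[of \<rho>'] lext_linop[OF linop_ev[OF lin(1)]]
 proof (rule lext_cong)
  fix w assume "w \<in> keys g"
  hence "w \<in> lists G'" using g by auto
  thus "ev \<rho> f (foldr \<rho>' w v) = foldr \<rho>' w (ev \<rho> f v)" using 3 by (simp only: Q_def)
 qed
qed

lemma orb_ev:
 assumes lin: "\<And>x. linop (\<rho> x)"
 shows "orb (\<rho> ` G) f = (\<lambda>g. ev \<rho> g f) ` frees G"
proof
 show "orb (\<rho> ` G) f \<subseteq> (\<lambda>g. ev \<rho> g f) ` frees G"
 proof (rule orb_least)
  show "f \<in> (\<lambda>g. ev \<rho> g f) ` frees G" using frees_1 by (intro image_eqI[of _ _ 1]) (simp_all del: carrier_free_algebra)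
  show "subsp ((\<lambda>g. ev \<rho> g f) ` frees G)"
   unfolding subsp_def
  proof (intro conjI ballI allI)
   show "0 \<in> (\<lambda>g. ev \<rho> g f) ` frees G" by (rule image_eqI[OF _ frees_0]) simp
   fix x assume "x \<in> (\<lambda>g. ev \<rho> g f) ` frees G"
   then obtain g where g: "x = ev \<rho> g f" "g \<in> frees G" by blast
   show "sc c x \<in> (\<lambda>g. ev \<rho> g f) ` frees G" for c
    by (rule image_eqI[OF _ frees_mult[OF frees_scal g(2)]]) (simp only: g(1) ev_scal)
   fix y assume "y \<in> (\<lambda>g. ev \<rho> g f) ` frees G"
   then obtain h where h: "y = ev \<rho> h f" "h \<in> frees G" by blast
   show "x + y \<in> (\<lambda>g. ev \<rho> g f) ` frees G"
    by (rule image_eqI[OF _ frees_add[OF g(2) h(2)]]) (simp only: g(1) h(1) ev_add)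
  qed
  fix x T assume "x \<in> (\<lambda>g. ev \<rho> g f) ` frees G" "T \<in> \<rho> ` G"
  then obtain g y where g: "x = ev \<rho> g f" "g \<in> frees G" "y \<in> G" "T = \<rho> y" by blast
  show "T x \<in> (\<lambda>g. ev \<rho> g f) ` frees G"
   by (rule image_eqI[OF _ frees_mult[OF frees_gen[OF g(3)] g(2)]]) (simp only: g(1,4) ev_mult[OF lin] ev_gen)
 qed
 have "ev \<rho> g f \<in> orb (\<rho> ` G) f" if "g \<in> frees G" for g
 proof (rule ev_in[where G = G, OF subsp_orb _ _ orb_base])
  fix x v assume "x \<in> G" "v \<in> orb (\<rho> ` G) f"
  thus "\<rho> x v \<in> orb (\<rho> ` G) f" using orb_step[where x = v and O' = "\<rho> ` G" and f = f and T = "\<rho> x"] by simp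
 qed (use that in simp)
 thus "(\<lambda>g. ev \<rho> g f) ` frees G \<subseteq> orb (\<rho> ` G) f" by blast
qed

lemma prj_commute:
 assumes T: "linop T" "\<And>\<beta> u. homog \<delta> \<beta> u ==> homog \<delta> \<beta> (T u)" and v: "v \<in> FS"
 shows "prj \<delta> \<alpha> (T v) = T (prj \<delta> \<alpha> v)"
proof -
 let ?D = "\<delta> ` {a. v a \<noteq> 0}"
 have fin: "finite ?D" using v by (simp add: FS_def)
 have "prj \<delta> \<alpha> (T v) = prj \<delta> \<alpha> (T (\<Sum>d\<in>?D. prj \<delta> d v))" by (simp only: sum_prj_FS[OF v])
 also have "\<dots> = (\<Sum>d\<in>?D. prj \<delta> \<alpha> (T (prj \<delta> d v)))"
  unfolding linop_sum[OF T(1)] linop_sum[OF linop_prj] ..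
 also have "\<dots> = (\<Sum>d\<in>?D. if d = \<alpha> then T (prj \<delta> \<alpha> v) else 0)"
 proof (intro sum.cong refl)
  fix d
  show "prj \<delta> \<alpha> (T (prj \<delta> d v)) = (if d = \<alpha> then T (prj \<delta> \<alpha> v) else 0)"
   using prj_homog[OF T(2)[OF homog_prj[of \<delta> d v]], of \<alpha>] by (cases "d = \<alpha>") simp_all
 qed
 also have "\<dots> = T (prj \<delta> \<alpha> v)"
 proof (cases "\<alpha> \<in> ?D")
  case True
  thus ?thesis using fin by (simp add: sum.delta')
 next
  case False
  hence "prj \<delta> \<alpha> v = 0" by (auto simp: prj_def fun_eq_iff)
  thus ?thesis using linop_0[OF T(1)] False fin by (simp add: sum.delta')
 qed
 finally show ?thesis .
qed

lemma homog_ev: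
 fixes \<delta> :: "'a => degree"
 assumes h: "\<And>x \<beta> v. x \<in> G ==> homog \<delta> \<beta> v ==> homog \<delta> (d x + \<beta>) (\<rho> x v)"
  and f: "keys f \<subseteq> {w \<in> lists G. (\<Sum>g\<leftarrow>w. d g) = \<alpha>}" and v: "homog \<delta> \<beta> v"
 shows "homog \<delta> (\<alpha> + \<beta>) (ev \<rho> f v)"
proof -
 have w: "homog \<delta> ((\<Sum>g\<leftarrow>w. d g) + \<beta>) (foldr \<rho> w v)" if "w \<in> lists G" for w
  using that
 proof (induction w)
  case Nil
  thus ?case using v by simp
 next
  case (Cons x w)
  hence "homog \<delta> (d x + ((\<Sum>g\<leftarrow>w. d g) + \<beta>)) (\<rho> x (foldr \<rho> w v))" by (intro h)
  thus ?case by (simp add: add.assoc)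
 qed
 have "ev \<rho> f v \<in> {v. homog \<delta> (\<alpha> + \<beta>) v}"
  unfolding ev_def
 proof (rule lext_in[OF subsp_supported])
  fix k assume "k \<in> keys f"
  hence "k \<in> lists G" "(\<Sum>g\<leftarrow>k. d g) = \<alpha>" using f by blast+
  thus "foldr \<rho> k v \<in> {v. homog \<delta> (\<alpha> + \<beta>) v}" using w by blast
 qed
 thus ?thesis by simp
qed

section \<open>The actions of the two enveloping algebras\<close>

context howe
begin

abbreviation "Uq \<equiv> U_glq m n q"

abbreviation "Ugl \<equiv> U_glN N"

abbreviation "GQ \<equiv> {..<m + n} \<times> {..<m + n}"

abbreviation "GN \<equiv> {..<N} \<times> {..<N}"

abbreviation "RQ \<equiv> gl_relations (m + n) glq_degree (omega m n q)"

abbreviation "RN \<equiv> gl_relations N (\<lambda>_. 0) (\<lambda>_ _. 1)"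

definition eE :: "nat \<times> nat => vec => vec" where
 "eE = (\<lambda>(i, j). E i j)"

definition eF :: "nat \<times> nat => vec => vec" where
 "eF = (\<lambda>(r, s). F M r s)"

lemma eE_simp [simp]: "eE (i, j) = E i j" and eF_simp [simp]: "eF (i, j) = F M i j"
 by (simp_all add: eE_def eF_def)

lemma linop_eE [simp]: "linop (eE x)" and linop_eF [simp]: "linop (eF x)"
 by (cases x; simp)+

lemma eE_B: "x \<in> GQ ==> v \<in> B M ==> eE x v \<in> B M"
 and eF_B: "x \<in> GN ==> v \<in> B M ==> eF x v \<in> B M"
 by (cases x; simp add: E_B F_B)+

interpretation PQ: presented GQ RQ by (rule presented_gl)

interpretation PN: presented GN RN by (rule presented_gl)

lemma Uq: "Uq = presented_algebra GQ glq_degree RQ" and Ugl: "Ugl = presented_algebra GN (\<lambda>_. 0) RN"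
 by (simp_all add: U_glq_def U_glN_def)

lemma ev_bracket:
 assumes "\<And>x. linop (\<rho> x)"
 shows "ev \<rho> (gl_bracket d \<omega> (i, j) (k, l)) v = (if j = k then \<rho> (i, l) v else 0)
  - sc (\<omega> (d (i, j)) (d (k, l))) (if l = i then \<rho> (k, j) v else 0)"
 by (simp add: gl_bracket_def ev_diff ev_scal ev_scal_alone ev_mult[OF assms])

lemma ev_RQ:
 assumes "z \<in> RQ" and v: "v \<in> B M"
 shows "ev eE z v = 0"
proof -
 obtain x y where xy: "x \<in> GQ" "y \<in> GQ"
  and z: "z = gen x * gen y - scal (omega m n q (glq_degree x) (glq_degree y)) * gen y * gen x - gl_bracket glq_degree (omega m n q) x y"
  using assms(1) unfolding gl_relations_def by blast
 obtain i j k l where ijkl: "x = (i, j)" "y = (k, l)" by (cases x; cases y)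
 have b: "i < M" "j < M" "k < M" "l < M" using xy ijkl by auto
 let ?c = "omega m n q (glq_degree (i, j)) (glq_degree (k, l))"
 have c: "?c = om i k * om l i * om k j * om j l" by (rule omega_glq_degree[OF b])
 have lhs: "ev eE z v = eE x (eE y v) - sc ?c (eE y (eE x v)) - ((if j = k then E i l v else 0) - sc ?c (if l = i then E k j v else 0))"
  unfolding z ev_diff ev_mult[OF linop_eE] ev_gen ev_scal_alone ijkl ev_bracket[OF linop_eE] eE_simp ..
 have "eE x (eE y v) = sc ?c (eE y (eE x v)) + (if j = k then E i l v else 0) - sc ?c (if l = i then E k j v else 0)"
  unfolding ijkl eE_simp by (rule E_E[OF v b(1,3) c])
 thus ?thesis unfolding lhs by simp
qed

lemma ev_RN:
 assumes "z \<in> RN" and v: "v \<in> B M"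
 shows "ev eF z v = 0"
proof -
 obtain x y where xy: "x \<in> GN" "y \<in> GN"
  and z: "z = gen x * gen y - scal 1 * gen y * gen x - gl_bracket (\<lambda>_. 0) (\<lambda>_ _. 1) x y"
  using assms(1) unfolding gl_relations_def by blast
 obtain i j k l where ijkl: "x = (i, j)" "y = (k, l)" by (cases x; cases y)
 have b: "i < N" "j < N" "k < N" "l < N" using xy ijkl by auto
 have lhs: "ev eF z v = eF x (eF y v) - eF y (eF x v) - ((if j = k then F M i l v else 0) - (if l = i then F M k j v else 0))"
  unfolding z ev_diff ev_mult[OF linop_eF] ev_gen ev_scal_alone ijkl ev_bracket[OF linop_eF] eF_simp sc_simps ..
 have "eF x (eF y v) = eF y (eF x v) + (if j = k then F M i l v else 0) - (if l = i then F M k j v else 0)"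
  unfolding ijkl eF_simp by (rule F_F[OF v b])
 thus ?thesis unfolding lhs by simp
qed

definition rhoQ :: "(nat \<times> nat) free set => vec => vec" where
 "rhoQ = PQ.pev eE"

definition rhoN :: "(nat \<times> nat) free set => vec => vec" where
 "rhoN = PN.pev eF"

lemma rhoQ_cls: "f \<in> frees GQ ==> v \<in> B M ==> rhoQ (PQ.cls f) v = ev eE f v"
 unfolding rhoQ_def by (rule PQ.pev_cls[OF linop_eE subsp_B eE_B ev_RQ])

lemma rhoN_cls: "f \<in> frees GN ==> v \<in> B M ==> rhoN (PN.cls f) v = ev eF f v"
 unfolding rhoN_def by (rule PN.pev_cls[OF linop_eF subsp_B eF_B ev_RN])

lemma rep_rhoQ: "rep Uq rhoQ (B M)"
 unfolding rhoQ_def Uq by (rule PQ.rep_pev[OF linop_eE subsp_B eE_B ev_RQ])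

lemma rep_rhoN: "rep Ugl rhoN (B M)"
 unfolding rhoN_def Ugl by (rule PN.rep_pev[OF linop_eF subsp_B eF_B ev_RN])

lemma Uq_elim: "a \<in> carrier Uq ==> \<exists>f\<in>frees GQ. a = PQ.cls f"
 unfolding Uq PQ.Alg_carrier by blast

lemma UN_elim: "a \<in> carrier Ugl ==> \<exists>f\<in>frees GN. a = PN.cls f"
 unfolding Ugl PN.Alg_carrier by blast

lemma ev_E_B: "f \<in> frees GQ ==> v \<in> B M ==> ev eE f v \<in> B M"
 by (rule ev_in[where S = "B M" and G = GQ]) (simp_all add: eE_B)

lemma ev_F_B: "f \<in> frees GN ==> v \<in> B M ==> ev eF f v \<in> B M"
 by (rule ev_in[where S = "B M" and G = GN]) (simp_all add: eF_B)

lemma ev_E_F: "f \<in> frees GQ ==> g \<in> frees GN ==> v \<in> B M ==> ev eE f (ev eF g v) = ev eF g (ev eE f v)"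
proof (rule ev_commute[OF linop_eE linop_eF subsp_B eE_B eF_B])
 fix x y v assume "x \<in> GQ" "y \<in> GN" "v \<in> B M"
 thus "eE x (eF y v) = eF y (eE x v)" by (cases x; cases y) (simp add: E_F_commute)
qed

lemma Eops_image: "Eops = eE ` GQ" and Fops_image: "Fops = eF ` GN"
 by (auto simp: Eops_def Fops_def image_iff) force+

lemma rho_commute: "a \<in> carrier Uq ==> b \<in> carrier Ugl ==> v \<in> B M ==> rhoQ a (rhoN b v) = rhoN b (rhoQ a v)"
proof -
 assume "a \<in> carrier Uq" "b \<in> carrier Ugl" and v: "v \<in> B M"
 then obtain f g where f: "f \<in> frees GQ" "a = PQ.cls f" and g: "g \<in> frees GN" "b = PN.cls g"
  using Uq_elim UN_elim by blast
 show ?thesis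
  unfolding f(2) g(2) rhoQ_cls[OF f(1) v] rhoN_cls[OF g(1) v] rhoQ_cls[OF f(1) ev_F_B[OF g(1) v]]
   rhoN_cls[OF g(1) ev_E_B[OF f(1) v]] by (rule ev_E_F[OF f(1) g(1) v])
qed

lemma Uq_distr: "distr_algebra Uq" and UN_distr: "distr_algebra Ugl"
 unfolding Uq Ugl by (rule PQ.Alg_distr PN.Alg_distr)+

lemma Uq_hcomp_carrier: "hcomp Uq \<alpha> \<subseteq> carrier Uq" and UN_hcomp_carrier: "hcomp Ugl \<alpha> \<subseteq> carrier Ugl"
 unfolding Uq Ugl by (rule PQ.Alg_hcomp_carrier PN.Alg_hcomp_carrier)+

lemma homog_rhoQ:
 assumes a: "a \<in> hcomp Uq \<alpha>" and v: "v \<in> B M" "homog mdeg \<beta> v"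
 shows "homog mdeg (\<alpha> + \<beta>) (rhoQ a v)"
proof -
 obtain f where f: "a = PQ.cls f" "keys f \<subseteq> {w \<in> lists GQ. (\<Sum>g\<leftarrow>w. glq_degree g) = \<alpha>}"
  using a unfolding Uq PQ.Alg_hcomp by blast
 have ff: "f \<in> frees GQ" using f(2) by auto
 show ?thesis
  unfolding f(1) rhoQ_cls[OF ff v(1)]
 proof (rule homog_ev[OF _ f(2) v(2)])
  fix x \<beta> and u :: vec assume "x \<in> GQ" "homog mdeg \<beta> u"
  thus "homog mdeg (glq_degree x + \<beta>) (eE x u)"
   by (cases x) (simp add: homog_E_mdeg)
 qed
qed

lemma homog_rhoN:
 assumes a: "a \<in> hcomp Ugl \<alpha>" and v: "v \<in> B M" "homog mdeg \<beta> v"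
 shows "homog mdeg (\<alpha> + \<beta>) (rhoN a v)"
proof -
 obtain f where f: "a = PN.cls f" "keys f \<subseteq> {w \<in> lists GN. (\<Sum>g\<leftarrow>w. 0) = \<alpha>}"
  using a unfolding Ugl PN.Alg_hcomp by blast
 have ff: "f \<in> frees GN" using f(2) by auto
 show ?thesis
  unfolding f(1) rhoN_cls[OF ff v(1)]
 proof (rule homog_ev[OF _ f(2) v(2)])
  fix x \<beta> and u :: vec assume "x \<in> GN" "homog mdeg \<beta> u"
  thus "homog mdeg (0 + \<beta>) (eF x u)"
   by (cases x) (simp add: homog_F_mdeg)
 qed
qed

lemma rhoN_hcomp_nonzero:
 assumes a: "a \<in> hcomp Ugl \<alpha>" "\<alpha> \<noteq> 0" and v: "v \<in> B M"
 shows "rhoN a v = 0"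
proof -
 obtain f where f: "a = PN.cls f" "keys f \<subseteq> {w \<in> lists GN. (\<Sum>g\<leftarrow>w. 0) = \<alpha>}"
  using a(1) unfolding Ugl PN.Alg_hcomp by blast
 have "(\<Sum>g\<leftarrow>w. 0) = (0 :: degree)" for w :: "(nat \<times> nat) list" by (induction w) auto
 hence "keys f = {}" using f(2) a(2) by auto
 hence "f = 0" by simp
 thus ?thesis unfolding f(1) using rhoN_cls[OF frees_0 v] by simp
qed

sublocale TR: tensor_rep Uq Ugl rhoQ rhoN "B M"
 by standard (simp_all add: Uq_distr UN_distr rep_rhoQ rep_rhoN rho_commute)

section \<open>The pairing of the row orbit and the column orbit of one vector\<close>

context
 fixes \<nu> \<mu> :: "nat => nat" and f :: vec
 assumes f: "jhw M \<mu> \<nu> f" and f0: "f \<noteq> 0"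
begin

abbreviation "SV \<equiv> orb Eops f"

abbreviation "SW \<equiv> orb Fops f"

lemma fB: "f \<in> B M" by (rule jhwD(1)[OF f])

lemma SV_B: "SV \<subseteq> B M" and SW_B: "SW \<subseteq> B M"
 by (rule orb_B[OF _ fB]; simp)+

lemma SV_ev: "SV = (\<lambda>g. ev eE g f) ` frees GQ" and SW_ev: "SW = (\<lambda>g. ev eF g f) ` frees GN"
 unfolding Eops_image Fops_image by (rule orb_ev; simp)+

definition Ph :: "vec => vec => vec" where
 "Ph v w = ev eF (SOME g. g \<in> frees GN \<and> ev eF g f = w) v"

text \<open>The choice of g does not matter: if g f = h f and v = k f with k built from row
  operators, then g v = k g f = k h f = h v, as both actions commute.\<close>

lemma Ph_ev:
 assumes v: "v \<in> SV" and g: "g \<in> frees GN"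
 shows "Ph v (ev eF g f) = ev eF g v"
proof -
 define h where "h = (SOME h. h \<in> frees GN \<and> ev eF h f = ev eF g f)"
 have h: "h \<in> frees GN \<and> ev eF h f = ev eF g f" unfolding h_def by (rule someI[of _ g]) (use g in simp)
 obtain k where k: "k \<in> frees GQ" "v = ev eE k f" using v unfolding SV_ev by blast
 have "ev eF h v = ev eE k (ev eF h f)" unfolding k(2) by (rule ev_E_F[OF k(1) _ fB, symmetric]) (use h in blast)
 also have "\<dots> = ev eE k (ev eF g f)" using h by simp
 also have "\<dots> = ev eF g v" unfolding k(2) by (rule ev_E_F[OF k(1) g fB])
 finally show ?thesis by (simp add: Ph_def h_def)
qed

lemma SW_elim: "w \<in> SW ==> \<exists>g\<in>frees GN. w = ev eF g f"
 unfolding SW_ev by blast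

lemma Ph_add1: "v \<in> SV ==> v' \<in> SV ==> w \<in> SW ==> Ph (v + v') w = Ph v w + Ph v' w"
 using SW_elim[of w] by (auto simp: Ph_ev subsp_add[OF subsp_orb] linop_add[OF linop_ev[OF linop_eF]] simp del: carrier_free_algebra)

lemma Ph_sc1: "v \<in> SV ==> w \<in> SW ==> Ph (sc c v) w = sc c (Ph v w)"
 using SW_elim[of w] by (auto simp: Ph_ev subsp_sc[OF subsp_orb] linop_sc[OF linop_ev[OF linop_eF]] simp del: carrier_free_algebra)

lemma Ph_add2: "v \<in> SV ==> w \<in> SW ==> w' \<in> SW ==> Ph v (w + w') = Ph v w + Ph v w'"
proof -
 assume v: "v \<in> SV" and "w \<in> SW" "w' \<in> SW"
 then obtain g g' where g: "g \<in> frees GN" "w = ev eF g f" "g' \<in> frees GN" "w' = ev eF g' f" using SW_elim by blast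
 show ?thesis unfolding g(2,4) ev_add[symmetric] Ph_ev[OF v frees_add[OF g(1,3)]] Ph_ev[OF v g(1)] Ph_ev[OF v g(3)] ..
qed

lemma Ph_sc2: "v \<in> SV ==> w \<in> SW ==> Ph v (sc c w) = sc c (Ph v w)"
proof -
 assume v: "v \<in> SV" and "w \<in> SW"
 then obtain g where g: "g \<in> frees GN" "w = ev eF g f" using SW_elim by blast
 show ?thesis unfolding g(2) ev_scal[symmetric] Ph_ev[OF v frees_mult[OF frees_scal g(1)]] Ph_ev[OF v g(1)] ..
qed

lemma Ph_f: "v \<in> SV ==> Ph v f = v"
 using Ph_ev[OF _ frees_1, of v] by simp

lemma Ph_F:
 assumes v: "v \<in> SV" and w: "w \<in> SW" and rs: "r < N" "s < N"
 shows "Ph v (F M r s w) = F M r s (Ph v w)"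
proof -
 obtain g where g: "g \<in> frees GN" "w = ev eF g f" using SW_elim[OF w] by blast
 have G: "gen (r, s) \<in> frees GN" using rs by (intro frees_gen) simp
 have "F M r s w = ev eF (gen (r, s) * g) f" unfolding g(2) ev_mult[OF linop_eF] by simp
 thus ?thesis unfolding g(2) using Ph_ev[OF v frees_mult[OF G g(1)]] Ph_ev[OF v g(1)] by (simp add: ev_mult)
qed

lemma Ph_equiv:
 assumes a: "a \<in> carrier Uq" and b: "b \<in> carrier Ugl" and v: "v \<in> SV" and w: "w \<in> SW"
 shows "Ph (rhoQ a v) (rhoN b w) = rhoQ a (rhoN b (Ph v w))"
proof -
 obtain h where h: "h \<in> frees GQ" "a = PQ.cls h" using Uq_elim[OF a] by blast
 obtain g' where g': "g' \<in> frees GN" "b = PN.cls g'" using UN_elim[OF b] by blast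
 obtain g where g: "g \<in> frees GN" "w = ev eF g f" using SW_elim[OF w] by blast
 have vB: "v \<in> B M" using v SV_B by blast
 have wB: "w \<in> B M" using w SW_B by blast
 have hv: "ev eE h v \<in> SV"
 proof -
  obtain k where k: "k \<in> frees GQ" "v = ev eE k f" using v unfolding SV_ev by blast
  have "ev eE h v = ev eE (h * k) f" unfolding k(2) by (simp add: ev_mult)
  thus ?thesis unfolding SV_ev using frees_mult[OF h(1) k(1)] by blast
 qed
 have gv: "ev eF g v \<in> B M" by (rule ev_F_B[OF g(1) vB])
 have "Ph (rhoQ a v) (rhoN b w) = Ph (ev eE h v) (ev eF (g' * g) f)"
  unfolding h(2) g'(2) rhoQ_cls[OF h(1) vB] rhoN_cls[OF g'(1) wB]
  unfolding g(2) ev_mult[OF linop_eF] ..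
 also have "\<dots> = ev eF g' (ev eF g (ev eE h v))"
  unfolding Ph_ev[OF hv frees_mult[OF g'(1) g(1)]] by (rule ev_mult) simp
 also have "\<dots> = ev eE h (ev eF g' (ev eF g v))"
  unfolding ev_E_F[OF h(1) g(1) vB, symmetric] by (rule ev_E_F[OF h(1) g'(1) gv, symmetric])
 also have "\<dots> = rhoQ a (rhoN b (Ph v w))"
  unfolding g(2) Ph_ev[OF v g(1)] h(2) g'(2) rhoN_cls[OF g'(1) gv] rhoQ_cls[OF h(1) ev_F_B[OF g'(1) gv]] ..
 finally show ?thesis .
qed

lemma Ph_B: "v \<in> SV ==> w \<in> SW ==> Ph v w \<in> B M"
proof -
 assume v: "v \<in> SV" and "w \<in> SW"
 then obtain g where g: "g \<in> frees GN" "w = ev eF g f" using SW_elim by blast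
 show ?thesis unfolding g(2) Ph_ev[OF v g(1)] using ev_F_B[OF g(1)] v SV_B by blast
qed

lemma Ph_orb: "v \<in> SV ==> w \<in> SW ==> Ph v w \<in> orb (Eops \<union> Fops) f"
proof -
 assume v: "v \<in> SV" and "w \<in> SW"
 then obtain g where g: "g \<in> frees GN" "w = ev eF g f" using SW_elim by blast
 have v': "v \<in> orb (Eops \<union> Fops) f" using v orb_mono[of Eops "Eops \<union> Fops" f] by blast
 show ?thesis unfolding g(2) Ph_ev[OF v g(1)]
 proof (rule ev_in[where G = GN, OF subsp_orb _ _ v'])
  fix x v assume x: "x \<in> GN" and v: "v \<in> orb (Eops \<union> Fops) f"
  have "eF x \<in> Eops \<union> Fops" unfolding Fops_image using x by blast
  thus "eF x v \<in> orb (Eops \<union> Fops) f" by (rule orb_step[OF v])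
 qed (use g(1) in simp)
qed

text \<open>Commutation moves all row operators to the left of the column operators, so the vectors
  h g f, which are values of \<open>Ph\<close>, span the joint orbit.\<close>

lemma Ph_least:
 assumes T: "subsp T" "\<And>v w. v \<in> SV ==> w \<in> SW ==> Ph v w \<in> T"
 shows "orb (Eops \<union> Fops) f \<subseteq> T"
proof -
 let ?T = "{x \<in> B M. \<forall>h\<in>frees GQ. \<forall>g\<in>frees GN. ev eE h (ev eF g x) \<in> T}"
 have "orb (Eops \<union> Fops) f \<subseteq> ?T"
 proof (rule orb_least)
  show "f \<in> ?T"
  proof (intro CollectI conjI ballI fB)
   fix h g assume h: "h \<in> frees GQ" and g: "g \<in> frees GN"
   have v: "ev eE h f \<in> SV" and w: "ev eF g f \<in> SW" unfolding SV_ev SW_ev using h g by blast+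
   have "ev eE h (ev eF g f) = Ph (ev eE h f) (ev eF g f)"
    unfolding Ph_ev[OF v g] by (rule ev_E_F[OF h g fB])
   thus "ev eE h (ev eF g f) \<in> T" using T(2)[OF v w] by simp
  qed
  show "subsp ?T"
   unfolding subsp_def
   by (auto simp: subsp_0[OF subsp_B] subsp_add[OF subsp_B] subsp_sc[OF subsp_B] subsp_0[OF T(1)] subsp_add[OF T(1)] subsp_sc[OF T(1)]
     linop_0[OF linop_ev[OF linop_eE]] linop_add[OF linop_ev[OF linop_eE]] linop_sc[OF linop_ev[OF linop_eE]]
     linop_0[OF linop_ev[OF linop_eF]] linop_add[OF linop_ev[OF linop_eF]] linop_sc[OF linop_ev[OF linop_eF]]
     simp del: carrier_free_algebra)
  fix x D assume x: "x \<in> ?T" and D: "D \<in> Eops \<union> Fops"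
  hence xB: "x \<in> B M" by blast
  show "D x \<in> ?T"
  proof (intro CollectI conjI ballI)
   show "D x \<in> B M" by (rule ops_B[OF admissible_both D xB])
   fix h g assume h: "h \<in> frees GQ" and g: "g \<in> frees GN"
   from D show "ev eE h (ev eF g (D x)) \<in> T"
   proof
    assume "D \<in> Eops"
    then obtain y where y: "y \<in> GQ" "D = eE y" unfolding Eops_image by blast
    have "ev eF g (D x) = ev eE (gen y) (ev eF g x)"
     unfolding y(2) using ev_E_F[OF frees_gen[OF y(1)] g xB] by simp
    hence "ev eE h (ev eF g (D x)) = ev eE (h * gen y) (ev eF g x)" by (simp add: ev_mult)
    thus ?thesis using x frees_mult[OF h frees_gen[OF y(1)]] g by auto
   next
    assume "D \<in> Fops"
    then obtain y where y: "y \<in> GN" "D = eF y" unfolding Fops_image by blast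
    have "ev eF g (D x) = ev eF (g * gen y) x" unfolding y(2) by (simp add: ev_mult)
    thus ?thesis using x frees_mult[OF g frees_gen[OF y(1)]] h by auto
   qed
  qed
 qed
 moreover have "x \<in> T" if "x \<in> ?T" for x
 proof -
  have "ev eE 1 (ev eF 1 x) \<in> T" using that frees_1 by blast
  thus ?thesis by simp
 qed
 ultimately show ?thesis by blast
qed

text \<open>The second argument acts through column operators, which preserve the row degree and
  hence commute with the projections.\<close>

lemma Ph_prj:
 assumes v: "v \<in> SV" and w: "w \<in> SW"
 shows "prj mdeg \<alpha> v \<in> SV" "prj mdeg \<alpha> (Ph v w) = Ph (prj mdeg \<alpha> v) w"
proof -
 have "graded_by mdeg SV"
  using graded_mdeg[OF SV_B subsp_orb] orb_graded_rdeg(1)[OF f admissible_E] by blast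
 thus pv: "prj mdeg \<alpha> v \<in> SV" using v by (simp add: graded_by_def)
 obtain g where g: "g \<in> frees GN" "w = ev eF g f" using SW_elim[OF w] by blast
 have keys: "keys g \<subseteq> {w \<in> lists GN. (\<Sum>g\<leftarrow>w. 0) = (0 :: degree)}"
 proof -
  have "(\<Sum>g\<leftarrow>w. 0) = (0 :: degree)" for w :: "(nat \<times> nat) list" by (induction w) auto
  thus ?thesis using g(1) by auto
 qed
 have "homog mdeg \<beta> (ev eF g u)" if u: "homog mdeg \<beta> u" for \<beta> u
 proof -
  have "homog mdeg (0 + \<beta>) (ev eF g u)"
  proof (rule homog_ev[OF _ keys u])
   fix x \<beta> and u :: vec assume "x \<in> GN" "homog mdeg \<beta> u"
   thus "homog mdeg (0 + \<beta>) (eF x u)" by (cases x) (simp add: homog_F_mdeg)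
  qed
  thus ?thesis by simp
 qed
 moreover have "v \<in> FS" using v SV_B B_FS by blast
 ultimately show "prj mdeg \<alpha> (Ph v w) = Ph (prj mdeg \<alpha> v) w"
  unfolding g(2) Ph_ev[OF v g(1)] Ph_ev[OF pv g(1)] by (intro prj_commute linop_ev) simp_all
qed

lemma SV_F_zero:
 assumes "v \<in> SV" "r < s" "s < N"
 shows "F M r s v = 0"
proof -
 have "F M r s f = sc 0 f" using jhwD(3)[OF f assms(2,3)] by simp
 hence "F M r s v = sc 0 v" using F_Fops[of r s] assms by (intro orb_eigen[OF _ fB _ assms(1)]) auto
 thus ?thesis by simp
qed

lemma SW_homog:
 assumes "w \<in> SW"
 shows "homog rdeg \<mu> w"
proof -
 have "SW \<subseteq> {w. homog rdeg \<mu> w}"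
 proof (rule orb_least[OF _ subsp_supported])
  show "f \<in> {w. homog rdeg \<mu> w}" using jhwD(4)[OF f] by simp
  fix x T assume x: "x \<in> {w. homog rdeg \<mu> w}" and "T \<in> Fops"
  then obtain r s where "r < N" "s < N" "T = F M r s" unfolding Fops_def by blast
  thus "T x \<in> {w. homog rdeg \<mu> w}" using homog_F[of r s \<mu> x M] x by simp
 qed
 thus ?thesis using assms by blast
qed

text \<open>By \<open>orb_lowering\<close>, w is built from f by lowering operators. Each of them
  makes both sides zero, since its adjoint raises and annihilates f as well as the whole row
  orbit.\<close>

lemma ip_Ph_f:
 assumes w: "w \<in> SW" and v: "v \<in> SV" "v' \<in> SV"
 shows "ip (Ph v w) v' * ip f f = ip w f * ip v v'"
proof -
 have FS: "x \<in> FS" if "x \<in> SV" for x using that SV_B B_FS by blast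
 let ?K = "{w \<in> SW. \<forall>v\<in>SV. \<forall>v'\<in>SV. ip (Ph v w) v' * ip f f = ip w f * ip v v'}"
 have "orb (Fops \<inter> Low) f \<subseteq> ?K"
 proof (rule orb_least)
  show "f \<in> ?K" using orb_base[of f Fops] by (simp add: Ph_f)
  have "Ph v 0 = 0" if "v \<in> SV" for v using Ph_sc2[OF that orb_base, of 0] by simp
  thus "subsp ?K"
   unfolding subsp_def using B_FS[OF fB] FS
   by (auto simp: subsp_0 subsp_add subsp_sc Ph_add2 Ph_sc2 ip_add_left ip_sc_left distrib_right)
  fix w T assume w: "w \<in> ?K" and T: "T \<in> Fops \<inter> Low"
  hence wS: "w \<in> SW" by blast
  have TF: "T \<in> Fops" using T by blast
  have TS: "T w \<in> SW" by (rule orb_step[OF wS TF])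
  \<comment> \<open>\<open>Low\<close> also contains row operators. Should one of them coincide with
    a column operator as a map, the fixed row degree shows that it kills w.\<close>
  have "T w = 0 \<or> (\<exists>r s. s < r \<and> r < N \<and> T = F M r s)"
  proof -
   have "T w = 0" if E: "T = E i j" "j < i" for i j
   proof (rule ccontr)
    assume "T w \<noteq> 0"
    then obtain a where a: "T w a \<noteq> 0" by (auto simp: fun_eq_iff)
    then obtain b where b: "w b \<noteq> 0" "rdeg a = move i j (rdeg b)" unfolding E(1) using rdeg_E by blast
    have "rdeg a = \<mu>" "rdeg b = \<mu>" using SW_homog[OF TS] SW_homog[OF wS] a b(1) by (auto simp: supported_def)
    hence "move i j \<mu> i = \<mu> i" using b(2) by simp
    thus False using E(2) by (simp add: move_def)
   qed
   thus ?thesis using T unfolding Low_def by blast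
  qed
  then consider "T w = 0" | r s where "s < r" "r < N" "T = F M r s" by blast
  thus "T w \<in> ?K"
  proof cases
   case 1
   have "Ph v 0 = 0" if "v \<in> SV" for v using Ph_sc2[OF that orb_base, of 0] by simp
   thus ?thesis using 1 TS by simp
  next
   case rs: 2
   show ?thesis
  proof (intro CollectI conjI ballI)
   show "T w \<in> SW" by (rule TS)
   fix v v' assume v: "v \<in> SV" "v' \<in> SV"
   have v'B: "v' \<in> B M" and wB: "w \<in> B M" using v wS SV_B SW_B by blast+
   have "ip (Ph v (T w)) v' = ip (F M r s (Ph v w)) v'"
    unfolding rs(3) using Ph_F[OF v(1) wS] rs by simp
   also have "\<dots> = ip (Ph v w) (F M s r v')" by (rule F_adjoint[OF Ph_B[OF v(1) wS] v'B])
   also have "\<dots> = 0" using SV_F_zero[OF v(2) rs(1,2)] by simp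
   finally have 1: "ip (Ph v (T w)) v' = 0" .
   have "ip (T w) f = ip w (F M s r f)" unfolding rs(3) by (rule F_adjoint[OF wB fB])
   hence "ip (T w) f = 0" using jhwD(3)[OF f rs(1,2)] by simp
   thus "ip (Ph v (T w)) v' * ip f f = ip (T w) f * ip v v'" using 1 by simp
  qed
  qed
 qed
 moreover have "SW = orb (Fops \<inter> Low) f" by (rule orb_lowering[OF f admissible_F])
 ultimately show ?thesis using w v by blast
qed

text \<open>Induction on w': a column operator is moved by adjunction from the second argument to
  the first on both sides, until \<open>ip_Ph_f\<close> applies.\<close>

lemma ip_Ph:
 assumes "w' \<in> SW" "w \<in> SW" "v \<in> SV" "v' \<in> SV"
 shows "ip (Ph v w) (Ph v' w') * ip f f = ip w w' * ip v v'"
proof -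
 have FS: "x \<in> FS" if "x \<in> SW" for x using that SW_B B_FS by blast
 have PFS: "Ph v w \<in> FS" if "v \<in> SV" "w \<in> SW" for v w using Ph_B[OF that] by (rule B_FS)
 let ?K = "{w' \<in> SW. \<forall>w\<in>SW. \<forall>v\<in>SV. \<forall>v'\<in>SV. ip (Ph v w) (Ph v' w') * ip f f = ip w w' * ip v v'}"
 have "orb Fops f \<subseteq> ?K"
 proof (rule orb_least)
  show "f \<in> ?K" using orb_base[of f Fops] ip_Ph_f by (simp add: Ph_f)
  have "Ph v 0 = 0" if "v \<in> SV" for v using Ph_sc2[OF that orb_base, of 0] by simp
  thus "subsp ?K"
   unfolding subsp_def using PFS FS
   by (auto simp: subsp_0 subsp_add subsp_sc Ph_add2 Ph_sc2 ip_add_right ip_sc_right distrib_right)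
  fix x T assume x: "x \<in> ?K" and T: "T \<in> Fops"
  hence xS: "x \<in> SW" by blast
  obtain r s where rs: "r < N" "s < N" "T = F M r s" using T unfolding Fops_def by blast
  show "T x \<in> ?K"
  proof (intro CollectI conjI ballI)
   show "T x \<in> SW" by (rule orb_step[OF xS T])
   fix w v v' assume w: "w \<in> SW" and v: "v \<in> SV" "v' \<in> SV"
   have Fw: "F M s r w \<in> SW" by (rule orb_step[OF w F_Fops[OF rs(2,1)]])
   have wB: "w \<in> B M" "x \<in> B M" using w xS SW_B by blast+
   have "ip (Ph v (F M s r w)) (Ph v' x) = ip (F M s r (Ph v w)) (Ph v' x)"
    using Ph_F[OF v(1) w rs(2,1)] by simp
   also have "\<dots> = ip (Ph v w) (F M r s (Ph v' x))" by (rule F_adjoint[OF Ph_B[OF v(1) w] Ph_B[OF v(2) xS]])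
   also have "\<dots> = ip (Ph v w) (Ph v' (T x))" unfolding rs(3) using Ph_F[OF v(2) xS rs(1,2)] by simp
   finally have 1: "ip (Ph v (F M s r w)) (Ph v' x) = ip (Ph v w) (Ph v' (T x))" .
   have 2: "ip (F M s r w) x = ip w (T x)" unfolding rs(3) by (rule F_adjoint[OF wB])
   have "ip (Ph v (F M s r w)) (Ph v' x) * ip f f = ip (F M s r w) x * ip v v'" using x Fw v by blast
   thus "ip (Ph v w) (Ph v' (T x)) * ip f f = ip w (T x) * ip v v'" unfolding 1 2 .
  qed
 qed
 thus ?thesis using assms by blast
qed

lemma Ph_nondegenerate:
 assumes fin: "finite I" and vw: "\<And>i. i \<in> I ==> v i \<in> SV \<and> w i \<in> SW"
  and z: "(\<Sum>i\<in>I. Ph (v i) (w i)) = 0" and j: "j \<in> I" "w j \<noteq> 0"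
 shows "\<exists>c. v j = (\<Sum>i\<in>I - {j}. sc (c i) (v i))"
proof -
 \<comment> \<open>Pairing the vanishing sum with \<open>Ph u (w j)\<close> gives the squared length
   of u by \<open>ip_Ph\<close>. So u = 0, a relation in which \<open>v j\<close> has the nonzero
   coefficient \<open>ip (w j) (w j)\<close>.\<close>
 define u where "u = (\<Sum>i\<in>I. sc (ip (w i) (w j)) (v i))"
 have uS: "u \<in> SV" unfolding u_def using vw by (intro subsp_sum subsp_sc subsp_orb) blast
 have uFS: "u \<in> FS" using uS SV_B B_FS by blast
 have wjS: "w j \<in> SW" using vw j by blast
 have wj: "ip (w j) (w j) \<noteq> 0" using ip_definite[of "w j"] j(2) wjS SW_B B_FS by blast
 have "0 = ip (\<Sum>i\<in>I. Ph (v i) (w i)) (Ph u (w j)) * ip f f" unfolding z by simp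
 also have "\<dots> = (\<Sum>i\<in>I. ip (Ph (v i) (w i)) (Ph u (w j)) * ip f f)"
  unfolding ip_sum_left[OF B_FS[OF Ph_B[OF uS wjS]]] sum_distrib_right ..
 also have "\<dots> = (\<Sum>i\<in>I. ip (w i) (w j) * ip (v i) u)"
  using vw ip_Ph[OF wjS _ _ uS] by (intro sum.cong refl) blast
 also have "\<dots> = ip u u"
  unfolding u_def[symmetric] by (subst (2) u_def) (simp add: ip_sum_left[OF uFS] ip_sc_left[OF uFS])
 finally have "u = 0" using ip_definite[OF uFS] by simp
 hence s0: "sc (ip (w j) (w j)) (v j) + (\<Sum>i\<in>I - {j}. sc (ip (w i) (w j)) (v i)) = 0"
  using sum.remove[OF fin j(1), of "\<lambda>i. sc (ip (w i) (w j)) (v i)"] by (simp only: u_def)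
 define c where "c i = - ip (w i) (w j) / ip (w j) (w j)" for i
 have "v j = (\<Sum>i\<in>I - {j}. sc (c i) (v i))"
 proof
  fix a
  have "ip (w j) (w j) * v j a + (\<Sum>i\<in>I - {j}. ip (w i) (w j) * v i a) = 0"
   using fun_cong[OF s0, of a] by simp
  hence "v j a = - (\<Sum>i\<in>I - {j}. ip (w i) (w j) * v i a) / ip (w j) (w j)"
   using wj by (simp add: field_simps eq_neg_iff_add_eq_0)
  thus "v j a = (\<Sum>i\<in>I - {j}. sc (c i) (v i)) a"
   by (simp add: c_def sum_negf sum_divide_distrib)
 qed
 thus ?thesis by blast
qed

end

end

section \<open>The simple constituents\<close>

text \<open>In a simple module a nonzero vector generates everything, so generation comes for
  free.\<close>

lemma simple_highest_weightI:
 assumes "is_simple \<Gamma> U V" "v \<in> hcomp V \<gamma>" "v \<noteq> \<zero>\<^bsub>V\<^esub>"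
  "\<And>i j. i < j ==> j < r ==> act V (e i j) v = \<zero>\<^bsub>V\<^esub>" "\<And>i. i < r ==> act V (e i i) v = \<mu> i \<odot>\<^bsub>V\<^esub> v"
 shows "is_simple_highest_weight \<Gamma> U e r \<mu> V"
proof -
 have "S = carrier V" if "is_graded_submodule \<Gamma> U V S" "v \<in> S" for S
  using assms(1,3) that unfolding is_simple_def by blast
 thus ?thesis
  unfolding is_simple_highest_weight_def using assms by blast
qed

context howe
begin

interpretation CX: presented GX RX by (rule presented_X)

interpretation PQ: presented GQ RQ by (rule presented_gl)

interpretation PN: presented GN RN by (rule presented_gl)

abbreviation "UT \<equiv> tensor_product Uq Ugl"

lemma rhoQ_in:
 assumes "subsp T" "T \<subseteq> B M" "\<And>x v. x \<in> GQ ==> v \<in> T ==> eE x v \<in> T" "a \<in> carrier Uq" "v \<in> T"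
 shows "rhoQ a v \<in> T"
proof -
 obtain g where g: "g \<in> frees GQ" "a = PQ.cls g" using Uq_elim[OF assms(4)] by blast
 have "v \<in> B M" using assms(2,5) by blast
 hence e: "rhoQ a v = ev eE g v" unfolding g(2) by (rule rhoQ_cls[OF g(1)])
 show ?thesis unfolding e by (rule ev_in[where G = GQ, OF assms(1)]) (use assms(3,5) g(1) in simp_all)
qed

lemma rhoN_in:
 assumes "subsp T" "T \<subseteq> B M" "\<And>x v. x \<in> GN ==> v \<in> T ==> eF x v \<in> T" "a \<in> carrier Ugl" "v \<in> T"
 shows "rhoN a v \<in> T"
proof -
 obtain g where g: "g \<in> frees GN" "a = PN.cls g" using UN_elim[OF assms(4)] by blast
 have "v \<in> B M" using assms(2,5) by blast
 hence e: "rhoN a v = ev eF g v" unfolding g(2) by (rule rhoN_cls[OF g(1)])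
 show ?thesis unfolding e by (rule ev_in[where G = GN, OF assms(1)]) (use assms(3,5) g(1) in simp_all)
qed

lemma E_glq: "x \<in> GQ ==> E_glq m n q (fst x) (snd x) \<in> carrier Uq"
  "x \<in> GQ ==> v \<in> B M ==> rhoQ (E_glq m n q (fst x) (snd x)) v = eE x v"
 using PQ.cls_carrier[OF frees_gen, of x] rhoQ_cls[OF frees_gen, of x] by (simp_all add: E_glq_def Uq)

lemma E_glN: "x \<in> GN ==> E_glN N (fst x) (snd x) \<in> carrier Ugl"
  "x \<in> GN ==> v \<in> B M ==> rhoN (E_glN N (fst x) (snd x)) v = eF x v"
 using PN.cls_carrier[OF frees_gen, of x] rhoN_cls[OF frees_gen, of x] by (simp_all add: E_glN_def Ugl)

lemma rr_pure:
 assumes "a \<in> carrier Uq" "b \<in> carrier Ugl"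
 shows "pure_tensor Uq Ugl a b \<in> carrier UT"
  "v \<in> B M ==> TR.rr (pure_tensor Uq Ugl a b) v = rhoQ a (rhoN b v)"
proof -
 show "pure_tensor Uq Ugl a b \<in> carrier UT"
  unfolding TR.UT_carrier pure_tensor_def using TR.good_single[OF assms] by blast
 show "TR.rr (pure_tensor Uq Ugl a b) v = rhoQ a (rhoN b v)" if "v \<in> B M"
  unfolding pure_tensor_def TR.rr_cl[OF that] by (simp add: TR.rhat_def)
qed

lemma rr_glq:
 assumes "i < M" "j < M"
 shows "glq_elem m n N q i j \<in> carrier UT" "v \<in> B M ==> TR.rr (glq_elem m n N q i j) v = E i j v"
proof -
 have G: "(i, j) \<in> GQ" using assms by simp
 note e = E_glq[OF G, unfolded fst_conv snd_conv eE_simp]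
 note r = rr_pure[OF e(1) distr_algebraD(1)[OF UN_distr]]
 show "glq_elem m n N q i j \<in> carrier UT" unfolding glq_elem_def by (rule r(1))
 show "TR.rr (glq_elem m n N q i j) v = E i j v" if "v \<in> B M"
  unfolding glq_elem_def r(2)[OF that] repD(7)[OF rep_rhoN that] by (rule e(2)[OF that])
qed

lemma rr_glN:
 assumes "r < N" "s < N"
 shows "glN_elem m n N q r s \<in> carrier UT" "v \<in> B M ==> TR.rr (glN_elem m n N q r s) v = F M r s v"
proof -
 have G: "(r, s) \<in> GN" using assms by simp
 note e = E_glN[OF G, unfolded fst_conv snd_conv eF_simp]
 note r = rr_pure[OF distr_algebraD(1)[OF Uq_distr] e(1)]
 show "glN_elem m n N q r s \<in> carrier UT" unfolding glN_elem_def by (rule r(1))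
 show "TR.rr (glN_elem m n N q r s) v = F M r s v" if "v \<in> B M"
 proof -
  have "F M r s v \<in> B M" using F_B[OF that assms(1)] .
  thus ?thesis unfolding glN_elem_def r(2)[OF that] e(2)[OF that] by (rule repD(7)[OF rep_rhoQ])
 qed
qed

lemma rr_ops: "D \<in> Eops \<union> Fops ==> \<exists>a\<in>carrier UT. \<forall>v\<in>B M. TR.rr a v = D v"
proof -
 assume "D \<in> Eops \<union> Fops"
 then consider i j where "i < M" "j < M" "D = E i j" | r s where "r < N" "s < N" "D = F M r s"
  unfolding Eops_def Fops_def by blast
 thus ?thesis
 proof cases
  case 1
  thus ?thesis using rr_glq[OF 1(1,2)] by (intro bexI[of _ "glq_elem m n N q i j"]) auto
 next
  case 2
  thus ?thesis using rr_glN[OF 2(1,2)] by (intro bexI[of _ "glN_elem m n N q r s"]) auto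
 qed
qed

lemma homog_rr:
 assumes a: "a \<in> hcomp UT \<gamma>" and v: "v \<in> B M" "homog mdeg \<beta> v"
 shows "homog mdeg (\<gamma> + \<beta>) (TR.rr a v)"
proof -
 obtain t where t: "a = TR.cl t" and K: "keys t \<subseteq> {(x, y). x \<in> carrier Uq \<and> y \<in> carrier Ugl \<and>
   (\<exists>\<alpha> \<beta>. x \<in> hcomp Uq \<alpha> \<and> y \<in> hcomp Ugl \<beta> \<and> \<alpha> + \<beta> = \<gamma>)}"
  using a unfolding tensor_product_def graded.simps by blast
 have "TR.rr a v \<in> {v. homog mdeg (\<gamma> + \<beta>) v}"
  unfolding t TR.rr_cl[OF v(1)] TR.rhat_def
 proof (rule lext_in[OF subsp_supported])
  fix k assume "k \<in> keys t"
  then obtain x y \<alpha>1 \<alpha>2 where k: "k = (x, y)" "y \<in> carrier Ugl" "x \<in> hcomp Uq \<alpha>1" "y \<in> hcomp Ugl \<alpha>2" "\<alpha>1 + \<alpha>2 = \<gamma>"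
   using K by blast
  have "rhoN y v \<in> B M" by (rule repD(1)[OF rep_rhoN k(2) v(1)])
  from homog_rhoQ[OF k(3) this homog_rhoN[OF k(4) v]]
  show "(case k of (a, b) => rhoQ a (rhoN b v)) \<in> {v. homog mdeg (\<gamma> + \<beta>) v}"
   by (simp add: k(1) k(5)[symmetric] add.assoc)
 qed
 thus ?thesis by simp
qed

lemma rr_in:
 assumes "subsp T" "T \<subseteq> B M" "\<And>D v. D \<in> Eops \<union> Fops ==> v \<in> T ==> D v \<in> T" "a \<in> carrier UT" "v \<in> T"
 shows "TR.rr a v \<in> T"
proof -
 obtain t where t: "a = TR.cl t" "TR.good t" using assms(4) unfolding TR.UT_carrier by blast
 have vB: "v \<in> B M" using assms(2,5) by blast
 have E: "eE x v \<in> T" if "x \<in> GQ" "v \<in> T" for x v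
  by (rule assms(3)[OF _ that(2)]) (use that(1) in \<open>auto simp: Eops_image\<close>)
 have F: "eF x v \<in> T" if "x \<in> GN" "v \<in> T" for x v
  by (rule assms(3)[OF _ that(2)]) (use that(1) in \<open>auto simp: Fops_image\<close>)
 show ?thesis
  unfolding t(1) TR.rr_cl[OF vB]
 proof (rule TR.rhat_in_sub[OF t(2) assms(5,1)])
  show "rhoQ a v \<in> T" if "a \<in> carrier Uq" "v \<in> T" for a v by (rule rhoQ_in[OF assms(1,2) E that])
  show "rhoN b v \<in> T" if "b \<in> carrier Ugl" "v \<in> T" for b v by (rule rhoN_in[OF assms(1,2) F that])
 qed
qed

text \<open>Realises a stable space S of functions as a module on the element type of the algebra,
  through the elements whose coordinates lie in S. Grading and action are parameters.\<close>

definition pull :: "vec set => (degree => vec set) => ('u => vec => vec) => ('u, (nat \<times> nat) free set) gmodule" where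
 "pull S H \<rho> = with_action (Cw\<lparr>carrier := {A \<in> carrier Cw. psi A \<in> S}, hcomp := (\<lambda>\<alpha>. {A \<in> carrier Cw. psi A \<in> H \<alpha>})\<rparr>)
   (\<lambda>a. tr (\<rho> a))"

lemma pull_simps [simp]:
 "carrier (pull S H \<rho>) = {A \<in> carrier Cw. psi A \<in> S}" "\<zero>\<^bsub>pull S H \<rho>\<^esub> = \<zero>\<^bsub>Cw\<^esub>"
 "add (pull S H \<rho>) = add Cw" "module.smult (pull S H \<rho>) = module.smult Cw"
 "hcomp (pull S H \<rho>) = (\<lambda>\<alpha>. {A \<in> carrier Cw. psi A \<in> H \<alpha>})" "act (pull S H \<rho>) = (\<lambda>a. tr (\<rho> a))"
 by (simp_all add: pull_def)

lemma tr_val: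
 assumes "T (psi A) \<in> B M"
 shows "tr T A \<in> carrier Cw" "psi (tr T A) = T (psi A)"
 unfolding tr_def using lin_model_inv[OF psi_lin_model assms] by blast+

lemma pull_model:
 assumes S: "subsp S" "S \<subseteq> B M" and H: "\<And>\<alpha>. H \<alpha> \<subseteq> S" and \<rho>: "\<And>a v. a \<in> carrier R ==> v \<in> S ==> \<rho> a v \<in> S"
 shows "gmod_model R (pull S H \<rho>) psi S H \<rho>"
proof -
 have surj: "\<exists>A\<in>carrier Cw. psi A = v" if "v \<in> B M" for v
  using lin_model_inv[OF psi_lin_model that] by blast
 have "bij_betw psi {A \<in> carrier Cw. psi A \<in> S} S"
  unfolding bij_betw_def
 proof
  show "inj_on psi {A \<in> carrier Cw. psi A \<in> S}" by (rule inj_onI) (use Cm(9) in blast)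
  show "psi ` {A \<in> carrier Cw. psi A \<in> S} = S" using surj S(2) by auto
 qed
 hence "lin_model (pull S H \<rho>) psi S"
  unfolding lin_model_def using S(1) Cm(3-8) subsp_0[OF S(1)] subsp_add[OF S(1)] subsp_sc[OF S(1)] by simp
 moreover have "hmodel (pull S H \<rho>) psi H"
  unfolding hmodel_def pull_simps
 proof (intro allI conjI)
  fix \<alpha>
  show "{A \<in> carrier Cw. psi A \<in> H \<alpha>} \<subseteq> {A \<in> carrier Cw. psi A \<in> S}" using H by blast
  show "psi ` {A \<in> carrier Cw. psi A \<in> H \<alpha>} = H \<alpha>"
  proof
   show "H \<alpha> \<subseteq> psi ` {A \<in> carrier Cw. psi A \<in> H \<alpha>}"
   proof
    fix v assume v: "v \<in> H \<alpha>"
    then obtain A where "A \<in> carrier Cw" "psi A = v" using surj H S(2) by blast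
    thus "v \<in> psi ` {A \<in> carrier Cw. psi A \<in> H \<alpha>}" using v by blast
   qed
  qed blast
 qed
 moreover have "tr (\<rho> a) A \<in> carrier Cw \<and> psi (tr (\<rho> a) A) = \<rho> a (psi A) \<and> \<rho> a (psi A) \<in> S"
  if "a \<in> carrier R" "A \<in> carrier Cw" "psi A \<in> S" for a A
 proof -
  have r: "\<rho> a (psi A) \<in> S" by (rule \<rho>[OF that(1,3)])
  hence "\<rho> a (psi A) \<in> B M" using S(2) by blast
  from tr_val[where T = "\<rho> a", OF this] r show ?thesis by simp
 qed
 ultimately show ?thesis unfolding gmod_model_def by simp
qed

lemma zero_Gamma: "0 \<in> \<Gamma>grp m n" by (simp add: \<Gamma>grp_def)

lemma gr_mdeg: "subsp S ==> S \<subseteq> B M ==> graded_by mdeg S ==> gr (\<Gamma>grp m n) S (\<lambda>\<alpha>. S \<inter> {v. homog mdeg \<alpha> v})"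
 by (rule gr_homog) (auto intro: B_FS mdeg_Gamma)

lemma mdeg_graded_module:
 assumes S: "subsp S" "S \<subseteq> B M" "graded_by mdeg S"
  and gm: "gmod_model R Wm \<phi> S (\<lambda>\<alpha>. S \<inter> {v. homog mdeg \<alpha> v}) r"
  and rep: "rep R r S" and ac: "alg_closed R" and hR: "\<And>\<alpha>. hcomp R \<alpha> \<subseteq> carrier R"
  and deg: "\<And>\<alpha> \<beta> a v. a \<in> hcomp R \<alpha> ==> v \<in> B M ==> homog mdeg \<beta> v ==> homog mdeg (\<alpha> + \<beta>) (r a v)"
 shows "is_graded_module (\<Gamma>grp m n) R Wm"
proof (rule graded_module_model[OF gm rep ac gr_mdeg[OF S] hR])
 fix \<alpha> \<beta> a v assume a: "a \<in> hcomp R \<alpha>" and v: "v \<in> S \<inter> {v. homog mdeg \<beta> v}"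
 have "r a v \<in> S" using repD(1)[OF rep, of a v] a hR v by blast
 moreover have "homog mdeg (\<alpha> + \<beta>) (r a v)" using deg[OF a, of v \<beta>] v S(2) by blast
 ultimately show "r a v \<in> S \<inter> {v. homog mdeg (\<alpha> + \<beta>) v}" by simp
qed

lemma simple_orb:
 assumes f: "jhw M \<mu> \<nu> f" "f \<noteq> 0" and O': "admissible O'"
  and gm: "gmod_model R Wm \<phi> (orb O' f) (\<lambda>\<alpha>. orb O' f \<inter> {v. homog mdeg \<alpha> v}) r"
  and rep: "rep R r (orb O' f)" and ac: "alg_closed R" and hR: "\<And>\<alpha>. hcomp R \<alpha> \<subseteq> carrier R"
  and deg: "\<And>\<alpha> \<beta> a v. a \<in> hcomp R \<alpha> ==> v \<in> B M ==> homog mdeg \<beta> v ==> homog mdeg (\<alpha> + \<beta>) (r a v)"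
  and ops: "\<And>D. D \<in> O' ==> \<exists>a\<in>carrier R. \<forall>v\<in>B M. r a v = D v"
 shows "is_simple (\<Gamma>grp m n) R Wm"
proof (rule simple_model[OF gm])
 have SB: "orb O' f \<subseteq> B M" by (rule orb_B[OF O' jhwD(1)[OF f(1)]])
 have "graded_by mdeg (orb O' f)"
  using graded_mdeg[OF SB subsp_orb] orb_graded_rdeg(1)[OF f(1) O'] by blast
 from mdeg_graded_module[OF subsp_orb SB this gm rep ac hR deg]
 show "is_graded_module (\<Gamma>grp m n) R Wm" .
 show "orb O' f \<noteq> {0}" using orb_base[of f O'] f(2) by blast
 fix T assume T: "T \<subseteq> orb O' f" "subsp T" "\<And>a v. a \<in> carrier R ==> v \<in> T ==> r a v \<in> T"
  "\<And>v. v \<in> T ==> \<exists>g. (\<forall>\<alpha>. g \<alpha> \<in> T \<inter> (orb O' f \<inter> {v. homog mdeg \<alpha> v})) \<and> finite {\<alpha>. g \<alpha> \<noteq> 0} \<and> v = (\<Sum>\<alpha> | g \<alpha> \<noteq> 0. g \<alpha>)"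
 have TB: "T \<subseteq> B M" using T(1) SB by blast
 have "graded_by mdeg T" by (rule graded_decomposition[OF T(4,2)])
 hence gT: "graded_by rdeg T" using graded_mdeg[OF TB T(2)] by blast
 have "D x \<in> T" if D: "D \<in> O'" and x: "x \<in> T" for D x
 proof -
  obtain a where a: "a \<in> carrier R" "\<And>v. v \<in> B M ==> r a v = D v" using ops[OF D] by blast
  have "x \<in> B M" using x TB by blast
  thus ?thesis using T(3)[OF a(1) x] a(2) by simp
 qed
 thus "T = {0} \<or> T = orb O' f" using orb_simple[OF f O' T(1,2) gT] by blast
qed

definition LQ :: "(nat => nat) => ((nat \<times> nat) free set, (nat \<times> nat) free set) gmodule" where
 "LQ \<nu> = pull (orb Eops (fv \<nu>)) (\<lambda>\<alpha>. orb Eops (fv \<nu>) \<inter> {v. homog mdeg \<alpha> v}) rhoQ"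

text \<open>Everything is put in degree zero although the vectors have a row degree: gl_N has degree
  zero, and the degree of the tensor product is carried by \<open>LQ\<close>.\<close>

definition LN :: "(nat => nat) => ((nat \<times> nat) free set, (nat \<times> nat) free set) gmodule" where
 "LN \<nu> = pull (orb Fops (fv \<nu>)) (\<lambda>\<alpha>. if \<alpha> = 0 then orb Fops (fv \<nu>) else {0}) rhoN"

definition actC :: "((nat \<times> nat) free set \<times> (nat \<times> nat) free set \<Rightarrow>\<^sub>0 complex) set => (nat \<times> nat) free set => (nat \<times> nat) free set" where
 "actC u = tr (TR.rr u)"

lemma rhoQ_orb: "f \<in> B M ==> a \<in> carrier Uq ==> v \<in> orb Eops f ==> rhoQ a v \<in> orb Eops f"
proof (rule rhoQ_in[OF subsp_orb])
 show "orb Eops f \<subseteq> B M" if "f \<in> B M" by (rule orb_B[OF admissible_E that])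
 show "eE x v \<in> orb Eops f" if "x \<in> GQ" "v \<in> orb Eops f" for x v
  by (rule orb_step[OF that(2)]) (use that(1) in \<open>auto simp: Eops_image\<close>)
qed

lemma rhoN_orb: "f \<in> B M ==> a \<in> carrier Ugl ==> v \<in> orb Fops f ==> rhoN a v \<in> orb Fops f"
proof (rule rhoN_in[OF subsp_orb])
 show "orb Fops f \<subseteq> B M" if "f \<in> B M" by (rule orb_B[OF admissible_F that])
 show "eF x v \<in> orb Fops f" if "x \<in> GN" "v \<in> orb Fops f" for x v
  by (rule orb_step[OF that(2)]) (use that(1) in \<open>auto simp: Fops_image\<close>)
qed

lemma Uq_ac: "alg_closed Uq" and Ugl_ac: "alg_closed Ugl"
 using Uq_distr UN_distr by (simp_all add: distr_algebra_def)

section \<open>The simple factors of one summand\<close>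

context
 fixes \<nu> assumes \<nu>: "\<nu> \<in> P"
begin

lemma fvB: "fv \<nu> \<in> B M" using fv(1)[OF \<nu>] jhwD(1) by blast

lemma LQ_model: "gmod_model Uq (LQ \<nu>) psi (orb Eops (fv \<nu>)) (\<lambda>\<alpha>. orb Eops (fv \<nu>) \<inter> {v. homog mdeg \<alpha> v}) rhoQ"
 unfolding LQ_def by (rule pull_model[OF subsp_orb orb_B[OF admissible_E fvB] _ rhoQ_orb[OF fvB]]) auto

lemma LN_model: "gmod_model Ugl (LN \<nu>) psi (orb Fops (fv \<nu>)) (\<lambda>\<alpha>. if \<alpha> = 0 then orb Fops (fv \<nu>) else {0}) rhoN"
 unfolding LN_def
 by (rule pull_model[OF subsp_orb orb_B[OF admissible_F fvB] _ rhoN_orb[OF fvB]]) (simp_all add: subsp_0)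

lemma weights:
 assumes f: "jhw M \<mu> \<nu> (fv \<nu>)"
 shows "i < M ==> E i i (fv \<nu>) = sc (of_nat (sharp m \<nu> i)) (fv \<nu>)" "F M r r (fv \<nu>) = sc (of_nat (\<nu> r)) (fv \<nu>)"
proof -
 show "E i i (fv \<nu>) = sc (of_nat (sharp m \<nu> i)) (fv \<nu>)" if "i < M"
 proof
  fix a show "E i i (fv \<nu>) a = sc (of_nat (sharp m \<nu> i)) (fv \<nu>) a"
   using jhwD(7)[OF f, of a] jhw_partition(2)[OF f fv(2)[OF \<nu>] that] by (cases "fv \<nu> a = 0") (simp_all add: E_diag[OF fvB])
 qed
 show "F M r r (fv \<nu>) = sc (of_nat (\<nu> r)) (fv \<nu>)"
 proof
  fix a show "F M r r (fv \<nu>) a = sc (of_nat (\<nu> r)) (fv \<nu>) a"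
   using jhwD(8)[OF f, of a] by (cases "fv \<nu> a = 0") (simp_all add: F_diag[OF fvB])
 qed
qed

definition "v0 = inv_into (carrier Cw) psi (fv \<nu>)"

lemma v0: "v0 \<in> carrier Cw" "psi v0 = fv \<nu>" "v0 \<noteq> \<zero>\<^bsub>Cw\<^esub>"
proof -
 show "v0 \<in> carrier Cw" and p: "psi v0 = fv \<nu>"
  unfolding v0_def using lin_model_inv[OF psi_lin_model fvB] by blast+
 show "v0 \<noteq> \<zero>\<^bsub>Cw\<^esub>" using p Cm(4) fv(2)[OF \<nu>] by auto
qed

lemma tr_v0: "T (fv \<nu>) = sc c (fv \<nu>) ==> tr T v0 = c \<odot>\<^bsub>Cw\<^esub> v0"
proof -
 assume T: "T (fv \<nu>) = sc c (fv \<nu>)"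
 hence b: "T (psi v0) \<in> B M" using v0(2) subsp_sc[OF subsp_B fvB] by simp
 show ?thesis by (rule Cm(9)[OF tr_val(1)[where T = T, OF b] Cm(7)[OF v0(1)]]) (simp only: tr_val(2)[where T = T, OF b] Cm(8)[OF v0(1)] v0(2) T)
qed

lemma tr_v0_zero: "T (fv \<nu>) = 0 ==> tr T v0 = \<zero>\<^bsub>Cw\<^esub>"
proof -
 assume T: "T (fv \<nu>) = 0"
 hence b: "T (psi v0) \<in> B M" using v0(2) subsp_0[OF subsp_B] by simp
 show ?thesis by (rule Cm(9)[OF tr_val(1)[where T = T, OF b] Cm(3)]) (simp only: tr_val(2)[where T = T, OF b] Cm(4) v0(2) T)
qed

lemma LQ_highest_weight:
 "is_simple_highest_weight (\<Gamma>grp m n) Uq (E_glq m n q) M (\<lambda>i. of_nat (sharp m \<nu> i)) (LQ \<nu>)"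
proof -
 obtain \<mu> where f: "jhw M \<mu> \<nu> (fv \<nu>)" using fv(1)[OF \<nu>] by blast
 have SB: "orb Eops (fv \<nu>) \<subseteq> B M" by (rule orb_B[OF admissible_E fvB])
 have rep: "rep Uq rhoQ (orb Eops (fv \<nu>))" by (rule rep_subspace[OF rep_rhoQ SB rhoQ_orb[OF fvB]])
 have simple: "is_simple (\<Gamma>grp m n) Uq (LQ \<nu>)"
 proof (rule simple_orb[OF f fv(2)[OF \<nu>] admissible_E LQ_model rep Uq_ac Uq_hcomp_carrier homog_rhoQ])
  fix D assume "D \<in> Eops"
  then obtain x where x: "x \<in> GQ" "D = eE x" unfolding Eops_image by blast
  show "\<exists>a\<in>carrier Uq. \<forall>v\<in>B M. rhoQ a v = D v"
   using E_glq[OF x(1)] x(2) by blast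
 qed
 obtain \<gamma> where \<gamma>: "homog mdeg \<gamma> (fv \<nu>)" using homog_mdeg[OF fvB jhwD(4)[OF f]] by blast
 show ?thesis
 proof (rule simple_highest_weightI[OF simple])
  show "v0 \<in> hcomp (LQ \<nu>) \<gamma>" using v0 \<gamma> orb_base[of "fv \<nu>" Eops] by (simp add: LQ_def)
  show "v0 \<noteq> \<zero>\<^bsub>LQ \<nu>\<^esub>" using v0 by (simp add: LQ_def)
  show "act (LQ \<nu>) (E_glq m n q i j) v0 = \<zero>\<^bsub>LQ \<nu>\<^esub>" if "i < j" "j < M" for i j
  proof -
   have "rhoQ (E_glq m n q i j) (fv \<nu>) = 0"
    using E_glq(2)[of "(i, j)", OF _ fvB] jhwD(2)[OF f that] that by simp
   from tr_v0_zero[of "rhoQ (E_glq m n q i j)", OF this] show ?thesis by (simp add: LQ_def)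
  qed
  show "act (LQ \<nu>) (E_glq m n q i i) v0 = of_nat (sharp m \<nu> i) \<odot>\<^bsub>LQ \<nu>\<^esub> v0" if "i < M" for i
  proof -
   have "rhoQ (E_glq m n q i i) (fv \<nu>) = sc (of_nat (sharp m \<nu> i)) (fv \<nu>)"
    using E_glq(2)[of "(i, i)", OF _ fvB] weights(1)[OF f that] that by (simp only: fst_conv snd_conv eE_simp) simp
   from tr_v0[of "rhoQ (E_glq m n q i i)", OF this] show ?thesis by (simp add: LQ_def)
  qed
 qed
qed

lemma LN_highest_weight:
 "is_simple_highest_weight (\<Gamma>grp m n) Ugl (E_glN N) N (\<lambda>r. of_nat (\<nu> r)) (LN \<nu>)"
proof -
 obtain \<mu> where f: "jhw M \<mu> \<nu> (fv \<nu>)" using fv(1)[OF \<nu>] by blast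
 let ?S = "orb Fops (fv \<nu>)"
 let ?H = "\<lambda>\<alpha> :: degree. if \<alpha> = 0 then ?S else {0}"
 have SB: "?S \<subseteq> B M" by (rule orb_B[OF admissible_F fvB])
 have rep: "rep Ugl rhoN ?S" by (rule rep_subspace[OF rep_rhoN SB rhoN_orb[OF fvB]])
 have deg: "rhoN a v \<in> ?H (\<alpha> + \<beta>)" if a: "a \<in> hcomp Ugl \<alpha>" and v: "v \<in> ?H \<beta>" for \<alpha> \<beta> a v
 proof -
  have ac: "a \<in> carrier Ugl" using a UN_hcomp_carrier by blast
  have vS: "v \<in> ?S" using v subsp_0[OF subsp_orb] by (cases "\<beta> = 0") auto
  have z: "0 \<in> ?H (\<alpha> + \<beta>)" using subsp_0[OF subsp_orb[of Fops "fv \<nu>"]] by simp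
  show ?thesis
  proof (cases "\<alpha> = 0 \<and> \<beta> = 0")
   case True
   thus ?thesis using repD(1)[OF rep ac vS] by simp
  next
   case False
   have "rhoN a v = 0"
   proof (cases "\<beta> = 0")
    case True
    thus ?thesis using False vS SB by (intro rhoN_hcomp_nonzero[OF a]) auto
   next
    case False
    hence "v = 0" using v by simp
    thus ?thesis using repD(3)[OF rep ac vS, of 0] by simp
   qed
   thus ?thesis using z by simp
  qed
 qed
 have simple: "is_simple (\<Gamma>grp m n) Ugl (LN \<nu>)"
 proof (rule simple_model[OF LN_model])
  show "is_graded_module (\<Gamma>grp m n) Ugl (LN \<nu>)"
   by (rule graded_module_model[OF LN_model rep Ugl_ac gr_trivial[OF subsp_orb zero_Gamma] UN_hcomp_carrier deg])
  show "?S \<noteq> {0}" using orb_base[of "fv \<nu>" Fops] fv(2)[OF \<nu>] by blast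
  fix T assume T: "T \<subseteq> ?S" "subsp T" "\<And>a v. a \<in> carrier Ugl ==> v \<in> T ==> rhoN a v \<in> T"
  \<comment> \<open>The column orbit lies in a single row degree, so each of its subspaces is graded
    by rows and \<open>orb_simple\<close> applies despite the changed grading.\<close>
  have "prj rdeg d v \<in> T" if v: "v \<in> T" for d v
  proof -
   have "homog rdeg \<mu> v" using SW_homog[OF f fv(2)[OF \<nu>]] v T(1) by blast
   thus ?thesis using prj_homog[of rdeg \<mu> v d] v subsp_0[OF T(2)] by simp
  qed
  hence gT: "graded_by rdeg T" by (simp add: graded_by_def)
  have "D x \<in> T" if D: "D \<in> Fops" and x: "x \<in> T" for D x
  proof -
   obtain y where y: "y \<in> GN" "D = eF y" using D unfolding Fops_image by blast
   have "x \<in> B M" using x T(1) SB by blast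
   thus ?thesis using T(3)[OF E_glN(1)[OF y(1)] x] E_glN(2)[OF y(1)] y(2) by simp
  qed
  thus "T = {0} \<or> T = ?S" using orb_simple[OF f fv(2)[OF \<nu>] admissible_F T(1,2) gT] by blast
 qed
 show ?thesis
 proof (rule simple_highest_weightI[OF simple])
  show "v0 \<in> hcomp (LN \<nu>) 0" using v0 orb_base[of "fv \<nu>" Fops] by (simp add: LN_def)
  show "v0 \<noteq> \<zero>\<^bsub>LN \<nu>\<^esub>" using v0 by (simp add: LN_def)
  show "act (LN \<nu>) (E_glN N i j) v0 = \<zero>\<^bsub>LN \<nu>\<^esub>" if "i < j" "j < N" for i j
  proof -
   have "rhoN (E_glN N i j) (fv \<nu>) = 0"
    using E_glN(2)[of "(i, j)", OF _ fvB] jhwD(3)[OF f that] that by simp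
   from tr_v0_zero[of "rhoN (E_glN N i j)", OF this] show ?thesis by (simp add: LN_def)
  qed
  show "act (LN \<nu>) (E_glN N i i) v0 = of_nat (\<nu> i) \<odot>\<^bsub>LN \<nu>\<^esub> v0" if "i < N" for i
  proof -
   have "rhoN (E_glN N i i) (fv \<nu>) = sc (of_nat (\<nu> i)) (fv \<nu>)"
    using E_glN(2)[of "(i, i)", OF _ fvB] weights(2)[OF f] that by (simp only: fst_conv snd_conv eF_simp) simp
   from tr_v0[of "rhoN (E_glN N i i)", OF this] show ?thesis by (simp add: LN_def)
  qed
 qed
qed

text \<open>The pairing \<open>Ph (fv \<nu>)\<close> fulfils the criterion for tensor products, with
  Y the joint orbit; injectivity comes from \<open>Ph_nondegenerate\<close>.\<close>

lemma tensor_model: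
 "\<exists>\<phi>. gmod_model UT (tensor_module (LQ \<nu>) (LN \<nu>)) \<phi> (AA \<nu>) (\<lambda>\<alpha>. AA \<nu> \<inter> {v. homog mdeg \<alpha> v}) TR.rr"
proof -
 obtain \<mu> where f: "jhw M \<mu> \<nu> (fv \<nu>)" using fv(1)[OF \<nu>] by blast
 note c = f fv(2)[OF \<nu>]
 have SB: "orb Eops (fv \<nu>) \<subseteq> B M" by (rule orb_B[OF admissible_E fvB])
 have gr: "graded_by mdeg (orb Eops (fv \<nu>))"
  using graded_mdeg[OF SB subsp_orb] orb_graded_rdeg(1)[OF f admissible_E] by blast
 have "gmod_model UT (tensor_module (LQ \<nu>) (LN \<nu>)) (TR.ph psi psi (Ph (fv \<nu>))) (AA \<nu>) (\<lambda>\<alpha>. AA \<nu> \<inter> {v. homog mdeg \<alpha> v}) TR.rr"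
  by (rule TR.tensor_module_model[where \<Phi> = "Ph (fv \<nu>)", OF LQ_model LN_model Ph_add1[OF c] Ph_add2[OF c] Ph_sc1[OF c] Ph_sc2[OF c]
   Ph_equiv[OF c] Ph_nondegenerate[OF c] subsp_AA AA_B[OF \<nu>] Ph_orb[OF c, folded AA_def] Ph_least[OF c, folded AA_def] gr Ph_prj(2)[OF c]])
 thus ?thesis by blast
qed

lemma AA_rep: "rep UT TR.rr (AA \<nu>)"
proof (rule rep_subspace[OF TR.rep_rr AA_B[OF \<nu>]])
 fix a v assume a: "a \<in> carrier UT" "v \<in> AA \<nu>"
 show "TR.rr a v \<in> AA \<nu>"
  by (rule rr_in[where T = "AA \<nu>", OF subsp_AA AA_B[OF \<nu>] _ a]) (rule AA_closed)
qed

lemma tensor_simple: "is_simple (\<Gamma>grp m n) UT (tensor_module (LQ \<nu>) (LN \<nu>))"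
proof -
 obtain \<mu> where f: "jhw M \<mu> \<nu> (fv \<nu>)" using fv(1)[OF \<nu>] by blast
 obtain \<phi> where gm: "gmod_model UT (tensor_module (LQ \<nu>) (LN \<nu>)) \<phi> (AA \<nu>) (\<lambda>\<alpha>. AA \<nu> \<inter> {v. homog mdeg \<alpha> v}) TR.rr"
  using tensor_model by blast
 show ?thesis
  by (rule simple_orb[OF f fv(2)[OF \<nu>] admissible_both gm[unfolded AA_def] AA_rep[unfolded AA_def]
   TR.UT_alg_closed TR.UT_hcomp homog_rr rr_ops])
qed

end

section \<open>The decomposition and the module algebra structure\<close>

lemma AA_independent:
 assumes J: "finite J" "J \<subseteq> P" and g: "\<And>\<nu>. \<nu> \<in> J ==> g \<nu> \<in> AA \<nu>" and z: "(\<Sum>\<nu>\<in>J. g \<nu>) = 0"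
 shows "\<forall>\<nu>\<in>J. g \<nu> = 0"
proof
 fix \<kappa> assume \<kappa>: "\<kappa> \<in> J"
 have gFS: "g \<kappa> \<in> FS" using g[OF \<kappa>] AA_B[of \<kappa>] \<kappa> J(2) B_FS by blast
 have "0 = ip (\<Sum>\<nu>\<in>J. g \<nu>) (g \<kappa>)" unfolding z by simp
 also have "\<dots> = (\<Sum>\<nu>\<in>J. ip (g \<nu>) (g \<kappa>))" by (rule ip_sum_left[OF gFS])
 also have "\<dots> = (\<Sum>\<nu>\<in>J. if \<nu> = \<kappa> then ip (g \<kappa>) (g \<kappa>) else 0)"
 proof (intro sum.cong refl)
  fix \<nu> assume \<nu>: "\<nu> \<in> J"
  show "ip (g \<nu>) (g \<kappa>) = (if \<nu> = \<kappa> then ip (g \<kappa>) (g \<kappa>) else 0)"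
  proof (cases "\<nu> = \<kappa>")
   case False
   hence "g \<kappa> \<in> perp M (AA \<nu>)" using AA_perp[of \<nu> \<kappa>] \<nu> \<kappa> J(2) g[OF \<kappa>] by blast
   thus ?thesis using g[OF \<nu>] False by (simp add: perp_def)
  qed simp
 qed
 also have "\<dots> = ip (g \<kappa>) (g \<kappa>)" using \<kappa> J(1) by (simp add: sum.delta)
 finally show "g \<kappa> = 0" using ip_definite[OF gFS] by simp
qed

lemma C_model: "gmod_model UT (with_action Cw actC) psi (B M) (\<lambda>\<alpha>. B M \<inter> {v. homog mdeg \<alpha> v}) TR.rr"
proof -
 have "lin_model (with_action Cw actC) psi (B M)" using psi_lin_model unfolding lin_model_def by simp
 moreover have "hmodel (with_action Cw actC) psi (\<lambda>\<alpha>. B M \<inter> {v. homog mdeg \<alpha> v})"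
  using psi_hmodel unfolding hmodel_def by simp
 moreover have "actC a w \<in> carrier Cw \<and> psi (actC a w) = TR.rr a (psi w)" if "a \<in> carrier UT" "w \<in> carrier Cw" for a w
  using tr_val[of "TR.rr a" w] repD(1)[OF TR.rep_rr that(1) Cm(10)[OF that(2)]] by (simp add: actC_def)
 ultimately show ?thesis unfolding gmod_model_def by simp
qed

lemma decomposition:
 "\<exists>\<phi>. is_graded_module_iso UT (with_action Cw actC) (direct_sum P (\<lambda>\<nu>. tensor_module (LQ \<nu>) (LN \<nu>))) \<phi>"
proof -
 have "\<forall>\<nu>\<in>P. \<exists>\<phi>. gmod_model UT (tensor_module (LQ \<nu>) (LN \<nu>)) \<phi> (AA \<nu>) (\<lambda>\<alpha>. AA \<nu> \<inter> {v. homog mdeg \<alpha> v}) TR.rr"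
  using tensor_model by blast
 from bchoice[OF this] obtain \<phi> where \<phi>: "\<And>\<nu>. \<nu> \<in> P ==>
  gmod_model UT (tensor_module (LQ \<nu>) (LN \<nu>)) (\<phi> \<nu>) (AA \<nu>) (\<lambda>\<alpha>. AA \<nu> \<inter> {v. homog mdeg \<alpha> v}) TR.rr" by blast
 have "\<exists>\<psi>. gmod_model UT (direct_sum P (\<lambda>\<nu>. tensor_module (LQ \<nu>) (LN \<nu>))) \<psi> (B M) (\<lambda>\<alpha>. B M \<inter> {v. homog mdeg \<alpha> v}) TR.rr"
 proof (rule direct_sum_model[where S = AA and \<phi> = \<phi>, OF \<phi> TR.rep_rr subsp_B AA_B])
  fix v assume "v \<in> B M"
  hence "v \<in> TT" by (simp add: TT_eq_B)
  thus "\<exists>J g. finite J \<and> J \<subseteq> P \<and> (\<forall>i\<in>J. g i \<in> AA i) \<and> v = (\<Sum>i\<in>J. g i)" unfolding TT_def by blast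
 next
  fix J g assume "finite J" "J \<subseteq> P" "\<And>i. i \<in> J ==> g i \<in> AA i" "(\<Sum>i\<in>J. g i) = 0"
  thus "\<forall>i\<in>J. g i = 0" by (rule AA_independent)
 next
  fix \<nu> assume "\<nu> \<in> P"
  thus "graded_by mdeg (AA \<nu>)" using graded_mdeg[OF AA_B subsp_AA] AA_graded(1) by blast
 qed
 thus ?thesis using iso_model[OF C_model] by blast
qed

text \<open>An isomorphism, which need not be graded, carries \<open>fv \<nu>\<close> to a vector u
  of \<open>AA \<kappa>\<close> with the same eigenvalue equations. The diagonal eigenvalues give
  back both degrees of u, so u is a multiple of \<open>fv \<nu>\<close>, although
  \<open>AA \<kappa>\<close> is orthogonal to \<open>fv \<nu>\<close>.\<close>

lemma not_isomorphic:
 assumes \<nu>: "\<nu> \<in> P" and \<kappa>: "\<kappa> \<in> P" and ne: "\<nu> \<noteq> \<kappa>"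
 shows "\<nexists>\<theta>. is_module_iso UT (tensor_module (LQ \<nu>) (LN \<nu>)) (tensor_module (LQ \<kappa>) (LN \<kappa>)) \<theta>"
proof
 let ?V = "tensor_module (LQ \<nu>) (LN \<nu>)" and ?W = "tensor_module (LQ \<kappa>) (LN \<kappa>)"
 assume "\<exists>\<theta>. is_module_iso UT ?V ?W \<theta>"
 then obtain \<theta> where bij: "bij_betw \<theta> (carrier ?V) (carrier ?W)"
  and smult: "\<And>c v. v \<in> carrier ?V ==> \<theta> (c \<odot>\<^bsub>?V\<^esub> v) = c \<odot>\<^bsub>?W\<^esub> \<theta> v"
  and acts: "\<And>a v. a \<in> carrier UT ==> v \<in> carrier ?V ==> \<theta> (act ?V a v) = act ?W a (\<theta> v)"
  unfolding is_module_iso_def by blast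
 obtain \<phi> where gV: "gmod_model UT ?V \<phi> (AA \<nu>) (\<lambda>\<alpha>. AA \<nu> \<inter> {v. homog mdeg \<alpha> v}) TR.rr"
  using tensor_model[OF \<nu>] by blast
 obtain \<psi> where gW: "gmod_model UT ?W \<psi> (AA \<kappa>) (\<lambda>\<alpha>. AA \<kappa> \<inter> {v. homog mdeg \<alpha> v}) TR.rr"
  using tensor_model[OF \<kappa>] by blast
 note V = gmod_modelD[OF gV] and W = gmod_modelD[OF gW]
 note v = lin_modelD[OF V(1)] and w = lin_modelD[OF W(1)]
 obtain \<mu> where f: "jhw M \<mu> \<nu> (fv \<nu>)" using fv(1)[OF \<nu>] by blast
 have fAA: "fv \<nu> \<in> AA \<nu>" unfolding AA_def by (rule orb_base)
 define t where "t = inv_into (carrier ?V) \<phi> (fv \<nu>)"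
 have t: "t \<in> carrier ?V" "\<phi> t = fv \<nu>" unfolding t_def using lin_model_inv[OF V(1) fAA] by blast+
 have \<theta>t: "\<theta> t \<in> carrier ?W" using bij_betwE[OF bij] t(1) by blast
 define u where "u = \<psi> (\<theta> t)"
 have uAA: "u \<in> AA \<kappa>" unfolding u_def by (rule w(10)[OF \<theta>t])
 have uB: "u \<in> B M" using uAA AA_B[OF \<kappa>] by blast
 have eig: "TR.rr a u = sc c u" if a: "a \<in> carrier UT" and e: "TR.rr a (fv \<nu>) = sc c (fv \<nu>)" for a c
 proof -
  have "act ?V a t = c \<odot>\<^bsub>?V\<^esub> t"
   by (rule v(9)[OF V(3)[OF a t(1)] v(7)[OF t(1)]]) (simp only: V(4)[OF a t(1)] v(8)[OF t(1)] t(2) e)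
  hence "act ?W a (\<theta> t) = c \<odot>\<^bsub>?W\<^esub> \<theta> t" using acts[OF a t(1)] smult[OF t(1)] by simp
  thus ?thesis using W(4)[OF a \<theta>t] w(8)[OF \<theta>t] by (simp add: u_def)
 qed
 have E0: "E i j u = sc c u" if "i < M" "j < M" "E i j (fv \<nu>) = sc c (fv \<nu>)" for i j c
  using eig[OF rr_glq(1)[OF that(1,2)]] rr_glq(2)[OF that(1,2) fvB[OF \<nu>]] rr_glq(2)[OF that(1,2) uB] that(3) by simp
 have F0: "F M r s u = sc c u" if "r < N" "s < N" "F M r s (fv \<nu>) = sc c (fv \<nu>)" for r s c
  using eig[OF rr_glN(1)[OF that(1,2)]] rr_glN(2)[OF that(1,2) fvB[OF \<nu>]] rr_glN(2)[OF that(1,2) uB] that(3) by simp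
 have u0: "u \<noteq> 0"
 proof
  assume "u = 0"
  hence "\<theta> t = 0 \<odot>\<^bsub>?W\<^esub> \<theta> t" using w(9)[OF \<theta>t w(7)[OF \<theta>t]] w(8)[OF \<theta>t] by (simp add: u_def)
  hence "\<theta> t = \<theta> (0 \<odot>\<^bsub>?V\<^esub> t)" using smult[OF t(1)] by simp
  hence "t = 0 \<odot>\<^bsub>?V\<^esub> t" using bij_betw_imp_inj_on[OF bij] t(1) v(7)[OF t(1)] by (metis inj_onD)
  hence "\<phi> t = 0" using v(8)[OF t(1), of 0] by simp
  thus False using t(2) fv(2)[OF \<nu>] by simp
 qed
 obtain a0 where a0: "fv \<nu> a0 \<noteq> 0" using fv(2)[OF \<nu>] by (auto simp: fun_eq_iff)
 note a0v = B_valid[OF fvB[OF \<nu>] a0]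
 have cdeg0: "cdeg M a r = 0" if "valid M a" "\<not> r < N" for a r
  unfolding cdeg_def using valid_box[OF that(1)] that(2) by (fastforce intro!: sum.neutral)
 have "jhw M \<mu> \<nu> u"
  unfolding jhw_def
 proof (intro conjI allI impI uB)
  show "E i j u = 0" if "i < j" "j < M" for i j
   using E0[of i j 0] jhwD(2)[OF f that] that by simp
  show "F M r s u = 0" if "r < s" "s < N" for r s
   using F0[of r s 0] jhwD(3)[OF f that] that by simp
  show "homog rdeg \<mu> u"
   unfolding supported_def
  proof (intro allI impI CollectI ext)
   fix a i assume a: "u a \<noteq> 0"
   show "rdeg a i = \<mu> i"
   proof (cases "i < M")
    case True
    have "E i i (fv \<nu>) = sc (of_nat (\<mu> i)) (fv \<nu>)"
     using weights(1)[OF \<nu> f True] jhw_partition(2)[OF f fv(2)[OF \<nu>] True] by simp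
    from fun_cong[OF E0[OF True True this], of a] have "of_nat (rdeg a i) * u a = of_nat (\<mu> i) * u a"
     unfolding E_diag[OF uB] sc_apply .
    thus ?thesis using a by simp
   next
    case False
    have "\<mu> i = 0" using valid_rdeg[OF a0v False] jhwD(7)[OF f a0] by simp
    thus ?thesis using valid_rdeg[OF B_valid[OF uB a] False] by simp
   qed
  qed
  show "homog (cdeg M) \<nu> u"
   unfolding supported_def
  proof (intro allI impI CollectI ext)
   fix a r assume a: "u a \<noteq> 0"
   show "cdeg M a r = \<nu> r"
   proof (cases "r < N")
    case True
    from fun_cong[OF F0[OF True True weights(2)[OF \<nu> f]], of a] have "of_nat (cdeg M a r) * u a = of_nat (\<nu> r) * u a"
     unfolding F_diag[OF uB] sc_apply .
    thus ?thesis using a by simp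
   next
    case False
    have "\<nu> r = 0" using cdeg0[OF a0v False] jhwD(8)[OF f a0] by simp
    thus ?thesis using cdeg0[OF B_valid[OF uB a] False] by simp
   qed
  qed
 qed
 then obtain c where c: "u = sc c (fv \<nu>)" using jhw_unique[OF f _ fv(2)[OF \<nu>] u0] by blast
 have "ip (fv \<nu>) u = 0" using AA_perp[OF \<nu> \<kappa> ne] uAA fAA by (auto simp: perp_def)
 hence "cnj c * ip (fv \<nu>) (fv \<nu>) = 0" unfolding c ip_sc_right[OF B_FS[OF fvB[OF \<nu>]]] .
 hence "c = 0" using ip_definite[OF B_FS[OF fvB[OF \<nu>]]] fv(2)[OF \<nu>] by simp
 thus False using c u0 by simp
qed

lemma actC_glq: "i < M ==> j < M ==> f \<in> carrier Cw ==> actC (glq_elem m n N q i j) f = tr (E i j) f"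
 by (simp add: actC_def tr_def rr_glq Cm(10))

lemma actC_glN: "r < N ==> s < N ==> f \<in> carrier Cw ==> actC (glN_elem m n N q r s) f = tr (F M r s) f"
 by (simp add: actC_def tr_def rr_glN Cm(10))

lemma tr_finsum:
 assumes A: "finite A" and p: "\<And>k. k \<in> A ==> p k \<in> GX"
  and f: "f \<in> carrier Cw" and T: "\<And>v. T v = (\<Sum>k\<in>A. xx (p k) (dd (p' k) v))"
 shows "tr T f = finsum Cw (\<lambda>k. x_gen m n N q (fst (p k)) (snd (p k)) \<otimes>\<^bsub>Cw\<^esub> tr (dd (p' k)) f) A"
proof -
 have fB: "psi f \<in> B M" by (rule Cm(10)[OF f])
 have d: "tr (dd (p' k)) f \<in> carrier Cw" "psi (tr (dd (p' k)) f) = dd (p' k) (psi f)" for k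
  using tr_val[where T = "dd (p' k)" and A = f, OF dd_B[OF fB]] by blast+
 have x: "x_gen m n N q (fst (p k)) (snd (p k)) \<otimes>\<^bsub>Cw\<^esub> tr (dd (p' k)) f \<in> carrier Cw"
  "psi (x_gen m n N q (fst (p k)) (snd (p k)) \<otimes>\<^bsub>Cw\<^esub> tr (dd (p' k)) f) = xx (p k) (dd (p' k) (psi f))" if "k \<in> A" for k
  using psi_x_gen(3)[OF p[OF that] d(1)] d(2) by simp_all
 have "T (psi f) \<in> B M"
  unfolding T using p by (intro subsp_sum[OF subsp_B] xx_closed dd_B fB)
 note t = tr_val[where T = T, OF this]
 have s: "finsum Cw (\<lambda>k. x_gen m n N q (fst (p k)) (snd (p k)) \<otimes>\<^bsub>Cw\<^esub> tr (dd (p' k)) f) A \<in> carrier Cw \<and>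
  psi (finsum Cw (\<lambda>k. x_gen m n N q (fst (p k)) (snd (p k)) \<otimes>\<^bsub>Cw\<^esub> tr (dd (p' k)) f) A)
   = (\<Sum>k\<in>A. psi (x_gen m n N q (fst (p k)) (snd (p k)) \<otimes>\<^bsub>Cw\<^esub> tr (dd (p' k)) f))"
  by (rule lin_model_finsum[OF psi_lin_model A x(1)])
 show ?thesis
 proof (rule Cm(9)[OF t(1) conjunct1[OF s]])
  show "psi (tr T f) = psi (finsum Cw (\<lambda>k. x_gen m n N q (fst (p k)) (snd (p k)) \<otimes>\<^bsub>Cw\<^esub> tr (dd (p' k)) f) A)"
   unfolding conjunct2[OF s] t(2) unfolding T using x(2) by (intro sum.cong refl) simp
 qed
qed

lemma Cw_mult_closed: "x \<in> carrier Cw ==> y \<in> carrier Cw ==> x \<otimes>\<^bsub>Cw\<^esub> y \<in> carrier Cw"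
 using psi_mult(1) unfolding Cw CX.Alg_carrier by blast

lemma module_algebra:
 "is_module_algebra (\<Gamma>grp m n) (omega m n q) UT (lie_elems m n N q) (with_action Cw actC)"
 unfolding is_module_algebra_def
proof
 have "graded_by mdeg (B M)" by (simp add: graded_by_def prj_B)
 thus "is_graded_module (\<Gamma>grp m n) UT (with_action Cw actC)"
  by (rule mdeg_graded_module[OF subsp_B order_refl _ C_model TR.rep_rr TR.UT_alg_closed TR.UT_hcomp homog_rr])
 show "\<forall>(x, \<delta>)\<in>lie_elems m n N q. \<forall>\<alpha>\<in>\<Gamma>grp m n. \<forall>f\<in>hcomp (with_action Cw actC) \<alpha>. \<forall>g\<in>carrier (with_action Cw actC).
   act (with_action Cw actC) x (f \<otimes>\<^bsub>with_action Cw actC\<^esub> g) =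
    (act (with_action Cw actC) x f \<otimes>\<^bsub>with_action Cw actC\<^esub> g) \<oplus>\<^bsub>with_action Cw actC\<^esub>
    (omega m n q \<delta> \<alpha> \<odot>\<^bsub>with_action Cw actC\<^esub> (f \<otimes>\<^bsub>with_action Cw actC\<^esub> act (with_action Cw actC) x g))"
  unfolding with_action_simps
 proof (intro ballI, clarify)
  fix x \<delta> \<alpha> f g assume L: "(x, \<delta>) \<in> lie_elems m n N q" and f: "f \<in> hcomp Cw \<alpha>" and g: "g \<in> carrier Cw"
  have fc: "f \<in> carrier Cw" using psi_hmodel f unfolding hmodel_def by blast
  note fg = Cw_mult_closed[OF fc g]
  from L consider i j where "i < M" "j < M" "x = glq_elem m n N q i j" "\<delta> = eps i - eps j"
   | r s where "r < N" "s < N" "x = glN_elem m n N q r s" "\<delta> = 0"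
   unfolding lie_elems_def by blast
  thus "actC x (f \<otimes>\<^bsub>Cw\<^esub> g) = (actC x f \<otimes>\<^bsub>Cw\<^esub> g) \<oplus>\<^bsub>Cw\<^esub> (omega m n q \<delta> \<alpha> \<odot>\<^bsub>Cw\<^esub> (f \<otimes>\<^bsub>Cw\<^esub> actC x g))"
  proof cases
   case 1
   have "E i j ` B M \<subseteq> B M" using E_B 1 by blast
   from leib_Cw[OF leib_E[OF 1(1,2)] linop_E this E_vac f g]
   show ?thesis unfolding 1(3,4) actC_glq[OF 1(1,2) fc] actC_glq[OF 1(1,2) g] actC_glq[OF 1(1,2) fg] .
  next
   case 2
   have "F M r s ` B M \<subseteq> B M" using F_B 2 by blast
   from leib_Cw[OF leib_F[OF 2(1,2)] linop_F this F_vac f g]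
   show ?thesis unfolding 2(3,4) actC_glN[OF 2(1,2) fc] actC_glN[OF 2(1,2) g] actC_glN[OF 2(1,2) fg] .
  qed
 qed
qed

end

theorem lemma4p30:
  fixes m n N :: nat and q :: complex
  assumes "0 < N" and "q \<noteq> 0"
  shows "\<exists>D act. let
      C = C_omega m n N q;
      A = with_action C act;
      P = hook_partitions m n N
    in
      (\<forall>i<m + n. \<forall>r<N. is_partial m n N q i r (D i r)) \<and>
      (\<forall>i<m + n. \<forall>j<m + n. \<forall>f\<in>carrier C.
         act (glq_elem m n N q i j) f =
           finsum C (\<lambda>r. x_gen m n N q i r \<otimes>\<^bsub>C\<^esub> D j r f) {..<N}) \<and>
      (\<forall>r<N. \<forall>s<N. \<forall>f\<in>carrier C.
         act (glN_elem m n N q r s) f =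
           finsum C (\<lambda>i. x_gen m n N q i r \<otimes>\<^bsub>C\<^esub> D i s f) {..<m + n}) \<and>
      is_module_algebra (\<Gamma>grp m n) (omega m n q) (UU m n N q) (lie_elems m n N q) A \<and>
      (\<exists>(L :: (nat \<Rightarrow> nat) \<Rightarrow> ((nat \<times> nat) free set, (nat \<times> nat) free set) gmodule)
        (L' :: (nat \<Rightarrow> nat) \<Rightarrow> ((nat \<times> nat) free set, (nat \<times> nat) free set) gmodule).
         (\<forall>\<nu>\<in>P.
            is_simple_highest_weight (\<Gamma>grp m n) (U_glq m n q) (E_glq m n q) (m + n)
              (\<lambda>i. of_nat (sharp m \<nu> i)) (L \<nu>) \<and>
            is_simple_highest_weight (\<Gamma>grp m n) (U_glN N) (E_glN N) N
              (\<lambda>r. of_nat (\<nu> r)) (L' \<nu>)) \<and>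
         (\<exists>\<phi>. is_graded_module_iso (UU m n N q) A
            (direct_sum P (\<lambda>\<nu>. tensor_module (L \<nu>) (L' \<nu>))) \<phi>) \<and>
         (\<forall>\<nu>\<in>P. is_simple (\<Gamma>grp m n) (UU m n N q) (tensor_module (L \<nu>) (L' \<nu>))) \<and>
         (\<forall>\<nu>\<in>P. \<forall>\<mu>\<in>P. \<nu> \<noteq> \<mu> \<longrightarrow>
            (\<nexists>\<phi>. is_module_iso (UU m n N q)
               (tensor_module (L \<nu>) (L' \<nu>)) (tensor_module (L \<mu>) (L' \<mu>)) \<phi>)))"
proof -
 interpret H: howe m N q n by standard (rule assms(2))
 have glq: "H.actC (glq_elem m n N q i j) f
   = finsum (C_omega m n N q) (\<lambda>r. x_gen m n N q i r \<otimes>\<^bsub>C_omega m n N q\<^esub> H.tr (H.dd (j, r)) f) {..<N}"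
  if "i < m + n" "j < m + n" "f \<in> carrier (C_omega m n N q)" for i j f
 proof -
  have G: "(i, k) \<in> {..<m + n} \<times> {..<N}" if "k \<in> {..<N}" for k using that \<open>i < m + n\<close> by simp
  show ?thesis
   unfolding H.actC_glq[OF that]
   using H.tr_finsum[where p = "\<lambda>k. (i, k)" and p' = "\<lambda>k. (j, k)" and T = "H.E i j", OF finite_lessThan G that(3) H.E_def] by simp
 qed
 have glN: "H.actC (glN_elem m n N q r s) f
   = finsum (C_omega m n N q) (\<lambda>i. x_gen m n N q i r \<otimes>\<^bsub>C_omega m n N q\<^esub> H.tr (H.dd (i, s)) f) {..<m + n}"
  if "r < N" "s < N" "f \<in> carrier (C_omega m n N q)" for r s f
 proof -
  have G: "(k, r) \<in> {..<m + n} \<times> {..<N}" if "k \<in> {..<m + n}" for k using that \<open>r < N\<close> by simp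
  show ?thesis
   unfolding H.actC_glN[OF that]
   using H.tr_finsum[where p = "\<lambda>k. (k, r)" and p' = "\<lambda>k. (k, s)" and T = "H.F (m + n) r s", OF finite_lessThan G that(3) H.F_def] by simp
 qed
 show ?thesis
  unfolding Let_def UU_def
 proof (rule exI[of _ "\<lambda>i r. H.tr (H.dd (i, r))"], rule exI[of _ H.actC], intro conjI ballI allI impI)
  show "is_partial m n N q i r (H.tr (H.dd (i, r)))" if "i < m + n" "r < N" for i r
   by (rule H.is_partial_dd[OF that])
 qed (rule glq glN H.module_algebra | assumption |
   (rule exI[of _ H.LQ], rule exI[of _ H.LN],
    use H.LQ_highest_weight H.LN_highest_weight H.decomposition H.tensor_simple H.not_isomorphic in simp))+
qed

end
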